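(* Let $\mathcal{X}$ be a set of morphisms in a locally presentable category $\mathcal{K}$ and let $\mathcal{W}$ be a class of morphisms of $\mathcal{K}$. Then $\mathcal{C}=\operatorname{cof}(\mathcal{X})$ (as cofibrations) and $\mathcal{W}$ (as weak equivalences) make $\mathcal{K}$ a combinatorial model category if and only if (1) $\mathcal{W}$ has the 2-out-of-3 property and is closed under retracts in $\mathcal{K}^{\to}$, (2) $\mathcal{X}^{\square}\subseteq\mathcal{W}$, (3) $\operatorname{cof}(\mathcal{X})\cap\mathcal{W}$ is closed under pushout and transfinite composition, and (4) $\mathcal{W}$, as a full subcategory of $\mathcal{K}^{\to}$, satisfies the solution-set condition at $\mathcal{X}$.
   Context: $\mathcal{K}^{\to}$ is the category whose objects are the morphisms of $\mathcal{K}$ and whose morphisms are commutative squares. For a class $\mathcal{X}$ of morphisms, $\mathcal{X}^{\square}$ (resp. ${}^{\square}\mathcal{X}$) is the class of morphisms having the right (resp. left) lifting property with respect to every morphism in $\mathcal{X}$ (diagonals are required to exist, not to be unique). A weak factorization system $(\mathcal{L},\mathcal{R})$ consists of classes of morphisms with $\mathcal{R}=\mathcal{L}^{\square}$, $\mathcal{L}={}^{\square}\mathcal{R}$, such that every morphism factors as $gf$ with $f\in\mathcal{L}$, $g\in\mathcal{R}$; it is cofibrantly generated if $\mathcal{R}=\mathcal{Y}^{\square}$ for some set $\mathcal{Y}$ of morphisms. $\operatorname{cof}(\mathcal{X})$ is the smallest class of morphisms containing $\mathcal{X}$ and all isomorphisms and (a) stable under pushout (along arbitrary morphisms), (b) closed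 under transfinite composition, (c) closed under retracts in $\mathcal{K}^{\to}$. A class $\mathcal{L}$ is closed under transfinite composition if it is closed under composition and, for every chain $(f_{ij}:A_i\to A_j)_{i\le j\le\lambda}$ with $\lambda$ a limit ordinal which is smooth (for each limit ordinal $j\le\lambda$, $(f_{ij})_{i<j}$ is a colimit cocone) and has $f_{ij}\in\mathcal{L}$ for all $i\le j<\lambda$, one has $f_{0\lambda}\in\mathcal{L}$. 2-out-of-3 property: whenever two of $f,g,gf$ belong to $\mathcal{W}$, so does the third. A model category is a complete and cocomplete category with classes $\mathcal{F}$ (fibrations), $\mathcal{C}$ (cofibrations), $\mathcal{W}$ (weak equivalences) such that $\mathcal{W}$ has the 2-out-of-3 property and is closed under retracts in $\mathcal{K}^{\to}$, and $(\mathcal{C},\mathcal{F}\cap\mathcal{W})$ and $(\mathcal{C}\cap\mathcal{W},\mathcal{F})$ are weak factorization systems. It is combinatorial if $\mathcal{K}$ is locally presentable and both weak factorization systems are cofibrantly generated. "$\mathcal{C}$ and $\mathcal{W}$ make $\mathcal{K}$ a combinatorial model category" means that $\mathcal{K}$ with cofibrations $\mathcal{C}$, weak equivalences $\mathcal{W}$ and fibrations $(\mathcal{C}\cap\mathcal{W})^{\square}$ is a combinatorial model category. A full subcategory $\mathcal{L}$ of a category $\mathcal{M}$ satisfies the solution-set condition at an object $M$ if there is a set of morphisms $(f_i:M\to L_i)_{i\in I}$ with all $L_i\in\mathcal{L}$ such that every morphism $f:M\to L$ with $L\in\mathcal{L}$ factorizes as $f=gf_i$ for some $i\in I$ and some $g$.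 It satisfies the condition at a set of objects if it does so at each object of the set. Here elements of $\mathcal{X}$ are viewed as objects of $\mathcal{K}^{\to}$. *)

theory Defs
  imports Main "HOL-Library.FuncSet"
begin

unbundle cardinal_syntax

text \<open>
  The distinction between sets and classes is made relative to a strongly inaccessible
  cardinal, given as a type \<open>'k\<close> whose order is the initial ordinal of that cardinal. Small
  sets (the ``sets'' of the category-theoretic literature) are those of smaller cardinality than
  \<open>'k\<close>; classes are arbitrary HOL sets. The elements of \<open>'k\<close> are exactly the small ordinals, and
  every small structure has a copy carried by a subset of \<open>'k\<close>.
\<close>

definition ord_le :: "'k::wellorder rel" where
  "ord_le = {(i, j). i \<le> j}"

definition inaccessible :: "'k::wellorder itself \<Rightarrow> bool" where
  "inaccessible _ \<longleftrightarrow>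
     Card_order (ord_le :: 'k rel) \<and>
     natLeq <o (ord_le :: 'k rel) \<and>
     regularCard (ord_le :: 'k rel) \<and>
     (\<forall>S :: 'k set. |S| <o (ord_le :: 'k rel) \<longrightarrow> |Pow S| <o (ord_le :: 'k rel))"

definition small :: "'k::wellorder itself \<Rightarrow> 'a set \<Rightarrow> bool" where
  "small _ S \<longleftrightarrow> |S| <o |UNIV :: 'k set|"

definition limit_ordinal :: "'k::wellorder \<Rightarrow> bool" where
  "limit_ordinal l \<longleftrightarrow> (\<exists>i. i < l) \<and> (\<forall>i<l. \<exists>j. i < j \<and> j < l)"

record ('o, 'm) cat =
  Obj :: "'o set"
  Arr :: "'m set"
  Dom :: "'m \<Rightarrow> 'o"
  Cod :: "'m \<Rightarrow> 'o"
  Ident :: "'o \<Rightarrow> 'm"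
  Comp :: "'m \<Rightarrow> 'm \<Rightarrow> 'm"  (infixl "\<cdot>\<index>" 70)

definition Hom :: "('o, 'm) cat \<Rightarrow> 'o \<Rightarrow> 'o \<Rightarrow> 'm set" where
  "Hom C a b = {f \<in> Arr C. Dom C f = a \<and> Cod C f = b}"

locale category =
  fixes C :: "('o, 'm) cat" (structure)
  assumes dom_in_Obj: "f \<in> Arr C \<Longrightarrow> Dom C f \<in> Obj C"
    and cod_in_Obj: "f \<in> Arr C \<Longrightarrow> Cod C f \<in> Obj C"
    and Id_in_Hom: "a \<in> Obj C \<Longrightarrow> Ident C a \<in> Hom C a a"
    and Comp_in_Hom: "f \<in> Hom C a b \<Longrightarrow> g \<in> Hom C b c \<Longrightarrow> g \<cdot> f \<in> Hom C a c"
    and Comp_Id: "f \<in> Hom C a b \<Longrightarrow> f \<cdot> Ident C a = f"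
    and Id_Comp: "f \<in> Hom C a b \<Longrightarrow> Ident C b \<cdot> f = f"
    and Comp_assoc: "f \<in> Hom C a b \<Longrightarrow> g \<in> Hom C b c \<Longrightarrow> h \<in> Hom C c d \<Longrightarrow>
      (h \<cdot> g) \<cdot> f = h \<cdot> (g \<cdot> f)"

definition locally_small :: "'k::wellorder itself \<Rightarrow> ('o, 'm) cat \<Rightarrow> bool" where
  "locally_small k C \<longleftrightarrow> (\<forall>a\<in>Obj C. \<forall>b\<in>Obj C. small k (Hom C a b))"

definition opposite :: "('o, 'm) cat \<Rightarrow> ('o, 'm) cat" where
  "opposite C = \<lparr>Obj = Obj C, Arr = Arr C, Dom = Cod C, Cod = Dom C, Ident = Ident C,
           Comp = (\<lambda>g f. Comp C f g)\<rparr>"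

definition isos :: "('o, 'm) cat \<Rightarrow> 'm set" where
  "isos C = {f \<in> Arr C. \<exists>g \<in> Hom C (Cod C f) (Dom C f).
     Comp C g f = Ident C (Dom C f) \<and> Comp C f g = Ident C (Cod C f)}"

text \<open>
  The category \<open>K\<^sup>\<rightarrow>\<close> of arrows: the morphism \<open>(f, u, v, g)\<close> is the commutative square from \<open>f\<close>
  to \<open>g\<close> with \<open>u\<close> between the domains and \<open>v\<close> between the codomains.
\<close>

definition arrow_cat :: "('o, 'm) cat \<Rightarrow> ('m, 'm \<times> 'm \<times> 'm \<times> 'm) cat" where
  "arrow_cat C = \<lparr>
     Obj = Arr C,
     Arr = {(f, u, v, g). f \<in> Arr C \<and> g \<in> Arr C \<and>
              u \<in> Hom C (Dom C f) (Dom C g) \<and> v \<in> Hom C (Cod C f) (Cod C g) \<and>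
              Comp C g u = Comp C v f},
     Dom = (\<lambda>(f, u, v, g). f),
     Cod = (\<lambda>(f, u, v, g). g),
     Ident = (\<lambda>f. (f, Ident C (Dom C f), Ident C (Cod C f), f)),
     Comp = (\<lambda>(g', u', v', h) (f, u, v, g). (f, Comp C u' u, Comp C v' v, h))\<rparr>"

definition poset_cat :: "'i rel \<Rightarrow> ('i, 'i \<times> 'i) cat" where
  "poset_cat r = \<lparr>Obj = Field r, Arr = r, Dom = fst, Cod = snd, Ident = (\<lambda>i. (i, i)),
                  Comp = (\<lambda>q p. (fst p, snd q))\<rparr>"

definition retract_of :: "('o, 'm) cat \<Rightarrow> 'o \<Rightarrow> 'o \<Rightarrow> bool" where
  "retract_of C a b \<longleftrightarrow> a \<in> Obj C \<and> b \<in> Obj C \<and>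
     (\<exists>s\<in>Hom C a b. \<exists>r\<in>Hom C b a. Comp C r s = Ident C a)"

text \<open>A full subcategory is given by its class \<open>L\<close> of objects.\<close>

definition solution_set_condition_at ::
    "'k::wellorder itself \<Rightarrow> ('o, 'm) cat \<Rightarrow> 'o set \<Rightarrow> 'o \<Rightarrow> bool" where
  "solution_set_condition_at k M L m \<longleftrightarrow>
     (\<exists>S. small k S \<and> S \<subseteq> {f \<in> Arr M. Dom M f = m \<and> Cod M f \<in> L} \<and>
       (\<forall>f\<in>Arr M. Dom M f = m \<and> Cod M f \<in> L \<longrightarrow>
          (\<exists>s\<in>S. \<exists>g\<in>Hom M (Cod M s) (Cod M f). f = Comp M g s)))"

text \<open>A diagram is given by its action \<open>F\<close> on objects and its action \<open>G\<close> on arrows.\<close>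

definition diagram ::
    "('i, 'j) cat \<Rightarrow> ('o, 'm) cat \<Rightarrow> ('i \<Rightarrow> 'o) \<Rightarrow> ('j \<Rightarrow> 'm) \<Rightarrow> bool" where
  "diagram J C F G \<longleftrightarrow>
     (\<forall>i\<in>Obj J. F i \<in> Obj C \<and> G (Ident J i) = Ident C (F i)) \<and>
     (\<forall>a\<in>Arr J. G a \<in> Hom C (F (Dom J a)) (F (Cod J a))) \<and>
     (\<forall>a\<in>Arr J. \<forall>b\<in>Arr J. Cod J a = Dom J b \<longrightarrow> G (Comp J b a) = Comp C (G b) (G a))"

definition cocone :: "('i, 'j) cat \<Rightarrow> ('o, 'm) cat \<Rightarrow> ('i \<Rightarrow> 'o) \<Rightarrow> ('j \<Rightarrow> 'm) \<Rightarrow>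
    'o \<Rightarrow> ('i \<Rightarrow> 'm) \<Rightarrow> bool" where
  "cocone J C F G c p \<longleftrightarrow> c \<in> Obj C \<and>
     (\<forall>i\<in>Obj J. p i \<in> Hom C (F i) c) \<and>
     (\<forall>a\<in>Arr J. Comp C (p (Cod J a)) (G a) = p (Dom J a))"

definition colimit :: "('i, 'j) cat \<Rightarrow> ('o, 'm) cat \<Rightarrow> ('i \<Rightarrow> 'o) \<Rightarrow> ('j \<Rightarrow> 'm) \<Rightarrow>
    'o \<Rightarrow> ('i \<Rightarrow> 'm) \<Rightarrow> bool" where
  "colimit J C F G c p \<longleftrightarrow> cocone J C F G c p \<and>
     (\<forall>d q. cocone J C F G d q \<longrightarrow>
        (\<exists>!u. u \<in> Hom C c d \<and> (\<forall>i\<in>Obj J. Comp C u (p i) = q i)))"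

definition limit :: "('i, 'j) cat \<Rightarrow> ('o, 'm) cat \<Rightarrow> ('i \<Rightarrow> 'o) \<Rightarrow> ('j \<Rightarrow> 'm) \<Rightarrow>
    'o \<Rightarrow> ('i \<Rightarrow> 'm) \<Rightarrow> bool" where
  "limit J C F G c p \<longleftrightarrow> colimit (opposite J) (opposite C) F G c p"

text \<open>Up to isomorphism every small category has its objects and arrows in \<open>'k\<close>.\<close>

definition cocomplete :: "'k::wellorder itself \<Rightarrow> ('o, 'm) cat \<Rightarrow> bool" where
  "cocomplete k C \<longleftrightarrow> (\<forall>(J :: ('k, 'k) cat) F G.
     category J \<and> small k (Obj J) \<and> small k (Arr J) \<and> diagram J C F G \<longrightarrow>
     (\<exists>c p. colimit J C F G c p))"

definition complete :: "'k::wellorder itself \<Rightarrow> ('o, 'm) cat \<Rightarrow> bool" where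
  "complete k C \<longleftrightarrow> (\<forall>(J :: ('k, 'k) cat) F G.
     category J \<and> small k (Obj J) \<and> small k (Arr J) \<and> diagram J C F G \<longrightarrow>
     (\<exists>c p. limit J C F G c p))"

definition pushout :: "('o, 'm) cat \<Rightarrow> 'm \<Rightarrow> 'm \<Rightarrow> 'm \<Rightarrow> 'm \<Rightarrow> bool" where
  "pushout C f u f' u' \<longleftrightarrow>
     f \<in> Arr C \<and> u \<in> Arr C \<and> f' \<in> Arr C \<and> u' \<in> Arr C \<and>
     Dom C f = Dom C u \<and> Dom C f' = Cod C u \<and> Dom C u' = Cod C f \<and> Cod C f' = Cod C u' \<and>
     Comp C f' u = Comp C u' f \<and>
     (\<forall>d. \<forall>x\<in>Hom C (Cod C u) d. \<forall>y\<in>Hom C (Cod C f) d. Comp C x u = Comp C y f \<longrightarrow>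
        (\<exists>!w. w \<in> Hom C (Cod C f') d \<and> Comp C w f' = x \<and> Comp C w u' = y))"

definition regular_cardinal :: "'k::wellorder rel \<Rightarrow> bool" where
  "regular_cardinal l \<longleftrightarrow> Cinfinite l \<and> regularCard l \<and> l <o |UNIV :: 'k set|"

definition directed :: "'k::wellorder rel \<Rightarrow> 'k rel \<Rightarrow> bool" where
  "directed l r \<longleftrightarrow> Partial_order r \<and> small TYPE('k) (Field r) \<and>
     (\<forall>S\<subseteq>Field r. |S| <o l \<longrightarrow> (\<exists>b\<in>Field r. \<forall>s\<in>S. (s, b) \<in> r))"

text \<open>
  The functor \<open>Hom(A, -)\<close> sends the cocone \<open>(c, p)\<close> to a colimit cocone in the category of small
  sets. The test objects \<open>T\<close> of the universal property may be taken to be subsets of \<open>'k\<close>,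
  since every small set is in bijection with one.
\<close>

definition hom_colimit :: "'k::wellorder itself \<Rightarrow> ('i, 'j) cat \<Rightarrow> ('o, 'm) cat \<Rightarrow> 'o \<Rightarrow>
    ('i \<Rightarrow> 'o) \<Rightarrow> ('j \<Rightarrow> 'm) \<Rightarrow> 'o \<Rightarrow> ('i \<Rightarrow> 'm) \<Rightarrow> bool" where
  "hom_colimit k J C A F G c p \<longleftrightarrow>
     (\<forall>(T :: 'k set) h. small k T \<and>
        (\<forall>i\<in>Obj J. h i \<in> Hom C A (F i) \<rightarrow> T) \<and>
        (\<forall>a\<in>Arr J. \<forall>x\<in>Hom C A (F (Dom J a)). h (Cod J a) (Comp C (G a) x) = h (Dom J a) x) \<longrightarrow>
        (\<exists>!t. t \<in> Hom C A c \<rightarrow>\<^sub>E T \<and>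
           (\<forall>i\<in>Obj J. \<forall>x\<in>Hom C A (F i). t (Comp C (p i) x) = h i x)))"

definition presentable :: "('o, 'm) cat \<Rightarrow> 'k::wellorder rel \<Rightarrow> 'o \<Rightarrow> bool" where
  "presentable C l A \<longleftrightarrow> A \<in> Obj C \<and>
     (\<forall>r F G c p. directed l r \<and> diagram (poset_cat r) C F G \<and>
        colimit (poset_cat r) C F G c p \<longrightarrow>
        hom_colimit TYPE('k) (poset_cat r) C A F G c p)"

definition locally_presentable :: "'k::wellorder itself \<Rightarrow> ('o, 'm) cat \<Rightarrow> bool" where
  "locally_presentable k C \<longleftrightarrow>
     category C \<and> locally_small k C \<and> cocomplete k C \<and>
     (\<exists>(l :: 'k rel) P. regular_cardinal l \<and> small k P \<and> (\<forall>A\<in>P. presentable C l A) \<and>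
        (\<forall>c\<in>Obj C. \<exists>r F G p. directed l r \<and> diagram (poset_cat r) C F G \<and>
           (\<forall>i\<in>Field r. F i \<in> P) \<and> colimit (poset_cat r) C F G c p))"

definition lifts :: "('o, 'm) cat \<Rightarrow> 'm \<Rightarrow> 'm \<Rightarrow> bool" where
  "lifts C f g \<longleftrightarrow>
     (\<forall>u\<in>Hom C (Dom C f) (Dom C g). \<forall>v\<in>Hom C (Cod C f) (Cod C g). Comp C g u = Comp C v f \<longrightarrow>
        (\<exists>d\<in>Hom C (Cod C f) (Dom C g). Comp C d f = u \<and> Comp C g d = v))"

definition rlp :: "('o, 'm) cat \<Rightarrow> 'm set \<Rightarrow> 'm set" where
  "rlp C X = {g \<in> Arr C. \<forall>f\<in>X. lifts C f g}"

definition llp :: "('o, 'm) cat \<Rightarrow> 'm set \<Rightarrow> 'm set" where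
  "llp C X = {f \<in> Arr C. \<forall>g\<in>X. lifts C f g}"

definition pushout_closed :: "('o, 'm) cat \<Rightarrow> 'm set \<Rightarrow> bool" where
  "pushout_closed C L \<longleftrightarrow> (\<forall>f u f' u'. f \<in> L \<and> pushout C f u f' u' \<longrightarrow> f' \<in> L)"

definition retract_closed :: "('o, 'm) cat \<Rightarrow> 'm set \<Rightarrow> bool" where
  "retract_closed C L \<longleftrightarrow> (\<forall>f g. g \<in> L \<and> retract_of (arrow_cat C) f g \<longrightarrow> f \<in> L)"

definition smooth_chain :: "('o, 'm) cat \<Rightarrow> 'k::wellorder \<Rightarrow> ('k \<Rightarrow> 'o) \<Rightarrow> ('k \<times> 'k \<Rightarrow> 'm) \<Rightarrow> bool"
where
  "smooth_chain C l A f \<longleftrightarrow>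
     diagram (poset_cat {(i, j). i \<le> j \<and> j \<le> l}) C A f \<and>
     (\<forall>j\<le>l. limit_ordinal j \<longrightarrow>
        colimit (poset_cat {(i, i'). i \<le> i' \<and> i' < j}) C A f (A j) (\<lambda>i. f (i, j)))"

definition transfinite_composition_closed ::
    "'k::wellorder itself \<Rightarrow> ('o, 'm) cat \<Rightarrow> 'm set \<Rightarrow> bool" where
  "transfinite_composition_closed _ C L \<longleftrightarrow>
     (\<forall>f\<in>L. \<forall>g\<in>L. Cod C f = Dom C g \<longrightarrow> Comp C g f \<in> L) \<and>
     (\<forall>(l :: 'k) A f z. limit_ordinal l \<and> (\<forall>i. z \<le> i) \<and> smooth_chain C l A f \<and>
        (\<forall>i j. i \<le> j \<and> j < l \<longrightarrow> f (i, j) \<in> L) \<longrightarrow> f (z, l) \<in> L)"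

definition cof :: "'k::wellorder itself \<Rightarrow> ('o, 'm) cat \<Rightarrow> 'm set \<Rightarrow> 'm set" where
  "cof k C X = \<Inter>{L. L \<subseteq> Arr C \<and> X \<subseteq> L \<and> isos C \<subseteq> L \<and>
     pushout_closed C L \<and> transfinite_composition_closed k C L \<and> retract_closed C L}"

definition two_out_of_three :: "('o, 'm) cat \<Rightarrow> 'm set \<Rightarrow> bool" where
  "two_out_of_three C W \<longleftrightarrow> (\<forall>f\<in>Arr C. \<forall>g\<in>Arr C. Cod C f = Dom C g \<longrightarrow>
     (f \<in> W \<and> g \<in> W \<longrightarrow> Comp C g f \<in> W) \<and>
     (f \<in> W \<and> Comp C g f \<in> W \<longrightarrow> g \<in> W) \<and>
     (g \<in> W \<and> Comp C g f \<in> W \<longrightarrow> f \<in> W))"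

definition weak_factorization_system :: "('o, 'm) cat \<Rightarrow> 'm set \<Rightarrow> 'm set \<Rightarrow> bool" where
  "weak_factorization_system C L R \<longleftrightarrow>
     L \<subseteq> Arr C \<and> R \<subseteq> Arr C \<and> R = rlp C L \<and> L = llp C R \<and>
     (\<forall>h\<in>Arr C. \<exists>f\<in>L. \<exists>g\<in>R. Cod C f = Dom C g \<and> h = Comp C g f)"

definition cofibrantly_generated ::
    "'k::wellorder itself \<Rightarrow> ('o, 'm) cat \<Rightarrow> 'm set \<Rightarrow> 'm set \<Rightarrow> bool" where
  "cofibrantly_generated k C L R \<longleftrightarrow> weak_factorization_system C L R \<and>
     (\<exists>Y\<subseteq>Arr C. small k Y \<and> R = rlp C Y)"

text \<open>The arguments are the cofibrations, the weak equivalences and the fibrations, in this order.\<close>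

definition model_category :: "'k::wellorder itself \<Rightarrow> ('o, 'm) cat \<Rightarrow>
    'm set \<Rightarrow> 'm set \<Rightarrow> 'm set \<Rightarrow> bool" where
  "model_category k K Cf W Fb \<longleftrightarrow>
     category K \<and> locally_small k K \<and> complete k K \<and> cocomplete k K \<and>
     Cf \<subseteq> Arr K \<and> W \<subseteq> Arr K \<and> Fb \<subseteq> Arr K \<and>
     two_out_of_three K W \<and> retract_closed K W \<and>
     weak_factorization_system K Cf (Fb \<inter> W) \<and>
     weak_factorization_system K (Cf \<inter> W) Fb"

definition combinatorial_model_category :: "'k::wellorder itself \<Rightarrow> ('o, 'm) cat \<Rightarrow>
    'm set \<Rightarrow> 'm set \<Rightarrow> 'm set \<Rightarrow> bool" where
  "combinatorial_model_category k K Cf W Fb \<longleftrightarrow>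
     model_category k K Cf W Fb \<and> locally_presentable k K \<and>
     cofibrantly_generated k K Cf (Fb \<inter> W) \<and>
     cofibrantly_generated k K (Cf \<inter> W) Fb"

definition make_combinatorial_model_category :: "'k::wellorder itself \<Rightarrow> ('o, 'm) cat \<Rightarrow>
    'm set \<Rightarrow> 'm set \<Rightarrow> bool" where
  "make_combinatorial_model_category k K Cf W \<longleftrightarrow>
     combinatorial_model_category k K Cf W (rlp K (Cf \<inter> W))"

end

theory Submission
  imports Defs
begin

text \<open>
  Sufficiency. Call the morphisms of \<open>cof(X) \<inter> W\<close> trivial cofibrations. By the solution set
  condition, and by factoring the map from a pushout through \<open>cof(X)\<close> and \<open>rlp(X)\<close>, there is a small
  set \<open>J\<close> of trivial cofibrations through which every square from \<open>X\<close> to \<open>W\<close> factors. Attaching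
  elements of \<open>J\<close> transfinitely to a weak equivalence keeps the remaining map in \<open>W\<close>, and in the end
  it lies in \<open>rlp(X)\<close>. So a trivial cofibration is a retract of a morphism of \<open>cof(J)\<close>, and \<open>J\<close>
  generates. Completeness holds because the cones over a diagram form a cocomplete category with a
  weakly terminal object.

  Necessity of the solution set condition. Let \<open>Y\<close> generate the trivial cofibrations. A weak
  equivalence \<open>w\<close> is a directed colimit, of a high index, of morphisms from a fixed small set, and the
  small object argument for \<open>Y\<close>, done functorially, commutes with this colimit. The second factor
  of \<open>w\<close> is a trivial fibration, so a square from \<open>x\<close> to \<open>w\<close> lifts to the first factor of \<open>w\<close>, and
  from there to the first factor of one of the morphisms in the small set.
\<close>

section \<open>Smallness\<close>

text \<open>Everything in sight has to be compact at one common cardinal. The elements of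
  \<open>'k\<close> are ordinals, so a single \<open>t\<close> with \<open>regular_above\<close>
  serves as that cardinal, as the length of the towers and as the degree of directedness of the
  indices. Necessity needs arrows as \<open>t\<close>-directed colimits, while only
  \<open>l\<close>-directed presentations are given, and raising the index of accessibility is
  delicate in general. Here cocompleteness helps: the sets of fewer than \<open>t\<close> indices
  form a \<open>t\<close>-directed poset, and the colimit over such a set exists whether or not the
  set is directed. Closing pairs of such sets under the indices that \<open>w\<close> requires then
  presents the arrow \<open>w\<close>. The stages found in this way may lie outside
  \<open>W\<close>. The solution set uses only their first factors, which belong to the class
  generated by \<open>Y\<close> and therefore to \<open>W\<close>. Functoriality of the
  factorization rests on uniqueness. Cells are attached along all squares at once, so a map of
  towers that respects the cells is determined by its ends, and identity and composition laws
  follow.\<close>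

lemma small_cong_card: "|A| \<le>o |B| \<Longrightarrow> small k B \<Longrightarrow> small k A"
  unfolding small_def using ordLeq_ordLess_trans by blast

lemma small_subset: "A \<subseteq> B \<Longrightarrow> small k B \<Longrightarrow> small k A"
  by (rule small_cong_card) (rule card_of_mono1)

lemma small_image: "small k A \<Longrightarrow> small k (f ` A)"
  by (rule small_cong_card) (rule card_of_image)

lemma small_inj_on: "inj_on f A \<Longrightarrow> small k (f ` A) \<Longrightarrow> small k A"
  by (metis small_image the_inv_into_onto)

lemma small_embed:
  fixes k :: "'k::wellorder itself"
  assumes "small k A"
  obtains b :: "'a \<Rightarrow> 'k" where "inj_on b A"
proof -
  have "|A| \<le>o |UNIV :: 'k set|" using assms ordLess_imp_ordLeq unfolding small_def by blast
  then show ?thesis using that card_of_ordLeq[of A "UNIV :: 'k set"] by blast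
qed

locale universe =
  fixes k :: "'k::wellorder itself"
  assumes inacc: "inaccessible k"
begin

lemma Field_ord_le [simp]: "Field (ord_le :: 'k rel) = UNIV"
  by (auto simp: ord_le_def Field_def)

lemma ord_le_card: "Card_order (ord_le :: 'k rel)"
  using inacc by (auto simp: inaccessible_def)

lemma ord_le_iso: "|UNIV :: 'k set| =o (ord_le :: 'k rel)"
  using card_of_Field_ordIso[OF ord_le_card] by simp

lemma small_iff: "small k A \<longleftrightarrow> |A| <o (ord_le :: 'k rel)"
  unfolding small_def using ord_le_iso ordLess_ordIso_trans ordIso_symmetric by blast

lemma infinite_UNIV_k: "infinite (UNIV :: 'k set)"
proof -
  have "natLeq <o |UNIV :: 'k set|"
    using inacc ord_le_iso ordLess_ordIso_trans ordIso_symmetric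
    unfolding inaccessible_def by blast
  then show ?thesis using infinite_iff_natLeq_ordLeq ordLess_imp_ordLeq by blast
qed

lemma Cinfinite_ord_le: "Cinfinite (ord_le :: 'k rel)"
  using infinite_UNIV_k ord_le_card by (simp add: cinfinite_def)

lemma small_finite: "finite A \<Longrightarrow> small k A"
  unfolding small_def
  by (rule finite_ordLess_infinite) (simp_all add: card_of_well_order_on Field_card_of infinite_UNIV_k)

lemma small_nat: "small k (A :: nat set)"
proof -
  have "natLeq <o |UNIV :: 'k set|"
    using inacc ord_le_iso ordLess_ordIso_trans ordIso_symmetric
    unfolding inaccessible_def by blast
  then have "small k (UNIV :: nat set)"
    unfolding small_def using card_of_nat ordIso_ordLess_trans by blast
  then show ?thesis by (rule small_subset[rotated]) simp
qed

lemma small_UNION: "small k I \<Longrightarrow> (\<And>i. i \<in> I \<Longrightarrow> small k (A i)) \<Longrightarrow> small k (\<Union>i\<in>I. A i)"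
  unfolding small_iff
  using card_of_UNION_ordLess_infinite_Field_regularCard[OF _ Cinfinite_ord_le] inacc
  unfolding inaccessible_def by blast

lemma small_Un: "small k A \<Longrightarrow> small k B \<Longrightarrow> small k (A \<union> B)"
  unfolding small_iff by (rule Un_Cinfinite_bound_strict[OF _ _ Cinfinite_ord_le])

lemma small_Sigma: "small k A \<Longrightarrow> (\<And>a. a \<in> A \<Longrightarrow> small k (B a)) \<Longrightarrow> small k (Sigma A B)"
proof -
  assume A: "small k A" and B: "\<And>a. a \<in> A \<Longrightarrow> small k (B a)"
  have "Sigma A B = (\<Union>a\<in>A. Pair a ` B a)" by auto
  then show ?thesis using small_UNION[OF A, of "\<lambda>a. Pair a ` B a"] small_image B by metis
qed

lemma small_Plus: "small k A \<Longrightarrow> small k B \<Longrightarrow> small k (A <+> B)"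
  unfolding Plus_def by (intro small_Un small_image)

lemma small_Pow: "small k A \<Longrightarrow> small k (Pow A)"
proof -
  assume A: "small k A"
  \<comment> \<open>Inaccessibility bounds the power sets of subsets of \<open>'k\<close> only, so
    \<open>A\<close> is first moved into \<open>'k\<close>.\<close>
  obtain b :: "'a \<Rightarrow> 'k" where b: "inj_on b A" using A small_embed by blast
  have "|b ` A| <o (ord_le :: 'k rel)" using small_image[OF A, of b] small_iff by blast
  then have "small k (Pow (b ` A))" using inacc unfolding inaccessible_def small_iff by blast
  then have "small k (image b ` Pow A)" by (rule small_subset[rotated]) auto
  then show ?thesis using small_inj_on[OF inj_on_image_Pow[OF b]] by blast
qed

text \<open>An extensional function is determined by its graph over \<open>A\<close>, and the graphs
  are subsets of a small \<open>Sigma\<close>.\<close>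

lemma small_PiE: "small k A \<Longrightarrow> (\<And>a. a \<in> A \<Longrightarrow> small k (B a)) \<Longrightarrow> small k (Pi\<^sub>E A B)"
proof -
  assume A: "small k A" and B: "\<And>a. a \<in> A \<Longrightarrow> small k (B a)"
  let ?g = "\<lambda>f. (\<lambda>a. (a, f a)) ` A"
  have "?g ` Pi\<^sub>E A B \<subseteq> Pow (Sigma A B)" by (auto simp: PiE_mem)
  then have 1: "small k (?g ` Pi\<^sub>E A B)"
    using small_Pow[OF small_Sigma[OF A B]] by (rule small_subset)
  have "inj_on ?g (Pi\<^sub>E A B)"
  proof (rule inj_onI)
    fix f h assume f: "f \<in> Pi\<^sub>E A B" and h: "h \<in> Pi\<^sub>E A B" and eq: "?g f = ?g h"
    show "f = h"
    proof (rule PiE_ext[OF f h])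
      fix a assume "a \<in> A"
      then have "(a, f a) \<in> ?g h" using eq[symmetric] by auto
      then show "f a = h a" by auto
    qed
  qed
  then show ?thesis using small_inj_on 1 by blast
qed

section \<open>Ordinals and regular cardinals below the inaccessible cardinal\<close>

lemma small_lessThan: "small k {i :: 'k. i < s}"
proof -
  have "underS (ord_le :: 'k rel) s = {i. i < s}" by (auto simp: underS_def ord_le_def)
  then show ?thesis using card_of_underS[OF ord_le_card, of s] by (simp add: small_iff)
qed

lemma small_atMost: "small k {i :: 'k. i \<le> s}"
proof -
  have "{i. i \<le> s} = insert s {i. i < s}" by auto
  then show ?thesis using small_Un[OF small_finite[of "{s}"] small_lessThan[of s]] by simp
qed

lemma ex_greater: "\<exists>j. (i :: 'k) < j"
proof -
  have "\<exists>b\<in>Field (ord_le :: 'k rel). i \<noteq> b \<and> (i, b) \<in> ord_le"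
    by (rule infinite_Card_order_limit[OF ord_le_card]) (simp_all add: infinite_UNIV_k)
  then obtain b where "i \<noteq> b" "(i, b) \<in> ord_le" by blast
  then show ?thesis by (auto simp: ord_le_def less_le)
qed

definition succ :: "'k \<Rightarrow> 'k" where "succ i = (LEAST j. i < j)"

lemma less_succ [simp]: "i < succ i"
  unfolding succ_def by (rule LeastI_ex[OF ex_greater])

lemma less_succ_iff [simp]: "i < succ j \<longleftrightarrow> i \<le> j"
  using not_less_Least[of i "\<lambda>x. j < x"] less_succ[of j] unfolding succ_def
  by (meson le_less_trans not_le)

lemma succ_le_iff [simp]: "succ i \<le> j \<longleftrightarrow> i < j"
  using less_succ_iff[of j i] by (simp add: not_less[symmetric])

lemma le_succ [simp]: "i \<le> succ i"
  by (rule less_imp_le) (rule less_succ)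

lemma succ_inject [simp]: "succ i = succ j \<longleftrightarrow> i = j"
  by (metis less_succ_iff order_eq_iff)

lemma succ_neq [simp]: "succ i \<noteq> i" "i \<noteq> succ i"
  by (metis less_irrefl less_succ)+

definition zero :: 'k where "zero = (LEAST i. True)"

lemma zero_le [simp]: "zero \<le> i"
  unfolding zero_def by (rule Least_le) simp

lemma not_less_zero [simp]: "\<not> i < zero"
  by (simp add: not_less)

lemma succ_neq_zero [simp]: "succ i \<noteq> zero"
  by (metis less_succ not_less_zero)

lemma min_eq_zero: "(\<forall>i. z \<le> i) \<longleftrightarrow> z = zero"
  by (metis zero_le order_antisym)

lemma ordinal_cases:
  obtains (zero) "j = zero" | (succ) i where "j = succ i" | (limit) "limit_ordinal j"
proof (cases "j = zero \<or> limit_ordinal j")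
  case False
  then have "zero < j" using zero_le[of j] by (metis less_le)
  then obtain i where i: "i < j" "\<And>m. i < m \<Longrightarrow> \<not> m < j"
    using False unfolding limit_ordinal_def by blast
  then have "j = succ i" using i(2)[of "succ i"] by (simp add: order_antisym not_less)
  then show ?thesis using that by blast
qed (use that in blast)

lemma limit_not_zero: "\<not> limit_ordinal zero"
  by (auto simp: limit_ordinal_def)

lemma limit_not_succ: "\<not> limit_ordinal (succ i)"
  unfolding limit_ordinal_def by (meson less_succ less_succ_iff not_le)

lemma limit_zero_less: "limit_ordinal j \<Longrightarrow> zero < j"
  unfolding limit_ordinal_def using le_less_trans zero_le by blast

lemma succ_less_induct [case_names zero succ limit]:
  assumes "P zero" "\<And>i. P i \<Longrightarrow> P (succ i)"
    "\<And>j. limit_ordinal j \<Longrightarrow> (\<And>i. i < j \<Longrightarrow> P i) \<Longrightarrow> P j"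
  shows "P (j :: 'k)"
proof (induction j rule: less_induct)
  case (less j)
  show ?case by (cases j rule: ordinal_cases) (use assms less in \<open>auto\<close>)
qed

lemma zero_neq_succ [simp]: "zero \<noteq> succ i"
  by (metis succ_neq_zero)

text \<open>Recursion with choices: a next value is only known to exist if the earlier values were
  chosen well. Chains, lifts along chains and maps of towers are all built with it; \<open>P\<close>
  therefore records every property that later stages rely on.\<close>

lemma transfinite_choice:
  fixes P :: "('k \<Rightarrow> 'b) \<Rightarrow> 'k \<Rightarrow> 'b \<Rightarrow> bool"
  assumes "\<And>f g x r. (\<And>z. z < x \<Longrightarrow> f z = g z) \<Longrightarrow> P f x r = P g x r"
    and "\<And>x f. (\<And>y. y < x \<Longrightarrow> P f y (f y)) \<Longrightarrow> \<exists>r. P f x r"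
  shows "\<exists>f. \<forall>x. P f x (f x)"
proof (rule dependent_wf_choice[OF wf])
  show "P f x r = P g x r" if "\<And>z. (z, x) \<in> {(x, y). x < y} \<Longrightarrow> f z = g z" for f g x r
    using assms(1)[of x f g r] that by simp
  show "\<exists>r. P f x r" if "\<And>y. (y, x) \<in> {(x, y). x < y} \<Longrightarrow> P f y (f y)" for x f
    using assms(2)[of x f] that by simp
qed

text \<open>This one relation has two uses: it indexes chains of length \<open>s\<close>, and, when
  \<open>s\<close> is an initial ordinal, it is the cardinal \<open>s\<close> in the sense of the
  cardinal library, where cardinals are well-order relations.\<close>

definition chain_ord :: "'k \<Rightarrow> 'k rel" where
  "chain_ord s = {(i, j). i \<le> j \<and> j < s}"

lemma chain_ord_iff: "(i, j) \<in> chain_ord s \<longleftrightarrow> i \<le> j \<and> j < s"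
  by (simp add: chain_ord_def)

definition regular_above :: "'a set \<Rightarrow> 'k \<Rightarrow> bool" where
  "regular_above A s \<longleftrightarrow> Cinfinite (chain_ord s) \<and> regularCard (chain_ord s) \<and> |A| <o chain_ord s"

lemma Field_chain_ord [simp]: "Field (chain_ord s) = {i. i < s}"
  by (auto simp: chain_ord_def Field_def)

text \<open>The successor of an infinite cardinal is regular, and inaccessibility keeps it below
  \<open>'k\<close> because it is at most a power set. Adding a copy of the natural numbers to
  \<open>A\<close> makes the cardinal infinite.\<close>

lemma ex_regular_above:
  assumes A: "small k (A :: 'a set)"
  shows "\<exists>s. regular_above A s"
proof -
  define B where "B = A <+> (UNIV :: nat set)"
  have B: "small k B" "infinite B"
    using small_Plus[OF A small_nat[of UNIV]] by (auto simp: B_def)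
  have cB: "Cinfinite |B|" using B by (simp add: cinfinite_def Field_card_of card_of_card_order_on)
  have "cardSuc |B| \<le>o |Pow B|"
    by (rule cardSuc_least) (simp_all add: card_of_Card_order card_of_Pow)
  then have "cardSuc |B| <o (ord_le :: 'k rel)"
    using small_Pow[OF B(1)] small_iff ordLeq_ordLess_trans by blast
  \<comment> \<open>A well-order strictly smaller than \<open>ord_le\<close> is isomorphic to a
    proper initial segment of it, and the bound of that segment is the ordinal wanted.\<close>
  then obtain s where s: "cardSuc |B| =o Restr (ord_le :: 'k rel) (underS ord_le s)"
    using ordLess_iff_ordIso_Restr[of ord_le "cardSuc |B|"] ord_le_card
      cardSuc_Card_order[OF card_of_Card_order] unfolding card_order_on_def by blast
  have "Restr (ord_le :: 'k rel) (underS ord_le s) = chain_ord s"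
    by (auto simp: ord_le_def underS_def chain_ord_def)
  then have s: "cardSuc |B| =o chain_ord s" using s by simp
  have "Cinfinite (cardSuc |B| )" "regularCard (cardSuc |B| )"
    using cB by (simp_all add: Cinfinite_cardSuc regularCard_cardSuc)
  then have 1: "Cinfinite (chain_ord s)" "regularCard (chain_ord s)"
    using s Cinfinite_cong regularCard_ordIso by blast+
  have "|A| \<le>o |B|" unfolding B_def by (rule card_of_Plus1)
  then have "|A| <o cardSuc |B|"
    using cardSuc_greater[OF card_of_Card_order] ordLeq_ordLess_trans by blast
  then have "|A| <o chain_ord s" using s ordLess_ordIso_trans by blast
  with 1 show ?thesis unfolding regular_above_def by blast
qed

lemma regular_above_mono: "|B| \<le>o |A| \<Longrightarrow> regular_above A s \<Longrightarrow> regular_above B s"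
  unfolding regular_above_def using ordLeq_ordLess_trans by blast

text \<open>By regularity a cofinal subset has the full cardinality, so \<open>S\<close> is not
  cofinal; in a total order this means that it is bounded.\<close>

lemma card_less_bounded:
  assumes s: "regular_above A s" and S: "S \<subseteq> {i. i < s}" "|S| <o chain_ord s"
  shows "\<exists>b<s. \<forall>i\<in>S. i \<le> b"
proof -
  have "\<not> cofinal S (chain_ord s)"
    using s S not_ordLess_ordIso unfolding regular_above_def regularCard_def by auto
  then obtain b where b: "b < s" "\<forall>i\<in>S. b = i \<or> \<not> (b, i) \<in> chain_ord s"
    unfolding cofinal_def by auto
  then have "\<forall>i\<in>S. i \<le> b" using S by (auto simp: chain_ord_def)
  then show ?thesis using b by blast
qed

lemma regular_limit: assumes "regular_above A s" shows "limit_ordinal s"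
proof -
  have c: "Card_order (chain_ord s)" "infinite (Field (chain_ord s))"
    using assms by (auto simp: regular_above_def cinfinite_def)
  have "\<exists>j. i < j \<and> j < s" if "i < s" for i
  proof -
    obtain b where "i \<noteq> b" "(i, b) \<in> chain_ord s"
      using infinite_Card_order_limit[OF c, of i] \<open>i < s\<close> by auto
    then show ?thesis by (auto simp: chain_ord_def less_le)
  qed
  moreover have "\<exists>i. i < s" using c(2) by (metis Field_chain_ord Collect_empty_eq finite.emptyI)
  ultimately show ?thesis unfolding limit_ordinal_def by blast
qed

end

section \<open>Categories and colimits\<close>

text \<open>Only the vertices and edges of \<open>J\<close> matter here, not its identities and
  composites. Spans, parallel arrows and sets of endomorphisms can thus serve as shapes of colimits
  without being completed to categories.\<close>

definition graph_diagram ::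
    "('i, 'j) cat \<Rightarrow> ('o, 'm) cat \<Rightarrow> ('i \<Rightarrow> 'o) \<Rightarrow> ('j \<Rightarrow> 'm) \<Rightarrow> bool" where
  "graph_diagram J C F G \<longleftrightarrow> (\<forall>i\<in>Obj J. F i \<in> Obj C) \<and>
     (\<forall>a\<in>Arr J. Dom J a \<in> Obj J \<and> Cod J a \<in> Obj J \<and> G a \<in> Hom C (F (Dom J a)) (F (Cod J a)))"

lemma poset_cat_simps [simp]:
  "Obj (poset_cat r) = Field r" "Arr (poset_cat r) = r" "Dom (poset_cat r) = fst"
  "Cod (poset_cat r) = snd" "Ident (poset_cat r) i = (i, i)"
  "Comp (poset_cat r) q p = (fst p, snd q)"
  by (simp_all add: poset_cat_def)

lemma diagram_poset_iff:
  "diagram (poset_cat r) C F G \<longleftrightarrow>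
     (\<forall>i\<in>Field r. F i \<in> Obj C \<and> G (i, i) = Ident C (F i)) \<and>
     (\<forall>i j. (i, j) \<in> r \<longrightarrow> G (i, j) \<in> Hom C (F i) (F j)) \<and>
     (\<forall>i j l. (i, j) \<in> r \<longrightarrow> (j, l) \<in> r \<longrightarrow> G (i, l) = Comp C (G (j, l)) (G (i, j)))"
  by (fastforce simp: diagram_def)

lemma diagram_graph_poset: "diagram (poset_cat r) C F G \<Longrightarrow> graph_diagram (poset_cat r) C F G"
  by (auto simp: diagram_def graph_diagram_def Field_def)

context category
begin

lemma Hom_iff [simp]: "f \<in> Hom C a b \<longleftrightarrow> f \<in> Arr C \<and> Dom C f = a \<and> Cod C f = b"
  by (simp add: Hom_def)

lemma comp_arr [simp]: "f \<in> Arr C \<Longrightarrow> g \<in> Arr C \<Longrightarrow> Dom C g = Cod C f \<Longrightarrow> g \<cdot> f \<in> Arr C"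
  and dom_comp [simp]: "f \<in> Arr C \<Longrightarrow> g \<in> Arr C \<Longrightarrow> Dom C g = Cod C f \<Longrightarrow> Dom C (g \<cdot> f) = Dom C f"
  and cod_comp [simp]: "f \<in> Arr C \<Longrightarrow> g \<in> Arr C \<Longrightarrow> Dom C g = Cod C f \<Longrightarrow> Cod C (g \<cdot> f) = Cod C g"
  using Comp_in_Hom[of f "Dom C f" "Cod C f" g "Cod C g"] by auto

lemma comp_assoc [simp]:
  "f \<in> Arr C \<Longrightarrow> g \<in> Arr C \<Longrightarrow> h \<in> Arr C \<Longrightarrow> Dom C g = Cod C f \<Longrightarrow> Dom C h = Cod C g \<Longrightarrow>
    (h \<cdot> g) \<cdot> f = h \<cdot> (g \<cdot> f)"
  using Comp_assoc[of f "Dom C f" "Cod C f" g "Cod C g" h "Cod C h"] by auto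

lemma id_arr [simp]: "a \<in> Obj C \<Longrightarrow> Ident C a \<in> Arr C"
  and dom_id [simp]: "a \<in> Obj C \<Longrightarrow> Dom C (Ident C a) = a"
  and cod_id [simp]: "a \<in> Obj C \<Longrightarrow> Cod C (Ident C a) = a"
  using Id_in_Hom[of a] by auto

lemma comp_id [simp]: "f \<in> Arr C \<Longrightarrow> Dom C f = a \<Longrightarrow> f \<cdot> Ident C a = f"
  and id_comp [simp]: "f \<in> Arr C \<Longrightarrow> Cod C f = a \<Longrightarrow> Ident C a \<cdot> f = f"
  using Comp_Id[of f a "Cod C f"] Id_Comp[of f "Dom C f" a] by auto

declare dom_in_Obj [simp] cod_in_Obj [simp]

lemma comp_cong2:
  assumes "g \<cdot> f = g' \<cdot> f'" "f \<in> Arr C" "g \<in> Arr C" "Dom C g = Cod C f"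
    "f' \<in> Arr C" "g' \<in> Arr C" "Dom C g' = Cod C f'" "h \<in> Arr C" "Dom C f = Cod C h" "Dom C f' = Cod C h"
  shows "g \<cdot> (f \<cdot> h) = g' \<cdot> (f' \<cdot> h)"
  using assms comp_assoc[of h f g] comp_assoc[of h f' g'] by simp

lemma comp_reduce:
  assumes "g \<cdot> f = f'" "f \<in> Arr C" "g \<in> Arr C" "Dom C g = Cod C f" "h \<in> Arr C" "Dom C f = Cod C h"
  shows "g \<cdot> (f \<cdot> h) = f' \<cdot> h"
  using assms comp_assoc[of h f g] by simp

lemma colimit_obj: "colimit J C F G c p \<Longrightarrow> c \<in> Obj C"
  by (simp add: colimit_def cocone_def)

lemma colimit_in: "colimit J C F G c p \<Longrightarrow> i \<in> Obj J \<Longrightarrow> p i \<in> Hom C (F i) c"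
  unfolding colimit_def cocone_def by blast

lemma colimit_comm: "colimit J C F G c p \<Longrightarrow> a \<in> Arr J \<Longrightarrow> p (Cod J a) \<cdot> G a = p (Dom J a)"
  unfolding colimit_def cocone_def by blast

lemma colimit_ex:
  assumes "colimit J C F G c p" "d \<in> Obj C" "\<And>i. i \<in> Obj J \<Longrightarrow> q i \<in> Hom C (F i) d"
    "\<And>a. a \<in> Arr J \<Longrightarrow> q (Cod J a) \<cdot> G a = q (Dom J a)"
  shows "\<exists>u\<in>Hom C c d. \<forall>i\<in>Obj J. u \<cdot> p i = q i"
proof -
  have "cocone J C F G d q" using assms unfolding cocone_def by blast
  then show ?thesis using assms(1) unfolding colimit_def by blast
qed

lemma cocone_comp:
  assumes "graph_diagram J C F G" "cocone J C F G c p" "u \<in> Hom C c d"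
  shows "cocone J C F G d (\<lambda>i. u \<cdot> p i)"
  unfolding cocone_def
proof (intro conjI ballI)
  show "d \<in> Obj C" using assms by auto
  show "u \<cdot> p i \<in> Hom C (F i) d" if "i \<in> Obj J" for i
    using assms that unfolding cocone_def by simp
  show "(u \<cdot> p (Cod J a)) \<cdot> G a = u \<cdot> p (Dom J a)" if "a \<in> Arr J" for a
    using assms that unfolding cocone_def graph_diagram_def by simp
qed

lemma colimit_eqI:
  assumes "graph_diagram J C F G" "colimit J C F G c p" "u \<in> Hom C c d" "v \<in> Hom C c d"
    "\<And>i. i \<in> Obj J \<Longrightarrow> u \<cdot> p i = v \<cdot> p i"
  shows "u = v"
proof -
  have "cocone J C F G d (\<lambda>i. u \<cdot> p i)"
    using cocone_comp assms(1-3) unfolding colimit_def by blast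
  then have "\<exists>!w. w \<in> Hom C c d \<and> (\<forall>i\<in>Obj J. w \<cdot> p i = u \<cdot> p i)"
    using assms(2) unfolding colimit_def by blast
  then show ?thesis using assms(3-5) by metis
qed

lemma colimitI:
  assumes "cocone J C F G c p"
    and "\<And>d q. cocone J C F G d q \<Longrightarrow> \<exists>u\<in>Hom C c d. \<forall>i\<in>Obj J. u \<cdot> p i = q i"
    and "\<And>d u v. u \<in> Hom C c d \<Longrightarrow> v \<in> Hom C c d \<Longrightarrow> (\<And>i. i \<in> Obj J \<Longrightarrow> u \<cdot> p i = v \<cdot> p i) \<Longrightarrow> u = v"
  shows "colimit J C F G c p"
  unfolding colimit_def
proof (intro conjI allI impI)
  fix d q assume "cocone J C F G d q"
  then obtain u where "u \<in> Hom C c d" "\<forall>i\<in>Obj J. u \<cdot> p i = q i" using assms(2) by blast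
  then show "\<exists>!u. u \<in> Hom C c d \<and> (\<forall>i\<in>Obj J. u \<cdot> p i = q i)"
    using assms(3) by (metis (no_types, lifting))
qed (rule assms(1))

lemma colimit_cong:
  assumes "colimit J C F G c p" "\<And>i. i \<in> Obj J \<Longrightarrow> F i = F' i" "\<And>a. a \<in> Arr J \<Longrightarrow> G a = G' a"
    "\<And>i. i \<in> Obj J \<Longrightarrow> p i = p' i"
    "\<And>a. a \<in> Arr J \<Longrightarrow> Dom J a \<in> Obj J \<and> Cod J a \<in> Obj J"
  shows "colimit J C F' G' c p'"
proof -
  have *: "cocone J C F' G' d q = cocone J C F G d q" for d q
    using assms(2,3) unfolding cocone_def by auto
  have "cocone J C F' G' c p'"
    using assms unfolding colimit_def cocone_def by auto
  then show ?thesis using assms(1,4) unfolding colimit_def * by simp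
qed

text \<open>Only the underlying graph of the index category matters for a colimit.\<close>

lemma colimit_reindex:
  fixes J :: "('i, 'j) cat" and J' :: "('i2, 'j2) cat"
  assumes col: "colimit J' C F' G' c p'"
    and b1: "bij_betw b1 (Obj J) (Obj J')" and b2: "b2 ` Arr J = Arr J'"
    and J: "\<And>a. a \<in> Arr J \<Longrightarrow> Dom J a \<in> Obj J \<and> Cod J a \<in> Obj J \<and>
      Dom J' (b2 a) = b1 (Dom J a) \<and> Cod J' (b2 a) = b1 (Cod J a) \<and> G' (b2 a) = G a"
    and F: "\<And>i. i \<in> Obj J \<Longrightarrow> F' (b1 i) = F i"
  shows "colimit J C F G c (\<lambda>i. p' (b1 i))"
proof -
  let ?d = "the_inv_into (Obj J) b1"
  have inj: "inj_on b1 (Obj J)" and img: "b1 ` Obj J = Obj J'" using b1 by (auto simp: bij_betw_def)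
  have d: "?d (b1 i) = i" if "i \<in> Obj J" for i by (rule the_inv_into_f_f[OF inj that])
  have co: "cocone J' C F' G' e (\<lambda>i. q (?d i)) \<longleftrightarrow> cocone J C F G e q" for e q
    unfolding cocone_def img[symmetric] b2[symmetric] using J F d by auto
  have co2: "cocone J' C F' G' c p' \<longleftrightarrow> cocone J C F G c (\<lambda>i. p' (b1 i))"
    unfolding cocone_def img[symmetric] b2[symmetric] using J F by auto
  show ?thesis unfolding colimit_def
  proof (intro conjI allI impI)
    show "cocone J C F G c (\<lambda>i. p' (b1 i))" using col co2 by (simp add: colimit_def)
    fix e q assume "cocone J C F G e q"
    then have "\<exists>!u. u \<in> Hom C c e \<and> (\<forall>i\<in>Obj J'. u \<cdot> p' i = q (?d i))"
      using col co unfolding colimit_def by blast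
    then show "\<exists>!u. u \<in> Hom C c e \<and> (\<forall>i\<in>Obj J. u \<cdot> p' (b1 i) = q i)"
      unfolding img[symmetric] using d by simp
  qed
qed

text \<open>The pushout of the coproduct of all \<open>j \<sigma>\<close> along the map induced by
  the \<open>u \<sigma>\<close>: the cells \<open>j \<sigma>\<close> are glued to \<open>Z\<close>
  simultaneously. A single universal property avoids speaking of the coproducts.\<close>

definition attach ::
    "'s set \<Rightarrow> ('s \<Rightarrow> 'm) \<Rightarrow> ('s \<Rightarrow> 'm) \<Rightarrow> 'o \<Rightarrow> 'o \<Rightarrow> 'm \<Rightarrow> ('s \<Rightarrow> 'm) \<Rightarrow> bool" where
  "attach S j u Z Z1 \<eta> e \<longleftrightarrow> \<eta> \<in> Hom C Z Z1 \<and>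
     (\<forall>\<sigma>\<in>S. e \<sigma> \<in> Hom C (Cod C (j \<sigma>)) Z1 \<and> e \<sigma> \<cdot> j \<sigma> = \<eta> \<cdot> u \<sigma>) \<and>
     (\<forall>T. \<forall>t\<in>Hom C Z T. \<forall>\<epsilon>.
        (\<forall>\<sigma>\<in>S. \<epsilon> \<sigma> \<in> Hom C (Cod C (j \<sigma>)) T \<and> \<epsilon> \<sigma> \<cdot> j \<sigma> = t \<cdot> u \<sigma>) \<longrightarrow>
        (\<exists>!q. q \<in> Hom C Z1 T \<and> q \<cdot> \<eta> = t \<and> (\<forall>\<sigma>\<in>S. q \<cdot> e \<sigma> = \<epsilon> \<sigma>)))"

lemma attach_in:
  assumes "attach S j u Z Z1 \<eta> e"
  shows "\<eta> \<in> Hom C Z Z1" "\<sigma> \<in> S \<Longrightarrow> e \<sigma> \<in> Hom C (Cod C (j \<sigma>)) Z1"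
    "\<sigma> \<in> S \<Longrightarrow> e \<sigma> \<cdot> j \<sigma> = \<eta> \<cdot> u \<sigma>"
  using assms unfolding attach_def by blast+

lemma attach_ex1:
  assumes a: "attach S j u Z Z1 \<eta> e" and t: "t \<in> Hom C Z T"
    and \<epsilon>: "\<And>\<sigma>. \<sigma> \<in> S \<Longrightarrow> \<epsilon> \<sigma> \<in> Hom C (Cod C (j \<sigma>)) T \<and> \<epsilon> \<sigma> \<cdot> j \<sigma> = t \<cdot> u \<sigma>"
  shows "\<exists>!q. q \<in> Hom C Z1 T \<and> q \<cdot> \<eta> = t \<and> (\<forall>\<sigma>\<in>S. q \<cdot> e \<sigma> = \<epsilon> \<sigma>)"
proof -
  have "\<forall>T. \<forall>t\<in>Hom C Z T. \<forall>\<epsilon>.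
    (\<forall>\<sigma>\<in>S. \<epsilon> \<sigma> \<in> Hom C (Cod C (j \<sigma>)) T \<and> \<epsilon> \<sigma> \<cdot> j \<sigma> = t \<cdot> u \<sigma>) \<longrightarrow>
    (\<exists>!q. q \<in> Hom C Z1 T \<and> q \<cdot> \<eta> = t \<and> (\<forall>\<sigma>\<in>S. q \<cdot> e \<sigma> = \<epsilon> \<sigma>))"
    using a unfolding attach_def by (elim conjE)
  from bspec[OF this[THEN spec] t, THEN spec, THEN mp] show ?thesis using \<epsilon> by blast
qed

lemma attach_ex:
  assumes "attach S j u Z Z1 \<eta> e" "t \<in> Hom C Z T"
    "\<And>\<sigma>. \<sigma> \<in> S \<Longrightarrow> \<epsilon> \<sigma> \<in> Hom C (Cod C (j \<sigma>)) T \<and> \<epsilon> \<sigma> \<cdot> j \<sigma> = t \<cdot> u \<sigma>"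
  shows "\<exists>q\<in>Hom C Z1 T. q \<cdot> \<eta> = t \<and> (\<forall>\<sigma>\<in>S. q \<cdot> e \<sigma> = \<epsilon> \<sigma>)"
  using ex1_implies_ex[OF attach_ex1[OF assms]] by blast

lemma attach_eqI:
  assumes a: "attach S j u Z Z1 \<eta> e" and q: "q \<in> Hom C Z1 T" "q' \<in> Hom C Z1 T"
    and j: "\<And>\<sigma>. \<sigma> \<in> S \<Longrightarrow> j \<sigma> \<in> Arr C \<and> u \<sigma> \<in> Hom C (Dom C (j \<sigma>)) Z"
    and eq: "q \<cdot> \<eta> = q' \<cdot> \<eta>" "\<And>\<sigma>. \<sigma> \<in> S \<Longrightarrow> q \<cdot> e \<sigma> = q' \<cdot> e \<sigma>"
  shows "q = q'"
proof -
  have "q \<cdot> \<eta> \<in> Hom C Z T" using attach_in[OF a] q by simp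
  moreover have "\<forall>\<sigma>\<in>S. q \<cdot> e \<sigma> \<in> Hom C (Cod C (j \<sigma>)) T \<and> (q \<cdot> e \<sigma>) \<cdot> j \<sigma> = (q \<cdot> \<eta>) \<cdot> u \<sigma>"
    using attach_in[OF a] q j by simp
  ultimately have "\<exists>!w. w \<in> Hom C Z1 T \<and> w \<cdot> \<eta> = q \<cdot> \<eta> \<and> (\<forall>\<sigma>\<in>S. w \<cdot> e \<sigma> = q \<cdot> e \<sigma>)"
    by (intro attach_ex1[OF a, where \<epsilon> = "\<lambda>\<sigma>. q \<cdot> e \<sigma>"]) blast+
  then show ?thesis using q eq by metis
qed

lemma attach_pushout:
  assumes a: "attach {\<sigma>} j u Z Z1 \<eta> e" and j: "j \<sigma> \<in> Arr C" "u \<sigma> \<in> Hom C (Dom C (j \<sigma>)) Z"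
  shows "pushout C (j \<sigma>) (u \<sigma>) \<eta> (e \<sigma>)"
  unfolding pushout_def
proof (intro conjI allI ballI impI)
  show "\<exists>!w. w \<in> Hom C (Cod C \<eta>) d \<and> w \<cdot> \<eta> = x \<and> w \<cdot> e \<sigma> = y"
    if "x \<in> Hom C (Cod C (u \<sigma>)) d" "y \<in> Hom C (Cod C (j \<sigma>)) d" "x \<cdot> u \<sigma> = y \<cdot> j \<sigma>" for d x y
  proof -
    have "x \<in> Hom C Z d" "\<forall>\<tau>\<in>{\<sigma>}. (\<lambda>_. y) \<tau> \<in> Hom C (Cod C (j \<tau>)) d \<and> (\<lambda>_. y) \<tau> \<cdot> j \<tau> = x \<cdot> u \<tau>"
      using that j by auto
    then have "\<exists>!w. w \<in> Hom C Z1 d \<and> w \<cdot> \<eta> = x \<and> (\<forall>\<tau>\<in>{\<sigma>}. w \<cdot> e \<tau> = (\<lambda>_. y) \<tau>)"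
      by (intro attach_ex1[OF a]) blast+
    moreover have "Cod C \<eta> = Z1" using attach_in[OF a] by simp
    ultimately show ?thesis by simp
  qed
qed (use attach_in[OF a] j in auto)

end

section \<open>Colimits over graphs and attachment of cells\<close>

locale cocomplete_category = category C + universe k
  for C :: "('o, 'm) cat" (structure) and k :: "'k::wellorder itself" +
  assumes cocomplete: "cocomplete k C"
begin

text \<open>A graph is turned into a category with an object for every vertex and every edge: the edge
  \<open>e\<close> gets arrows to its two ends, the one to its source being sent to an identity.\<close>

lemma graph_colimit:
  fixes J :: "('i, 'j) cat"
  assumes gd: "graph_diagram J C F G" and small: "small k (Obj J)" "small k (Arr J)"
  shows "\<exists>c p. colimit J C F G c p"
proof -
  \<comment> \<open>\<open>Inl\<close> codes the objects, vertices and edges alike, together with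
    their identities. \<open>Inr (e, t)\<close> codes the two arrows out of the object for the edge
    \<open>e\<close>: to the target of \<open>e\<close> if \<open>t\<close>, to its source
    otherwise.\<close>
  define A :: "(('i + 'j) + ('j \<times> bool)) set" where "A = (Obj J <+> Arr J) <+> (Arr J \<times> UNIV)"
  have "small k A" unfolding A_def
    by (intro small_Plus small_Sigma small) (simp add: small_finite)
  then obtain b :: "('i + 'j) + ('j \<times> bool) \<Rightarrow> 'k" where b: "inj_on b A" by (rule small_embed)
  define d where "d = the_inv_into A b"
  have d: "d (b x) = x" if "x \<in> A" for x unfolding d_def by (rule the_inv_into_f_f[OF b that])
  \<comment> \<open>No two arrows that are not identities can be composed, since an object that
    comes from an edge receives only its identity. Hence \<open>Comp\<close> just returns whichever
    factor is not an identity.\<close>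
  define J1 where "J1 = \<lparr>Obj = b ` Inl ` (Obj J <+> Arr J), Arr = b ` A,
    Dom = (\<lambda>m. case d m of Inl x \<Rightarrow> b (Inl x) | Inr (e, _) \<Rightarrow> b (Inl (Inr e))),
    Cod = (\<lambda>m. case d m of Inl x \<Rightarrow> b (Inl x) | Inr (e, t) \<Rightarrow>
       b (Inl (Inl (if t then Cod J e else Dom J e)))),
    Ident = (\<lambda>m. m), Comp = (\<lambda>q p. case d q of Inl _ \<Rightarrow> p | Inr _ \<Rightarrow> q)\<rparr>"
  define F1 where "F1 = (\<lambda>m. case d m of Inl (Inl v) \<Rightarrow> F v | Inl (Inr e) \<Rightarrow> F (Dom J e))"
  define G1 where "G1 = (\<lambda>m. case d m of Inl x \<Rightarrow> Ident C (F1 m) |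
    Inr (e, t) \<Rightarrow> if t then G e else Ident C (F (Dom J e)))"
  have J: "Dom J a \<in> Obj J" "Cod J a \<in> Obj J" "F (Dom J a) \<in> Obj C"
    "G a \<in> Hom C (F (Dom J a)) (F (Cod J a))" if "a \<in> Arr J" for a
    using gd that unfolding graph_diagram_def by blast+
  have FO: "F v \<in> Obj C" if "v \<in> Obj J" for v using gd that by (simp add: graph_diagram_def)
  have inA: "Inl (Inl v) \<in> A \<longleftrightarrow> v \<in> Obj J" "Inl (Inr e) \<in> A \<longleftrightarrow> e \<in> Arr J"
    "Inr (e, t) \<in> A \<longleftrightarrow> e \<in> Arr J" for v e t by (auto simp: A_def)
  have beq: "b x = b y \<longleftrightarrow> x = y" if "x \<in> A" "y \<in> A" for x y
    using b that by (auto dest: inj_onD)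
  have arrE: "\<exists>x. m = b (Inl x) \<and> Inl x \<in> A \<or> (\<exists>e t. m = b (Inr (e, t)) \<and> e \<in> Arr J)"
    if "m \<in> Arr J1" for m
    using that by (auto simp: J1_def A_def)
  have DomI [simp]: "Dom J1 (b (Inl x)) = b (Inl x)" "Cod J1 (b (Inl x)) = b (Inl x)"
    if "Inl x \<in> A" for x using that by (simp_all add: J1_def d)
  have DomE [simp]: "Dom J1 (b (Inr (e, t))) = b (Inl (Inr e))"
    "Cod J1 (b (Inr (e, t))) = b (Inl (Inl (if t then Cod J e else Dom J e)))"
    if "e \<in> Arr J" for e t using that by (simp_all add: J1_def d inA)
  have CompI [simp]: "Comp J1 (b (Inl x)) p = p" if "Inl x \<in> A" for x p using that by (simp add: J1_def d)
  have CompE [simp]: "Comp J1 (b (Inr (e, t))) p = b (Inr (e, t))" if "e \<in> Arr J" for e t p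
    using that by (simp add: J1_def d inA)
  have [simp]: "b (Inl x) \<in> Obj J1 \<longleftrightarrow> Inl x \<in> A" if "Inl x \<in> A" for x
    using that by (auto simp: J1_def A_def)
  have [simp]: "b x \<in> Arr J1" if "x \<in> A" for x using that by (simp add: J1_def)
  have Id [simp]: "Ident J1 m = m" for m by (simp add: J1_def)
  have objE: "\<exists>x. m = b (Inl x) \<and> Inl x \<in> A" if "m \<in> Obj J1" for m
    using that by (auto simp: J1_def A_def)
  have compo: "Comp J1 g f \<in> Arr J1 \<and> Dom J1 (Comp J1 g f) = Dom J1 f \<and>
      Cod J1 (Comp J1 g f) = Cod J1 g \<and> (g = Cod J1 f \<or> f = Dom J1 g)"
    if "f \<in> Arr J1" "g \<in> Arr J1" "Dom J1 g = Cod J1 f" for f g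
    using arrE[OF that(1)] arrE[OF that(2)] that(3) J
    by (elim exE disjE conjE) (auto simp: beq inA)
  have cat: "category J1"
  proof
    show "Dom J1 f \<in> Obj J1" if "f \<in> Arr J1" for f
      using arrE[OF that] by (auto simp: inA)
    show "Cod J1 f \<in> Obj J1" if "f \<in> Arr J1" for f
      using arrE[OF that] J by (auto simp: inA)
    show "Ident J1 a \<in> Hom J1 a a" if "a \<in> Obj J1" for a
      using objE[OF that] by (auto simp: Hom_def)
    show "Comp J1 g f \<in> Hom J1 a c" if "f \<in> Hom J1 a b" "g \<in> Hom J1 b c" for f g a b c
      using that compo[of f g] by (auto simp: Hom_def)
    show "Comp J1 f (Ident J1 a) = f" if "f \<in> Hom J1 a b" for f a b
      using arrE[of f] that by (auto simp: Hom_def)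
    show "Comp J1 (Ident J1 b) f = f" if "f \<in> Hom J1 a b" for f a b
      using arrE[of f] that J by (auto simp: Hom_def inA)
    show "Comp J1 (Comp J1 h g) f = Comp J1 h (Comp J1 g f)"
      if fgh: "f \<in> Hom J1 x1 x2" "g \<in> Hom J1 x2 x3" "h \<in> Hom J1 x3 x4" for f g h x1 x2 x3 x4
    proof -
      consider x where "h = b (Inl x)" "Inl x \<in> A" | y t where "h = b (Inr (y, t))" "y \<in> Arr J"
        using arrE[of h] fgh(3) unfolding Hom_def by blast
      then show ?thesis by cases simp_all
    qed
  qed
  have F1 [simp]: "v \<in> Obj J \<Longrightarrow> F1 (b (Inl (Inl v))) = F v"
    "e \<in> Arr J \<Longrightarrow> F1 (b (Inl (Inr e))) = F (Dom J e)" for v e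
    by (simp_all add: F1_def d inA)
  have G1 [simp]: "Inl x \<in> A \<Longrightarrow> G1 (b (Inl x)) = Ident C (F1 (b (Inl x)))"
    "e \<in> Arr J \<Longrightarrow> G1 (b (Inr (e, t))) = (if t then G e else Ident C (F (Dom J e)))" for x e t
    by (simp_all add: G1_def d inA)
  have F1O: "F1 m \<in> Obj C" if "m \<in> Obj J1" for m
    using that J FO by (auto simp: J1_def)
  have G1H: "G1 m \<in> Hom C (F1 (Dom J1 m)) (F1 (Cod J1 m))" if "m \<in> Arr J1" for m
    using arrE[OF that] J FO F1O[of m] by (auto simp: inA)
  have dia: "diagram J1 C F1 G1" unfolding diagram_def
  proof (intro conjI ballI impI)
    show "G1 (Ident J1 i) = Ident C (F1 i)" if "i \<in> Obj J1" for i
      using objE[OF that] by auto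
    fix m n assume mn: "m \<in> Arr J1" "n \<in> Arr J1" "Cod J1 m = Dom J1 n"
    show "G1 (Comp J1 n m) = G1 n \<cdot> G1 m"
    proof (cases "\<exists>x. n = b (Inl x) \<and> Inl x \<in> A")
      case True
      then show ?thesis using mn G1H[of m] by auto
    next
      case False
      then obtain e t where n: "n = b (Inr (e, t))" "e \<in> Arr J" using arrE[OF mn(2)] by blast
      then have m: "m = b (Inl (Inr e))"
        using mn(3) arrE[OF mn(1)] J by (auto simp: beq inA)
      show ?thesis using n m J by (auto simp: inA)
    qed
  qed (use F1O G1H in auto)
  have "small k (Obj J1)" "small k (Arr J1)"
    using small_image[OF \<open>small k A\<close>, of b] small_subset[of "Obj J1" "b ` A" k]
    by (auto simp: J1_def A_def)
  then obtain c p where col: "colimit J1 C F1 G1 c p"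
    using cocomplete cat dia unfolding cocomplete_def small_def by blast
  let ?v = "\<lambda>v. b (Inl (Inl v))" and ?e = "\<lambda>e. b (Inl (Inr e))"
  have pe: "p (?e e) = p (?v (Dom J e))" "p (?v (Cod J e)) \<cdot> G e = p (?e e)"
    if "e \<in> Arr J" for e
    using colimit_comm[OF col, of "b (Inr (e, False))"] colimit_comm[OF col, of "b (Inr (e, True))"]
      colimit_in[OF col, of "?v (Dom J e)"] that J[OF that] by (simp_all add: inA)
  have "colimit J C F G c (\<lambda>v. p (?v v))"
  proof (rule colimitI)
    show "cocone J C F G c (\<lambda>v. p (?v v))" unfolding cocone_def
    proof (intro conjI ballI)
      show "c \<in> Obj C" by (rule colimit_obj[OF col])
      show "p (?v i) \<in> Hom C (F i) c" if "i \<in> Obj J" for i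
        using colimit_in[OF col, of "?v i"] that by (simp add: inA)
    qed (simp add: pe)
  next
    fix e q assume q: "cocone J C F G e q"
    let ?q = "\<lambda>m. case d m of Inl (Inl v) \<Rightarrow> q v | Inl (Inr e) \<Rightarrow> q (Dom J e)"
    have qv [simp]: "v \<in> Obj J \<Longrightarrow> ?q (?v v) = q v" "a \<in> Arr J \<Longrightarrow> ?q (?e a) = q (Dom J a)" for v a
      by (simp_all add: d inA)
    have qH: "q v \<in> Hom C (F v) e" if "v \<in> Obj J" for v using q that by (simp add: cocone_def)
    have qG: "q (Cod J a) \<cdot> G a = q (Dom J a)" if "a \<in> Arr J" for a
      using q that by (simp add: cocone_def)
    have qO: "?q m \<in> Hom C (F1 m) e" if m: "m \<in> Obj J1" for m
    proof -
      obtain x where x: "m = b (Inl x)" "Inl x \<in> A" using objE[OF m] by blast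
      show ?thesis using x qH J by (cases x) (auto simp: inA)
    qed
    have "\<exists>u\<in>Hom C c e. \<forall>i\<in>Obj J1. u \<cdot> p i = ?q i"
    proof (rule colimit_ex[OF col])
      show "e \<in> Obj C" using q by (simp add: cocone_def)
      show "?q (Cod J1 m) \<cdot> G1 m = ?q (Dom J1 m)" if m: "m \<in> Arr J1" for m
      proof -
        consider x where "m = b (Inl x)" "Inl x \<in> A" | a t where "m = b (Inr (a, t))" "a \<in> Arr J"
          using arrE[OF m] by blast
        then show ?thesis
        proof cases
          case 1
          then have "m \<in> Obj J1" by simp
          then show ?thesis using 1 qO[of m] by simp
        next
          case 2
          then show ?thesis using qH[of "Dom J a"] qG J by simp
        qed
      qed
    qed (rule qO)
    then obtain u where u: "u \<in> Hom C c e" "\<forall>i\<in>Obj J1. u \<cdot> p i = ?q i" by blast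
    have "u \<cdot> p (?v i) = q i" if "i \<in> Obj J" for i
      using bspec[OF u(2), of "?v i"] that by (simp add: inA)
    then show "\<exists>u\<in>Hom C c e. \<forall>i\<in>Obj J. u \<cdot> p (?v i) = q i" using u(1) by blast
  next
    fix e u v assume uv: "u \<in> Hom C c e" "v \<in> Hom C c e"
      and eq: "\<And>i. i \<in> Obj J \<Longrightarrow> u \<cdot> p (?v i) = v \<cdot> p (?v i)"
    have gd1: "graph_diagram J1 C F1 G1"
      using F1O G1H cat by (auto simp: graph_diagram_def category.dom_in_Obj category.cod_in_Obj)
    show "u = v"
    proof (rule colimit_eqI[OF gd1 col uv])
      fix m assume "m \<in> Obj J1"
      then obtain x where x: "m = b (Inl x)" "Inl x \<in> A" using objE by blast
      then show "u \<cdot> p m = v \<cdot> p m" using eq pe(1) J by (cases x) (auto simp: inA)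
    qed
  qed
  then show ?thesis by blast
qed

lemma poset_colimit:
  assumes "diagram (poset_cat r) C F G" "small k r"
  shows "\<exists>c p. colimit (poset_cat r) C F G c p"
proof -
  have "small k (Field r)" unfolding Field_def Domain_fst Range_snd
    by (intro small_Un small_image assms(2))
  then show ?thesis using graph_colimit[OF diagram_graph_poset[OF assms(1)]] assms(2) by simp
qed

lemma attach_exists:
  fixes S :: "'s set"
  assumes S: "small k S" and Z: "Z \<in> Obj C"
    and j: "\<And>\<sigma>. \<sigma> \<in> S \<Longrightarrow> j \<sigma> \<in> Arr C \<and> u \<sigma> \<in> Hom C (Dom C (j \<sigma>)) Z"
  shows "\<exists>Z1 \<eta> e. attach S j u Z Z1 \<eta> e"
proof -
  \<comment> \<open>Each cell contributes a span: its domain \<open>Some (\<sigma>, False)\<close>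
    maps to its codomain \<open>Some (\<sigma>, True)\<close> by \<open>j \<sigma>\<close>, and to
    the common vertex \<open>None\<close>, which is \<open>Z\<close>, by
    \<open>u \<sigma>\<close>.\<close>
  define J :: "(('s \<times> bool) option, 's \<times> bool) cat" where
    "J = \<lparr>Obj = insert None (Some ` (S \<times> UNIV)), Arr = S \<times> UNIV, Dom = (\<lambda>(\<sigma>, t). Some (\<sigma>, False)),
      Cod = (\<lambda>(\<sigma>, t). if t then Some (\<sigma>, True) else None), Ident = undefined, Comp = undefined\<rparr>"
  define F where "F = (\<lambda>x. case x of None \<Rightarrow> Z | Some (\<sigma>, t) \<Rightarrow>
    if t then Cod C (j \<sigma>) else Dom C (j \<sigma>))"
  define G where "G = (\<lambda>(\<sigma>, t). if t then j \<sigma> else u \<sigma>)"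
  have sm: "small k (S \<times> (UNIV :: bool set))" by (intro small_Sigma S small_finite) simp
  have "small k (Obj J)" "small k (Arr J)"
    using small_Un[OF small_finite[of "{None}"] small_image[OF sm, of Some]] sm by (simp_all add: J_def)
  moreover have gd: "graph_diagram J C F G"
    using Z j unfolding graph_diagram_def J_def F_def G_def by (auto dest!: dom_in_Obj)
  ultimately obtain c p where col: "colimit J C F G c p" using graph_colimit by blast
  have obj: "None \<in> Obj J" "\<sigma> \<in> S \<Longrightarrow> Some (\<sigma>, t) \<in> Obj J" for \<sigma> t by (auto simp: J_def)
  have F: "F None = Z" "F (Some (\<sigma>, True)) = Cod C (j \<sigma>)" "F (Some (\<sigma>, False)) = Dom C (j \<sigma>)" for \<sigma>
    by (simp_all add: F_def)
  have pin: "p None \<in> Hom C Z c" "\<sigma> \<in> S \<Longrightarrow> p (Some (\<sigma>, True)) \<in> Hom C (Cod C (j \<sigma>)) c" for \<sigma>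
    using colimit_in[OF col obj(1)] colimit_in[OF col obj(2), of \<sigma> True] F by simp_all
  have pc: "p (Some (\<sigma>, True)) \<cdot> j \<sigma> = p (Some (\<sigma>, False))" "p None \<cdot> u \<sigma> = p (Some (\<sigma>, False))"
    if "\<sigma> \<in> S" for \<sigma>
    using colimit_comm[OF col, of "(\<sigma>, True)"] colimit_comm[OF col, of "(\<sigma>, False)"] that
    by (simp_all add: J_def G_def)
  have "attach S j u Z c (p None) (\<lambda>\<sigma>. p (Some (\<sigma>, True)))" unfolding attach_def
  proof (intro conjI ballI allI impI)
    fix T t \<epsilon> assume t: "t \<in> Hom C Z T"
      and \<epsilon>: "\<forall>\<sigma>\<in>S. \<epsilon> \<sigma> \<in> Hom C (Cod C (j \<sigma>)) T \<and> \<epsilon> \<sigma> \<cdot> j \<sigma> = t \<cdot> u \<sigma>"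
    let ?q = "\<lambda>x. case x of None \<Rightarrow> t | Some (\<sigma>, b) \<Rightarrow> if b then \<epsilon> \<sigma> else t \<cdot> u \<sigma>"
    have "\<exists>w\<in>Hom C c T. \<forall>i\<in>Obj J. w \<cdot> p i = ?q i"
    proof (rule colimit_ex[OF col])
      show "T \<in> Obj C" using t by auto
    qed (use t \<epsilon> j in \<open>auto simp: J_def F_def G_def\<close>)
    then obtain w where w: "w \<in> Hom C c T" "\<forall>i\<in>Obj J. w \<cdot> p i = ?q i" by blast
    show "\<exists>!q. q \<in> Hom C c T \<and> q \<cdot> p None = t \<and> (\<forall>\<sigma>\<in>S. q \<cdot> p (Some (\<sigma>, True)) = \<epsilon> \<sigma>)"
    proof (rule ex1I)
      show "w \<in> Hom C c T \<and> w \<cdot> p None = t \<and> (\<forall>\<sigma>\<in>S. w \<cdot> p (Some (\<sigma>, True)) = \<epsilon> \<sigma>)"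
        using w obj by auto
      fix q assume q: "q \<in> Hom C c T \<and> q \<cdot> p None = t \<and> (\<forall>\<sigma>\<in>S. q \<cdot> p (Some (\<sigma>, True)) = \<epsilon> \<sigma>)"
      show "q = w"
      proof (rule colimit_eqI[OF gd col, of _ T])
        fix i assume i: "i \<in> Obj J"
        consider "i = None" | \<sigma> where "\<sigma> \<in> S" "i = Some (\<sigma>, True)" | \<sigma> where "\<sigma> \<in> S" "i = Some (\<sigma>, False)"
          using i by (auto simp: J_def)
        then show "q \<cdot> p i = w \<cdot> p i"
        proof cases
          case 3
          then have "q \<cdot> p i = t \<cdot> u \<sigma>"
            using q pc(2)[of \<sigma>, symmetric] j pin by simp (metis comp_assoc)
          then show ?thesis using w obj 3 by simp
        qed (use w q obj in auto)
      qed (use q w in auto)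
    qed
  qed (use pin pc in auto)
  then show ?thesis by blast
qed

lemma pushout_exists:
  assumes "j \<in> Arr C" "u \<in> Arr C" "Dom C u = Dom C j"
  shows "\<exists>\<eta> e. pushout C j u \<eta> e"
proof -
  have "\<exists>Z1 \<eta> e. attach {()} (\<lambda>_. j) (\<lambda>_. u) (Cod C u) Z1 \<eta> e"
  proof (rule attach_exists)
    show "small k {()}" by (rule small_finite) simp
  qed (use assms in auto)
  then obtain Z1 \<eta> e where "attach {()} (\<lambda>_. j) (\<lambda>_. u) (Cod C u) Z1 \<eta> e" by blast
  from attach_pushout[OF this] assms show ?thesis by auto
qed

end

section \<open>Lifting properties and saturated classes\<close>

lemma liftsI:
  assumes "\<And>u v. u \<in> Hom C (Dom C f) (Dom C g) \<Longrightarrow> v \<in> Hom C (Cod C f) (Cod C g) \<Longrightarrow>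
    Comp C g u = Comp C v f \<Longrightarrow> \<exists>d\<in>Hom C (Cod C f) (Dom C g). Comp C d f = u \<and> Comp C g d = v"
  shows "lifts C f g"
  using assms unfolding lifts_def by blast

lemma lifts_ex:
  assumes "lifts C f g" "u \<in> Hom C (Dom C f) (Dom C g)" "v \<in> Hom C (Cod C f) (Cod C g)"
    "Comp C g u = Comp C v f"
  shows "\<exists>d. d \<in> Hom C (Cod C f) (Dom C g) \<and> Comp C d f = u \<and> Comp C g d = v"
  using assms unfolding lifts_def by blast

lemma rlp_antimono: "X \<subseteq> Y \<Longrightarrow> rlp C Y \<subseteq> rlp C X"
  by (auto simp: rlp_def)

lemma subset_llp_rlp: "X \<subseteq> Arr C \<Longrightarrow> X \<subseteq> llp C (rlp C X)"
  by (auto simp: rlp_def llp_def)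

lemma subset_rlp_llp: "X \<subseteq> Arr C \<Longrightarrow> X \<subseteq> rlp C (llp C X)"
  by (auto simp: rlp_def llp_def)

lemma rlp_llp_rlp: "X \<subseteq> Arr C \<Longrightarrow> rlp C (llp C (rlp C X)) = rlp C X"
  by (rule antisym[OF rlp_antimono[OF subset_llp_rlp] subset_rlp_llp]) (auto simp: rlp_def)

definition saturated :: "'k::wellorder itself \<Rightarrow> ('o, 'm) cat \<Rightarrow> 'm set \<Rightarrow> bool" where
  "saturated k C L \<longleftrightarrow> L \<subseteq> Arr C \<and> isos C \<subseteq> L \<and> pushout_closed C L \<and>
     transfinite_composition_closed k C L \<and> retract_closed C L"

lemma saturatedD:
  assumes "saturated k C L"
  shows "L \<subseteq> Arr C" "isos C \<subseteq> L" "pushout_closed C L" "transfinite_composition_closed k C L"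
    "retract_closed C L"
  using assms by (auto simp: saturated_def)

lemma cof_least: "saturated k C L \<Longrightarrow> X \<subseteq> L \<Longrightarrow> cof k C X \<subseteq> L"
  unfolding cof_def saturated_def by blast

lemma subset_cof: "X \<subseteq> cof k C X"
  unfolding cof_def by blast

lemma transfinite_composition_closed_chain:
  fixes k :: "'k::wellorder itself"
  assumes "transfinite_composition_closed k C L" "limit_ordinal (l :: 'k)" "\<forall>i. z \<le> i"
    "smooth_chain C l A f" "\<And>i j. i \<le> j \<Longrightarrow> j < l \<Longrightarrow> f (i, j) \<in> L"
  shows "f (z, l) \<in> L"
proof -
  have *: "\<forall>(l :: 'k) A f z. limit_ordinal l \<and> (\<forall>i. z \<le> i) \<and> smooth_chain C l A f \<and>
        (\<forall>i j. i \<le> j \<and> j < l \<longrightarrow> f (i, j) \<in> L) \<longrightarrow> f (z, l) \<in> L"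
    using assms(1) unfolding transfinite_composition_closed_def by (elim conjE)
  show ?thesis by (rule *[rule_format]) (use assms in simp)
qed

text \<open>Each closure condition passes to intersections. The class \<open>L0\<close> ensures that
  the intersected family is not empty; this is what puts \<open>cof\<close> inside
  \<open>Arr C\<close>.\<close>

lemma saturated_cof:
  fixes k :: "'k::wellorder itself"
  assumes "saturated k C L0" "X \<subseteq> L0"
  shows "saturated k C (cof k C X)"
proof -
  have *: "f \<in> cof k C X \<longleftrightarrow> (\<forall>L. saturated k C L \<and> X \<subseteq> L \<longrightarrow> f \<in> L)" for f
    unfolding cof_def saturated_def by auto
  show ?thesis unfolding saturated_def
  proof (intro conjI)
    show "cof k C X \<subseteq> Arr C" using cof_least[OF assms] saturatedD(1)[OF assms(1)] by blast
    show "isos C \<subseteq> cof k C X" using saturatedD(2)[of k C] unfolding subset_iff * by blast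
    show "pushout_closed C (cof k C X)"
      unfolding pushout_closed_def * using saturatedD(3) unfolding pushout_closed_def by meson
    show "retract_closed C (cof k C X)"
      unfolding retract_closed_def * using saturatedD(5) unfolding retract_closed_def by meson
    show "transfinite_composition_closed k C (cof k C X)"
      unfolding transfinite_composition_closed_def
    proof (intro conjI ballI allI impI)
      fix f g assume "f \<in> cof k C X" "g \<in> cof k C X" "Cod C f = Dom C g"
      then show "Comp C g f \<in> cof k C X"
        unfolding * using saturatedD(4) unfolding transfinite_composition_closed_def by meson
    next
      fix l z :: 'k and A f assume a: "limit_ordinal l \<and> (\<forall>i. z \<le> i) \<and> smooth_chain C l A f \<and>
         (\<forall>i j. i \<le> j \<and> j < l \<longrightarrow> f (i, j) \<in> cof k C X)"
      show "f (z, l) \<in> cof k C X" unfolding *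
      proof (intro allI impI)
        fix L assume L: "saturated k C L \<and> X \<subseteq> L"
        show "f (z, l) \<in> L"
          by (rule transfinite_composition_closed_chain[of k C L])
            (use a L saturatedD(4) cof_least[of k C L X] in auto)
      qed
    qed
  qed
qed

context category
begin

lemma retract_arrow_iff:
  "retract_of (arrow_cat C) f g \<longleftrightarrow> f \<in> Arr C \<and> g \<in> Arr C \<and>
     (\<exists>s1 s2 r1 r2. s1 \<in> Hom C (Dom C f) (Dom C g) \<and> s2 \<in> Hom C (Cod C f) (Cod C g) \<and>
       g \<cdot> s1 = s2 \<cdot> f \<and> r1 \<in> Hom C (Dom C g) (Dom C f) \<and> r2 \<in> Hom C (Cod C g) (Cod C f) \<and>
       f \<cdot> r1 = r2 \<cdot> g \<and> r1 \<cdot> s1 = Ident C (Dom C f) \<and> r2 \<cdot> s2 = Ident C (Cod C f))"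
  unfolding retract_of_def arrow_cat_def Hom_def by fastforce

lemma isos_llp: "R \<subseteq> Arr C \<Longrightarrow> isos C \<subseteq> llp C R"
proof
  fix f assume R: "R \<subseteq> Arr C" and "f \<in> isos C"
  then obtain h where f: "f \<in> Arr C" and h: "h \<in> Hom C (Cod C f) (Dom C f)"
    "h \<cdot> f = Ident C (Dom C f)" "f \<cdot> h = Ident C (Cod C f)" by (auto simp: isos_def)
  have "lifts C f g" if g: "g \<in> R" for g
  proof (rule liftsI)
    fix u v assume uv: "u \<in> Hom C (Dom C f) (Dom C g)" "v \<in> Hom C (Cod C f) (Cod C g)" "g \<cdot> u = v \<cdot> f"
    have g: "g \<in> Arr C" using g R by blast
    have "(u \<cdot> h) \<cdot> f = u" using uv h f by simp
    moreover have "g \<cdot> (u \<cdot> h) = v"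
      using uv h f g by (simp add: comp_cong2[OF uv(3)])
    ultimately show "\<exists>d\<in>Hom C (Cod C f) (Dom C g). d \<cdot> f = u \<and> g \<cdot> d = v"
      using uv h f by (intro bexI[of _ "u \<cdot> h"]) auto
  qed
  then show "f \<in> llp C R" using f by (simp add: llp_def)
qed

lemma llp_retract_closed: "R \<subseteq> Arr C \<Longrightarrow> retract_closed C (llp C R)"
  unfolding retract_closed_def retract_arrow_iff
proof (intro allI impI, elim conjE exE)
  fix f g s1 s2 r1 r2
  assume R: "R \<subseteq> Arr C" and g: "g \<in> llp C R" and fg: "f \<in> Arr C" "g \<in> Arr C"
    and s: "s1 \<in> Hom C (Dom C f) (Dom C g)" "s2 \<in> Hom C (Cod C f) (Cod C g)" "g \<cdot> s1 = s2 \<cdot> f"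
    and r: "r1 \<in> Hom C (Dom C g) (Dom C f)" "r2 \<in> Hom C (Cod C g) (Cod C f)" "f \<cdot> r1 = r2 \<cdot> g"
    and rs: "r1 \<cdot> s1 = Ident C (Dom C f)" "r2 \<cdot> s2 = Ident C (Cod C f)"
  have "lifts C f h" if h: "h \<in> R" for h
  proof (rule liftsI)
    fix u v assume uv: "u \<in> Hom C (Dom C f) (Dom C h)" "v \<in> Hom C (Cod C f) (Cod C h)" "h \<cdot> u = v \<cdot> f"
    have hA: "h \<in> Arr C" using h R by blast
    have "lifts C g h" using g h by (simp add: llp_def)
    moreover have "h \<cdot> (u \<cdot> r1) = (v \<cdot> r2) \<cdot> g"
      using uv r fg hA by (simp add: comp_cong2[OF uv(3)])
    moreover have "u \<cdot> r1 \<in> Hom C (Dom C g) (Dom C h)" "v \<cdot> r2 \<in> Hom C (Cod C g) (Cod C h)"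
      using uv r by simp_all
    ultimately obtain d where d: "d \<in> Hom C (Cod C g) (Dom C h)" "d \<cdot> g = u \<cdot> r1" "h \<cdot> d = v \<cdot> r2"
      using lifts_ex[of C g h] by blast
    have "(d \<cdot> s2) \<cdot> f = d \<cdot> (g \<cdot> s1)" using d s fg by simp
    also have "\<dots> = u \<cdot> (r1 \<cdot> s1)"
      by (rule comp_cong2[OF d(2)]) (use d s fg uv r in simp_all)
    also have "\<dots> = u" using rs uv by simp
    finally have 1: "(d \<cdot> s2) \<cdot> f = u" .
    have "h \<cdot> (d \<cdot> s2) = v \<cdot> (r2 \<cdot> s2)" using d s fg uv r hA by (simp add: comp_cong2[OF d(3)])
    also have "\<dots> = v" using rs uv by simp
    finally show "\<exists>d\<in>Hom C (Cod C f) (Dom C h). d \<cdot> f = u \<and> h \<cdot> d = v"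
      using 1 d s by (intro bexI[of _ "d \<cdot> s2"]) auto
  qed
  then show "f \<in> llp C R" using fg by (simp add: llp_def)
qed

lemma llp_pushout_closed: "R \<subseteq> Arr C \<Longrightarrow> pushout_closed C (llp C R)"
  unfolding pushout_closed_def
proof (intro allI impI, elim conjE)
  fix f u f' u'
  assume R: "R \<subseteq> Arr C" and f: "f \<in> llp C R" and po: "pushout C f u f' u'"
  have ar: "f \<in> Arr C" "u \<in> Arr C" "f' \<in> Arr C" "u' \<in> Arr C" "Dom C f = Dom C u" "Dom C f' = Cod C u"
    "Dom C u' = Cod C f" "Cod C f' = Cod C u'" "f' \<cdot> u = u' \<cdot> f"
    and un: "\<And>d x y. x \<in> Hom C (Cod C u) d \<Longrightarrow> y \<in> Hom C (Cod C f) d \<Longrightarrow> x \<cdot> u = y \<cdot> f \<Longrightarrow>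
      \<exists>!w. w \<in> Hom C (Cod C f') d \<and> w \<cdot> f' = x \<and> w \<cdot> u' = y"
    using po unfolding pushout_def by blast+
  have "lifts C f' g" if gR: "g \<in> R" for g
  proof (rule liftsI)
    fix x y assume xy: "x \<in> Hom C (Dom C f') (Dom C g)" "y \<in> Hom C (Cod C f') (Cod C g)" "g \<cdot> x = y \<cdot> f'"
    have g: "g \<in> Arr C" using gR R by blast
    have "g \<cdot> (x \<cdot> u) = (y \<cdot> u') \<cdot> f"
      using ar xy g by (simp add: comp_cong2[OF xy(3)])
    moreover have "x \<cdot> u \<in> Hom C (Dom C f) (Dom C g)" "y \<cdot> u' \<in> Hom C (Cod C f) (Cod C g)"
      using ar xy by simp_all
    moreover have "lifts C f g" using f gR by (simp add: llp_def)
    ultimately obtain d where d: "d \<in> Hom C (Cod C f) (Dom C g)" "d \<cdot> f = x \<cdot> u" "g \<cdot> d = y \<cdot> u'"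
      using lifts_ex[of C f g] by blast
    obtain w where w: "w \<in> Hom C (Cod C f') (Dom C g)" "w \<cdot> f' = x" "w \<cdot> u' = d"
      using un[of x "Dom C g" d] xy d ar by auto
    \<comment> \<open>Both \<open>g \<cdot> w\<close> and \<open>y\<close> solve this pushout
      problem, so uniqueness gives the lower triangle of the lift.\<close>
    have "\<exists>!w. w \<in> Hom C (Cod C f') (Cod C g) \<and> w \<cdot> f' = g \<cdot> x \<and> w \<cdot> u' = y \<cdot> u'"
      by (rule un) (use xy ar g in \<open>simp_all add: comp_cong2[OF xy(3), of u]\<close>)
    moreover have "g \<cdot> w \<in> Hom C (Cod C f') (Cod C g)" "(g \<cdot> w) \<cdot> f' = g \<cdot> x" "(g \<cdot> w) \<cdot> u' = y \<cdot> u'"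
      using w d xy ar g by simp_all
    moreover have "y \<in> Hom C (Cod C f') (Cod C g)" "y \<cdot> f' = g \<cdot> x" using xy by simp_all
    ultimately have "g \<cdot> w = y" by blast
    then show "\<exists>d\<in>Hom C (Cod C f') (Dom C g). d \<cdot> f' = x \<and> g \<cdot> d = y" using w by blast
  qed
  then show "f' \<in> llp C R" using ar by (simp add: llp_def)
qed

lemma llp_comp_closed:
  assumes R: "R \<subseteq> Arr C" and f: "f \<in> llp C R" and g: "g \<in> llp C R" and fg: "Cod C f = Dom C g"
  shows "g \<cdot> f \<in> llp C R"
proof -
  have ar: "f \<in> Arr C" "g \<in> Arr C" using f g by (auto simp: llp_def)
  have "lifts C (g \<cdot> f) h" if hR: "h \<in> R" for h
  proof (rule liftsI)
    fix u v assume uv0: "u \<in> Hom C (Dom C (g \<cdot> f)) (Dom C h)" "v \<in> Hom C (Cod C (g \<cdot> f)) (Cod C h)"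
      "h \<cdot> u = v \<cdot> (g \<cdot> f)"
    have h: "h \<in> Arr C" using hR R by blast
    have uv: "u \<in> Hom C (Dom C f) (Dom C h)" "v \<in> Hom C (Cod C g) (Cod C h)" using uv0 ar fg by simp_all
    have "h \<cdot> u = (v \<cdot> g) \<cdot> f" using uv0 uv ar fg by simp
    moreover have "v \<cdot> g \<in> Hom C (Cod C f) (Cod C h)" using uv ar fg by simp
    moreover have l: "lifts C f h" "lifts C g h" using f g hR by (simp_all add: llp_def)
    ultimately obtain d where d: "d \<in> Hom C (Cod C f) (Dom C h)" "d \<cdot> f = u" "h \<cdot> d = v \<cdot> g"
      using lifts_ex[OF l(1) uv(1)] by blast
    then obtain d' where d': "d' \<in> Hom C (Cod C g) (Dom C h)" "d' \<cdot> g = d" "h \<cdot> d' = v"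
      using lifts_ex[OF l(2) _ uv(2)] fg by auto
    have "d' \<cdot> (g \<cdot> f) = u" using d' d ar fg by (simp add: comp_reduce[OF d'(2)])
    then show "\<exists>d\<in>Hom C (Cod C (g \<cdot> f)) (Dom C h). d \<cdot> (g \<cdot> f) = u \<and> h \<cdot> d = v"
      using d' ar fg by auto
  qed
  then show ?thesis using ar fg by (simp add: llp_def)
qed

end

context cocomplete_category
begin

lemma Field_atMost_rel [simp]: "Field {(i, j). i \<le> j \<and> j \<le> (l :: 'k)} = {i. i \<le> l}"
  by (auto simp: Field_def)

lemma smooth_chainI:
  assumes "\<And>i j. i \<le> j \<Longrightarrow> j \<le> l \<Longrightarrow> f (i, j) \<in> Hom C (A i) (A j)"
    "\<And>i. i \<le> l \<Longrightarrow> f (i, i) = Ident C (A i)"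
    "\<And>i j m. i \<le> j \<Longrightarrow> j \<le> m \<Longrightarrow> m \<le> l \<Longrightarrow> f (j, m) \<cdot> f (i, j) = f (i, m)"
    "\<And>j. j \<le> l \<Longrightarrow> limit_ordinal j \<Longrightarrow> colimit (poset_cat (chain_ord j)) C A f (A j) (\<lambda>i. f (i, j))"
  shows "smooth_chain C (l :: 'k) A f"
proof -
  have "A i \<in> Obj C" if "i \<le> l" for i
    using assms(1)[OF order_refl that] dom_in_Obj[of "f (i, i)"] by simp
  then show ?thesis
    unfolding smooth_chain_def diagram_poset_iff chain_ord_def[symmetric]
    using assms by auto
qed

lemma smooth_chainD:
  assumes "smooth_chain C (l :: 'k) A f"
  shows "i \<le> j \<Longrightarrow> j \<le> l \<Longrightarrow> f (i, j) \<in> Hom C (A i) (A j)"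
    "i \<le> l \<Longrightarrow> f (i, i) = Ident C (A i)"
    "i \<le> l \<Longrightarrow> A i \<in> Obj C"
    "i \<le> j \<Longrightarrow> j \<le> m \<Longrightarrow> m \<le> l \<Longrightarrow> f (j, m) \<cdot> f (i, j) = f (i, m)"
    "j \<le> l \<Longrightarrow> limit_ordinal j \<Longrightarrow> colimit (poset_cat (chain_ord j)) C A f (A j) (\<lambda>i. f (i, j))"
proof -
  have *: "\<And>i. i \<le> l \<Longrightarrow> A i \<in> Obj C \<and> f (i, i) = Ident C (A i)"
    "\<And>i j. i \<le> j \<Longrightarrow> j \<le> l \<Longrightarrow> f (i, j) \<in> Hom C (A i) (A j)"
    "\<And>i j m. i \<le> j \<Longrightarrow> j \<le> l \<Longrightarrow> j \<le> m \<Longrightarrow> m \<le> l \<Longrightarrow> f (i, m) = f (j, m) \<cdot> f (i, j)"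
    "\<And>j. j \<le> l \<Longrightarrow> limit_ordinal j \<Longrightarrow>
      colimit (poset_cat (chain_ord j)) C A f (A j) (\<lambda>i. f (i, j))"
    using assms unfolding smooth_chain_def diagram_poset_iff chain_ord_def[symmetric]
    by (simp_all only: Field_atMost_rel mem_Collect_eq case_prod_conv)
  show "i \<le> j \<Longrightarrow> j \<le> l \<Longrightarrow> f (i, j) \<in> Hom C (A i) (A j)" by (rule *(2))
  show "i \<le> l \<Longrightarrow> f (i, i) = Ident C (A i)" "i \<le> l \<Longrightarrow> A i \<in> Obj C" using *(1) by blast+
  show "i \<le> j \<Longrightarrow> j \<le> m \<Longrightarrow> m \<le> l \<Longrightarrow> f (j, m) \<cdot> f (i, j) = f (i, m)"
    using *(3)[of i j m] by simp
  show "j \<le> l \<Longrightarrow> limit_ordinal j \<Longrightarrow>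
    colimit (poset_cat (chain_ord j)) C A f (A j) (\<lambda>i. f (i, j))" by (rule *(4))
qed

lemma smooth_chain_diagram:
  assumes "smooth_chain C (l :: 'k) A f" "j \<le> l"
  shows "diagram (poset_cat (chain_ord j)) C A f"
  unfolding diagram_poset_iff
proof (intro conjI ballI allI impI)
  show "A i \<in> Obj C" "f (i, i) = Ident C (A i)" if "i \<in> Field (chain_ord j)" for i
    using smooth_chainD(2,3)[OF assms(1), of i] that assms(2) by auto
  show "f (i, m) \<in> Hom C (A i) (A m)" if "(i, m) \<in> chain_ord j" for i m
    by (rule smooth_chainD(1)[OF assms(1)]) (use that assms(2) in \<open>auto simp: chain_ord_iff\<close>)
  show "f (i, n) = f (m, n) \<cdot> f (i, m)" if "(i, m) \<in> chain_ord j" "(m, n) \<in> chain_ord j" for i m n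
    by (rule smooth_chainD(4)[OF assms(1), symmetric]) (use that assms(2) in \<open>auto simp: chain_ord_iff\<close>)
qed

lemma small_chain_ord: "small k (chain_ord j)"
proof -
  have "chain_ord j \<subseteq> {i. i < j} \<times> {i. i < j}" by (auto simp: chain_ord_iff)
  then show ?thesis using small_Sigma[OF small_lessThan small_lessThan] by (rule small_subset)
qed

lemma tc_closedD:
  assumes "transfinite_composition_closed k C L" "limit_ordinal (l :: 'k)" "smooth_chain C l A f"
    "\<And>i j. i \<le> j \<Longrightarrow> j < l \<Longrightarrow> f (i, j) \<in> L"
  shows "f (zero, l) \<in> L"
  by (rule transfinite_composition_closed_chain[OF assms(1,2) _ assms(3,4)]) simp_all

lemma comp_closedD:
  assumes "transfinite_composition_closed k C L" "f \<in> L" "g \<in> L" "Cod C f = Dom C g"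
  shows "g \<cdot> f \<in> L"
  using assms unfolding transfinite_composition_closed_def by blast

lemma id_in_isos: "a \<in> Obj C \<Longrightarrow> Ident C a \<in> isos C"
  by (auto simp: isos_def intro!: bexI[of _ "Ident C a"])

text \<open>Closure under transfinite composition only speaks about the map out of the first object;
  replacing \<open>A m\<close> by \<open>A (max i m)\<close> gives the maps out of \<open>A i\<close>.\<close>

lemma chain_in_closed:
  assumes tc: "transfinite_composition_closed k C L" and iso: "isos C \<subseteq> L"
    and ch: "smooth_chain C (l :: 'k) A f" and step: "\<And>i. i < l \<Longrightarrow> f (i, succ i) \<in> L"
    and ij: "i \<le> j" "j \<le> l"
  shows "f (i, j) \<in> L"
  using ij
proof (induction j arbitrary: i rule: succ_less_induct)
  case zero
  then have "i = zero" using order_antisym zero_le by blast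
  then show ?case using smooth_chainD(2,3)[OF ch, of zero] id_in_isos iso by auto
next
  case (succ j)
  have jl: "j < l" using succ.prems(2) by simp
  show ?case
  proof (cases "i = succ j")
    case True
    then show ?thesis using smooth_chainD(2,3)[OF ch, of i] succ.prems id_in_isos iso by auto
  next
    case False
    then have i: "i \<le> j" using succ.prems by (metis less_le less_succ_iff)
    have "f (j, succ j) \<cdot> f (i, j) \<in> L"
      using comp_closedD[OF tc succ.IH[OF i] step[OF jl]] jl i
        smooth_chainD(1)[OF ch, of i j] smooth_chainD(1)[OF ch, of j "succ j"] by simp
    then show ?thesis using smooth_chainD(4)[OF ch, of i j "succ j"] i jl by simp
  qed
next
  case (limit j)
  show ?case
  proof (cases "i = j")
    case True
    then show ?thesis using smooth_chainD(2,3)[OF ch, of i] limit.prems id_in_isos iso by auto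
  next
    case False
    then have ij: "i < j" using limit.prems by simp
    let ?A = "\<lambda>m. A (max i m)" and ?f = "\<lambda>(m, n). f (max i m, max i n)"
    have "smooth_chain C j ?A ?f"
    proof (rule smooth_chainI)
      fix m assume m: "m \<le> j" "limit_ordinal m"
      show "colimit (poset_cat (chain_ord m)) C ?A ?f (?A m) (\<lambda>n. ?f (n, m))"
      proof (cases "m \<le> i")
        case True
        \<comment> \<open>Below \<open>m\<close> the shifted chain stays at \<open>A i\<close> with
          identities as maps. Since \<open>m\<close> is a limit ordinal there is an index
          \<open>zero\<close> below it, all legs of a cocone agree with the leg at
          \<open>zero\<close>, and so the colimit is \<open>A i\<close>.\<close>
        have const: "max i n = i" if "n < m" for n using less_le_trans[OF that True] by simp
        have max: "max i m = i" using True by (simp add: max_def)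
        have Ai: "A i \<in> Obj C" "f (i, i) = Ident C (A i)"
          using smooth_chainD(2,3)[OF ch, of i] limit.prems by auto
        show ?thesis
        proof (rule colimitI)
          show "cocone (poset_cat (chain_ord m)) C ?A ?f (?A m) (\<lambda>n. ?f (n, m))"
            unfolding cocone_def using Ai by (auto simp: const max chain_ord_iff)
        next
          fix d q assume q: "cocone (poset_cat (chain_ord m)) C ?A ?f d q"
          have "q n = q zero" if "n < m" for n
            using q that limit_zero_less[OF m(2)] Ai unfolding cocone_def
            by (auto simp: chain_ord_iff const dest!: bspec[of _ _ "(zero, n)"])
          moreover have "q zero \<in> Hom C (A i) d"
            using q limit_zero_less[OF m(2)] unfolding cocone_def by (auto simp: const)
          ultimately show "\<exists>u\<in>Hom C (?A m) d. \<forall>n\<in>Obj (poset_cat (chain_ord m)). u \<cdot> ?f (n, m) = q n"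
            using Ai by (intro bexI[of _ "q zero"]) (auto simp: const max)
        next
          fix d u v assume "u \<in> Hom C (?A m) d" "v \<in> Hom C (?A m) d"
            and "\<And>n. n \<in> Obj (poset_cat (chain_ord m)) \<Longrightarrow> u \<cdot> ?f (n, m) = v \<cdot> ?f (n, m)"
          then show "u = v" using limit_zero_less[OF m(2)] Ai by (fastforce simp: const max)
        qed
      next
        case False
        then have im: "i < m" by simp
        have max: "max i m = m" by (rule max.absorb2[OF less_imp_le[OF im]])
        have ml: "m \<le> l" using m limit.prems by simp
        note col = smooth_chainD(5)[OF ch ml m(2)]
        note gd = diagram_graph_poset[OF smooth_chain_diagram[OF ch ml]]
        have fm: "f (a, b) \<in> Hom C (A a) (A b)" if "a \<le> b" "b \<le> m" for a b
          using smooth_chainD(1)[OF ch that(1)] that(2) ml by simp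
        have fc: "f (b, d) \<cdot> f (a, b) = f (a, d)" if "a \<le> b" "b \<le> d" "d \<le> m" for a b d
          using smooth_chainD(4)[OF ch that(1,2)] that(3) ml by simp
        show ?thesis
        proof (rule colimitI)
          show "cocone (poset_cat (chain_ord m)) C ?A ?f (?A m) (\<lambda>n. ?f (n, m))"
            unfolding cocone_def using fm fc smooth_chainD(3)[OF ch ml] im
            by (auto simp: chain_ord_iff max max_def)
        next
          fix d q assume q: "cocone (poset_cat (chain_ord m)) C ?A ?f d q"
          have qm: "q n \<in> Hom C (A (max i n)) d" if "n < m" for n
            using q that unfolding cocone_def by auto
          have qc: "q b \<cdot> f (max i a, max i b) = q a" if "a \<le> b" "b < m" for a b
            using q that unfolding cocone_def by (auto simp: chain_ord_iff dest!: bspec[of _ _ "(a, b)"])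
          \<comment> \<open>A cocone on the shifted chain gives one on the original chain: a stage
            before \<open>i\<close> is first mapped forward to \<open>A i\<close>.\<close>
          define q' where "q' = (\<lambda>n. q (max i n) \<cdot> f (n, max i n))"
          have q'in: "q' n \<in> Hom C (A n) d" if "n < m" for n
            using qm[of "max i n"] fm[of n "max i n"] that im less_imp_le[OF that] less_imp_le[OF im]
            by (simp add: q'_def)
          have q'c: "q' b \<cdot> f (a, b) = q' a" if ab: "a \<le> b" "b < m" for a b
          proof -
            have le: "max i a \<le> max i b" using ab(1) by (rule max.mono[OF order_refl])
            have bm: "max i b < m" "max i a < m" "max i b \<le> m" "max i a \<le> m" "a \<le> m" "b \<le> m"
              using im ab by auto
            have "q' b \<cdot> f (a, b) = q (max i b) \<cdot> (f (b, max i b) \<cdot> f (a, b))"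
              unfolding q'_def using qm[of "max i b"] fm[of b "max i b"] fm[of a b] bm ab by simp
            also have "\<dots> = q (max i b) \<cdot> (f (max i a, max i b) \<cdot> f (a, max i a))"
              using fc[of a b "max i b"] fc[of a "max i a" "max i b"] ab le bm by simp
            also have "\<dots> = q' a" unfolding q'_def
              by (rule comp_reduce) (use qc[OF le bm(1)] qm[of "max i b"] fm[of "max i a" "max i b"]
                fm[of a "max i a"] le bm in simp_all)
            finally show ?thesis .
          qed
          have "\<exists>u\<in>Hom C (A m) d. \<forall>n\<in>Obj (poset_cat (chain_ord m)). u \<cdot> f (n, m) = q' n"
            by (rule colimit_ex[OF col]) (use q q'in q'c in \<open>auto simp: cocone_def chain_ord_iff\<close>)
          then obtain u where u: "u \<in> Hom C (A m) d" "\<And>n. n < m \<Longrightarrow> u \<cdot> f (n, m) = q' n" by auto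
          have "u \<cdot> ?f (n, m) = q n" if "n < m" for n
            using u(2)[of "max i n"] qc[of n "max i n"] that im by (simp add: q'_def max)
          then show "\<exists>u\<in>Hom C (?A m) d. \<forall>n\<in>Obj (poset_cat (chain_ord m)). u \<cdot> ?f (n, m) = q n"
            using u(1) by (intro bexI[of _ u]) (simp_all add: max)
        next
          fix d u v assume uv: "u \<in> Hom C (?A m) d" "v \<in> Hom C (?A m) d"
            and eq: "\<And>n. n \<in> Obj (poset_cat (chain_ord m)) \<Longrightarrow> u \<cdot> ?f (n, m) = v \<cdot> ?f (n, m)"
          show "u = v"
          proof (rule colimit_eqI[OF gd col, of _ d])
            fix n assume "n \<in> Obj (poset_cat (chain_ord m))"
            then have n: "n < m" by simp
            have "f (n, m) = f (max i n, m) \<cdot> f (n, max i n)"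
              using fc[of n "max i n" m] n im less_imp_le[OF n] less_imp_le[OF im] by simp
            moreover have "u \<cdot> f (max i n, m) = v \<cdot> f (max i n, m)" using eq[of n] n by (simp add: max)
            ultimately show "u \<cdot> f (n, m) = v \<cdot> f (n, m)"
              using comp_cong2[of u "f (max i n, m)" v "f (max i n, m)" "f (n, max i n)"] uv n im
                fm[of "max i n" m] fm[of n "max i n"] less_imp_le[OF n] less_imp_le[OF im]
              by (simp add: max)
          qed (use uv in \<open>simp_all add: max\<close>)
        qed
      qed
    qed (use smooth_chainD(1-4)[OF ch] limit.prems ij in \<open>auto simp: max_def\<close>)
    then have "?f (zero, j) \<in> L"
    proof (rule tc_closedD[OF tc limit.hyps])
      show "?f (a, b) \<in> L" if "a \<le> b" "b < j" for a b
        using limit.IH[of "max i b" "max i a"] that ij limit.prems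
        by (auto simp: max_def)
    qed
    moreover have "max i zero = i" by (rule max.absorb1) simp
    ultimately show ?thesis using ij by simp
  qed
qed

text \<open>The lift is built recursively along the chain. A successor uses the lifting property of
  one step, a limit glues the earlier lifts by the colimit. The recursion runs up to and including
  \<open>l\<close>. Demanding that each lift extends all earlier ones makes them a cocone at
  limits.\<close>

lemma llp_transfinite_composition_closed:
  assumes R: "R \<subseteq> Arr C"
  shows "transfinite_composition_closed k C (llp C R)"
  unfolding transfinite_composition_closed_def min_eq_zero
proof (intro conjI ballI allI impI)
  fix f g assume "f \<in> llp C R" "g \<in> llp C R" "Cod C f = Dom C g"
  then show "g \<cdot> f \<in> llp C R" by (rule llp_comp_closed[OF R])
next
  fix l z :: 'k and A f
  assume "limit_ordinal l \<and> z = zero \<and> smooth_chain C l A f \<and> (\<forall>i j. i \<le> j \<and> j < l \<longrightarrow> f (i, j) \<in> llp C R)"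
  then have l: "limit_ordinal l" and z: "z = zero" and ch: "smooth_chain C l A f"
    and fL: "\<And>i j. i \<le> j \<Longrightarrow> j < l \<Longrightarrow> f (i, j) \<in> llp C R" by blast+
  note fin = smooth_chainD(1)[OF ch] and fid = smooth_chainD(2)[OF ch] and fcomp = smooth_chainD(4)[OF ch]
  have "lifts C (f (zero, l)) g" if gR: "g \<in> R" for g
  proof (rule liftsI)
    fix u v assume u: "u \<in> Hom C (Dom C (f (zero, l))) (Dom C g)"
      and v: "v \<in> Hom C (Cod C (f (zero, l))) (Cod C g)" and uv: "g \<cdot> u = v \<cdot> f (zero, l)"
    have g: "g \<in> Arr C" using gR R by blast
    have u: "u \<in> Hom C (A zero) (Dom C g)" and v: "v \<in> Hom C (A l) (Cod C g)"
      using u v fin[of zero l] by simp_all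
    let ?P = "\<lambda>\<phi> s a. s \<le> l \<longrightarrow> a \<in> Hom C (A s) (Dom C g) \<and> g \<cdot> a = v \<cdot> f (s, l) \<and>
      (s = zero \<longrightarrow> a = u) \<and> (\<forall>i<s. a \<cdot> f (i, s) = \<phi> i)"
    have "\<exists>\<phi>. \<forall>s. ?P \<phi> s (\<phi> s)"
    proof (rule transfinite_choice)
      show "?P \<phi> s a = ?P \<psi> s a" if "\<And>z. z < s \<Longrightarrow> \<phi> z = \<psi> z" for \<phi> \<psi> s a using that by simp
    next
      fix s \<phi> assume IH: "\<And>t. t < s \<Longrightarrow> ?P \<phi> t (\<phi> t)"
      show "\<exists>a. ?P \<phi> s a"
      proof (cases "s \<le> l")
        case sl: True
        show ?thesis
        proof (cases s rule: ordinal_cases)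
          case zero
          then show ?thesis using u uv by (intro exI[of _ u]) simp
        next
          case (succ p)
          then have p: "p < s" "p \<le> l" using sl less_imp_le[of p l] by auto
          have "succ p \<le> l" using sl unfolding succ .
          \<comment> \<open>The lifting property is given only for \<open>f (i, j)\<close> with
            \<open>j < l\<close>; a successor that is at most the limit ordinal \<open>l\<close>
            lies strictly below it.\<close>
          then have sp: "succ p < l" using l limit_not_succ unfolding le_less by blast
          have \<phi>p: "\<phi> p \<in> Hom C (A p) (Dom C g)" "g \<cdot> \<phi> p = v \<cdot> f (p, l)" "\<And>i. i < p \<Longrightarrow> \<phi> p \<cdot> f (i, p) = \<phi> i"
            using IH[OF p(1)] p(2) by auto
          have "lifts C (f (p, succ p)) g" using fL[of p "succ p"] sp gR by (simp add: llp_def)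
          moreover have fp: "f (p, succ p) \<in> Hom C (A p) (A (succ p))" "f (succ p, l) \<in> Hom C (A (succ p)) (A l)"
            using fin[of p "succ p"] fin[of "succ p" l] sp less_imp_le[OF sp] by simp_all
          moreover have "g \<cdot> \<phi> p = (v \<cdot> f (succ p, l)) \<cdot> f (p, succ p)"
            using \<phi>p(2) fcomp[of p "succ p" l] sp p(2) v fp less_imp_le[OF sp] by (simp del: succ_le_iff)
          ultimately obtain a where a: "a \<in> Hom C (A (succ p)) (Dom C g)" "a \<cdot> f (p, succ p) = \<phi> p"
              "g \<cdot> a = v \<cdot> f (succ p, l)"
            using lifts_ex[of C "f (p, succ p)" g "\<phi> p" "v \<cdot> f (succ p, l)"] \<phi>p(1) v by auto
          have "a \<cdot> f (i, succ p) = \<phi> i" if "i < succ p" for i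
          proof -
            have ip: "i \<le> p" using that by simp
            have fi: "f (i, p) \<in> Hom C (A i) (A p)" using fin[OF ip p(2)] .
            have "a \<cdot> f (i, succ p) = a \<cdot> (f (p, succ p) \<cdot> f (i, p))"
              using fcomp[of i p "succ p"] ip p(2) sp less_imp_le[OF sp] by (simp del: succ_le_iff)
            also have "\<dots> = \<phi> p \<cdot> f (i, p)"
              by (rule comp_reduce[OF a(2)]) (use a fp fi in simp_all)
            also have "\<dots> = \<phi> i" using \<phi>p ip fid[OF p(2)] by (cases "i = p") (auto simp: less_le)
            finally show ?thesis .
          qed
          then show ?thesis using succ a by (intro exI[of _ a]) auto
        next
          case limit
          note col = smooth_chainD(5)[OF ch sl limit]
          have \<phi>: "\<phi> t \<in> Hom C (A t) (Dom C g)" "g \<cdot> \<phi> t = v \<cdot> f (t, l)" "\<And>i. i < t \<Longrightarrow> \<phi> t \<cdot> f (i, t) = \<phi> i"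
            if "t < s" for t using IH[OF that] that sl by auto
          have "\<exists>a\<in>Hom C (A s) (Dom C g). \<forall>i\<in>Obj (poset_cat (chain_ord s)). a \<cdot> f (i, s) = \<phi> i"
          proof (rule colimit_ex[OF col])
            show "\<phi> (Cod (poset_cat (chain_ord s)) m) \<cdot> f m = \<phi> (Dom (poset_cat (chain_ord s)) m)"
              if m: "m \<in> Arr (poset_cat (chain_ord s))" for m
            proof -
              obtain i j where m': "m = (i, j)" "i \<le> j" "j < s" using m by (cases m) (auto simp: chain_ord_iff)
              show ?thesis
              proof (cases "i = j")
                case True
                then show ?thesis using m' fid[of j] \<phi>[of j] sl by simp
              next
                case False
                then show ?thesis using m' \<phi>(3)[of j i] by simp
              qed
            qed
          qed (use \<phi> g in auto)
          then obtain a where a: "a \<in> Hom C (A s) (Dom C g)" "\<And>i. i < s \<Longrightarrow> a \<cdot> f (i, s) = \<phi> i" by auto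
          have "g \<cdot> a = v \<cdot> f (s, l)"
          proof (rule colimit_eqI[OF diagram_graph_poset[OF smooth_chain_diagram[OF ch sl]] col, of _ "Cod C g"])
            fix i assume "i \<in> Obj (poset_cat (chain_ord s))"
            then have i: "i < s" by simp
            then show "(g \<cdot> a) \<cdot> f (i, s) = (v \<cdot> f (s, l)) \<cdot> f (i, s)"
              using a g v \<phi>(2)[OF i] fin[of i s] fin[of s l] fcomp[of i s l] sl by simp
          qed (use a g v fin[OF sl] in simp_all)
          then show ?thesis using a limit limit_not_zero by (intro exI[of _ a]) auto
        qed
      qed simp
    qed
    then obtain \<phi> where "\<forall>s. ?P \<phi> s (\<phi> s)" by blast
    then have \<phi>: "?P \<phi> zero (\<phi> zero)" "?P \<phi> l (\<phi> l)" by blast+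
    have "\<phi> l \<cdot> f (zero, l) = u" using \<phi> limit_zero_less[OF l] by simp
    moreover have "g \<cdot> \<phi> l = v" using \<phi> fid[of l] v by simp
    ultimately show "\<exists>d\<in>Hom C (Cod C (f (zero, l))) (Dom C g). d \<cdot> f (zero, l) = u \<and> g \<cdot> d = v"
      using \<phi> fin[of zero l] by (intro bexI[of _ "\<phi> l"]) auto
  qed
  then show "f (z, l) \<in> llp C R" using fin[of zero l] by (simp add: llp_def z)
qed

lemma saturated_llp: "R \<subseteq> Arr C \<Longrightarrow> saturated k C (llp C R)"
  unfolding saturated_def
  using isos_llp llp_pushout_closed llp_transfinite_composition_closed llp_retract_closed
  by (auto simp: llp_def)

lemma cof_subset_llp_rlp: "X \<subseteq> Arr C \<Longrightarrow> cof k C X \<subseteq> llp C (rlp C X)"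
  by (intro cof_least saturated_llp subset_llp_rlp) (auto simp: rlp_def)

lemma saturated_cof': "X \<subseteq> Arr C \<Longrightarrow> saturated k C (cof k C X)"
  by (rule saturated_cof[OF saturated_llp subset_llp_rlp]) (auto simp: rlp_def)

text \<open>\<open>rlp\<close> reverses the inclusions of \<open>X\<close> in
  \<open>cof k C X\<close> and of \<open>cof k C X\<close> in \<open>llp C (rlp C X)\<close>, and it
  sends both outer classes to \<open>rlp C X\<close>.\<close>

lemma rlp_cof: "X \<subseteq> Arr C \<Longrightarrow> rlp C (cof k C X) = rlp C X"
  using rlp_antimono[OF cof_subset_llp_rlp[of X], of C] rlp_antimono[OF subset_cof[of X k C], of C]
    rlp_llp_rlp[of X C] by blast

section \<open>Transfinite chains\<close>

text \<open>Iterates a one-step factorization \<open>r = M s h r \<cdot> N s h r\<close> of maps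
  into the fixed object \<open>D\<close>. The step also sees its index \<open>s\<close> and the
  composite \<open>h\<close> from the start \<open>x0\<close>, because attaching cells one by one
  has to know which cell comes next and how to push its attaching map forward.\<close>

lemma chain_exists:
  assumes g: "g \<in> Hom C x0 D"
    and step: "\<And>s h r. h \<in> Hom C x0 (Dom C r) \<Longrightarrow> r \<in> Arr C \<Longrightarrow> Cod C r = D \<Longrightarrow> r \<cdot> h = g \<Longrightarrow>
      N s h r \<in> Arr C \<and> Dom C (N s h r) = Dom C r \<and> M s h r \<in> Hom C (Cod C (N s h r)) D \<and>
      M s h r \<cdot> N s h r = r"
  shows "\<exists>Z f r. (\<forall>l :: 'k. smooth_chain C l Z f) \<and> Z zero = x0 \<and> r zero = g \<and>
    (\<forall>s. r s \<in> Hom C (Z s) D) \<and> (\<forall>i j. i \<le> j \<longrightarrow> r j \<cdot> f (i, j) = r i) \<and>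
    (\<forall>s. f (s, succ s) = N s (f (zero, s)) (r s) \<and> r (succ s) = M s (f (zero, s)) (r s))"
proof -
  \<comment> \<open>The value at stage \<open>j\<close> consists of the object, its map to
    \<open>D\<close> and all maps into it from stages up to \<open>j\<close>, so
    \<open>f (i, j)\<close> is read off from stage \<open>j\<close>. At the index \<open>j\<close>
    itself the stored map is the identity.\<close>
  let ?Z = "\<lambda>\<phi> i. fst (\<phi> i)" and ?r = "\<lambda>\<phi> i. fst (snd (\<phi> i))" and ?f = "\<lambda>\<phi> m. snd (snd (\<phi> (snd m))) (fst m)"
  let ?P = "\<lambda>\<phi> (s :: 'k) a. (case a of (Z, r, f) \<Rightarrow>
     Z \<in> Obj C \<and> r \<in> Hom C Z D \<and> f s = Ident C Z \<and>
     (\<forall>i<s. f i \<in> Hom C (?Z \<phi> i) Z \<and> r \<cdot> f i = ?r \<phi> i) \<and>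
     (\<forall>j<s. \<forall>i\<le>j. f j \<cdot> ?f \<phi> (i, j) = f i) \<and>
     (s = zero \<longrightarrow> Z = x0 \<and> r = g) \<and>
     (\<forall>p. s = succ p \<longrightarrow> f p = N p (?f \<phi> (zero, p)) (?r \<phi> p) \<and> r = M p (?f \<phi> (zero, p)) (?r \<phi> p)) \<and>
     (limit_ordinal s \<longrightarrow> colimit (poset_cat (chain_ord s)) C (?Z \<phi>) (?f \<phi>) Z f))"
  have "\<exists>\<phi>. \<forall>s. ?P \<phi> s (\<phi> s)"
  proof (rule transfinite_choice)
    fix \<phi> \<psi> :: "'k \<Rightarrow> 'o \<times> 'm \<times> ('k \<Rightarrow> 'm)" and s :: 'k and a :: "'o \<times> 'm \<times> ('k \<Rightarrow> 'm)"
    assume eq: "\<And>z. z < s \<Longrightarrow> \<phi> z = \<psi> z"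
    obtain Z r f where a: "a = (Z, r, f)" by (cases a)
    have F: "?f \<phi> (i, j) = ?f \<psi> (i, j)" if "j < s" for i j using eq[OF that] by simp
    have "colimit (poset_cat (chain_ord s)) C (?Z \<phi>) (?f \<phi>) Z f =
        colimit (poset_cat (chain_ord s)) C (?Z \<psi>) (?f \<psi>) Z f"
    proof
      show "colimit (poset_cat (chain_ord s)) C (?Z \<phi>) (?f \<phi>) Z f \<Longrightarrow>
          colimit (poset_cat (chain_ord s)) C (?Z \<psi>) (?f \<psi>) Z f"
        by (erule colimit_cong) (use eq in \<open>auto simp: chain_ord_iff\<close>)
      show "colimit (poset_cat (chain_ord s)) C (?Z \<psi>) (?f \<psi>) Z f \<Longrightarrow>
          colimit (poset_cat (chain_ord s)) C (?Z \<phi>) (?f \<phi>) Z f"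
        by (erule colimit_cong) (use eq in \<open>auto simp: chain_ord_iff\<close>)
    qed
    moreover have "(\<forall>p. s = succ p \<longrightarrow> Q p (\<phi> p)) = (\<forall>p. s = succ p \<longrightarrow> Q p (\<psi> p))" for Q
      using eq by auto
    moreover have "(\<forall>j<s. Q j (\<phi> j)) = (\<forall>j<s. Q j (\<psi> j))" for Q
      using eq by auto
    ultimately show "?P \<phi> s a = ?P \<psi> s a" unfolding a by (simp add: eq)
  next
    fix s \<phi> assume IH: "\<And>t. t < s \<Longrightarrow> ?P \<phi> t (\<phi> t)"
    define Z where "Z = ?Z \<phi>"
    define r where "r = ?r \<phi>"
    define f where "f = ?f \<phi>"
    have \<phi>: "\<phi> t = (Z t, r t, \<lambda>i. f (i, t))" for t by (simp add: Z_def r_def f_def)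
    have Zt: "Z t \<in> Obj C" "r t \<in> Hom C (Z t) D" "f (t, t) = Ident C (Z t)" if "t < s" for t
      using IH[OF that] by (auto simp: \<phi>)
    have ft: "f (i, t) \<in> Hom C (Z i) (Z t)" "r t \<cdot> f (i, t) = r i" if "i \<le> t" "t < s" for i t
      using IH[OF that(2)] Zt[OF that(2)] that by (cases "i = t"; auto simp: \<phi>)+
    have fc: "f (j, t) \<cdot> f (i, j) = f (i, t)" if "i \<le> j" "j \<le> t" "t < s" for i j t
      using IH[OF that(3)] Zt[OF that(3)] ft(1)[of i j] that by (cases "j = t") (auto simp: \<phi>)
    have Z0: "zero < s \<Longrightarrow> Z zero = x0 \<and> r zero = g" using IH[of zero] by (auto simp: \<phi>)
    show "\<exists>a. ?P \<phi> s a"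
    proof (cases s rule: ordinal_cases)
      case zero
      have "?P \<phi> s (x0, g, \<lambda>_. Ident C x0)" using g dom_in_Obj[of g] zero limit_not_zero by simp
      then show ?thesis by (rule exI)
    next
      case (succ p)
      then have p: "p < s" by simp
      define n where "n = N p (f (zero, p)) (r p)"
      define m where "m = M p (f (zero, p)) (r p)"
      have z: "Z zero = x0" "r zero = g" using Z0 succ zero_le[of p] by (auto simp: less_le)
      have nm: "n \<in> Arr C" "Dom C n = Z p" "m \<in> Hom C (Cod C n) D" "m \<cdot> n = r p"
        using step[of "f (zero, p)" "r p" p] ft[of zero p] Zt[OF p] p z by (simp_all add: n_def m_def)
      let ?h = "\<lambda>i. if i = s then Ident C (Cod C n) else n \<cdot> f (i, p)"
      have ip: "i \<le> p" if "i < s" for i using that succ by simp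
      have "?P \<phi> s (Cod C n, m, ?h)"
        unfolding prod.case
      proof (intro conjI allI impI)
        fix i assume i: "i < s"
        then have "i \<noteq> s" by simp
        then show "?h i \<in> Hom C (?Z \<phi> i) (Cod C n)" using i ft[OF ip[OF i] p] nm by (simp add: \<phi>)
        show "m \<cdot> ?h i = ?r \<phi> i"
          using \<open>i \<noteq> s\<close> i ft[OF ip[OF i] p] nm comp_reduce[OF nm(4), of "f (i, p)"] by (simp add: \<phi>)
      next
        fix j i assume j: "j < s" "i \<le> j"
        then have "j \<noteq> s" "i \<noteq> s" by auto
        then show "?h j \<cdot> ?f \<phi> (i, j) = ?h i"
          using fc[of i j p] ft[of i j] ft[of j p] ip[OF j(1)] j p nm by (simp add: \<phi>)
      next
        fix q assume "s = succ q"
        then have "q = p" using succ by simp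
        moreover have "p \<noteq> s" using p by simp
        ultimately show "?h q = N q (?f \<phi> (zero, q)) (?r \<phi> q)" "m = M q (?f \<phi> (zero, q)) (?r \<phi> q)"
          using p nm Zt[OF p] by (simp_all add: \<phi> n_def m_def)
      qed (use nm succ limit_not_succ in auto)
      then show ?thesis by (rule exI)
    next
      case limit
      have dia: "diagram (poset_cat (chain_ord s)) C Z f"
        unfolding diagram_poset_iff using Zt ft fc by (auto simp: chain_ord_iff)
      obtain c q where col: "colimit (poset_cat (chain_ord s)) C Z f c q"
        using poset_colimit[OF dia small_chain_ord] by blast
      have D: "D \<in> Obj C" using g by auto
      have "\<exists>u\<in>Hom C c D. \<forall>i\<in>Obj (poset_cat (chain_ord s)). u \<cdot> q i = r i"
        by (rule colimit_ex[OF col]) (use Zt ft D in \<open>auto simp: chain_ord_iff\<close>)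
      then obtain u where u: "u \<in> Hom C c D" "\<And>i. i < s \<Longrightarrow> u \<cdot> q i = r i" by auto
      let ?h = "\<lambda>i. if i = s then Ident C c else q i"
      have qin: "q i \<in> Hom C (Z i) c" if "i < s" for i using colimit_in[OF col, of i] that by simp
      have qc: "q j \<cdot> f (i, j) = q i" if "i \<le> j" "j < s" for i j
        using colimit_comm[OF col, of "(i, j)"] that by (simp add: chain_ord_iff)
      have "colimit (poset_cat (chain_ord s)) C (?Z \<phi>) (?f \<phi>) c ?h"
        by (rule colimit_cong[OF col]) (auto simp: \<phi> chain_ord_iff)
      then have "?P \<phi> s (c, u, ?h)"
        using colimit_obj[OF col] u qin qc limit limit_not_zero limit_not_succ by (auto simp: \<phi>)
      then show ?thesis by (rule exI)
    qed
  qed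
  then obtain \<phi> where "\<forall>s. ?P \<phi> s (\<phi> s)" by (rule exE)
  note P = this[THEN spec]
  define Z where "Z = ?Z \<phi>"
  define r where "r = ?r \<phi>"
  define f where "f = ?f \<phi>"
  have \<phi>: "\<phi> t = (Z t, r t, \<lambda>i. f (i, t))" for t by (simp add: Z_def r_def f_def)
  have fcol: "colimit (poset_cat (chain_ord s)) C Z f (Z s) (\<lambda>i. f (i, s))" if "limit_ordinal s" for s
    using P[of s] that unfolding \<phi>[of s] prod.case Z_def[symmetric] f_def[symmetric] by simp
  have Zt: "Z t \<in> Obj C" "r t \<in> Hom C (Z t) D" "f (t, t) = Ident C (Z t)" for t
    using P[of t] by (auto simp: \<phi>)
  have ft: "f (i, t) \<in> Hom C (Z i) (Z t)" "r t \<cdot> f (i, t) = r i" if "i \<le> t" for i t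
    using P[of t] Zt[of t] that by (cases "i = t"; auto simp: \<phi>)+
  have fc: "f (j, t) \<cdot> f (i, j) = f (i, t)" if "i \<le> j" "j \<le> t" for i j t
    using P[of t] Zt[of t] ft(1)[of i j] that by (cases "j = t") (auto simp: \<phi>)
  have "smooth_chain C l Z f" for l
    by (rule smooth_chainI) (use ft fc Zt fcol in auto)
  moreover have "Z zero = x0" "r zero = g" using P[of zero] by (auto simp: \<phi>)
  moreover have "f (s, succ s) = N s (f (zero, s)) (r s) \<and> r (succ s) = M s (f (zero, s)) (r s)" for s
    using P[of "succ s"] by (auto simp: \<phi>)
  ultimately show ?thesis
    by (intro exI[of _ Z] exI[of _ f] exI[of _ r] conjI allI impI Zt ft) simp_all
qed

end

section \<open>Bounds in directed posets\<close>

lemma ex1_unique: "\<exists>!x. P x \<Longrightarrow> P a \<Longrightarrow> P b \<Longrightarrow> a = b"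
  by blast

context universe
begin

lemma small_bounded:
  assumes "small k (S :: 'k set)"
  shows "\<exists>\<theta>. \<forall>i\<in>S. i < \<theta>"
proof -
  have "small k (\<Union>i\<in>S. {j. j \<le> i})" by (rule small_UNION[OF assms small_atMost])
  moreover have "\<not> small k (UNIV :: 'k set)"
    unfolding small_def using ordLess_irreflexive by blast
  ultimately have "(\<Union>i\<in>S. {j. j \<le> i}) \<noteq> UNIV" by metis
  then obtain \<theta> where "\<theta> \<notin> (\<Union>i\<in>S. {j. j \<le> i})" by blast
  then show ?thesis by (auto simp: not_le)
qed

text \<open>This lets compactness at a regular \<open>s\<close> be applied to chains of length
  \<open>s\<close>, which is the point of the small object argument.\<close>

lemma directed_chain_ord:
  assumes "regular_above B s"
  shows "directed (chain_ord s) (chain_ord s)"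
  unfolding directed_def
proof (intro conjI allI impI)
  show "Partial_order (chain_ord s)"
    unfolding partial_order_on_def preorder_on_def
    by (auto simp: refl_on_def trans_def antisym_def chain_ord_iff)
  show "small TYPE('k) (Field (chain_ord s))"
    using small_lessThan[of s] by (simp add: small_def)
  fix S assume S: "S \<subseteq> Field (chain_ord s)" "|S| <o chain_ord s"
  then obtain b where "b < s" "\<forall>i\<in>S. i \<le> b" using card_less_bounded[OF assms, of S] by auto
  then show "\<exists>b\<in>Field (chain_ord s). \<forall>i\<in>S. (i, b) \<in> chain_ord s"
    by (auto simp: chain_ord_iff)
qed

lemma directed_family:
  assumes d: "directed l (r :: 'k rel)" and I: "|I| <o l" and m: "\<And>i. i \<in> I \<Longrightarrow> m i \<in> Field r"
  shows "\<exists>b\<in>Field r. \<forall>i\<in>I. (m i, b) \<in> r"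
proof -
  have "|m ` I| <o l" using card_of_image I ordLeq_ordLess_trans by blast
  then have "\<exists>b\<in>Field r. \<forall>x\<in>m ` I. (x, b) \<in> r" using d m unfolding directed_def by blast
  then show ?thesis by simp
qed

lemma directed_ub:
  assumes d: "directed l (r :: 'k rel)" and l: "Cinfinite l" and ab: "a \<in> Field r" "b \<in> Field r"
  obtains c where "c \<in> Field r" "(a, c) \<in> r" "(b, c) \<in> r"
proof -
  have "|{a, b}| <o l"
    by (rule finite_ordLess_infinite)
      (use l in \<open>auto simp: cinfinite_def Field_card_of card_of_well_order_on card_order_on_def\<close>)
  then show ?thesis using directed_family[OF d, of "{a, b}" "\<lambda>x. x"] ab that by auto
qed

lemma directed_order:
  assumes "directed l r"
  shows "Partial_order r" "a \<in> Field r \<Longrightarrow> (a, a) \<in> r" "(a, b) \<in> r \<Longrightarrow> (b, c) \<in> r \<Longrightarrow> (a, c) \<in> r"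
  using assms unfolding directed_def partial_order_on_def preorder_on_def refl_on_def trans_def
  by blast+

lemma directed_mono:
  assumes "directed l' r" "l \<le>o l'"
  shows "directed l r"
  using assms ordLess_ordLeq_trans unfolding directed_def by blast

end

lemma pushoutD:
  assumes "pushout C f u f' u'"
  shows "f \<in> Arr C" "u \<in> Arr C" "f' \<in> Arr C" "u' \<in> Arr C" "Dom C f = Dom C u" "Dom C f' = Cod C u"
    "Dom C u' = Cod C f" "Cod C f' = Cod C u'" "Comp C f' u = Comp C u' f"
    "x \<in> Hom C (Cod C u) d \<Longrightarrow> y \<in> Hom C (Cod C f) d \<Longrightarrow> Comp C x u = Comp C y f \<Longrightarrow>
      \<exists>!w. w \<in> Hom C (Cod C f') d \<and> Comp C w f' = x \<and> Comp C w u' = y"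
  using assms unfolding pushout_def by blast+

context cocomplete_category
begin

text \<open>The cells are attached one at a time; the resulting chain has the attachment of all of them
  as a retract.\<close>

lemma attach_in_saturated:
  fixes S :: "'s set"
  assumes L: "saturated k C L" and S: "small k S" and a: "attach S j u Z Z1 \<eta> e"
    and j: "\<And>\<sigma>. \<sigma> \<in> S \<Longrightarrow> j \<sigma> \<in> L \<and> u \<sigma> \<in> Hom C (Dom C (j \<sigma>)) Z"
  shows "\<eta> \<in> L"
proof -
  obtain b :: "'s \<Rightarrow> 'k" where b: "inj_on b S" using small_embed[OF S] by blast
  note \<eta> = attach_in(1)[OF a] and ein = attach_in(2)[OF a] and ej = attach_in(3)[OF a]
  have jA: "j \<sigma> \<in> Arr C" "u \<sigma> \<in> Hom C (Dom C (j \<sigma>)) Z" "j \<sigma> \<in> L" if "\<sigma> \<in> S" for \<sigma>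
    using j[OF that] saturatedD(1)[OF L] by blast+
  \<comment> \<open>Stage \<open>s\<close> attaches the cell \<open>\<sigma>\<close> with code
    \<open>b \<sigma> = s\<close>, if there is one, along its attaching map pushed forward by
    \<open>h\<close>; \<open>E\<close> is the inclusion of the cell. A stage that codes no cell
    takes an identity, and then \<open>?Q\<close> puts no condition on \<open>E\<close>.\<close>
  let ?Q = "\<lambda>s h r n m E. n \<in> L \<and> Dom C n = Dom C r \<and> m \<in> Hom C (Cod C n) Z1 \<and> m \<cdot> n = r \<and>
    (\<forall>\<sigma>\<in>S. b \<sigma> = s \<longrightarrow> E \<in> Hom C (Cod C (j \<sigma>)) (Cod C n) \<and> E \<cdot> j \<sigma> = n \<cdot> (h \<cdot> u \<sigma>) \<and> m \<cdot> E = e \<sigma>)"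
  let ?V = "\<lambda>h r. h \<in> Hom C Z (Dom C r) \<and> r \<in> Arr C \<and> Cod C r = Z1 \<and> r \<cdot> h = \<eta>"
  have ex: "\<exists>n m E. ?V h r \<longrightarrow> ?Q s h r n m E" for s h r
  proof (cases "?V h r \<and> (\<exists>\<sigma>\<in>S. b \<sigma> = s)")
    case True
    then obtain \<sigma> where \<sigma>: "\<sigma> \<in> S" "b \<sigma> = s" by blast
    have h: "h \<in> Hom C Z (Dom C r)" "r \<in> Arr C" "Cod C r = Z1" "r \<cdot> h = \<eta>" using True by blast+
    obtain n E where po: "pushout C (j \<sigma>) (h \<cdot> u \<sigma>) n E"
      using pushout_exists[of "j \<sigma>" "h \<cdot> u \<sigma>"] jA(1,2)[OF \<sigma>(1)] h(1) by force
    have nE: "n \<in> Arr C" "Dom C n = Dom C r" "E \<in> Hom C (Cod C (j \<sigma>)) (Cod C n)" "n \<cdot> (h \<cdot> u \<sigma>) = E \<cdot> j \<sigma>"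
      using pushoutD(3,4,6-9)[OF po] h(1,2) jA(1,2)[OF \<sigma>(1)] by simp_all
    have "n \<in> L" using saturatedD(3)[OF L] po jA[OF \<sigma>(1)] unfolding pushout_closed_def by blast
    moreover have "\<exists>!w. w \<in> Hom C (Cod C n) Z1 \<and> w \<cdot> n = r \<and> w \<cdot> E = e \<sigma>"
    proof -
      have "r \<in> Hom C (Cod C (h \<cdot> u \<sigma>)) Z1" using h jA[OF \<sigma>(1)] by simp
      moreover have "e \<sigma> \<in> Hom C (Cod C (j \<sigma>)) Z1" by (rule ein[OF \<sigma>(1)])
      moreover have "r \<cdot> (h \<cdot> u \<sigma>) = e \<sigma> \<cdot> j \<sigma>"
        using h jA[OF \<sigma>(1)] ej[OF \<sigma>(1)] by (simp add: comp_reduce[OF h(4)])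
      ultimately show ?thesis using nE by (intro pushoutD(10)[OF po])
    qed
    then obtain w where "w \<in> Hom C (Cod C n) Z1" "w \<cdot> n = r" "w \<cdot> E = e \<sigma>" by blast
    moreover have "\<tau> = \<sigma>" if "\<tau> \<in> S" "b \<tau> = s" for \<tau> using b that \<sigma> by (auto dest: inj_onD)
    ultimately have "?Q s h r n w E" using nE by auto
    then show ?thesis by blast
  next
    case False
    have "?V h r \<longrightarrow> ?Q s h r (Ident C (Dom C r)) r undefined"
      using False saturatedD(2)[OF L] id_in_isos by auto
    then show ?thesis by blast
  qed
  let ?X = "\<lambda>s h r. SOME x. ?V h r \<longrightarrow> ?Q s h r (fst x) (fst (snd x)) (snd (snd x))"
  define N where "N = (\<lambda>s h r. fst (?X s h r))"
  define M where "M = (\<lambda>s h r. fst (snd (?X s h r)))"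
  define E where "E = (\<lambda>s h r. snd (snd (?X s h r)))"
  have NM: "?Q s h r (N s h r) (M s h r) (E s h r)" if V: "?V h r" for s h r
  proof -
    obtain n m E' where "?V h r \<longrightarrow> ?Q s h r n m E'" using ex[of h r s] by (elim exE)
    then have "\<exists>x. ?V h r \<longrightarrow> ?Q s h r (fst x) (fst (snd x)) (snd (snd x))"
      by (intro exI[of _ "(n, m, E')"]) (unfold fst_conv snd_conv)
    then have "?V h r \<longrightarrow> ?Q s h r (N s h r) (M s h r) (E s h r)"
      unfolding N_def M_def E_def by (rule someI_ex)
    then show ?thesis using V by (rule mp)
  qed
  have "\<exists>Zc f r. (\<forall>l :: 'k. smooth_chain C l Zc f) \<and> Zc zero = Z \<and> r zero = \<eta> \<and>
    (\<forall>s. r s \<in> Hom C (Zc s) Z1) \<and> (\<forall>i j. i \<le> j \<longrightarrow> r j \<cdot> f (i, j) = r i) \<and>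
    (\<forall>s. f (s, succ s) = N s (f (zero, s)) (r s) \<and> r (succ s) = M s (f (zero, s)) (r s))"
  proof (rule chain_exists[OF \<eta>])
    fix s h r assume "h \<in> Hom C Z (Dom C r)" "r \<in> Arr C" "Cod C r = Z1" "r \<cdot> h = \<eta>"
    then have "?Q s h r (N s h r) (M s h r) (E s h r)" by (intro NM conjI)
    then show "N s h r \<in> Arr C \<and> Dom C (N s h r) = Dom C r \<and> M s h r \<in> Hom C (Cod C (N s h r)) Z1 \<and>
        M s h r \<cdot> N s h r = r" using saturatedD(1)[OF L] by auto
  qed
  then obtain Zc f r where ch: "\<And>l. smooth_chain C l Zc f" and z: "Zc zero = Z" "r zero = \<eta>"
    and r: "\<And>s. r s \<in> Hom C (Zc s) Z1" "\<And>i j. i \<le> j \<Longrightarrow> r j \<cdot> f (i, j) = r i"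
    and st: "\<And>s. f (s, succ s) = N s (f (zero, s)) (r s)" "\<And>s. r (succ s) = M s (f (zero, s)) (r s)"
    by (elim exE conjE) metis
  have fin: "f (i, t) \<in> Hom C (Zc i) (Zc t)" if "i \<le> t" for i t
    using smooth_chainD(1)[OF ch that order_refl] .
  have fcomp: "f (t, m) \<cdot> f (i, t) = f (i, m)" if "i \<le> t" "t \<le> m" for i t m
    using smooth_chainD(4)[OF ch that order_refl] .
  have V: "?V (f (zero, s)) (r s)" for s using r(1)[of s] r(2)[of zero s] fin[of zero s] z by simp
  note Q = NM[OF V]
  have "small k (b ` S)" by (rule small_image[OF S])
  \<comment> \<open>The codes of the cells are bounded, so every cell has been attached by stage
    \<open>\<theta>\<close>.\<close>
  then obtain \<theta> where \<theta>: "\<And>\<sigma>. \<sigma> \<in> S \<Longrightarrow> b \<sigma> < \<theta>" using small_bounded by blast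
  have fL: "f (zero, \<theta>) \<in> L"
    by (rule chain_in_closed[OF saturatedD(4)[OF L] saturatedD(2)[OF L] ch[of \<theta>]]) (use Q st in auto)
  let ?c = "f (zero, \<theta>)"
  let ?E = "\<lambda>\<sigma>. E (b \<sigma>) (f (zero, b \<sigma>)) (r (b \<sigma>))"
  let ?\<epsilon> = "\<lambda>\<sigma>. f (succ (b \<sigma>), \<theta>) \<cdot> ?E \<sigma>"
  have E: "?E \<sigma> \<in> Hom C (Cod C (j \<sigma>)) (Zc (succ (b \<sigma>)))"
    "?E \<sigma> \<cdot> j \<sigma> = f (b \<sigma>, succ (b \<sigma>)) \<cdot> (f (zero, b \<sigma>) \<cdot> u \<sigma>)" "r (succ (b \<sigma>)) \<cdot> ?E \<sigma> = e \<sigma>"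
    if "\<sigma> \<in> S" for \<sigma>
    using Q[of "b \<sigma>" "b \<sigma>"] that fin[of "b \<sigma>" "succ (b \<sigma>)"] st[of "b \<sigma>"] by auto
  have c: "?c \<in> Hom C Z (Zc \<theta>)" using fin[of zero \<theta>] z by simp
  have "\<exists>q\<in>Hom C Z1 (Zc \<theta>). q \<cdot> \<eta> = ?c \<and> (\<forall>\<sigma>\<in>S. q \<cdot> e \<sigma> = ?\<epsilon> \<sigma>)"
  proof (rule attach_ex[OF a c])
    fix \<sigma> assume \<sigma>: "\<sigma> \<in> S"
    have sb: "succ (b \<sigma>) \<le> \<theta>" using \<theta>[OF \<sigma>] by simp
    note H = fin[OF sb] fin[of "b \<sigma>" "succ (b \<sigma>)"] fin[of zero "b \<sigma>"] E[OF \<sigma>] jA[OF \<sigma>] z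
    have "?\<epsilon> \<sigma> \<cdot> j \<sigma> = f (succ (b \<sigma>), \<theta>) \<cdot> (f (b \<sigma>, succ (b \<sigma>)) \<cdot> (f (zero, b \<sigma>) \<cdot> u \<sigma>))"
      using H by simp
    also have "\<dots> = f (b \<sigma>, \<theta>) \<cdot> (f (zero, b \<sigma>) \<cdot> u \<sigma>)"
      by (rule comp_reduce[OF fcomp]) (use H sb in simp_all)
    also have "\<dots> = ?c \<cdot> u \<sigma>"
      by (rule comp_reduce[OF fcomp]) (use H fin[of "b \<sigma>" \<theta>] less_imp_le[OF \<theta>[OF \<sigma>]] in simp_all)
    finally show "?\<epsilon> \<sigma> \<in> Hom C (Cod C (j \<sigma>)) (Zc \<theta>) \<and> ?\<epsilon> \<sigma> \<cdot> j \<sigma> = ?c \<cdot> u \<sigma>"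
      using H by simp
  qed
  then obtain q where q: "q \<in> Hom C Z1 (Zc \<theta>)" "q \<cdot> \<eta> = ?c" "\<And>\<sigma>. \<sigma> \<in> S \<Longrightarrow> q \<cdot> e \<sigma> = ?\<epsilon> \<sigma>" by blast
  \<comment> \<open>One composite suffices, because \<open>L\<close> is closed under retracts. The
    equation is tested on \<open>Z\<close> and on every cell.\<close>
  have "r \<theta> \<cdot> q = Ident C Z1"
  proof (rule attach_eqI[OF a, of _ Z1])
    have Z1: "Z1 \<in> Obj C" using \<eta> by auto
    show "r \<theta> \<cdot> q \<in> Hom C Z1 Z1" "Ident C Z1 \<in> Hom C Z1 Z1" using q(1) r(1)[of \<theta>] Z1 by simp_all
    show "j \<sigma> \<in> Arr C \<and> u \<sigma> \<in> Hom C (Dom C (j \<sigma>)) Z" if "\<sigma> \<in> S" for \<sigma> using jA[OF that] by blast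
    show "(r \<theta> \<cdot> q) \<cdot> \<eta> = Ident C Z1 \<cdot> \<eta>" using q r(1)[of \<theta>] r(2)[of zero \<theta>] \<eta> z by simp
    show "(r \<theta> \<cdot> q) \<cdot> e \<sigma> = Ident C Z1 \<cdot> e \<sigma>" if \<sigma>: "\<sigma> \<in> S" for \<sigma>
    proof -
      have sb: "succ (b \<sigma>) \<le> \<theta>" using \<theta>[OF \<sigma>] by simp
      have "(r \<theta> \<cdot> q) \<cdot> e \<sigma> = r \<theta> \<cdot> ?\<epsilon> \<sigma>" using q r(1)[of \<theta>] ein[OF \<sigma>] \<sigma> by simp
      also have "\<dots> = e \<sigma>"
        using comp_reduce[OF r(2)[OF sb], of "?E \<sigma>"] E[OF \<sigma>] r(1)[of \<theta>] fin[OF sb] by simp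
      finally show ?thesis using ein[OF \<sigma>] by simp
    qed
  qed
  moreover have "Z \<in> Obj C" using \<eta> by auto
  moreover have "r \<theta> \<cdot> ?c = \<eta>" using r(2)[of zero \<theta>] z by simp
  ultimately have "retract_of (arrow_cat C) \<eta> ?c"
    unfolding retract_arrow_iff using q(1,2) \<eta> r(1)[of \<theta>] c
    by (intro conjI exI[of _ "Ident C Z"] exI[of _ q] exI[of _ "Ident C Z"] exI[of _ "r \<theta>"]) simp_all
  then show ?thesis using saturatedD(5)[OF L] fL unfolding retract_closed_def by blast
qed

section \<open>Compact objects\<close>

text \<open>The elementwise form of presentability: the comparison map from the colimit of the sets
  \<open>Hom C A (F i)\<close> to \<open>Hom C A c\<close> is surjective (first clause) and
  injective (second clause).\<close>

definition compact_at :: "'k rel \<Rightarrow> 'o \<Rightarrow> bool" where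
  "compact_at s A \<longleftrightarrow> A \<in> Obj C \<and>
     (\<forall>r F G c p. directed s r \<and> diagram (poset_cat r) C F G \<and>
        colimit (poset_cat r) C F G c p \<longrightarrow>
        (\<forall>x\<in>Hom C A c. \<exists>i\<in>Field r. \<exists>y\<in>Hom C A (F i). p i \<cdot> y = x) \<and>
        (\<forall>i\<in>Field r. \<forall>x\<in>Hom C A (F i). \<forall>y\<in>Hom C A (F i). p i \<cdot> x = p i \<cdot> y \<longrightarrow>
           (\<exists>j. (i, j) \<in> r \<and> G (i, j) \<cdot> x = G (i, j) \<cdot> y)))"

lemma compact_atI:
  assumes "A \<in> Obj C"
    "\<And>r F G c p. directed s r \<Longrightarrow> diagram (poset_cat r) C F G \<Longrightarrow>
       colimit (poset_cat r) C F G c p \<Longrightarrow>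
        (\<forall>x\<in>Hom C A c. \<exists>i\<in>Field r. \<exists>y\<in>Hom C A (F i). p i \<cdot> y = x) \<and>
        (\<forall>i\<in>Field r. \<forall>x\<in>Hom C A (F i). \<forall>y\<in>Hom C A (F i). p i \<cdot> x = p i \<cdot> y \<longrightarrow>
           (\<exists>j. (i, j) \<in> r \<and> G (i, j) \<cdot> x = G (i, j) \<cdot> y))"
  shows "compact_at s A"
  unfolding compact_at_def by (intro conjI[OF assms(1)] allI impI assms(2)) (elim conjE, assumption)+

lemma compactD:
  assumes "compact_at s A" "directed s r" "diagram (poset_cat r) C F G"
    "colimit (poset_cat r) C F G c p"
  shows "x \<in> Hom C A c \<Longrightarrow> \<exists>i\<in>Field r. \<exists>y\<in>Hom C A (F i). p i \<cdot> y = x"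
    and "i \<in> Field r \<Longrightarrow> x \<in> Hom C A (F i) \<Longrightarrow> y \<in> Hom C A (F i) \<Longrightarrow> p i \<cdot> x = p i \<cdot> y \<Longrightarrow>
      \<exists>j. (i, j) \<in> r \<and> G (i, j) \<cdot> x = G (i, j) \<cdot> y"
proof -
  have *: "(\<forall>x\<in>Hom C A c. \<exists>i\<in>Field r. \<exists>y\<in>Hom C A (F i). p i \<cdot> y = x) \<and>
        (\<forall>i\<in>Field r. \<forall>x\<in>Hom C A (F i). \<forall>y\<in>Hom C A (F i). p i \<cdot> x = p i \<cdot> y \<longrightarrow>
           (\<exists>j. (i, j) \<in> r \<and> G (i, j) \<cdot> x = G (i, j) \<cdot> y))"
    using assms(1)[unfolded compact_at_def, THEN conjunct2, rule_format,
        of r F G c p, OF conjI[OF assms(2) conjI[OF assms(3,4)]]] by blast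
  show "x \<in> Hom C A c \<Longrightarrow> \<exists>i\<in>Field r. \<exists>y\<in>Hom C A (F i). p i \<cdot> y = x" by (rule bspec[OF conjunct1[OF *]])
  show "i \<in> Field r \<Longrightarrow> x \<in> Hom C A (F i) \<Longrightarrow> y \<in> Hom C A (F i) \<Longrightarrow> p i \<cdot> x = p i \<cdot> y \<Longrightarrow>
      \<exists>j. (i, j) \<in> r \<and> G (i, j) \<cdot> x = G (i, j) \<cdot> y"
    using bspec[OF bspec[OF bspec[OF conjunct2[OF *]]], THEN mp] .
qed

text \<open>Functions to a two-element set suffice to detect that an element comes from a stage, and that two
  elements become equal at a later stage.\<close>

lemma presentable_compact:
  assumes pr: "presentable C (l :: 'k rel) A" and l: "regular_cardinal l" "l \<le>o s"
  shows "compact_at s A"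
proof (rule compact_atI, goal_cases)
  case 1
  then show ?case using pr by (simp add: presentable_def)
next
  case (2 r F G c p)
  then have d: "directed l r" and dia: "diagram (poset_cat r) C F G"
    and col: "colimit (poset_cat r) C F G c p" using directed_mono l by blast+
  have hc: "hom_colimit TYPE('k) (poset_cat r) C A F G c p"
    using pr d dia col unfolding presentable_def by blast
  have cin: "p i \<in> Hom C (F i) c" if "i \<in> Field r" for i using colimit_in[OF col] that by simp
  let ?T = "{zero, succ zero}"
  have hc: "\<exists>!t. t \<in> Hom C A c \<rightarrow>\<^sub>E ?T \<and> (\<forall>i\<in>Field r. \<forall>x\<in>Hom C A (F i). t (p i \<cdot> x) = h i x)"
    if "\<And>i x. h i x \<in> ?T"
      "\<And>i j x. (i, j) \<in> r \<Longrightarrow> x \<in> Hom C A (F i) \<Longrightarrow> h j (G (i, j) \<cdot> x) = h i x" for h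
  proof -
    have "small TYPE('k) ?T" using small_finite[of ?T] by (simp add: small_def)
    moreover have "\<forall>i\<in>Obj (poset_cat r). h i \<in> Hom C A (F i) \<rightarrow> ?T" using that(1) by blast
    moreover have "\<forall>a\<in>Arr (poset_cat r). \<forall>x\<in>Hom C A (F (Dom (poset_cat r) a)).
        h (Cod (poset_cat r) a) (G a \<cdot> x) = h (Dom (poset_cat r) a) x"
      using that(2) by (auto simp del: Hom_iff)
    ultimately show ?thesis using hc unfolding hom_colimit_def by simp
  qed
  show ?case
  proof (intro conjI ballI impI)
    fix x assume x: "x \<in> Hom C A c"
    show "\<exists>i\<in>Field r. \<exists>y\<in>Hom C A (F i). p i \<cdot> y = x"
    proof (rule ccontr)
      assume no: "\<not> ?thesis"
      \<comment> \<open>These two functions differ exactly at \<open>x\<close>. If \<open>x\<close>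
        came from no stage they would agree on everything that does, contrary to uniqueness.\<close>
      let ?t1 = "restrict (\<lambda>_. zero) (Hom C A c)"
      let ?t2 = "restrict (\<lambda>y. if y = x then succ zero else zero) (Hom C A c)"
      have ex: "\<exists>!t. t \<in> Hom C A c \<rightarrow>\<^sub>E ?T \<and> (\<forall>i\<in>Field r. \<forall>x\<in>Hom C A (F i). t (p i \<cdot> x) = zero)"
        by (rule hc) auto
      have co: "p i \<cdot> y \<in> Hom C A c" if "i \<in> Field r" "y \<in> Hom C A (F i)" for i y
        using cin[OF that(1)] that(2) by simp
      have "?t1 = ?t2"
      proof (rule ex1_unique[OF ex])
        show "?t1 \<in> Hom C A c \<rightarrow>\<^sub>E ?T \<and> (\<forall>i\<in>Field r. \<forall>x\<in>Hom C A (F i). ?t1 (p i \<cdot> x) = zero)"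
          using co by (auto simp del: Hom_iff)
        show "?t2 \<in> Hom C A c \<rightarrow>\<^sub>E ?T \<and> (\<forall>i\<in>Field r. \<forall>x\<in>Hom C A (F i). ?t2 (p i \<cdot> x) = zero)"
          using co no by (auto simp del: Hom_iff)
      qed
      then have "?t1 x = ?t2 x" by simp
      then show False using x by (simp del: Hom_iff)
    qed
  next
    fix i x y assume i: "i \<in> Field r" and x: "x \<in> Hom C A (F i)" and y: "y \<in> Hom C A (F i)"
      and eq: "p i \<cdot> x = p i \<cdot> y"
    have li: "Cinfinite l" using l by (simp add: regular_cardinal_def)
    note tr = directed_order[OF d]
    have Gin: "G (a, b) \<in> Hom C (F a) (F b)" if "(a, b) \<in> r" for a b
      using dia that unfolding diagram_poset_iff by blast
    have Gc: "G (b, e) \<cdot> (G (a, b) \<cdot> z) = G (a, e) \<cdot> z" if "(a, b) \<in> r" "(b, e) \<in> r" "z \<in> Hom C A (F a)" for a b e z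
    proof (rule comp_reduce)
      show "G (b, e) \<cdot> G (a, b) = G (a, e)" using dia that unfolding diagram_poset_iff by metis
    qed (use Gin[OF that(1)] Gin[OF that(2)] that(3) in auto)
    \<comment> \<open>\<open>R j z\<close> says that \<open>z\<close> at stage \<open>j\<close>
      becomes equal to \<open>x\<close> at some later stage. It is invariant under transition maps,
      so its characteristic function descends to the colimit, where \<open>x\<close> and
      \<open>y\<close> have the same image.\<close>
    define R where "R = (\<lambda>j z. \<exists>m. (i, m) \<in> r \<and> (j, m) \<in> r \<and> G (i, m) \<cdot> x = G (j, m) \<cdot> z)"
    have comp: "R b (G (a, b) \<cdot> z) = R a z" if ab: "(a, b) \<in> r" and z: "z \<in> Hom C A (F a)" for a b z
    proof
      assume "R b (G (a, b) \<cdot> z)"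
      then obtain m where "(i, m) \<in> r" "(b, m) \<in> r" "G (i, m) \<cdot> x = G (b, m) \<cdot> (G (a, b) \<cdot> z)"
        by (auto simp: R_def)
      then show "R a z" using Gc[OF ab _ z] tr(3)[OF ab] by (auto simp: R_def)
    next
      assume "R a z"
      then obtain m where m: "(i, m) \<in> r" "(a, m) \<in> r" "G (i, m) \<cdot> x = G (a, m) \<cdot> z"
        by (auto simp: R_def)
      obtain n where n: "(m, n) \<in> r" "(b, n) \<in> r"
        by (rule directed_ub[OF d li FieldI2[OF m(1)] FieldI2[OF ab]])
      have "G (i, n) \<cdot> x = G (m, n) \<cdot> (G (i, m) \<cdot> x)" using Gc[OF m(1) n(1) x] by simp
      also have "\<dots> = G (a, n) \<cdot> z" using Gc[OF m(2) n(1) z] m(3) by simp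
      also have "\<dots> = G (b, n) \<cdot> (G (a, b) \<cdot> z)" using Gc[OF ab n(2) z] by simp
      finally show "R b (G (a, b) \<cdot> z)" using n tr(3)[OF m(1) n(1)] by (auto simp: R_def)
    qed
    have "\<exists>!t. t \<in> Hom C A c \<rightarrow>\<^sub>E ?T \<and>
        (\<forall>j\<in>Field r. \<forall>z\<in>Hom C A (F j). t (p j \<cdot> z) = (if R j z then succ zero else zero))"
      by (rule hc) (use comp in auto)
    then obtain t where t: "\<And>j z. j \<in> Field r \<Longrightarrow> z \<in> Hom C A (F j) \<Longrightarrow>
        t (p j \<cdot> z) = (if R j z then succ zero else zero)" by blast
    have "R i x" using tr(2)[OF i] by (auto simp: R_def)
    then have "t (p i \<cdot> y) = succ zero" using t[OF i x] eq by simp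
    then have "R i y" using t[OF i y] by (auto split: if_splits)
    then show "\<exists>j. (i, j) \<in> r \<and> G (i, j) \<cdot> x = G (i, j) \<cdot> y" by (auto simp: R_def)
  qed
qed

text \<open>Fewer than \<open>s\<close> objects and arrows are involved, so the stages found
  separately for each of them have a common upper bound, and the separate factorizations can be
  assembled to a map out of \<open>c\<close>.\<close>

lemma compact_colimit:
  assumes gd: "graph_diagram J C F G" and col: "colimit J C F G c p"
    and sz: "|Obj J| <o s" "|Arr J| <o s" and inf: "Cinfinite s"
    and cp: "\<And>i. i \<in> Obj J \<Longrightarrow> compact_at s (F i)"
  shows "compact_at s c"
proof (rule compact_atI, goal_cases)
  case 1
  then show ?case by (rule colimit_obj[OF col])
next
  case (2 r H T d q)
  then have dir: "directed s r" and dia: "diagram (poset_cat r) C H T"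
    and colr: "colimit (poset_cat r) C H T d q" by blast+
  note cE = compactD(1)[OF cp dir dia colr] and cU = compactD(2)[OF cp dir dia colr]
  note tr = directed_order[OF dir]
  have Tin: "T (a, b) \<in> Hom C (H a) (H b)" if "(a, b) \<in> r" for a b
    using dia that unfolding diagram_poset_iff by blast
  have Tc: "T (a, e) = T (b, e) \<cdot> T (a, b)" if "(a, b) \<in> r" "(b, e) \<in> r" for a b e
    using dia that unfolding diagram_poset_iff by blast
  have qin: "q i \<in> Hom C (H i) d" if "i \<in> Field r" for i using colimit_in[OF colr] that by simp
  have qc: "q b \<cdot> T (a, b) = q a" if "(a, b) \<in> r" for a b using colimit_comm[OF colr, of "(a, b)"] that by simp
  have pin: "p i \<in> Hom C (F i) c" if "i \<in> Obj J" for i using colimit_in[OF col that] .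
  have pc: "p (Cod J a) \<cdot> G a = p (Dom J a)" if "a \<in> Arr J" for a using colimit_comm[OF col that] .
  have J: "Dom J a \<in> Obj J" "Cod J a \<in> Obj J" "G a \<in> Hom C (F (Dom J a)) (F (Cod J a))"
    if "a \<in> Arr J" for a using gd that unfolding graph_diagram_def by blast+
  show ?case
  proof (intro conjI ballI impI)
    fix x assume x: "x \<in> Hom C c d"
    have "\<exists>m\<in>Field r. \<exists>y\<in>Hom C (F i) (H m). q m \<cdot> y = x \<cdot> p i" if "i \<in> Obj J" for i
      by (rule cE[OF that]) (use pin[OF that] x in simp)
    then obtain m y where m: "\<And>i. i \<in> Obj J \<Longrightarrow> m i \<in> Field r"
      and y: "\<And>i. i \<in> Obj J \<Longrightarrow> y i \<in> Hom C (F i) (H (m i))" "\<And>i. i \<in> Obj J \<Longrightarrow> q (m i) \<cdot> y i = x \<cdot> p i"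
      by metis
    obtain b0 where b0: "b0 \<in> Field r" "\<And>i. i \<in> Obj J \<Longrightarrow> (m i, b0) \<in> r"
      using directed_family[OF dir sz(1), of m] m by blast
    define y0 where "y0 = (\<lambda>i. T (m i, b0) \<cdot> y i)"
    have y0: "y0 i \<in> Hom C (F i) (H b0)" "q b0 \<cdot> y0 i = x \<cdot> p i" if "i \<in> Obj J" for i
      using y[OF that] Tin[OF b0(2)[OF that]] qin[OF b0(1)] comp_reduce[OF qc[OF b0(2)[OF that]], of "y i"]
      by (simp_all add: y0_def)
    \<comment> \<open>The maps \<open>y0 i\<close> are known to form a cocone only after composition
      with \<open>q b0\<close>. The injectivity half of compactness turns this into an equation at a
      later stage, one for every arrow of \<open>J\<close>.\<close>
    have "\<exists>n. (b0, n) \<in> r \<and> T (b0, n) \<cdot> (y0 (Cod J a) \<cdot> G a) = T (b0, n) \<cdot> y0 (Dom J a)"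
      if a: "a \<in> Arr J" for a
    proof (rule cU[OF J(1)[OF a] b0(1)])
      have "q b0 \<cdot> (y0 (Cod J a) \<cdot> G a) = (x \<cdot> p (Cod J a)) \<cdot> G a"
        using J[OF a] y0[OF J(2)[OF a]] qin[OF b0(1)] by (intro comp_reduce) simp_all
      also have "\<dots> = x \<cdot> p (Dom J a)" using J[OF a] pin[OF J(2)[OF a]] pc[OF a] x by simp
      finally show "q b0 \<cdot> (y0 (Cod J a) \<cdot> G a) = q b0 \<cdot> y0 (Dom J a)"
        using y0[OF J(1)[OF a]] by simp
    qed (use y0 J[OF a] in auto)
    then obtain n where n: "\<And>a. a \<in> Arr J \<Longrightarrow> (b0, n a) \<in> r"
        "\<And>a. a \<in> Arr J \<Longrightarrow> T (b0, n a) \<cdot> (y0 (Cod J a) \<cdot> G a) = T (b0, n a) \<cdot> y0 (Dom J a)"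
      by metis
    obtain b1' where b1': "b1' \<in> Field r" "\<And>a. a \<in> Arr J \<Longrightarrow> (n a, b1') \<in> r"
      using directed_family[OF dir sz(2), of n] n(1) by (meson FieldI2)
    obtain b1 where b1: "b1 \<in> Field r" "(b1', b1) \<in> r" "(b0, b1) \<in> r"
      using directed_ub[OF dir inf b1'(1) b0(1)] by blast
    have nb: "(n a, b1) \<in> r" if "a \<in> Arr J" for a using tr(3)[OF b1'(2)[OF that] b1(2)] .
    define y1 where "y1 = (\<lambda>i. T (b0, b1) \<cdot> y0 i)"
    have y1: "y1 i \<in> Hom C (F i) (H b1)" "q b1 \<cdot> y1 i = x \<cdot> p i" if "i \<in> Obj J" for i
      using y0[OF that] Tin[OF b1(3)] qin[OF b1(1)] comp_reduce[OF qc[OF b1(3)], of "y0 i"]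
      by (simp_all add: y1_def)
    have "\<exists>w\<in>Hom C c (H b1). \<forall>i\<in>Obj J. w \<cdot> p i = y1 i"
    proof (rule colimit_ex[OF col])
      show "H b1 \<in> Obj C" using dia b1(1) unfolding diagram_poset_iff by blast
      fix a assume a: "a \<in> Arr J"
      note H = Tin[OF n(1)[OF a]] Tin[OF nb[OF a]] Tin[OF b1(3)] y0[OF J(1)[OF a]] y0[OF J(2)[OF a]] J[OF a]
      have "y1 (Cod J a) \<cdot> G a = T (b0, b1) \<cdot> (y0 (Cod J a) \<cdot> G a)"
        unfolding y1_def using H by simp
      also have "\<dots> = T (n a, b1) \<cdot> (T (b0, n a) \<cdot> (y0 (Cod J a) \<cdot> G a))"
        unfolding Tc[OF n(1)[OF a] nb[OF a]] using H by simp
      also have "\<dots> = T (n a, b1) \<cdot> (T (b0, n a) \<cdot> y0 (Dom J a))" using n(2)[OF a] by simp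
      also have "\<dots> = y1 (Dom J a)"
        unfolding y1_def Tc[OF n(1)[OF a] nb[OF a]] using H by simp
      finally show "y1 (Cod J a) \<cdot> G a = y1 (Dom J a)" .
    qed (rule y1(1))
    then obtain w where w: "w \<in> Hom C c (H b1)" "\<And>i. i \<in> Obj J \<Longrightarrow> w \<cdot> p i = y1 i" by blast
    have "q b1 \<cdot> w = x"
      by (rule colimit_eqI[OF gd col, of _ d]) (use w qin[OF b1(1)] x y1 pin in auto)
    then show "\<exists>i\<in>Field r. \<exists>y\<in>Hom C c (H i). q i \<cdot> y = x" using w b1(1) by blast
  next
    fix b x y assume b: "b \<in> Field r" and x: "x \<in> Hom C c (H b)" and y: "y \<in> Hom C c (H b)"
      and eq: "q b \<cdot> x = q b \<cdot> y"
    have "\<exists>n. (b, n) \<in> r \<and> T (b, n) \<cdot> (x \<cdot> p i) = T (b, n) \<cdot> (y \<cdot> p i)" if i: "i \<in> Obj J" for i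
    proof (rule cU[OF i b])
      show "q b \<cdot> (x \<cdot> p i) = q b \<cdot> (y \<cdot> p i)"
        by (rule comp_cong2[OF eq]) (use pin[OF i] x y qin[OF b] in simp_all)
    qed (use pin[OF i] x y in simp_all)
    then obtain n where n: "\<And>i. i \<in> Obj J \<Longrightarrow> (b, n i) \<in> r"
        "\<And>i. i \<in> Obj J \<Longrightarrow> T (b, n i) \<cdot> (x \<cdot> p i) = T (b, n i) \<cdot> (y \<cdot> p i)" by metis
    obtain b1' where b1': "b1' \<in> Field r" "\<And>i. i \<in> Obj J \<Longrightarrow> (n i, b1') \<in> r"
      using directed_family[OF dir sz(1), of n] n(1) by (meson FieldI2)
    obtain b1 where b1: "b1 \<in> Field r" "(b1', b1) \<in> r" "(b, b1) \<in> r"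
      using directed_ub[OF dir inf b1'(1) b] by blast
    have "T (b, b1) \<cdot> x = T (b, b1) \<cdot> y"
    proof (rule colimit_eqI[OF gd col, of _ "H b1"])
      fix i assume i: "i \<in> Obj J"
      have nb: "(n i, b1) \<in> r" using tr(3)[OF b1'(2)[OF i] b1(2)] .
      note H = Tin[OF n(1)[OF i]] Tin[OF nb] pin[OF i] x y
      have "(T (b, b1) \<cdot> x) \<cdot> p i = T (n i, b1) \<cdot> (T (b, n i) \<cdot> (x \<cdot> p i))"
        unfolding Tc[OF n(1)[OF i] nb] using H by simp
      also have "\<dots> = (T (b, b1) \<cdot> y) \<cdot> p i"
        unfolding Tc[OF n(1)[OF i] nb] n(2)[OF i] using H by simp
      finally show "(T (b, b1) \<cdot> x) \<cdot> p i = (T (b, b1) \<cdot> y) \<cdot> p i" .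
    qed (use Tin[OF b1(3)] x y in simp_all)
    then show "\<exists>j. (b, j) \<in> r \<and> T (b, j) \<cdot> x = T (b, j) \<cdot> y" using b1(3) by blast
  qed
qed

end

section \<open>The small object argument\<close>

locale locally_presentable_category = category C + universe k
  for C :: "('o, 'm) cat" (structure) and k :: "'k::wellorder itself" +
  assumes locally_presentable: "locally_presentable k C"
begin

sublocale cocomplete_category
  using locally_presentable by unfold_locales (simp add: locally_presentable_def)

lemma small_Hom: "small k (Hom C a b)"
proof (cases "a \<in> Obj C \<and> b \<in> Obj C")
  case True
  then show ?thesis using locally_presentable unfolding locally_presentable_def locally_small_def by blast
next
  case False
  then have "Hom C a b = {}" by (auto simp: Hom_def)
  then show ?thesis using small_finite[of "{}"] by simp
qed

definition generating :: "'k rel \<Rightarrow> 'o set \<Rightarrow> bool" where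
  "generating l P \<longleftrightarrow> regular_cardinal l \<and> small k P \<and> (\<forall>A\<in>P. presentable C l A) \<and>
     (\<forall>c\<in>Obj C. \<exists>r F G p. directed l r \<and> diagram (poset_cat r) C F G \<and>
        (\<forall>i\<in>Field r. F i \<in> P) \<and> colimit (poset_cat r) C F G c p)"

lemma ex_generating: "\<exists>l P. generating l P"
  using locally_presentable unfolding locally_presentable_def generating_def small_def by blast

lemma generatingE:
  assumes "generating l P" "c \<in> Obj C"
  obtains r F G p where "directed l r" "diagram (poset_cat r) C F G" "\<And>i. i \<in> Field r \<Longrightarrow> F i \<in> P"
    "colimit (poset_cat r) C F G c p"
proof -
  have "\<exists>r F G p. directed l r \<and> diagram (poset_cat r) C F G \<and>
        (\<forall>i\<in>Field r. F i \<in> P) \<and> colimit (poset_cat r) C F G c p"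
    using assms unfolding generating_def by blast
  then show ?thesis using that by (elim exE conjE) blast
qed

lemma generating_Obj: "generating l P \<Longrightarrow> P \<subseteq> Obj C"
  by (auto simp: generating_def presentable_def)

lemma small_rel: "small k (Field r) \<Longrightarrow> small k r"
  by (rule small_subset[OF _ small_Sigma]) (auto simp: Field_def)

text \<open>Each object of \<open>Q\<close> is a colimit of generators over some small poset. A
  regular cardinal above \<open>l\<close> and above the sizes of all these posets makes the
  generators compact, and by \<open>compact_colimit\<close> also the objects of \<open>Q\<close>.
  The disjoint sum \<open>X\<close> collects everything that the cardinal has to exceed.\<close>

lemma compact_above:
  fixes B :: "'x set"
  assumes gen: "generating l P" and Q: "small k Q" "Q \<subseteq> Obj C" and B: "small k B"
  shows "\<exists>s. l \<le>o chain_ord s \<and> regular_above B s \<and> (\<forall>A\<in>Q. compact_at (chain_ord s) A)"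
proof -
  have l: "regular_cardinal l" and P: "\<And>A. A \<in> P \<Longrightarrow> presentable C l A"
    using gen by (auto simp: generating_def)
  have lc: "Card_order l" using l by (simp add: regular_cardinal_def)
  have "\<exists>r. \<forall>A\<in>Q. \<exists>F G p. directed l (r A) \<and> diagram (poset_cat (r A)) C F G \<and>
      (\<forall>i\<in>Field (r A). F i \<in> P) \<and> colimit (poset_cat (r A)) C F G A p"
    using gen Q(2) unfolding generating_def by (intro bchoice) blast
  then obtain r where r: "\<And>A. A \<in> Q \<Longrightarrow> \<exists>F G p. directed l (r A) \<and> diagram (poset_cat (r A)) C F G \<and>
      (\<forall>i\<in>Field (r A). F i \<in> P) \<and> colimit (poset_cat (r A)) C F G A p" by blast
  have sr: "small k (Field (r A))" "small k (r A)" if "A \<in> Q" for A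
    using r[OF that] small_rel[of "r A"] by (auto simp: directed_def small_def)
  define X where "X = B <+> Field l <+> (\<Union>A\<in>Q. Field (r A)) <+> (\<Union>A\<in>Q. r A)"
  have "|Field l| =o l" by (rule card_of_Field_ordIso[OF lc])
  then have "small k (Field l)"
    using l ordIso_ordLess_trans unfolding regular_cardinal_def small_def by blast
  then have "small k X" unfolding X_def by (intro small_Plus small_UNION B Q sr)
  then obtain s where s: "regular_above X s" using ex_regular_above by blast
  have emb: "regular_above Y s" if "inj f" "f ` Y \<subseteq> X" for f and Y :: "'y set"
  proof (rule regular_above_mono[OF _ s])
    show "|Y| \<le>o |X|" using that card_of_ordLeq[of Y X] by (metis inj_on_subset top_greatest)
  qed
  have 1: "regular_above B s" by (rule emb[of Inl]) (auto simp: X_def)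
  have "regular_above (Field l) s" by (rule emb[of "Inr \<circ> Inl"]) (auto simp: X_def inj_on_def)
  then have "|Field l| \<le>o chain_ord s" using ordLess_imp_ordLeq unfolding regular_above_def by blast
  then have ls: "l \<le>o chain_ord s"
    using \<open>|Field l| =o l\<close> ordIso_symmetric ordIso_ordLeq_trans by blast
  have "compact_at (chain_ord s) A" if A: "A \<in> Q" for A
  proof -
    obtain F G p where dia: "diagram (poset_cat (r A)) C F G" and FP: "\<And>i. i \<in> Field (r A) \<Longrightarrow> F i \<in> P"
      and col: "colimit (poset_cat (r A)) C F G A p" using r[OF A] by (elim exE conjE) blast
    have "regular_above (Field (r A)) s"
      by (rule emb[of "Inr \<circ> Inr \<circ> Inl"]) (use A in \<open>auto simp: X_def inj_on_def\<close>)
    moreover have "regular_above (r A) s"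
      by (rule emb[of "Inr \<circ> Inr \<circ> Inr"]) (use A in \<open>auto simp: X_def inj_on_def\<close>)
    ultimately show ?thesis
      using presentable_compact[OF P[OF FP] l ls]
      by (intro compact_colimit[OF diagram_graph_poset[OF dia] col]) (auto simp: regular_above_def)
  qed
  then show ?thesis using 1 ls by blast
qed

text \<open>What is attached is not the morphism \<open>i\<close> of a square but the
  \<open>j\<close> in \<open>L\<close> through which the square factors. So \<open>n\<close> lies in
  \<open>L\<close>, even if \<open>i\<close> does not, and the square from \<open>i\<close> is still
  solved one step later through the cell of \<open>j\<close>.\<close>

lemma small_object_step:
  assumes I: "small k I" "I \<subseteq> Arr C" and L: "saturated k C L" and g: "g \<in> Arr C"
    and fac: "\<And>i u v. i \<in> I \<Longrightarrow> u \<in> Hom C (Dom C i) (Dom C g) \<Longrightarrow>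
      v \<in> Hom C (Cod C i) (Cod C g) \<Longrightarrow> g \<cdot> u = v \<cdot> i \<Longrightarrow>
      \<exists>j a1 a2 b1 b2. j \<in> L \<and> a1 \<in> Hom C (Dom C i) (Dom C j) \<and> a2 \<in> Hom C (Cod C i) (Cod C j) \<and>
        j \<cdot> a1 = a2 \<cdot> i \<and> b1 \<in> Hom C (Dom C j) (Dom C g) \<and> b2 \<in> Hom C (Cod C j) (Cod C g) \<and>
        g \<cdot> b1 = b2 \<cdot> j \<and> b1 \<cdot> a1 = u \<and> b2 \<cdot> a2 = v"
  shows "\<exists>n m. n \<in> L \<and> Dom C n = Dom C g \<and> m \<in> Hom C (Cod C n) (Cod C g) \<and> m \<cdot> n = g \<and>
    (\<forall>i\<in>I. \<forall>u\<in>Hom C (Dom C i) (Dom C g). \<forall>v\<in>Hom C (Cod C i) (Cod C g). g \<cdot> u = v \<cdot> i \<longrightarrow>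
      (\<exists>d\<in>Hom C (Cod C i) (Cod C n). d \<cdot> i = n \<cdot> u \<and> m \<cdot> d = v))"
proof -
  define S where "S = {(i, u, v). i \<in> I \<and> u \<in> Hom C (Dom C i) (Dom C g) \<and>
      v \<in> Hom C (Cod C i) (Cod C g) \<and> g \<cdot> u = v \<cdot> i}"
  have "S \<subseteq> Sigma I (\<lambda>i. Hom C (Dom C i) (Dom C g) \<times> Hom C (Cod C i) (Cod C g))"
    by (auto simp: S_def)
  then have sS: "small k S"
    by (rule small_subset) (intro small_Sigma I small_Hom)
  let ?R = "\<lambda>(i, u, v) (j, a1, a2, b1, b2). j \<in> L \<and> a1 \<in> Hom C (Dom C i) (Dom C j) \<and> a2 \<in> Hom C (Cod C i) (Cod C j) \<and>
        j \<cdot> a1 = a2 \<cdot> i \<and> b1 \<in> Hom C (Dom C j) (Dom C g) \<and> b2 \<in> Hom C (Cod C j) (Cod C g) \<and>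
        g \<cdot> b1 = b2 \<cdot> j \<and> b1 \<cdot> a1 = u \<and> b2 \<cdot> a2 = v"
  have ex: "\<exists>x. ?R \<sigma> x" if "\<sigma> \<in> S" for \<sigma>
  proof -
    obtain i u v where \<sigma>: "\<sigma> = (i, u, v)" by (cases \<sigma>)
    have "i \<in> I" "u \<in> Hom C (Dom C i) (Dom C g)" "v \<in> Hom C (Cod C i) (Cod C g)" "g \<cdot> u = v \<cdot> i"
      using that unfolding S_def \<sigma> by blast+
    from fac[OF this] obtain j a1 a2 b1 b2 where "?R \<sigma> (j, a1, a2, b1, b2)"
      unfolding \<sigma> prod.case by (elim exE)
    then show ?thesis by (rule exI)
  qed
  have "\<exists>w. \<forall>\<sigma>\<in>S. ?R \<sigma> (w \<sigma>)" by (rule bchoice, rule ballI, rule ex)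
  then obtain w where "\<forall>\<sigma>\<in>S. ?R \<sigma> (w \<sigma>)" by (rule exE)
  note w = bspec[OF this]
  define j where "j = (\<lambda>\<sigma>. fst (w \<sigma>))"
  define a1 where "a1 = (\<lambda>\<sigma>. fst (snd (w \<sigma>)))"
  define a2 where "a2 = (\<lambda>\<sigma>. fst (snd (snd (w \<sigma>))))"
  define b1 where "b1 = (\<lambda>\<sigma>. fst (snd (snd (snd (w \<sigma>)))))"
  define b2 where "b2 = (\<lambda>\<sigma>. snd (snd (snd (snd (w \<sigma>)))))"
  have weq: "w \<sigma> = (j \<sigma>, a1 \<sigma>, a2 \<sigma>, b1 \<sigma>, b2 \<sigma>)" for \<sigma>
    by (simp add: j_def a1_def a2_def b1_def b2_def)
  have R: "j \<sigma> \<in> L" "a1 \<sigma> \<in> Hom C (Dom C (fst \<sigma>)) (Dom C (j \<sigma>))" "a2 \<sigma> \<in> Hom C (Cod C (fst \<sigma>)) (Cod C (j \<sigma>))"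
    "j \<sigma> \<cdot> a1 \<sigma> = a2 \<sigma> \<cdot> fst \<sigma>" "b1 \<sigma> \<in> Hom C (Dom C (j \<sigma>)) (Dom C g)"
    "b2 \<sigma> \<in> Hom C (Cod C (j \<sigma>)) (Cod C g)" "g \<cdot> b1 \<sigma> = b2 \<sigma> \<cdot> j \<sigma>"
    "b1 \<sigma> \<cdot> a1 \<sigma> = fst (snd \<sigma>)" "b2 \<sigma> \<cdot> a2 \<sigma> = snd (snd \<sigma>)" if "\<sigma> \<in> S" for \<sigma>
    using w[OF that] unfolding weq by (auto split: prod.splits)
  have jA: "j \<sigma> \<in> Arr C \<and> b1 \<sigma> \<in> Hom C (Dom C (j \<sigma>)) (Dom C g)" if "\<sigma> \<in> S" for \<sigma>
    using R(1,5)[OF that] saturatedD(1)[OF L] by auto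
  have "\<exists>Z1 n e. attach S j b1 (Dom C g) Z1 n e"
    by (rule attach_exists[OF sS dom_in_Obj[OF g]]) (rule jA)
  then obtain Z1 n e where att: "attach S j b1 (Dom C g) Z1 n e" by (elim exE)
  note n = attach_in(1)[OF att] and e = attach_in(2,3)[OF att]
  have nL: "n \<in> L"
    by (rule attach_in_saturated[OF L sS att]) (use R jA in blast)
  have "\<exists>m\<in>Hom C Z1 (Cod C g). m \<cdot> n = g \<and> (\<forall>\<sigma>\<in>S. m \<cdot> e \<sigma> = b2 \<sigma>)"
    by (rule attach_ex[OF att]) (use R g in simp_all)
  then obtain m where m: "m \<in> Hom C Z1 (Cod C g)" "m \<cdot> n = g" "\<And>\<sigma>. \<sigma> \<in> S \<Longrightarrow> m \<cdot> e \<sigma> = b2 \<sigma>" by blast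
  have sol: "\<exists>d\<in>Hom C (Cod C i) (Cod C n). d \<cdot> i = n \<cdot> u \<and> m \<cdot> d = v"
    if "i \<in> I" "u \<in> Hom C (Dom C i) (Dom C g)" "v \<in> Hom C (Cod C i) (Cod C g)" "g \<cdot> u = v \<cdot> i" for i u v
  proof -
    have \<sigma>: "(i, u, v) \<in> S" using that by (simp add: S_def)
    let ?\<sigma> = "(i, u, v)"
    have iA: "i \<in> Arr C" using that I by blast
    note H = R[OF \<sigma>, unfolded fst_conv snd_conv] jA[OF \<sigma>] e[OF \<sigma>] n m(1) iA
    have "(e ?\<sigma> \<cdot> a2 ?\<sigma>) \<cdot> i = e ?\<sigma> \<cdot> (j ?\<sigma> \<cdot> a1 ?\<sigma>)" using H by simp
    also have "\<dots> = n \<cdot> (b1 ?\<sigma> \<cdot> a1 ?\<sigma>)"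
      by (rule comp_cong2[OF e(2)[OF \<sigma>]]) (use H in simp_all)
    also have "\<dots> = n \<cdot> u" using R(8)[OF \<sigma>] by simp
    finally have "(e ?\<sigma> \<cdot> a2 ?\<sigma>) \<cdot> i = n \<cdot> u" .
    moreover have "m \<cdot> (e ?\<sigma> \<cdot> a2 ?\<sigma>) = b2 ?\<sigma> \<cdot> a2 ?\<sigma>"
      by (rule comp_reduce[OF m(3)[OF \<sigma>]]) (use H in simp_all)
    then have "m \<cdot> (e ?\<sigma> \<cdot> a2 ?\<sigma>) = v" using R(9)[OF \<sigma>] by simp
    ultimately show ?thesis using H by (intro bexI[of _ "e ?\<sigma> \<cdot> a2 ?\<sigma>"]) simp_all
  qed
  show ?thesis
  proof (rule exI[of _ n], rule exI[of _ m], intro conjI ballI impI)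
    show "n \<in> L" "m \<cdot> n = g" by (rule nL m)+
    show "Dom C n = Dom C g" "m \<in> Hom C (Cod C n) (Cod C g)" using m n by simp_all
  qed (rule sol)
qed

text \<open>In the classical case \<open>L\<close> is the class generated by \<open>I\<close> and \<open>W\<close> consists of all morphisms.
  The general form also gives the factorization of weak equivalences on which Smith's theorem rests:
  there the squares from \<open>I\<close> into weak equivalences factor through trivial cofibrations.\<close>

lemma small_object_argument:
  assumes I: "small k I" "I \<subseteq> Arr C" and L: "saturated k C L" and W: "W \<subseteq> Arr C"
    and fac: "\<And>g i u v. g \<in> W \<Longrightarrow> i \<in> I \<Longrightarrow> u \<in> Hom C (Dom C i) (Dom C g) \<Longrightarrow>
      v \<in> Hom C (Cod C i) (Cod C g) \<Longrightarrow> g \<cdot> u = v \<cdot> i \<Longrightarrow>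
      \<exists>j a1 a2 b1 b2. j \<in> L \<and> a1 \<in> Hom C (Dom C i) (Dom C j) \<and> a2 \<in> Hom C (Cod C i) (Cod C j) \<and>
        j \<cdot> a1 = a2 \<cdot> i \<and> b1 \<in> Hom C (Dom C j) (Dom C g) \<and> b2 \<in> Hom C (Cod C j) (Cod C g) \<and>
        g \<cdot> b1 = b2 \<cdot> j \<and> b1 \<cdot> a1 = u \<and> b2 \<cdot> a2 = v"
    and can: "\<And>g l. g \<in> Arr C \<Longrightarrow> l \<in> L \<Longrightarrow> Dom C g = Cod C l \<Longrightarrow> g \<cdot> l \<in> W \<Longrightarrow> g \<in> W"
    and g: "g \<in> W"
  shows "\<exists>f\<in>L. \<exists>p\<in>rlp C I. Cod C f = Dom C p \<and> g = p \<cdot> f"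
proof -
  let ?Q = "\<lambda>r n m. Dom C n = Dom C r \<and> n \<in> L \<and> m \<in> Hom C (Cod C n) (Cod C r) \<and> m \<cdot> n = r \<and>
    (r \<in> W \<longrightarrow> (\<forall>i\<in>I. \<forall>u\<in>Hom C (Dom C i) (Dom C r). \<forall>v\<in>Hom C (Cod C i) (Cod C r). r \<cdot> u = v \<cdot> i \<longrightarrow>
      (\<exists>d\<in>Hom C (Cod C i) (Cod C n). d \<cdot> i = n \<cdot> u \<and> m \<cdot> d = v)))"
  have ex: "\<exists>x. ?Q r (fst x) (snd x)" if "r \<in> Arr C" for r
  proof (cases "r \<in> W")
    case True
    have "\<exists>n m. n \<in> L \<and> Dom C n = Dom C r \<and> m \<in> Hom C (Cod C n) (Cod C r) \<and> m \<cdot> n = r \<and>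
      (\<forall>i\<in>I. \<forall>u\<in>Hom C (Dom C i) (Dom C r). \<forall>v\<in>Hom C (Cod C i) (Cod C r). r \<cdot> u = v \<cdot> i \<longrightarrow>
        (\<exists>d\<in>Hom C (Cod C i) (Cod C n). d \<cdot> i = n \<cdot> u \<and> m \<cdot> d = v))"
      by (rule small_object_step[OF I L that]) (rule fac[OF True])
    then obtain n m where "?Q r n m" by (elim exE conjE) blast
    then show ?thesis by (intro exI[of _ "(n, m)"]) (unfold fst_conv snd_conv)
  next
    case False
    \<comment> \<open>A default that makes the step total; by \<open>rW\<close> below every map of
      the chain is in \<open>W\<close>.\<close>
    have "?Q r (Ident C (Dom C r)) r"
      using that False saturatedD(2)[OF L] id_in_isos[of "Dom C r"] by auto
    then show ?thesis by (intro exI[of _ "(Ident C (Dom C r), r)"]) (unfold fst_conv snd_conv)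
  qed
  have "\<exists>w. \<forall>r\<in>Arr C. ?Q r (fst (w r)) (snd (w r))" by (rule bchoice, rule ballI, rule ex)
  then obtain w where "\<forall>r\<in>Arr C. ?Q r (fst (w r)) (snd (w r))" by (rule exE)
  note w = bspec[OF this]
  define N where "N = (\<lambda>r. fst (w r))"
  define M where "M = (\<lambda>r. snd (w r))"
  have NM: "Dom C (N r) = Dom C r" "N r \<in> L" "N r \<in> Arr C" "M r \<in> Hom C (Cod C (N r)) (Cod C r)" "M r \<cdot> N r = r"
    if "r \<in> Arr C" for r
    using w[OF that] saturatedD(1)[OF L] unfolding N_def M_def by blast+
  have solve: "\<exists>d\<in>Hom C (Cod C i) (Cod C (N r)). d \<cdot> i = N r \<cdot> u \<and> M r \<cdot> d = v"
    if "r \<in> W" "i \<in> I" "u \<in> Hom C (Dom C i) (Dom C r)" "v \<in> Hom C (Cod C i) (Cod C r)" "r \<cdot> u = v \<cdot> i" for r i u v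
    using w[of r] that W unfolding N_def M_def by blast
  have gA: "g \<in> Arr C" using g W by blast
  have "\<exists>Z f r. (\<forall>l :: 'k. smooth_chain C l Z f) \<and> Z zero = Dom C g \<and> r zero = g \<and>
    (\<forall>s. r s \<in> Hom C (Z s) (Cod C g)) \<and> (\<forall>i j. i \<le> j \<longrightarrow> r j \<cdot> f (i, j) = r i) \<and>
    (\<forall>s. f (s, succ s) = N (r s) \<and> r (succ s) = M (r s))"
    by (rule chain_exists[where N = "\<lambda>_ _. N" and M = "\<lambda>_ _. M"]) (use gA NM in auto)
  then obtain Z f r where ch: "\<And>l. smooth_chain C l Z f" and z: "Z zero = Dom C g" "r zero = g"
    and r: "\<And>s. r s \<in> Hom C (Z s) (Cod C g)" "\<And>i j. i \<le> j \<Longrightarrow> r j \<cdot> f (i, j) = r i"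
    and st: "\<And>s. f (s, succ s) = N (r s)" "\<And>s. r (succ s) = M (r s)"
    by (elim exE conjE) metis
  have rA: "r s \<in> Arr C" for s using r(1) by simp
  have fin: "f (i, t) \<in> Hom C (Z i) (Z t)" if "i \<le> t" for i t
    using smooth_chainD(1)[OF ch that order_refl] .
  have fcomp: "f (t, m) \<cdot> f (i, t) = f (i, m)" if "i \<le> t" "t \<le> m" for i t m
    using smooth_chainD(4)[OF ch that order_refl] .
  have fL: "f (zero, s) \<in> L" for s
    by (rule chain_in_closed[OF saturatedD(4)[OF L] saturatedD(2)[OF L] ch[of s]]) (use NM rA st in auto)
  \<comment> \<open>The start \<open>g = r s \<cdot> f (zero, s)\<close> is in \<open>W\<close> and
    \<open>f (zero, s)\<close> is in \<open>L\<close>, so the cancellation hypothesis applies. Hence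
    squares can be factored at every stage, including limits.\<close>
  have rW: "r s \<in> W" for s
    by (rule can[OF rA fL[of s]]) (use r(1)[of s] r(2)[of zero s] fin[of zero s] z g in simp_all)
  have so: "small k (Dom C ` I)" "Dom C ` I \<subseteq> Obj C" using I by (auto intro: small_image)
  obtain l P where "generating l P" using ex_generating by blast
  from compact_above[OF this so small_finite[of "{}"]]
  obtain s where s: "regular_above ({} :: nat set) s" "\<And>i. i \<in> I \<Longrightarrow> compact_at (chain_ord s) (Dom C i)" by auto
  have ls: "limit_ordinal s" by (rule regular_limit[OF s(1)])
  note col = smooth_chainD(5)[OF ch[of s] order_refl ls]
  note dia = smooth_chain_diagram[OF ch[of s] order_refl]
  have "lifts C i (r s)" if i: "i \<in> I" for i
  proof (rule liftsI)
    fix u v assume u: "u \<in> Hom C (Dom C i) (Dom C (r s))" and v: "v \<in> Hom C (Cod C i) (Cod C (r s))"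
      and uv: "r s \<cdot> u = v \<cdot> i"
    have iA: "i \<in> Arr C" using i I by blast
    have "u \<in> Hom C (Dom C i) (Z s)" using u r(1)[of s] by simp
    \<comment> \<open>Stage \<open>s\<close> is the colimit of the earlier ones, so by compactness
      the top of the square comes from some \<open>t < s\<close>; the square is then solved at
      \<open>succ t\<close>.\<close>
    then have "\<exists>t\<in>Field (chain_ord s). \<exists>u'\<in>Hom C (Dom C i) (Z t). f (t, s) \<cdot> u' = u"
      by (rule compactD(1)[OF s(2)[OF i] directed_chain_ord[OF s(1)] dia col])
    then obtain t u' where t: "t < s" and u': "u' \<in> Hom C (Dom C i) (Z t)" "f (t, s) \<cdot> u' = u" by auto
    have ts: "succ t \<le> s" "t \<le> s" using t less_imp_le[OF t] by simp_all
    have "r t \<cdot> u' = r s \<cdot> (f (t, s) \<cdot> u')"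
      using comp_reduce[OF r(2)[OF ts(2)], of u'] r(1)[of s] fin[OF ts(2)] u' by simp
    then have "r t \<cdot> u' = v \<cdot> i" using u' uv by simp
    then obtain d where d: "d \<in> Hom C (Cod C i) (Z (succ t))" "d \<cdot> i = f (t, succ t) \<cdot> u'" "r (succ t) \<cdot> d = v"
      using solve[OF rW[of t] i, of u' v] u' v r(1)[of t] r(1)[of s] st[of t] fin[of t "succ t"] by auto
    note H = d u' fin[OF ts(1)] fin[of t "succ t"] r(1)[of s] iA
    have "(f (succ t, s) \<cdot> d) \<cdot> i = f (succ t, s) \<cdot> (f (t, succ t) \<cdot> u')" using H by simp
    also have "\<dots> = f (t, s) \<cdot> u'"
      by (rule comp_reduce[OF fcomp]) (use H ts in simp_all)
    finally have "(f (succ t, s) \<cdot> d) \<cdot> i = u" using u' by simp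
    moreover have "r s \<cdot> (f (succ t, s) \<cdot> d) = v"
      using comp_reduce[OF r(2)[OF ts(1)], of d] H by simp
    ultimately show "\<exists>d\<in>Hom C (Cod C i) (Dom C (r s)). d \<cdot> i = u \<and> r s \<cdot> d = v"
      using H by (intro bexI[of _ "f (succ t, s) \<cdot> d"]) simp_all
  qed
  then have "r s \<in> rlp C I" using rA by (simp add: rlp_def)
  moreover have "g = r s \<cdot> f (zero, s)" using r(2)[of zero s] z by simp
  moreover have "Cod C (f (zero, s)) = Dom C (r s)" using fin[of zero s] r(1)[of s] by simp
  ultimately show ?thesis using fL[of s] by blast
qed

text \<open>The classical case: every square from \<open>i\<close> factors through \<open>i\<close>
  itself, with identities on the left.\<close>

lemma factorization:
  assumes Y: "small k Y" "Y \<subseteq> Arr C" and g: "g \<in> Arr C"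
  shows "\<exists>f\<in>cof k C Y. \<exists>p\<in>rlp C Y. Cod C f = Dom C p \<and> g = p \<cdot> f"
proof (rule small_object_argument[OF Y saturated_cof'[OF Y(2)] subset_refl _ _ g])
  fix g i u v assume *: "g \<in> Arr C" "i \<in> Y" "u \<in> Hom C (Dom C i) (Dom C g)"
    "v \<in> Hom C (Cod C i) (Cod C g)" "g \<cdot> u = v \<cdot> i"
  then have "i \<in> Arr C" "i \<in> cof k C Y" using Y subset_cof[of Y k C] by auto
  then show "\<exists>j a1 a2 b1 b2. j \<in> cof k C Y \<and> a1 \<in> Hom C (Dom C i) (Dom C j) \<and> a2 \<in> Hom C (Cod C i) (Cod C j) \<and>
        j \<cdot> a1 = a2 \<cdot> i \<and> b1 \<in> Hom C (Dom C j) (Dom C g) \<and> b2 \<in> Hom C (Cod C j) (Cod C g) \<and>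
        g \<cdot> b1 = b2 \<cdot> j \<and> b1 \<cdot> a1 = u \<and> b2 \<cdot> a2 = v"
    using * by (intro exI[of _ i] exI[of _ "Ident C (Dom C i)"] exI[of _ "Ident C (Cod C i)"]
        exI[of _ u] exI[of _ v]) simp
qed

end

section \<open>Retract arguments\<close>

context category
begin

text \<open>The lift is taken in the square with top \<open>f\<close> and bottom an identity. With
  identities on domains, it is the inclusion on codomains and \<open>p\<close> is the
  retraction.\<close>

lemma retract_argument:
  assumes f: "f \<in> Arr C" and p: "p \<in> Arr C" "Cod C f = Dom C p" and l: "lifts C (p \<cdot> f) p"
  shows "retract_of (arrow_cat C) (p \<cdot> f) f"
proof -
  have "\<exists>d. d \<in> Hom C (Cod C (p \<cdot> f)) (Dom C p) \<and> d \<cdot> (p \<cdot> f) = f \<and> p \<cdot> d = Ident C (Cod C p)"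
    by (rule lifts_ex[OF l]) (use f p in simp_all)
  then obtain d where d: "d \<in> Hom C (Cod C p) (Dom C p)" "d \<cdot> (p \<cdot> f) = f" "p \<cdot> d = Ident C (Cod C p)"
    using f p by auto
  show ?thesis unfolding retract_arrow_iff
    by (intro conjI exI[of _ "Ident C (Dom C f)"] exI[of _ d] exI[of _ p]) (use f p d in simp_all)
qed

text \<open>The dual: the square now has an identity on top and bottom \<open>p\<close>, and the
  codomains carry identities.\<close>

lemma retract_argument_right:
  assumes f: "f \<in> Arr C" and p: "p \<in> Arr C" "Cod C f = Dom C p" and l: "lifts C f (p \<cdot> f)"
  shows "retract_of (arrow_cat C) (p \<cdot> f) p"
proof -
  have "\<exists>d. d \<in> Hom C (Cod C f) (Dom C (p \<cdot> f)) \<and> d \<cdot> f = Ident C (Dom C f) \<and> (p \<cdot> f) \<cdot> d = p"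
    by (rule lifts_ex[OF l]) (use f p in simp_all)
  then obtain d where d: "d \<in> Hom C (Cod C f) (Dom C f)" "d \<cdot> f = Ident C (Dom C f)" "p \<cdot> (f \<cdot> d) = p"
    using f p by auto
  show ?thesis unfolding retract_arrow_iff
    by (intro conjI exI[of _ f] exI[of _ "Ident C (Cod C p)"] exI[of _ d]) (use f p d in simp_all)
qed

lemma rlp_retract:
  assumes r: "retract_of (arrow_cat C) f g" and g: "g \<in> rlp C X" and X: "X \<subseteq> Arr C"
  shows "f \<in> rlp C X"
proof -
  from r obtain s1 s2 r1 r2 where fg: "f \<in> Arr C" "g \<in> Arr C"
    and s: "s1 \<in> Hom C (Dom C f) (Dom C g)" "s2 \<in> Hom C (Cod C f) (Cod C g)" "g \<cdot> s1 = s2 \<cdot> f"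
    and r: "r1 \<in> Hom C (Dom C g) (Dom C f)" "r2 \<in> Hom C (Cod C g) (Cod C f)" "f \<cdot> r1 = r2 \<cdot> g"
    and rs: "r1 \<cdot> s1 = Ident C (Dom C f)" "r2 \<cdot> s2 = Ident C (Cod C f)"
    unfolding retract_arrow_iff by blast
  have "lifts C h f" if h: "h \<in> X" for h
  proof (rule liftsI)
    fix u v assume u: "u \<in> Hom C (Dom C h) (Dom C f)" and v: "v \<in> Hom C (Cod C h) (Cod C f)"
      and uv: "f \<cdot> u = v \<cdot> h"
    have hA: "h \<in> Arr C" using h X by blast
    have "\<exists>d. d \<in> Hom C (Cod C h) (Dom C g) \<and> d \<cdot> h = s1 \<cdot> u \<and> g \<cdot> d = s2 \<cdot> v"
    proof (rule lifts_ex)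
      show "lifts C h g" using g h by (simp add: rlp_def)
      have "g \<cdot> (s1 \<cdot> u) = s2 \<cdot> (f \<cdot> u)" by (rule comp_cong2[OF s(3)]) (use fg s u in simp_all)
      then show "g \<cdot> (s1 \<cdot> u) = (s2 \<cdot> v) \<cdot> h" using uv v s hA by simp
    qed (use u v s in simp_all)
    then obtain d where d: "d \<in> Hom C (Cod C h) (Dom C g)" "d \<cdot> h = s1 \<cdot> u" "g \<cdot> d = s2 \<cdot> v" by blast
    have "(r1 \<cdot> d) \<cdot> h = u"
      using d r(1) hA s(1) u comp_reduce[OF rs(1), of u] by simp
    moreover have "f \<cdot> (r1 \<cdot> d) = r2 \<cdot> (g \<cdot> d)" by (rule comp_cong2[OF r(3)]) (use fg d r in simp_all)
    then have "f \<cdot> (r1 \<cdot> d) = v" using d r(2) s(2) v comp_reduce[OF rs(2), of v] by simp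
    ultimately show "\<exists>d\<in>Hom C (Cod C h) (Dom C f). d \<cdot> h = u \<and> f \<cdot> d = v"
      using d r by (intro bexI[of _ "r1 \<cdot> d"]) simp_all
  qed
  then show ?thesis using fg by (simp add: rlp_def)
qed

end

context locally_presentable_category
begin

text \<open>For the inclusion of the right side, factor \<open>g\<close> into \<open>f\<close> from
  \<open>cof k C Y\<close> followed by \<open>p\<close> from \<open>rlp C Y\<close>. As
  \<open>g\<close> lifts against \<open>p\<close>, it is a retract of \<open>f\<close>.\<close>

lemma cof_eq_llp_rlp:
  assumes Y: "small k Y" "Y \<subseteq> Arr C"
  shows "cof k C Y = llp C (rlp C Y)"
proof
  show "cof k C Y \<subseteq> llp C (rlp C Y)" by (rule cof_subset_llp_rlp[OF Y(2)])
  show "llp C (rlp C Y) \<subseteq> cof k C Y"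
  proof
    fix g assume g: "g \<in> llp C (rlp C Y)"
    then have gA: "g \<in> Arr C" by (simp add: llp_def)
    obtain f p where f: "f \<in> cof k C Y" and p: "p \<in> rlp C Y" and fp: "Cod C f = Dom C p" "g = p \<cdot> f"
      using factorization[OF Y gA] by blast
    have "f \<in> Arr C" "p \<in> Arr C" using f p saturatedD(1)[OF saturated_cof'[OF Y(2)]] by (auto simp: rlp_def)
    moreover have "lifts C g p" using g p by (simp add: llp_def)
    ultimately have "retract_of (arrow_cat C) g f" using retract_argument[of f p] fp by simp
    then show "g \<in> cof k C Y"
      using f saturatedD(5)[OF saturated_cof'[OF Y(2)]] unfolding retract_closed_def by blast
  qed
qed

lemma cofibrantly_generated_cof:
  assumes Y: "small k Y" "Y \<subseteq> Arr C"
  shows "cofibrantly_generated k C (cof k C Y) (rlp C Y)"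
  unfolding cofibrantly_generated_def weak_factorization_system_def
proof (intro conjI)
  show "cof k C Y \<subseteq> Arr C" using saturatedD(1)[OF saturated_cof'[OF Y(2)]] .
  show "rlp C Y = rlp C (cof k C Y)" using rlp_cof[OF Y(2)] by simp
  show "cof k C Y = llp C (rlp C Y)" by (rule cof_eq_llp_rlp[OF Y])
  show "\<forall>h\<in>Arr C. \<exists>f\<in>cof k C Y. \<exists>g\<in>rlp C Y. Cod C f = Dom C g \<and> h = g \<cdot> f"
    using factorization[OF Y] by blast
qed (use Y in \<open>auto simp: rlp_def\<close>)

section \<open>Completeness\<close>

definition limit_cone :: "('i, 'j) cat \<Rightarrow> ('i \<Rightarrow> 'o) \<Rightarrow> ('j \<Rightarrow> 'm) \<Rightarrow> 'o \<Rightarrow> ('i \<Rightarrow> 'm) \<Rightarrow> bool" where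
  "limit_cone J F G a q \<longleftrightarrow> a \<in> Obj C \<and> (\<forall>i\<in>Obj J. q i \<in> Hom C a (F i)) \<and>
     (\<forall>m\<in>Arr J. G m \<cdot> q (Dom J m) = q (Cod J m))"

lemma coneD:
  assumes "limit_cone J F G a q"
  shows "a \<in> Obj C" "i \<in> Obj J \<Longrightarrow> q i \<in> Hom C a (F i)"
    "m \<in> Arr J \<Longrightarrow> G m \<cdot> q (Dom J m) = q (Cod J m)"
  using assms unfolding limit_cone_def by blast+

lemma cone_comp:
  assumes gd: "graph_diagram J C F G" and q: "limit_cone J F G a q" and h: "h \<in> Hom C b a"
  shows "limit_cone J F G b (\<lambda>i. q i \<cdot> h)"
  unfolding limit_cone_def
proof (intro conjI ballI)
  show "b \<in> Obj C" using h by auto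
  show "q i \<cdot> h \<in> Hom C b (F i)" if "i \<in> Obj J" for i using coneD(2)[OF q that] h by simp
  show "G m \<cdot> (q (Dom J m) \<cdot> h) = q (Cod J m) \<cdot> h" if m: "m \<in> Arr J" for m
  proof (rule comp_reduce[OF coneD(3)[OF q m]])
    have J: "Dom J m \<in> Obj J" "G m \<in> Hom C (F (Dom J m)) (F (Cod J m))"
      using gd m unfolding graph_diagram_def by blast+
    then show "q (Dom J m) \<in> Arr C" "G m \<in> Arr C" "Dom C (G m) = Cod C (q (Dom J m))"
      "Dom C (q (Dom J m)) = Cod C h" using coneD(2)[OF q J(1)] h by simp_all
  qed (use h in simp)
qed

text \<open>The forgetful functor from cones to their vertices creates colimits: \<open>c\<close> is
  a colimit of vertices of cones, and the legs of the new cone are induced by the legs at the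
  stages.\<close>

lemma cone_colimit:
  assumes gd: "graph_diagram J C F G" and gd': "graph_diagram J' C F' G'"
    and col: "colimit J' C F' G' c p"
    and cn: "\<And>e. e \<in> Obj J' \<Longrightarrow> limit_cone J F G (F' e) (q e)"
    and co: "\<And>a i. a \<in> Arr J' \<Longrightarrow> i \<in> Obj J \<Longrightarrow> q (Cod J' a) i \<cdot> G' a = q (Dom J' a) i"
  shows "\<exists>Q. limit_cone J F G c Q \<and> (\<forall>i\<in>Obj J. \<forall>e\<in>Obj J'. Q i \<cdot> p e = q e i)"
proof -
  have F: "F i \<in> Obj C" if "i \<in> Obj J" for i using gd that unfolding graph_diagram_def by blast
  have "\<exists>u\<in>Hom C c (F i). \<forall>e\<in>Obj J'. u \<cdot> p e = q e i" if i: "i \<in> Obj J" for i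
    by (rule colimit_ex[OF col F[OF i]]) (use coneD(2)[OF cn i] co[OF _ i] in auto)
  then obtain Q where Q: "\<And>i. i \<in> Obj J \<Longrightarrow> Q i \<in> Hom C c (F i)"
      "\<And>i e. i \<in> Obj J \<Longrightarrow> e \<in> Obj J' \<Longrightarrow> Q i \<cdot> p e = q e i" by metis
  have "limit_cone J F G c Q" unfolding limit_cone_def
  proof (intro conjI ballI)
    show "c \<in> Obj C" by (rule colimit_obj[OF col])
    fix m assume m: "m \<in> Arr J"
    then have J: "Dom J m \<in> Obj J" "Cod J m \<in> Obj J" "G m \<in> Hom C (F (Dom J m)) (F (Cod J m))"
      using gd unfolding graph_diagram_def by blast+
    show "G m \<cdot> Q (Dom J m) = Q (Cod J m)"
    proof (rule colimit_eqI[OF gd' col, of _ "F (Cod J m)"])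
      fix e assume e: "e \<in> Obj J'"
      show "(G m \<cdot> Q (Dom J m)) \<cdot> p e = Q (Cod J m) \<cdot> p e"
        using Q(1)[OF J(1)] Q(2)[OF J(1) e] Q(2)[OF J(2) e] J(3) colimit_in[OF col e] coneD(3)[OF cn[OF e] m]
        by simp
    qed (use Q(1)[OF J(1)] Q(1)[OF J(2)] J(3) in simp_all)
  qed (rule Q)
  then show ?thesis using Q(2) by blast
qed

text \<open>The witness is the colimit of all cones with vertex in the generating set.\<close>

lemma weakly_terminal_cone:
  fixes J :: "('i, 'j) cat"
  assumes gd: "graph_diagram J C F G" and sJ: "small k (Obj J)"
  shows "\<exists>c Q. limit_cone J F G c Q \<and> (\<forall>d q. limit_cone J F G d q \<longrightarrow>
    (\<exists>w\<in>Hom C d c. \<forall>i\<in>Obj J. Q i \<cdot> w = q i))"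
proof -
  obtain l P where gen: "generating l P" using ex_generating by blast
  have P: "small k P" "P \<subseteq> Obj C" using gen generating_Obj by (auto simp: generating_def)
  \<comment> \<open>The families of legs are taken extensional on \<open>Obj J\<close>, so that the
    cones with vertex in \<open>P\<close> form a small set.\<close>
  define V where "V = {(a, q). a \<in> P \<and> q \<in> (\<Pi>\<^sub>E i\<in>Obj J. Hom C a (F i)) \<and> limit_cone J F G a q}"
  define JJ where "JJ = \<lparr>Obj = V, Arr = {(e, h, e'). e \<in> V \<and> e' \<in> V \<and> h \<in> Hom C (fst e) (fst e') \<and>
      (\<forall>i\<in>Obj J. snd e' i \<cdot> h = snd e i)}, Dom = fst, Cod = (\<lambda>(e, h, e'). e'), Ident = undefined,
      Comp = undefined\<rparr>"
  define F' where "F' = (fst :: 'o \<times> ('i \<Rightarrow> 'm) \<Rightarrow> 'o)"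
  define G' where "G' = (\<lambda>(e :: 'o \<times> ('i \<Rightarrow> 'm), h :: 'm, e' :: 'o \<times> ('i \<Rightarrow> 'm)). h)"
  have "V \<subseteq> Sigma P (\<lambda>a. \<Pi>\<^sub>E i\<in>Obj J. Hom C a (F i))" by (auto simp: V_def)
  then have sV: "small k V" by (rule small_subset) (intro small_Sigma small_PiE P sJ small_Hom)
  have "Arr JJ \<subseteq> Sigma V (\<lambda>e. \<Union>e'\<in>V. Hom C (fst e) (fst e') \<times> {e'})" by (auto simp: JJ_def)
  then have sA: "small k (Arr JJ)"
    by (rule small_subset) (intro small_Sigma small_UNION sV small_Hom small_finite; simp)
  have gdJ: "graph_diagram JJ C F' G'" unfolding graph_diagram_def
    using P(2) by (auto simp: JJ_def F'_def G'_def V_def simp del: Hom_iff)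
  obtain c p where col: "colimit JJ C F' G' c p"
    using graph_colimit[OF gdJ _ sA] sV by (auto simp: JJ_def)
  have "\<exists>Q. limit_cone J F G c Q \<and> (\<forall>i\<in>Obj J. \<forall>e\<in>Obj JJ. Q i \<cdot> p e = snd e i)"
    by (rule cone_colimit[OF gd gdJ col]) (auto simp: JJ_def V_def F'_def G'_def)
  then obtain Q where Q: "limit_cone J F G c Q" "\<And>i e. i \<in> Obj J \<Longrightarrow> e \<in> V \<Longrightarrow> Q i \<cdot> p e = snd e i"
    by (auto simp: JJ_def)
  have "\<exists>w\<in>Hom C d c. \<forall>i\<in>Obj J. Q i \<cdot> w = q i" if q: "limit_cone J F G d q" for d q
  proof -
    obtain r F2 G2 p2 where "directed l r" and dia: "diagram (poset_cat r) C F2 G2"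
      and FP: "\<And>x. x \<in> Field r \<Longrightarrow> F2 x \<in> P" and col2: "colimit (poset_cat r) C F2 G2 d p2"
      by (rule generatingE[OF gen coneD(1)[OF q]]) (rule that)
    have p2: "p2 x \<in> Hom C (F2 x) d" if "x \<in> Field r" for x using colimit_in[OF col2] that by simp
    \<comment> \<open>Pulling the cone back along \<open>p2 x\<close> makes every stage of the
      presentation of \<open>d\<close> an element of \<open>V\<close>. The legs of the big colimit
      at these elements then form a cocone, which gives the map from \<open>d\<close> to
      \<open>c\<close>.\<close>
    define E where "E = (\<lambda>x. (F2 x, restrict (\<lambda>i. q i \<cdot> p2 x) (Obj J)))"
    have E: "E x \<in> V" if x: "x \<in> Field r" for x
    proof -
      have "limit_cone J F G (F2 x) (\<lambda>i. q i \<cdot> p2 x)" by (rule cone_comp[OF gd q p2[OF x]])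
      then have "limit_cone J F G (F2 x) (restrict (\<lambda>i. q i \<cdot> p2 x) (Obj J))"
        using gd unfolding limit_cone_def graph_diagram_def by simp
      then show ?thesis using FP[OF x] coneD(2)[OF cone_comp[OF gd q p2[OF x]]]
        unfolding V_def E_def by (auto simp del: Hom_iff)
    qed
    have G2: "G2 (x, y) \<in> Hom C (F2 x) (F2 y)" if "(x, y) \<in> r" for x y
      using dia that unfolding diagram_poset_iff by blast
    have ar: "(E x, G2 (x, y), E y) \<in> Arr JJ" if xy: "(x, y) \<in> r" for x y
    proof -
      have "(q i \<cdot> p2 y) \<cdot> G2 (x, y) = q i \<cdot> p2 x" if i: "i \<in> Obj J" for i
        using coneD(2)[OF q i] p2[OF FieldI2[OF xy]] G2[OF xy] colimit_comm[OF col2, of "(x, y)"] xy by simp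
      then show ?thesis using E[OF FieldI1[OF xy]] E[OF FieldI2[OF xy]] G2[OF xy]
        by (simp add: JJ_def) (simp add: E_def)
    qed
    have "\<exists>w\<in>Hom C d c. \<forall>x\<in>Obj (poset_cat r). w \<cdot> p2 x = p (E x)"
    proof (rule colimit_ex[OF col2 colimit_obj[OF col]])
      show "p (E x) \<in> Hom C (F2 x) c" if "x \<in> Obj (poset_cat r)" for x
        using colimit_in[OF col, of "E x"] E[of x] that by (simp add: JJ_def F'_def E_def)
      show "p (E (Cod (poset_cat r) a)) \<cdot> G2 a = p (E (Dom (poset_cat r) a))"
        if "a \<in> Arr (poset_cat r)" for a
        using colimit_comm[OF col ar, of "fst a" "snd a"] that by (simp add: JJ_def G'_def)
    qed
    then obtain w where w: "w \<in> Hom C d c" "\<And>x. x \<in> Field r \<Longrightarrow> w \<cdot> p2 x = p (E x)" by auto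
    have "Q i \<cdot> w = q i" if i: "i \<in> Obj J" for i
    proof (rule colimit_eqI[OF diagram_graph_poset[OF dia] col2, of _ "F i"])
      fix x assume "x \<in> Obj (poset_cat r)"
      then have x: "x \<in> Field r" by simp
      show "(Q i \<cdot> w) \<cdot> p2 x = q i \<cdot> p2 x"
        using coneD(2)[OF Q(1) i] w(1) w(2)[OF x] p2[OF x] Q(2)[OF i E[OF x]] i by (simp add: E_def)
    qed (use coneD(2)[OF Q(1) i] coneD(2)[OF q i] w(1) in simp_all)
    then show ?thesis using w(1) by blast
  qed
  then show ?thesis using Q(1) by blast
qed

text \<open>Coequalize all endomorphisms of a weakly terminal cone.\<close>

lemma terminal_cone:
  fixes J :: "('i, 'j) cat"
  assumes gd: "graph_diagram J C F G" and sJ: "small k (Obj J)"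
  shows "\<exists>t Q. limit_cone J F G t Q \<and> (\<forall>d q. limit_cone J F G d q \<longrightarrow>
    (\<exists>!w. w \<in> Hom C d t \<and> (\<forall>i\<in>Obj J. Q i \<cdot> w = q i)))"
proof -
  obtain c Q where Q: "limit_cone J F G c Q"
    and wt: "\<And>d q. limit_cone J F G d q \<Longrightarrow> \<exists>w\<in>Hom C d c. \<forall>i\<in>Obj J. Q i \<cdot> w = q i"
    using weakly_terminal_cone[OF gd sJ] by blast
  \<comment> \<open>One vertex, with the endomorphisms of the cone as edges. The colimit leg
    \<open>e\<close> is the universal map with \<open>e \<cdot> h = e\<close> for all of them, and
    it is an epimorphism.\<close>
  define JE :: "(unit, 'm) cat" where "JE = \<lparr>Obj = UNIV, Arr = {h \<in> Hom C c c. \<forall>i\<in>Obj J. Q i \<cdot> h = Q i},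
    Dom = (\<lambda>_. ()), Cod = (\<lambda>_. ()), Ident = undefined, Comp = undefined\<rparr>"
  have gdE: "graph_diagram JE C (\<lambda>_. c) (\<lambda>h. h)"
    using coneD(1)[OF Q] by (auto simp: graph_diagram_def JE_def)
  have sE: "small k (Obj JE)" "small k (Arr JE)"
    by (auto simp: JE_def intro: small_finite small_subset[OF _ small_Hom[of c c]] simp del: Hom_iff)
  obtain t p where colE: "colimit JE C (\<lambda>_. c) (\<lambda>h. h) t p" using graph_colimit[OF gdE sE] by blast
  define e where "e = p ()"
  have e: "e \<in> Hom C c t" using colimit_in[OF colE, of "()"] by (simp add: JE_def e_def)
  have eh: "e \<cdot> h = e" if "h \<in> Hom C c c" "\<And>i. i \<in> Obj J \<Longrightarrow> Q i \<cdot> h = Q i" for h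
    using colimit_comm[OF colE, of h] that by (simp add: JE_def e_def)
  have epi: "u = v" if "u \<in> Hom C t d" "v \<in> Hom C t d" "u \<cdot> e = v \<cdot> e" for u v d
    by (rule colimit_eqI[OF gdE colE that(1,2)]) (use that(3) in \<open>simp add: e_def\<close>)
  have "\<exists>R. limit_cone J F G t R \<and> (\<forall>i\<in>Obj J. \<forall>x\<in>Obj JE. R i \<cdot> p x = Q i)"
    by (rule cone_colimit[OF gd gdE colE]) (auto simp: Q JE_def)
  then obtain R where R: "limit_cone J F G t R" "\<And>i. i \<in> Obj J \<Longrightarrow> R i \<cdot> e = Q i"
    by (auto simp: JE_def e_def)
  have "\<exists>!w. w \<in> Hom C d t \<and> (\<forall>i\<in>Obj J. R i \<cdot> w = q i)" if q: "limit_cone J F G d q" for d q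
  proof (rule ex_ex1I)
    obtain w where w: "w \<in> Hom C d c" "\<And>i. i \<in> Obj J \<Longrightarrow> Q i \<cdot> w = q i" using wt[OF q] by blast
    have "R i \<cdot> (e \<cdot> w) = q i" if i: "i \<in> Obj J" for i
      using comp_reduce[OF R(2)[OF i], of w] coneD(2)[OF R(1) i] e w i by simp
    then show "\<exists>w. w \<in> Hom C d t \<and> (\<forall>i\<in>Obj J. R i \<cdot> w = q i)"
      using e w(1) by (intro exI[of _ "e \<cdot> w"]) simp
  next
    fix u v assume "u \<in> Hom C d t \<and> (\<forall>i\<in>Obj J. R i \<cdot> u = q i)" "v \<in> Hom C d t \<and> (\<forall>i\<in>Obj J. R i \<cdot> v = q i)"
    then have u: "u \<in> Hom C d t" "\<And>i. i \<in> Obj J \<Longrightarrow> R i \<cdot> u = q i"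
      and v: "v \<in> Hom C d t" "\<And>i. i \<in> Obj J \<Longrightarrow> R i \<cdot> v = q i" by blast+
    \<comment> \<open>The coequalizer \<open>z\<close> of two competing maps is again the vertex of
      a cone, so there is a map \<open>m\<close> of cones back to \<open>c\<close>. Then
      \<open>m \<cdot> (z \<cdot> e)\<close> is an endomorphism of the weakly terminal cone and is
      absorbed by \<open>e\<close>. Cancelling the epimorphism \<open>e\<close> shows that
      \<open>z\<close> has a left inverse, whence \<open>u = v\<close>.\<close>
    define JB :: "(bool, 'm) cat" where "JB = \<lparr>Obj = UNIV, Arr = {u, v},
      Dom = (\<lambda>_. False), Cod = (\<lambda>_. True), Ident = undefined, Comp = undefined\<rparr>"
    let ?F = "\<lambda>b. if b then t else d"
    have gdB: "graph_diagram JB C ?F (\<lambda>h. h)"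
      using coneD(1)[OF R(1)] coneD(1)[OF q] u v by (auto simp: graph_diagram_def JB_def)
    have sB: "small k (Obj JB)" "small k (Arr JB)" by (auto simp: JB_def intro!: small_finite)
    obtain s p' where colB: "colimit JB C ?F (\<lambda>h. h) s p'" using graph_colimit[OF gdB sB] by blast
    define z where "z = p' True"
    have z: "z \<in> Hom C t s" using colimit_in[OF colB, of True] by (simp add: JB_def z_def)
    have zuv: "z \<cdot> u = z \<cdot> v"
      using colimit_comm[OF colB, of u] colimit_comm[OF colB, of v] by (simp add: JB_def z_def)
    have "\<exists>S. limit_cone J F G s S \<and> (\<forall>i\<in>Obj J. \<forall>b\<in>Obj JB. S i \<cdot> p' b = (if b then R else q) i)"
      by (rule cone_colimit[OF gd gdB colB]) (use R(1) q u v in \<open>auto simp: JB_def\<close>)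
    then obtain S where S: "limit_cone J F G s S" "\<And>i. i \<in> Obj J \<Longrightarrow> S i \<cdot> z = R i"
      by (auto simp: JB_def z_def)
    obtain m where m: "m \<in> Hom C s c" "\<And>i. i \<in> Obj J \<Longrightarrow> Q i \<cdot> m = S i" using wt[OF S(1)] by blast
    have "Q i \<cdot> (m \<cdot> (z \<cdot> e)) = Q i" if i: "i \<in> Obj J" for i
      using comp_reduce[OF m(2)[OF i], of "z \<cdot> e"] comp_reduce[OF S(2)[OF i], of e] R(2)[OF i]
        coneD(2)[OF Q i] coneD(2)[OF S(1) i] m(1) z e by simp
    then have "e \<cdot> (m \<cdot> (z \<cdot> e)) = e" using m(1) z e by (intro eh) simp_all
    then have eq: "(e \<cdot> (m \<cdot> z)) \<cdot> e = Ident C t \<cdot> e" using m(1) z e by simp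
    have "e \<cdot> (m \<cdot> z) \<in> Hom C t t" "Ident C t \<in> Hom C t t"
      using m(1) z e coneD(1)[OF R(1)] by simp_all
    from epi[OF this eq] have id: "e \<cdot> (m \<cdot> z) = Ident C t" .
    have "u = (e \<cdot> (m \<cdot> z)) \<cdot> u" using id u by simp
    also have "\<dots> = (e \<cdot> (m \<cdot> z)) \<cdot> v" using zuv u v m(1) z e by simp
    also have "\<dots> = v" using id v by simp
    finally show "u = v" .
  qed
  then show ?thesis using R(1) by blast
qed

lemma opposite_simps:
  "Obj (opposite D) = Obj D" "Arr (opposite D) = Arr D" "Dom (opposite D) = Cod D"
  "Cod (opposite D) = Dom D" "Comp (opposite D) g f = Comp D f g"
  "Hom (opposite D) a b = Hom D b a"
  by (auto simp: opposite_def Hom_def)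

lemma complete: "complete k C"
  unfolding complete_def
proof (intro allI impI)
  fix J :: "('k, 'k) cat" and F G
  assume "category J \<and> small k (Obj J) \<and> small k (Arr J) \<and> diagram J C F G"
  then have J: "category J" "small k (Obj J)" "diagram J C F G" by blast+
  have gd: "graph_diagram J C F G"
    using J(3) category.dom_in_Obj[OF J(1)] category.cod_in_Obj[OF J(1)]
    unfolding graph_diagram_def diagram_def by blast
  have co: "cocone (opposite J) (opposite C) F G a q = limit_cone J F G a q" for a q
    by (simp only: cocone_def limit_cone_def opposite_simps)
  obtain t Q where t: "limit_cone J F G t Q" "\<And>d q. limit_cone J F G d q \<Longrightarrow>
      \<exists>!w. w \<in> Hom C d t \<and> (\<forall>i\<in>Obj J. Q i \<cdot> w = q i)"
    using terminal_cone[OF gd J(2)] by blast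
  have "limit J C F G t Q"
    unfolding limit_def colimit_def co opposite_simps using t by blast
  then show "\<exists>c p. limit J C F G c p" by blast
qed

section \<open>Smith's theorem: constructing the model structure\<close>

lemma saturated_Int:
  assumes "saturated k C L" "isos C \<subseteq> W" "retract_closed C W" "pushout_closed C (L \<inter> W)"
    "transfinite_composition_closed k C (L \<inter> W)"
  shows "saturated k C (L \<inter> W)"
  using assms unfolding saturated_def retract_closed_def by blast

lemma isos_rlp: "X \<subseteq> Arr C \<Longrightarrow> isos C \<subseteq> rlp C X"
proof
  fix f assume X: "X \<subseteq> Arr C" and "f \<in> isos C"
  then obtain h where f: "f \<in> Arr C" and h: "h \<in> Hom C (Cod C f) (Dom C f)"
    "h \<cdot> f = Ident C (Dom C f)" "f \<cdot> h = Ident C (Cod C f)" by (auto simp: isos_def)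
  have "lifts C g f" if g: "g \<in> X" for g
  proof (rule liftsI)
    fix u v assume u: "u \<in> Hom C (Dom C g) (Dom C f)" and v: "v \<in> Hom C (Cod C g) (Cod C f)"
      and uv: "f \<cdot> u = v \<cdot> g"
    have g: "g \<in> Arr C" using g X by blast
    have "(h \<cdot> v) \<cdot> g = h \<cdot> (v \<cdot> g)" using v h(1) f g by simp
    also have "\<dots> = h \<cdot> (f \<cdot> u)" using uv by simp
    also have "\<dots> = u" using comp_reduce[OF h(2), of u] u f h(1) by simp
    finally have "(h \<cdot> v) \<cdot> g = u" .
    moreover have "f \<cdot> (h \<cdot> v) = v" using comp_reduce[OF h(3), of v] v f h(1) by simp
    ultimately show "\<exists>d\<in>Hom C (Cod C g) (Dom C f). d \<cdot> g = u \<and> f \<cdot> d = v"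
      using v h f by (intro bexI[of _ "h \<cdot> v"]) simp_all
  qed
  then show "f \<in> rlp C X" using f by (simp add: rlp_def)
qed

lemma arrow_cat_simps:
  "Obj (arrow_cat C) = Arr C" "Dom (arrow_cat C) (f, u, v, g) = f"
  "Cod (arrow_cat C) (f, u, v, g) = g"
  "Comp (arrow_cat C) (g', u', v', h) (f, u, v, g) = (f, u' \<cdot> u, v' \<cdot> v, h)"
  "(f, u, v, g) \<in> Arr (arrow_cat C) \<longleftrightarrow> f \<in> Arr C \<and> g \<in> Arr C \<and>
     u \<in> Hom C (Dom C f) (Dom C g) \<and> v \<in> Hom C (Cod C f) (Cod C g) \<and> g \<cdot> u = v \<cdot> f"
  by (simp_all add: arrow_cat_def)

lemma two_out_of_threeD:
  assumes "two_out_of_three C W" "f \<in> Arr C" "g \<in> Arr C" "Cod C f = Dom C g"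
  shows "f \<in> W \<Longrightarrow> g \<in> W \<Longrightarrow> g \<cdot> f \<in> W" "f \<in> W \<Longrightarrow> g \<cdot> f \<in> W \<Longrightarrow> g \<in> W"
    "g \<in> W \<Longrightarrow> g \<cdot> f \<in> W \<Longrightarrow> f \<in> W"
  using assms unfolding two_out_of_three_def by blast+

text \<open>Factor the map from the pushout of \<open>x\<close> to the codomain of \<open>w\<close>.\<close>

lemma square_factors_through_trivial_cofibration:
  assumes X: "small k X" "X \<subseteq> Arr C" and W: "two_out_of_three C W" "W \<subseteq> Arr C" "rlp C X \<subseteq> W"
    and x: "x \<in> X" and w: "w \<in> W" and u: "u \<in> Hom C (Dom C x) (Dom C w)"
    and v: "v \<in> Hom C (Cod C x) (Cod C w)" and uv: "w \<cdot> u = v \<cdot> x"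
  shows "\<exists>j a b. j \<in> cof k C X \<inter> W \<and> Dom C j = Dom C w \<and> a \<in> Hom C (Cod C x) (Cod C j) \<and>
    j \<cdot> u = a \<cdot> x \<and> b \<in> Hom C (Cod C j) (Cod C w) \<and> b \<cdot> j = w \<and> b \<cdot> a = v"
proof -
  note sat = saturated_cof'[OF X(2)]
  have xA: "x \<in> Arr C" and wA: "w \<in> Arr C" using x X w W by auto
  obtain n e where po: "pushout C x u n e" using pushout_exists[of x u] xA u by auto
  have n: "n \<in> Arr C" "Dom C n = Dom C w" and e: "e \<in> Hom C (Cod C x) (Cod C n)" "n \<cdot> u = e \<cdot> x"
    using pushoutD(3,4,6-9)[OF po] u by simp_all
  have "\<exists>!h. h \<in> Hom C (Cod C n) (Cod C w) \<and> h \<cdot> n = w \<and> h \<cdot> e = v"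
    by (rule pushoutD(10)[OF po]) (use u v uv wA in simp_all)
  then obtain h where h: "h \<in> Hom C (Cod C n) (Cod C w)" "h \<cdot> n = w" "h \<cdot> e = v" by blast
  have hA: "h \<in> Arr C" using h by simp
  obtain c p where c: "c \<in> cof k C X" and p: "p \<in> rlp C X" and cp: "Cod C c = Dom C p" "h = p \<cdot> c"
    using factorization[OF X hA] by blast
  have cA: "c \<in> Arr C" and pA: "p \<in> Arr C" using c p saturatedD(1)[OF sat] by (auto simp: rlp_def)
  have ty: "Dom C c = Cod C n" "Cod C p = Cod C w" using h(1) cp cA pA by simp_all
  have "n \<in> cof k C X"
    using saturatedD(3)[OF sat] po subset_cof[of X k C] x unfolding pushout_closed_def by blast
  then have cn: "c \<cdot> n \<in> cof k C X"
    by (rule comp_closedD[OF saturatedD(4)[OF sat] _ c]) (simp add: ty)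
  have pcn: "p \<cdot> (c \<cdot> n) = w" using h(2) cp(2) cA pA n ty cp(1) by simp
  have "c \<cdot> n \<in> W"
    by (rule two_out_of_threeD(3)[OF W(1), of _ p]) (use cA pA n ty cp(1) p W(3) pcn w in auto)
  moreover have "(c \<cdot> n) \<cdot> u = (c \<cdot> e) \<cdot> x" using cA n e u ty xA by simp
  moreover have "p \<cdot> (c \<cdot> e) = v" using h(3) cp cA pA e ty by simp
  ultimately show ?thesis
    by - (rule exI[of _ "c \<cdot> n"], rule exI[of _ "c \<cdot> e"], rule exI[of _ p],
      use cn cA pA n e ty cp(1) pcn in simp)
qed

lemma trivial_cofibrations_generated:
  assumes X: "small k X" "X \<subseteq> Arr C" and W: "W \<subseteq> Arr C" "two_out_of_three C W" "retract_closed C W"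
    and XW: "rlp C X \<subseteq> W" and po: "pushout_closed C (cof k C X \<inter> W)"
    and tc: "transfinite_composition_closed k C (cof k C X \<inter> W)"
    and sol: "\<And>x. x \<in> X \<Longrightarrow> solution_set_condition_at k (arrow_cat C) W x"
  shows "\<exists>J. small k J \<and> J \<subseteq> Arr C \<and> cof k C J = cof k C X \<inter> W"
proof -
  note satX = saturated_cof'[OF X(2)]
  have satXW: "saturated k C (cof k C X \<inter> W)"
    by (rule saturated_Int[OF satX _ W(3) po tc]) (use isos_rlp[OF X(2)] XW in blast)
  let ?S = "\<lambda>x S. small k S \<and>
       S \<subseteq> {f \<in> Arr (arrow_cat C). Dom (arrow_cat C) f = x \<and> Cod (arrow_cat C) f \<in> W} \<and>
       (\<forall>f\<in>Arr (arrow_cat C). Dom (arrow_cat C) f = x \<and> Cod (arrow_cat C) f \<in> W \<longrightarrow>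
          (\<exists>s\<in>S. \<exists>g\<in>Hom (arrow_cat C) (Cod (arrow_cat C) s) (Cod (arrow_cat C) f).
             f = Comp (arrow_cat C) g s))"
  have "\<exists>S. \<forall>x\<in>X. ?S x (S x)"
    using sol unfolding solution_set_condition_at_def by (rule bchoice[OF ballI])
  then obtain S where "\<forall>x\<in>X. ?S x (S x)" by (rule exE)
  note S0 = bspec[OF this]
  have S: "\<And>x. x \<in> X \<Longrightarrow> small k (S x)"
    "\<And>x. x \<in> X \<Longrightarrow> S x \<subseteq> {f \<in> Arr (arrow_cat C). Dom (arrow_cat C) f = x \<and> Cod (arrow_cat C) f \<in> W}"
    using S0 by blast+
  have S3: "\<exists>s\<in>S x. \<exists>g\<in>Hom (arrow_cat C) (Cod (arrow_cat C) s) (Cod (arrow_cat C) f). f = Comp (arrow_cat C) g s"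
    if "x \<in> X" "f \<in> Arr (arrow_cat C)" "Dom (arrow_cat C) f = x" "Cod (arrow_cat C) f \<in> W" for x f
    using conjunct2[OF conjunct2[OF S0[OF that(1)]]] that(2-) by blast
  let ?R = "\<lambda>(x, u, v, w) (j, a, b). j \<in> cof k C X \<inter> W \<and> Dom C j = Dom C w \<and> a \<in> Hom C (Cod C x) (Cod C j) \<and>
    j \<cdot> u = a \<cdot> x \<and> b \<in> Hom C (Cod C j) (Cod C w) \<and> b \<cdot> j = w \<and> b \<cdot> a = v"
  have ex: "\<exists>t. ?R s t" if s: "s \<in> (\<Union>x\<in>X. S x)" for s
  proof -
    obtain x where x: "x \<in> X" "s \<in> S x" using s by blast
    obtain x' u v w where sq: "s = (x', u, v, w)" by (cases s)
    have "s \<in> Arr (arrow_cat C)" "x' = x" "w \<in> W" using S(2)[OF x(1)] x(2) sq by (auto simp: arrow_cat_simps)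
    then have "\<exists>j a b. j \<in> cof k C X \<inter> W \<and> Dom C j = Dom C w \<and> a \<in> Hom C (Cod C x') (Cod C j) \<and>
        j \<cdot> u = a \<cdot> x' \<and> b \<in> Hom C (Cod C j) (Cod C w) \<and> b \<cdot> j = w \<and> b \<cdot> a = v"
      using x(1) unfolding sq arrow_cat_simps
      by (intro square_factors_through_trivial_cofibration[OF X W(2,1) XW]) simp_all
    then obtain j a b where "?R s (j, a, b)" unfolding sq prod.case by (elim exE)
    then show ?thesis by (rule exI)
  qed
  have "\<exists>t. \<forall>s\<in>(\<Union>x\<in>X. S x). ?R s (t s)" by (rule bchoice, rule ballI, rule ex)
  then obtain t where "\<forall>s\<in>(\<Union>x\<in>X. S x). ?R s (t s)" by (rule exE)
  note t = bspec[OF this]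
  define J where "J = (\<lambda>s. fst (t s)) ` (\<Union>x\<in>X. S x)"
  have sJ: "small k J" unfolding J_def by (intro small_image small_UNION X S)
  have JXW: "J \<subseteq> cof k C X \<inter> W"
  proof
    fix j assume "j \<in> J"
    then obtain s where s: "s \<in> (\<Union>x\<in>X. S x)" "j = fst (t s)" unfolding J_def by blast
    show "j \<in> cof k C X \<inter> W" using t[OF s(1)] s(2) by (cases s; cases "t s") auto
  qed
  have JA: "J \<subseteq> Arr C" using JXW W by blast
  have cJ: "cof k C J \<subseteq> cof k C X \<inter> W" by (rule cof_least[OF satXW JXW])
  have fac: "\<exists>f\<in>cof k C J. \<exists>p\<in>rlp C X. Cod C f = Dom C p \<and> g = p \<cdot> f" if g: "g \<in> W" for g
  proof (rule small_object_argument[OF X saturated_cof'[OF JA] W(1) _ _ g])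
    fix g i u v assume g: "g \<in> W" and i: "i \<in> X" and u: "u \<in> Hom C (Dom C i) (Dom C g)"
      and v: "v \<in> Hom C (Cod C i) (Cod C g)" and uv: "g \<cdot> u = v \<cdot> i"
    have gA: "g \<in> Arr C" and iA: "i \<in> Arr C" using g i W X by auto
    have sq: "(i, u, v, g) \<in> Arr (arrow_cat C)" using gA iA u v uv by (simp add: arrow_cat_simps)
    obtain s m where s: "s \<in> S i" and m: "m \<in> Hom (arrow_cat C) (Cod (arrow_cat C) s) g"
      and eq: "(i, u, v, g) = Comp (arrow_cat C) m s"
      using S3[OF i sq, unfolded arrow_cat_simps, OF refl g] by blast
    obtain x u0 v0 w where sd: "s = (x, u0, v0, w)" by (cases s)
    obtain w' b1 b2 g' where md: "m = (w', b1, b2, g')" by (cases m)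
    have mm: "w' = w" "g' = g" "x = i" "u = b1 \<cdot> u0" "v = b2 \<cdot> v0"
      and mA: "(w, b1, b2, g) \<in> Arr (arrow_cat C)"
      using m eq unfolding sd md Hom_def arrow_cat_simps by (auto simp: arrow_cat_simps)
    have "s \<in> Arr (arrow_cat C)" using S(2)[OF i] s by blast
    then have sA: "u0 \<in> Hom C (Dom C i) (Dom C w)" "v0 \<in> Hom C (Cod C i) (Cod C w)" "w \<cdot> u0 = v0 \<cdot> i" "w \<in> Arr C"
      unfolding sd mm arrow_cat_simps by blast+
    have mA: "b1 \<in> Hom C (Dom C w) (Dom C g)" "b2 \<in> Hom C (Cod C w) (Cod C g)" "g \<cdot> b1 = b2 \<cdot> w"
      using mA unfolding arrow_cat_simps by blast+
    have sU: "s \<in> (\<Union>x\<in>X. S x)" using s i by blast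
    obtain j a b where td: "t s = (j, a, b)" by (cases "t s")
    have "j \<in> cof k C X \<inter> W \<and> Dom C j = Dom C w \<and> a \<in> Hom C (Cod C i) (Cod C j) \<and> j \<cdot> u0 = a \<cdot> i \<and>
      b \<in> Hom C (Cod C j) (Cod C w) \<and> b \<cdot> j = w \<and> b \<cdot> a = v0"
      using t[OF sU, unfolded td] unfolding sd prod.case mm(3) .
    then have j: "j \<in> cof k C X \<inter> W" "Dom C j = Dom C w" "a \<in> Hom C (Cod C i) (Cod C j)" "j \<cdot> u0 = a \<cdot> i"
      "b \<in> Hom C (Cod C j) (Cod C w)" "b \<cdot> j = w" "b \<cdot> a = v0" by blast+
    have jA: "j \<in> Arr C" using j(1) W by blast
    have jJ: "j \<in> cof k C J" using subset_cof[of J k C] imageI[OF sU, of "\<lambda>s. fst (t s)"] td unfolding J_def by auto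
    show "\<exists>j a1 a2 b1 b2. j \<in> cof k C J \<and> a1 \<in> Hom C (Dom C i) (Dom C j) \<and> a2 \<in> Hom C (Cod C i) (Cod C j) \<and>
        j \<cdot> a1 = a2 \<cdot> i \<and> b1 \<in> Hom C (Dom C j) (Dom C g) \<and> b2 \<in> Hom C (Cod C j) (Cod C g) \<and>
        g \<cdot> b1 = b2 \<cdot> j \<and> b1 \<cdot> a1 = u \<and> b2 \<cdot> a2 = v"
      by (rule exI[of _ j], rule exI[of _ u0], rule exI[of _ a], rule exI[of _ b1], rule exI[of _ "b2 \<cdot> b"])
        (use jJ j(2-7) jA sA mA mm in simp)
  next
    \<comment> \<open>The class \<open>cof k C J\<close> lies in \<open>W\<close>, so the
      cancellation hypothesis of the small object argument is an instance of 2-out-of-3.\<close>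
    fix g l assume g: "g \<in> Arr C" "l \<in> cof k C J" "Dom C g = Cod C l" "g \<cdot> l \<in> W"
    have "l \<in> W" "l \<in> Arr C" using g(2) cJ W by auto
    then show "g \<in> W" using g by (intro two_out_of_threeD(2)[OF W(2), of l g]) simp_all
  qed
  have "cof k C X \<inter> W \<subseteq> cof k C J"
  proof
    fix g assume g: "g \<in> cof k C X \<inter> W"
    then obtain f p where f: "f \<in> cof k C J" and p: "p \<in> rlp C X" and fp: "Cod C f = Dom C p" "g = p \<cdot> f"
      using fac by blast
    have "f \<in> Arr C" "p \<in> Arr C" using f p saturatedD(1)[OF saturated_cof'[OF JA]] by (auto simp: rlp_def)
    moreover have "lifts C g p" using g p cof_subset_llp_rlp[OF X(2)] by (auto simp: llp_def)
    ultimately have "retract_of (arrow_cat C) g f" using retract_argument[of f p] fp by simp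
    then show "g \<in> cof k C J"
      using f saturatedD(5)[OF saturated_cof'[OF JA]] unfolding retract_closed_def by blast
  qed
  then show ?thesis using sJ JA cJ by blast
qed

text \<open>For the harder inclusion factor \<open>g = p \<cdot> f\<close> through
  \<open>cof(X)\<close> and \<open>rlp(X)\<close>. By 2-out-of-3 \<open>f\<close> is a trivial
  cofibration, so \<open>g\<close> has the right lifting property against it and is a retract of
  \<open>p\<close>.\<close>

lemma trivial_fibrations_eq:
  assumes X: "small k X" "X \<subseteq> Arr C" and W: "W \<subseteq> Arr C" "two_out_of_three C W" and XW: "rlp C X \<subseteq> W"
  shows "rlp C (cof k C X \<inter> W) \<inter> W = rlp C X"
proof
  show "rlp C X \<subseteq> rlp C (cof k C X \<inter> W) \<inter> W"
    using XW rlp_cof[OF X(2)] rlp_antimono[of "cof k C X \<inter> W" "cof k C X" C] by blast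
  show "rlp C (cof k C X \<inter> W) \<inter> W \<subseteq> rlp C X"
  proof
    fix g assume g: "g \<in> rlp C (cof k C X \<inter> W) \<inter> W"
    then have gA: "g \<in> Arr C" using W by blast
    obtain f p where f: "f \<in> cof k C X" and p: "p \<in> rlp C X" and fp: "Cod C f = Dom C p" "g = p \<cdot> f"
      using factorization[OF X gA] by blast
    have fA: "f \<in> Arr C" and pA: "p \<in> Arr C"
      using f p saturatedD(1)[OF saturated_cof'[OF X(2)]] by (auto simp: rlp_def)
    have "f \<in> W" by (rule two_out_of_threeD(3)[OF W(2) fA pA fp(1)]) (use p XW g fp in auto)
    then have "lifts C f g" using g f by (auto simp: rlp_def)
    then have "retract_of (arrow_cat C) g p" using retract_argument_right[OF fA pA fp(1)] fp(2) by simp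
    then show "g \<in> rlp C X" by (rule rlp_retract[OF _ p X(2)])
  qed
qed

lemma smith_construction:
  assumes X: "small k X" "X \<subseteq> Arr C" and W: "W \<subseteq> Arr C" "two_out_of_three C W" "retract_closed C W"
    and XW: "rlp C X \<subseteq> W" and po: "pushout_closed C (cof k C X \<inter> W)"
    and tc: "transfinite_composition_closed k C (cof k C X \<inter> W)"
    and sol: "\<And>x. x \<in> X \<Longrightarrow> solution_set_condition_at k (arrow_cat C) W x"
  shows "make_combinatorial_model_category k C (cof k C X) W"
proof -
  obtain J where J: "small k J" "J \<subseteq> Arr C" "cof k C J = cof k C X \<inter> W"
    using trivial_cofibrations_generated[OF assms] by blast
  have Fb: "rlp C (cof k C X \<inter> W) = rlp C J" using rlp_cof[OF J(2)] J(3) by simp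
  have tf: "rlp C J \<inter> W = rlp C X" using trivial_fibrations_eq[OF X W(1,2) XW] Fb by simp
  have 1: "cofibrantly_generated k C (cof k C X) (rlp C J \<inter> W)"
    unfolding tf by (rule cofibrantly_generated_cof[OF X])
  have 2: "cofibrantly_generated k C (cof k C X \<inter> W) (rlp C J)"
    using cofibrantly_generated_cof[OF J(1,2)] J(3) by simp
  have "category C" "locally_small k C" using locally_presentable by (simp_all add: locally_presentable_def)
  then show ?thesis
    unfolding make_combinatorial_model_category_def combinatorial_model_category_def model_category_def Fb
    using 1 2 locally_presentable complete cocomplete W saturatedD(1)[OF saturated_cof'[OF X(2)]]
    by (auto simp: cofibrantly_generated_def rlp_def)
qed

section \<open>Functoriality of the small object argument\<close>

definition squares :: "'m set \<Rightarrow> 'm \<Rightarrow> ('m \<times> 'm \<times> 'm) set" where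
  "squares Y g = {(y, u, v). y \<in> Y \<and> u \<in> Hom C (Dom C y) (Dom C g) \<and>
     v \<in> Hom C (Cod C y) (Cod C g) \<and> g \<cdot> u = v \<cdot> y}"

abbreviation top_side :: "'m \<times> 'm \<times> 'm \<Rightarrow> 'm" where
  "top_side \<sigma> \<equiv> fst (snd \<sigma>)"

lemma small_squares: "small k Y \<Longrightarrow> small k (squares Y g)"
proof -
  assume Y: "small k Y"
  have "squares Y g \<subseteq> Sigma Y (\<lambda>y. Hom C (Dom C y) (Dom C g) \<times> Hom C (Cod C y) (Cod C g))"
    by (auto simp: squares_def)
  then show ?thesis by (rule small_subset) (intro small_Sigma Y small_Hom)
qed

text \<open>Attaching cells along all squares at once, without any choice, makes the construction functorial.\<close>

definition cell_chain ::
    "'m set \<Rightarrow> 'm \<Rightarrow> ('k \<Rightarrow> 'o) \<Rightarrow> ('k \<times> 'k \<Rightarrow> 'm) \<Rightarrow> ('k \<Rightarrow> 'm) \<Rightarrow> ('k \<Rightarrow> 'm \<times> 'm \<times> 'm \<Rightarrow> 'm) \<Rightarrow> bool"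
  where
  "cell_chain Y g Z f r e \<longleftrightarrow> (\<forall>l. smooth_chain C l Z f) \<and> Z zero = Dom C g \<and> r zero = g \<and>
     (\<forall>s. r s \<in> Hom C (Z s) (Cod C g)) \<and> (\<forall>i j. i \<le> j \<longrightarrow> r j \<cdot> f (i, j) = r i) \<and>
     (\<forall>s. attach (squares Y (r s)) fst top_side (Z s) (Z (succ s)) (f (s, succ s)) (e s)) \<and>
     (\<forall>s y u v. (y, u, v) \<in> squares Y (r s) \<longrightarrow> r (succ s) \<cdot> e s (y, u, v) = v)"

text \<open>A map of towers over the square \<open>(a, b)\<close>. The last clause, that each cell
  goes to the cell of the image square, is what determines the map at successor stages.\<close>

definition chain_map where
  "chain_map Y Z f r e Z' f' r' e' a b \<alpha> \<longleftrightarrow>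
     (\<forall>s. \<alpha> s \<in> Hom C (Z s) (Z' s)) \<and> \<alpha> zero = a \<and> (\<forall>s. r' s \<cdot> \<alpha> s = b \<cdot> r s) \<and>
     (\<forall>i j. i \<le> j \<longrightarrow> \<alpha> j \<cdot> f (i, j) = f' (i, j) \<cdot> \<alpha> i) \<and>
     (\<forall>s y u v. (y, u, v) \<in> squares Y (r s) \<longrightarrow>
        \<alpha> (succ s) \<cdot> e s (y, u, v) = e' s (y, \<alpha> s \<cdot> u, b \<cdot> v))"

lemma cell_chain_exists:
  assumes Y: "small k Y" "Y \<subseteq> Arr C" and g: "g \<in> Arr C"
  shows "\<exists>Z f r e. cell_chain Y g Z f r e"
proof -
  let ?Q = "\<lambda>r n m E. attach (squares Y r) fst top_side (Dom C r) (Cod C n) n E \<and>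
    m \<in> Hom C (Cod C n) (Cod C r) \<and> m \<cdot> n = r \<and> (\<forall>y u v. (y, u, v) \<in> squares Y r \<longrightarrow> m \<cdot> E (y, u, v) = v)"
  have ex: "\<exists>x. ?Q r (fst x) (fst (snd x)) (snd (snd x))" if r: "r \<in> Arr C" for r
  proof -
    have "\<exists>Z1 n E. attach (squares Y r) fst top_side (Dom C r) Z1 n E"
      by (rule attach_exists[OF small_squares[OF Y(1)] dom_in_Obj[OF r]])
        (use Y in \<open>auto simp: squares_def\<close>)
    then obtain Z1 n E where att: "attach (squares Y r) fst top_side (Dom C r) Z1 n E" by (elim exE)
    have Z1: "Cod C n = Z1" using attach_in(1)[OF att] by simp
    have "\<exists>m\<in>Hom C Z1 (Cod C r). m \<cdot> n = r \<and> (\<forall>\<sigma>\<in>squares Y r. m \<cdot> E \<sigma> = snd (snd \<sigma>))"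
      by (rule attach_ex[OF att]) (use r in \<open>auto simp: squares_def\<close>)
    then obtain m where m: "m \<in> Hom C Z1 (Cod C r)" "m \<cdot> n = r"
      "\<forall>\<sigma>\<in>squares Y r. m \<cdot> E \<sigma> = snd (snd \<sigma>)" by blast
    have "m \<cdot> E (y, u, v) = v" if "(y, u, v) \<in> squares Y r" for y u v
      using bspec[OF m(3) that] by simp
    then have "?Q r n m E" using att m(1,2) unfolding Z1 by blast
    then show ?thesis by (intro exI[of _ "(n, m, E)"]) (unfold fst_conv snd_conv)
  qed
  have "\<exists>w. \<forall>r\<in>Arr C. ?Q r (fst (w r)) (fst (snd (w r))) (snd (snd (w r)))"
    by (rule bchoice, rule ballI, rule ex)
  then obtain w where "\<forall>r\<in>Arr C. ?Q r (fst (w r)) (fst (snd (w r))) (snd (snd (w r)))" by (rule exE)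
  note w = bspec[OF this]
  define N where "N = (\<lambda>r. fst (w r))"
  define M where "M = (\<lambda>r. fst (snd (w r)))"
  define E where "E = (\<lambda>r. snd (snd (w r)))"
  have Q: "attach (squares Y r) fst top_side (Dom C r) (Cod C (N r)) (N r) (E r)"
    "M r \<in> Hom C (Cod C (N r)) (Cod C r)" "M r \<cdot> N r = r"
    "\<And>y u v. (y, u, v) \<in> squares Y r \<Longrightarrow> M r \<cdot> E r (y, u, v) = v" if "r \<in> Arr C" for r
    using w[OF that] unfolding N_def M_def E_def by blast+
  have "\<exists>Z f r. (\<forall>l :: 'k. smooth_chain C l Z f) \<and> Z zero = Dom C g \<and> r zero = g \<and>
    (\<forall>s. r s \<in> Hom C (Z s) (Cod C g)) \<and> (\<forall>i j. i \<le> j \<longrightarrow> r j \<cdot> f (i, j) = r i) \<and>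
    (\<forall>s. f (s, succ s) = N (r s) \<and> r (succ s) = M (r s))"
  proof (rule chain_exists[where N = "\<lambda>_ _. N" and M = "\<lambda>_ _. M"])
    fix s h r assume r: "r \<in> Arr C" "Cod C r = Cod C g"
    show "N r \<in> Arr C \<and> Dom C (N r) = Dom C r \<and> M r \<in> Hom C (Cod C (N r)) (Cod C g) \<and> M r \<cdot> N r = r"
      using attach_in(1)[OF Q(1)[OF r(1)]] Q(2,3)[OF r(1)] r by simp
  qed (use g in simp)
  then obtain Z f r where ch: "\<And>l. smooth_chain C l Z f" and z: "Z zero = Dom C g" "r zero = g"
    and r: "\<And>s. r s \<in> Hom C (Z s) (Cod C g)" "\<And>i j. i \<le> j \<Longrightarrow> r j \<cdot> f (i, j) = r i"
    and st: "\<And>s. f (s, succ s) = N (r s)" "\<And>s. r (succ s) = M (r s)"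
    by (elim exE conjE) metis
  have rA: "r s \<in> Arr C" "Dom C (r s) = Z s" for s using r(1)[of s] by simp_all
  have "Cod C (N (r s)) = Z (succ s)" for s
    using smooth_chainD(1)[OF ch[of "succ s"], of s "succ s"] st(1)[of s] by simp
  then have "attach (squares Y (r s)) fst top_side (Z s) (Z (succ s)) (f (s, succ s)) (E (r s))" for s
    using Q(1)[OF rA(1)[of s]] rA(2)[of s] st(1)[of s] by simp
  then have "cell_chain Y g Z f r (\<lambda>s. E (r s))"
    unfolding cell_chain_def using ch z r Q(4)[OF rA(1)] st(2) by simp
  then show ?thesis by blast
qed

lemma cell_chainD:
  assumes "cell_chain Y g Z f r e"
  shows "smooth_chain C l Z f" "Z zero = Dom C g" "r zero = g" "r s \<in> Hom C (Z s) (Cod C g)"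
    "i \<le> j \<Longrightarrow> r j \<cdot> f (i, j) = r i"
    "attach (squares Y (r s)) fst top_side (Z s) (Z (succ s)) (f (s, succ s)) (e s)"
    "(y, u, v) \<in> squares Y (r s) \<Longrightarrow> r (succ s) \<cdot> e s (y, u, v) = v"
    "i \<le> j \<Longrightarrow> f (i, j) \<in> Hom C (Z i) (Z j)" "f (i, i) = Ident C (Z i)"
    "i \<le> j \<Longrightarrow> j \<le> m \<Longrightarrow> f (j, m) \<cdot> f (i, j) = f (i, m)"
    "limit_ordinal j \<Longrightarrow> colimit (poset_cat (chain_ord j)) C Z f (Z j) (\<lambda>i. f (i, j))"
    "graph_diagram (poset_cat (chain_ord j)) C Z f"
    "Z s \<in> Obj C"
proof -
  have ch: "\<And>l. smooth_chain C l Z f" using assms by (simp add: cell_chain_def)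
  show "smooth_chain C l Z f" "Z zero = Dom C g" "r zero = g" "r s \<in> Hom C (Z s) (Cod C g)"
    "i \<le> j \<Longrightarrow> r j \<cdot> f (i, j) = r i"
    "attach (squares Y (r s)) fst top_side (Z s) (Z (succ s)) (f (s, succ s)) (e s)"
    "(y, u, v) \<in> squares Y (r s) \<Longrightarrow> r (succ s) \<cdot> e s (y, u, v) = v"
    using assms unfolding cell_chain_def by (simp_all del: Hom_iff)
  show "i \<le> j \<Longrightarrow> f (i, j) \<in> Hom C (Z i) (Z j)" by (rule smooth_chainD(1)[OF ch _ order_refl])
  show "f (i, i) = Ident C (Z i)" by (rule smooth_chainD(2)[OF ch order_refl])
  show "i \<le> j \<Longrightarrow> j \<le> m \<Longrightarrow> f (j, m) \<cdot> f (i, j) = f (i, m)"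
    by (rule smooth_chainD(4)[OF ch _ _ order_refl])
  show "limit_ordinal j \<Longrightarrow> colimit (poset_cat (chain_ord j)) C Z f (Z j) (\<lambda>i. f (i, j))"
    by (rule smooth_chainD(5)[OF ch order_refl])
  show "graph_diagram (poset_cat (chain_ord j)) C Z f"
    by (rule diagram_graph_poset[OF smooth_chain_diagram[OF ch order_refl]])
  show "Z s \<in> Obj C" by (rule smooth_chainD(3)[OF ch order_refl])
qed

lemma squaresD:
  assumes "(y, u, v) \<in> squares Y g"
  shows "y \<in> Y" "u \<in> Hom C (Dom C y) (Dom C g)" "v \<in> Hom C (Cod C y) (Cod C g)" "g \<cdot> u = v \<cdot> y"
  using assms by (simp_all add: squares_def)

lemma cell_chain_cell:
  assumes c: "cell_chain Y g Z f r e" and \<sigma>: "(y, u, v) \<in> squares Y (r s)"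
  shows "e s (y, u, v) \<in> Hom C (Cod C y) (Z (succ s))" "e s (y, u, v) \<cdot> y = f (s, succ s) \<cdot> u"
  using attach_in(2,3)[OF cell_chainD(6)[OF c] \<sigma>] by simp_all

lemma cell_chain_eqI:
  assumes c: "cell_chain Y g Z f r e" and Y: "Y \<subseteq> Arr C"
    and q: "q \<in> Hom C (Z (succ s)) T" "q' \<in> Hom C (Z (succ s)) T" "q \<cdot> f (s, succ s) = q' \<cdot> f (s, succ s)"
    and e: "\<And>y u v. (y, u, v) \<in> squares Y (r s) \<Longrightarrow> q \<cdot> e s (y, u, v) = q' \<cdot> e s (y, u, v)"
  shows "q = q'"
proof (rule attach_eqI[OF cell_chainD(6)[OF c] q(1,2) _ q(3)])
  fix \<sigma> assume \<sigma>: "\<sigma> \<in> squares Y (r s)"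
  obtain y u v where [simp]: "\<sigma> = (y, u, v)" by (cases \<sigma>)
  have "Dom C (r s) = Z s" using cell_chainD(4)[OF c, of s] by simp
  then show "fst \<sigma> \<in> Arr C \<and> top_side \<sigma> \<in> Hom C (Dom C (fst \<sigma>)) (Z s)"
    using squaresD(1,2)[of y u v Y "r s"] \<sigma> Y by auto
  show "q \<cdot> e s \<sigma> = q' \<cdot> e s \<sigma>" using e \<sigma> by simp
qed

lemma chain_mapD:
  assumes "chain_map Y Z f r e Z' f' r' e' a b \<alpha>"
  shows "\<alpha> s \<in> Hom C (Z s) (Z' s)" "\<alpha> zero = a" "r' s \<cdot> \<alpha> s = b \<cdot> r s"
    "i \<le> j \<Longrightarrow> \<alpha> j \<cdot> f (i, j) = f' (i, j) \<cdot> \<alpha> i"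
    "(y, u, v) \<in> squares Y (r s) \<Longrightarrow> \<alpha> (succ s) \<cdot> e s (y, u, v) = e' s (y, \<alpha> s \<cdot> u, b \<cdot> v)"
  using assms unfolding chain_map_def by blast+

lemma squares_map:
  assumes \<sigma>: "(y, u, v) \<in> squares Y g" and a: "a \<in> Hom C (Dom C g) (Dom C g')"
    and b: "b \<in> Hom C (Cod C g) (Cod C g')" and ab: "g' \<cdot> a = b \<cdot> g" and g: "g \<in> Arr C" "g' \<in> Arr C"
    and Y: "Y \<subseteq> Arr C"
  shows "(y, a \<cdot> u, b \<cdot> v) \<in> squares Y g'"
proof -
  note s = squaresD[OF \<sigma>]
  have y: "y \<in> Arr C" using s(1) Y by blast
  have "g' \<cdot> (a \<cdot> u) = b \<cdot> (g \<cdot> u)" by (rule comp_cong2[OF ab]) (use s a b g in simp_all)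
  also have "\<dots> = (b \<cdot> v) \<cdot> y" unfolding s(4) using s(3) b y by simp
  finally show ?thesis using s a b by (simp add: squares_def)
qed

lemma chain_map_squares:
  assumes c: "cell_chain Y g Z f r e" and c': "cell_chain Y g' Z' f' r' e'" and Y: "Y \<subseteq> Arr C"
    and b: "b \<in> Hom C (Cod C g) (Cod C g')"
    and x: "x \<in> Hom C (Z s) (Z' s)" "r' s \<cdot> x = b \<cdot> r s"
    and \<sigma>: "(y, u, v) \<in> squares Y (r s)"
  shows "(y, x \<cdot> u, b \<cdot> v) \<in> squares Y (r' s)"
  using squares_map[OF \<sigma>, of x "r' s" b] cell_chainD(4)[OF c, of s] cell_chainD(4)[OF c', of s] x b Y by simp

text \<open>Composition with the square takes squares into \<open>r s\<close> to squares into
  \<open>r' s\<close>, so at a successor each cell is sent to the cell of its image. Limits use the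
  colimit. Compatibility with the maps to the codomain is kept in the recursion, since it is needed
  to form the image squares.\<close>

lemma chain_map_exists:
  assumes c: "cell_chain Y g Z f r e" and c': "cell_chain Y g' Z' f' r' e'" and Y: "Y \<subseteq> Arr C"
    and a: "a \<in> Hom C (Dom C g) (Dom C g')" and b: "b \<in> Hom C (Cod C g) (Cod C g')" and ab: "g' \<cdot> a = b \<cdot> g"
  shows "\<exists>\<alpha>. chain_map Y Z f r e Z' f' r' e' a b \<alpha>"
proof -
  note fin = cell_chainD(8)[OF c] and fin' = cell_chainD(8)[OF c']
  note fc = cell_chainD(10)[OF c] and fc' = cell_chainD(10)[OF c']
  note rin = cell_chainD(4)[OF c] and rin' = cell_chainD(4)[OF c']
  note rc = cell_chainD(5)[OF c] and rc' = cell_chainD(5)[OF c']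
  note sq = chain_map_squares[OF c c' Y b]
  let ?P = "\<lambda>\<phi> s x. x \<in> Hom C (Z s) (Z' s) \<and> r' s \<cdot> x = b \<cdot> r s \<and> (s = zero \<longrightarrow> x = a) \<and>
    (\<forall>i<s. x \<cdot> f (i, s) = f' (i, s) \<cdot> \<phi> i) \<and>
    (\<forall>p. s = succ p \<longrightarrow> (\<forall>y u v. (y, u, v) \<in> squares Y (r p) \<longrightarrow> x \<cdot> e p (y, u, v) = e' p (y, \<phi> p \<cdot> u, b \<cdot> v)))"
  have "\<exists>\<phi>. \<forall>s. ?P \<phi> s (\<phi> s)"
  proof (rule transfinite_choice)
    fix \<phi> \<psi> :: "'k \<Rightarrow> 'm" and s x assume eq: "\<And>z. z < s \<Longrightarrow> \<phi> z = \<psi> z"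
    have "(\<forall>p. s = succ p \<longrightarrow> Q p (\<phi> p)) = (\<forall>p. s = succ p \<longrightarrow> Q p (\<psi> p))" for Q
      using eq by auto
    then show "?P \<phi> s x = ?P \<psi> s x" using eq by simp
  next
    fix s \<phi> assume IH: "\<And>t. t < s \<Longrightarrow> ?P \<phi> t (\<phi> t)"
    have \<phi>: "\<phi> t \<in> Hom C (Z t) (Z' t)" "r' t \<cdot> \<phi> t = b \<cdot> r t" if "t < s" for t
      using IH[OF that] by blast+
    have nat: "\<phi> t \<cdot> f (i, t) = f' (i, t) \<cdot> \<phi> i" if "i \<le> t" "t < s" for i t
    proof (cases "i = t")
      case True
      then show ?thesis using \<phi>(1)[OF that(2)] cell_chainD(9)[OF c] cell_chainD(9)[OF c'] by simp
    next
      case False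
      then show ?thesis using IH[OF that(2)] that(1) by (simp add: less_le)
    qed
    show "\<exists>x. ?P \<phi> s x"
    proof (cases s rule: ordinal_cases)
      case zero
      have "a \<in> Hom C (Z zero) (Z' zero)" "r' zero \<cdot> a = b \<cdot> r zero"
        using a ab unfolding cell_chainD(2,3)[OF c] cell_chainD(2,3)[OF c'] by blast+
      then show ?thesis unfolding zero
        by (intro exI[of _ a] conjI allI impI) (assumption | rule refl | erule notE[OF not_less_zero]
          | erule notE[OF zero_neq_succ])+
    next
      case (succ p)
      have p: "p < s" using succ by simp
      note fp = fin[OF le_succ[of p]] fin'[OF le_succ[of p]]
      let ?t = "f' (p, succ p) \<cdot> \<phi> p"
      let ?\<epsilon> = "\<lambda>\<sigma>. e' p (fst \<sigma>, \<phi> p \<cdot> top_side \<sigma>, b \<cdot> snd (snd \<sigma>))"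
      have \<epsilon>: "e' p (y, \<phi> p \<cdot> u, b \<cdot> v) \<in> Hom C (Cod C y) (Z' (succ p))"
        "e' p (y, \<phi> p \<cdot> u, b \<cdot> v) \<cdot> y = ?t \<cdot> u" "r' (succ p) \<cdot> e' p (y, \<phi> p \<cdot> u, b \<cdot> v) = b \<cdot> v"
        if "(y, u, v) \<in> squares Y (r p)" for y u v
        using cell_chain_cell[OF c' sq[OF \<phi>[OF p] that]] cell_chainD(7)[OF c' sq[OF \<phi>[OF p] that]]
          squaresD(2)[OF that] \<phi>(1)[OF p] fp rin[of p] by simp_all
      have "\<exists>x\<in>Hom C (Z (succ p)) (Z' (succ p)). x \<cdot> f (p, succ p) = ?t \<and>
          (\<forall>\<sigma>\<in>squares Y (r p). x \<cdot> e p \<sigma> = ?\<epsilon> \<sigma>)"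
      proof (rule attach_ex[OF cell_chainD(6)[OF c]])
        show "?t \<in> Hom C (Z p) (Z' (succ p))" using \<phi>(1)[OF p] fp by simp
        show "?\<epsilon> \<sigma> \<in> Hom C (Cod C (fst \<sigma>)) (Z' (succ p)) \<and> ?\<epsilon> \<sigma> \<cdot> fst \<sigma> = ?t \<cdot> top_side \<sigma>"
          if "\<sigma> \<in> squares Y (r p)" for \<sigma>
          using \<epsilon>(1,2)[of "fst \<sigma>" "top_side \<sigma>" "snd (snd \<sigma>)"] that by simp
      qed
      then obtain x where x: "x \<in> Hom C (Z (succ p)) (Z' (succ p))" "x \<cdot> f (p, succ p) = ?t"
        and xe: "\<forall>\<sigma>\<in>squares Y (r p). x \<cdot> e p \<sigma> = ?\<epsilon> \<sigma>" by blast
      have xe: "x \<cdot> e p (y, u, v) = e' p (y, \<phi> p \<cdot> u, b \<cdot> v)" if "(y, u, v) \<in> squares Y (r p)" for y u v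
        using bspec[OF xe that] by simp
      have "r' (succ p) \<cdot> x = b \<cdot> r (succ p)"
      proof (rule cell_chain_eqI[OF c Y, of _ _ "Cod C g'"])
        show "r' (succ p) \<cdot> x \<in> Hom C (Z (succ p)) (Cod C g')" "b \<cdot> r (succ p) \<in> Hom C (Z (succ p)) (Cod C g')"
          using x rin[of "succ p"] rin'[of "succ p"] b by simp_all
        have "(r' (succ p) \<cdot> x) \<cdot> f (p, succ p) = r' (succ p) \<cdot> (f' (p, succ p) \<cdot> \<phi> p)"
          using x rin'[of "succ p"] fp by simp
        also have "\<dots> = r' p \<cdot> \<phi> p"
          by (rule comp_reduce[OF rc'[OF le_succ]]) (use \<phi>(1)[OF p] rin'[of "succ p"] fp in simp_all)
        also have "\<dots> = (b \<cdot> r (succ p)) \<cdot> f (p, succ p)"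
          using \<phi>(2)[OF p] rc[OF le_succ[of p]] rin[of "succ p"] fp b by simp
        finally show "(r' (succ p) \<cdot> x) \<cdot> f (p, succ p) = (b \<cdot> r (succ p)) \<cdot> f (p, succ p)" .
        show "(r' (succ p) \<cdot> x) \<cdot> e p (y, u, v) = (b \<cdot> r (succ p)) \<cdot> e p (y, u, v)"
          if \<sigma>: "(y, u, v) \<in> squares Y (r p)" for y u v
          using xe[OF \<sigma>] \<epsilon>(3)[OF \<sigma>] cell_chainD(7)[OF c \<sigma>] cell_chain_cell(1)[OF c \<sigma>] x
            rin[of "succ p"] rin'[of "succ p"] b by simp
      qed
      moreover have "x \<cdot> f (i, succ p) = f' (i, succ p) \<cdot> \<phi> i" if i: "i < succ p" for i
      proof -
        have ip: "i \<le> p" using i by simp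
        note H = fin[OF ip] fin'[OF ip] fp \<phi>(1)[OF p] \<phi>(1)[OF le_less_trans[OF ip p]] x(1)
        have "x \<cdot> f (i, succ p) = x \<cdot> (f (p, succ p) \<cdot> f (i, p))" using fc[OF ip le_succ[of p]] by simp
        also have "\<dots> = ?t \<cdot> f (i, p)" by (rule comp_reduce[OF x(2)]) (use H in simp_all)
        also have "\<dots> = f' (p, succ p) \<cdot> (f' (i, p) \<cdot> \<phi> i)" using nat[OF ip p] H by simp
        also have "\<dots> = f' (i, succ p) \<cdot> \<phi> i"
          by (rule comp_reduce[OF fc'[OF ip le_succ[of p]]]) (use H in simp_all)
        finally show ?thesis .
      qed
      moreover have "x \<cdot> e q (y, u, v) = e' q (y, \<phi> q \<cdot> u, b \<cdot> v)"
        if "succ p = succ q" "(y, u, v) \<in> squares Y (r q)" for q y u v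
      proof -
        have "q = p" using that(1) by simp
        then show ?thesis using xe[of y u v] that(2) by (simp only:)
      qed
      ultimately show ?thesis unfolding succ
        by (intro exI[of _ x] conjI allI impI x(1)) (assumption | erule notE[OF succ_neq_zero] | blast)+
    next
      case limit
      note col = cell_chainD(11)[OF c limit]
      have "\<exists>x\<in>Hom C (Z s) (Z' s). \<forall>i\<in>Obj (poset_cat (chain_ord s)). x \<cdot> f (i, s) = f' (i, s) \<cdot> \<phi> i"
      proof (rule colimit_ex[OF col cell_chainD(13)[OF c']])
        show "f' (i, s) \<cdot> \<phi> i \<in> Hom C (Z i) (Z' s)" if "i \<in> Obj (poset_cat (chain_ord s))" for i
          using that \<phi>(1)[of i] fin'[of i s] less_imp_le[of i s] by simp
        fix m assume "m \<in> Arr (poset_cat (chain_ord s))"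
        then obtain i j where m: "m = (i, j)" "i \<le> j" "j < s" by (cases m) (auto simp: chain_ord_iff)
        have js: "j \<le> s" "i < s" using m by auto
        have "(f' (j, s) \<cdot> \<phi> j) \<cdot> f (i, j) = f' (j, s) \<cdot> (f' (i, j) \<cdot> \<phi> i)"
          using nat[OF m(2,3)] \<phi>(1)[OF m(3)] fin'[OF js(1)] fin[OF m(2)] by simp
        also have "\<dots> = f' (i, s) \<cdot> \<phi> i"
          by (rule comp_reduce[OF fc'[OF m(2) js(1)]]) (use \<phi>(1)[OF js(2)] fin'[OF js(1)] fin'[OF m(2)] in simp_all)
        finally show "(f' (Cod (poset_cat (chain_ord s)) m, s) \<cdot> \<phi> (Cod (poset_cat (chain_ord s)) m)) \<cdot> f m =
            f' (Dom (poset_cat (chain_ord s)) m, s) \<cdot> \<phi> (Dom (poset_cat (chain_ord s)) m)"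
          unfolding m(1) by simp
      qed
      then obtain x where x: "x \<in> Hom C (Z s) (Z' s)" "\<And>i. i < s \<Longrightarrow> x \<cdot> f (i, s) = f' (i, s) \<cdot> \<phi> i" by auto
      have "r' s \<cdot> x = b \<cdot> r s"
      proof (rule colimit_eqI[OF cell_chainD(12)[OF c] col, of _ "Cod C g'"])
        fix i assume "i \<in> Obj (poset_cat (chain_ord s))"
        then have i: "i < s" "i \<le> s" by auto
        have "(r' s \<cdot> x) \<cdot> f (i, s) = r' s \<cdot> (f' (i, s) \<cdot> \<phi> i)"
          using x(1) x(2)[OF i(1)] rin'[of s] fin[OF i(2)] by simp
        also have "\<dots> = r' i \<cdot> \<phi> i"
          by (rule comp_reduce[OF rc'[OF i(2)]]) (use \<phi>(1)[OF i(1)] rin'[of s] fin'[OF i(2)] in simp_all)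
        also have "\<dots> = (b \<cdot> r s) \<cdot> f (i, s)"
          using \<phi>(2)[OF i(1)] rc[OF i(2)] rin[of s] fin[OF i(2)] b by simp
        finally show "(r' s \<cdot> x) \<cdot> f (i, s) = (b \<cdot> r s) \<cdot> f (i, s)" .
      qed (use x(1) rin[of s] rin'[of s] b in simp_all)
      moreover have "s \<noteq> zero" "\<And>p. s \<noteq> succ p" using limit limit_not_zero limit_not_succ by auto
      ultimately show ?thesis
        by (intro exI[of _ x] conjI allI impI x) (assumption | blast)+
    qed
  qed
  then obtain \<phi> where "\<forall>s. ?P \<phi> s (\<phi> s)" by (rule exE)
  note P = this[THEN spec]
  have "\<phi> j \<cdot> f (i, j) = f' (i, j) \<cdot> \<phi> i" if "i \<le> j" for i j
  proof (cases "i = j")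
    case True
    have "\<phi> j \<in> Hom C (Z j) (Z' j)" using P[of j] by blast
    then show ?thesis using True cell_chainD(9)[OF c] cell_chainD(9)[OF c'] by simp
  next
    case False
    then show ?thesis using P[of j] that by (simp add: less_le)
  qed
  moreover have "\<phi> zero = a" using P[of zero] by simp
  moreover have "\<phi> (succ s) \<cdot> e s (y, u, v) = e' s (y, \<phi> s \<cdot> u, b \<cdot> v)" if "(y, u, v) \<in> squares Y (r s)" for s y u v
    using P[of "succ s"] that by simp
  ultimately have "chain_map Y Z f r e Z' f' r' e' a b \<phi>"
    unfolding chain_map_def
    by (intro conjI allI impI conjunct1[OF P] conjunct1[OF conjunct2[OF P]])
  then show ?thesis by blast
qed

text \<open>Together with the next two lemmas this makes the construction functorial: composites and
  identities are maps of towers over the right squares, so they coincide with the chosen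
  ones.\<close>

lemma chain_map_unique:
  assumes c: "cell_chain Y g Z f r e" and Y: "Y \<subseteq> Arr C"
    and m: "chain_map Y Z f r e Z' f' r' e' a b \<alpha>" and m': "chain_map Y Z f r e Z' f' r' e' a b \<beta>"
  shows "\<alpha> s = \<beta> s"
proof (induction s rule: succ_less_induct)
  case zero
  then show ?case using chain_mapD(2)[OF m] chain_mapD(2)[OF m'] by simp
next
  case (succ s)
  show ?case
  proof (rule cell_chain_eqI[OF c Y chain_mapD(1)[OF m] chain_mapD(1)[OF m']])
    show "\<alpha> (succ s) \<cdot> f (s, succ s) = \<beta> (succ s) \<cdot> f (s, succ s)"
      using chain_mapD(4)[OF m le_succ[of s]] chain_mapD(4)[OF m' le_succ[of s]] succ by simp
    show "\<alpha> (succ s) \<cdot> e s (y, u, v) = \<beta> (succ s) \<cdot> e s (y, u, v)" if "(y, u, v) \<in> squares Y (r s)" for y u v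
      using chain_mapD(5)[OF m that] chain_mapD(5)[OF m' that] succ by simp
  qed
next
  case (limit s)
  show ?case
  proof (rule colimit_eqI[OF cell_chainD(12)[OF c] cell_chainD(11)[OF c limit(1)] chain_mapD(1)[OF m] chain_mapD(1)[OF m']])
    fix i assume "i \<in> Obj (poset_cat (chain_ord s))"
    then have "i < s" "i \<le> s" by auto
    then show "\<alpha> s \<cdot> f (i, s) = \<beta> s \<cdot> f (i, s)"
      using chain_mapD(4)[OF m, of i s] chain_mapD(4)[OF m', of i s] limit(2)[of i] by simp
  qed
qed

lemma chain_map_comp:
  assumes c: "cell_chain Y g Z f r e" and c': "cell_chain Y g' Z' f' r' e'" and c'': "cell_chain Y g'' Z'' f'' r'' e''"
    and Y: "Y \<subseteq> Arr C" and b: "b \<in> Hom C (Cod C g) (Cod C g')" and b': "b' \<in> Hom C (Cod C g') (Cod C g'')"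
    and m: "chain_map Y Z f r e Z' f' r' e' a b \<alpha>" and m': "chain_map Y Z' f' r' e' Z'' f'' r'' e'' a' b' \<beta>"
  shows "chain_map Y Z f r e Z'' f'' r'' e'' (a' \<cdot> a) (b' \<cdot> b) (\<lambda>s. \<beta> s \<cdot> \<alpha> s)"
  unfolding chain_map_def
proof (intro conjI allI impI)
  note A = chain_mapD(1)[OF m] chain_mapD(1)[OF m']
  note R = cell_chainD(4)[OF c] cell_chainD(4)[OF c'] cell_chainD(4)[OF c'']
  show "\<beta> s \<cdot> \<alpha> s \<in> Hom C (Z s) (Z'' s)" for s using A(1)[of s] A(2)[of s] by simp
  show "\<beta> zero \<cdot> \<alpha> zero = a' \<cdot> a" using chain_mapD(2)[OF m] chain_mapD(2)[OF m'] by simp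
  show "r'' s \<cdot> (\<beta> s \<cdot> \<alpha> s) = (b' \<cdot> b) \<cdot> r s" for s
  proof -
    have "r'' s \<cdot> (\<beta> s \<cdot> \<alpha> s) = b' \<cdot> (r' s \<cdot> \<alpha> s)"
      by (rule comp_cong2[OF chain_mapD(3)[OF m']]) (use A(1)[of s] A(2)[of s] R(2,3)[of s] b' in simp_all)
    then show ?thesis using chain_mapD(3)[OF m, of s] R(1)[of s] b b' by simp
  qed
  show "(\<beta> j \<cdot> \<alpha> j) \<cdot> f (i, j) = f'' (i, j) \<cdot> (\<beta> i \<cdot> \<alpha> i)" if ij: "i \<le> j" for i j
  proof -
    note H = A(1)[of i] A(2)[of i] A(1)[of j] A(2)[of j] cell_chainD(8)[OF c ij] cell_chainD(8)[OF c' ij] cell_chainD(8)[OF c'' ij]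
    have "(\<beta> j \<cdot> \<alpha> j) \<cdot> f (i, j) = \<beta> j \<cdot> (f' (i, j) \<cdot> \<alpha> i)" using chain_mapD(4)[OF m ij] H by simp
    also have "\<dots> = f'' (i, j) \<cdot> (\<beta> i \<cdot> \<alpha> i)"
      by (rule comp_cong2[OF chain_mapD(4)[OF m' ij]]) (use H in simp_all)
    finally show ?thesis .
  qed
  show "(\<beta> (succ s) \<cdot> \<alpha> (succ s)) \<cdot> e s (y, u, v) = e'' s (y, (\<beta> s \<cdot> \<alpha> s) \<cdot> u, (b' \<cdot> b) \<cdot> v)"
    if \<sigma>: "(y, u, v) \<in> squares Y (r s)" for s y u v
  proof -
    note \<sigma>' = chain_map_squares[OF c c' Y b A(1) chain_mapD(3)[OF m] \<sigma>]
    have "(\<beta> (succ s) \<cdot> \<alpha> (succ s)) \<cdot> e s (y, u, v) = \<beta> (succ s) \<cdot> e' s (y, \<alpha> s \<cdot> u, b \<cdot> v)"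
      using chain_mapD(5)[OF m \<sigma>] A(1)[of "succ s"] A(2)[of "succ s"] cell_chain_cell(1)[OF c \<sigma>] by simp
    also have "\<dots> = e'' s (y, \<beta> s \<cdot> (\<alpha> s \<cdot> u), b' \<cdot> (b \<cdot> v))" by (rule chain_mapD(5)[OF m' \<sigma>'])
    finally show ?thesis using squaresD(2,3)[OF \<sigma>] A(1)[of s] A(2)[of s] R(1)[of s] b b' by simp
  qed
qed

lemma chain_map_id:
  assumes c: "cell_chain Y g Z f r e" and g: "g \<in> Arr C"
  shows "chain_map Y Z f r e Z f r e (Ident C (Dom C g)) (Ident C (Cod C g)) (\<lambda>s. Ident C (Z s))"
  unfolding chain_map_def
proof (intro conjI allI impI)
  note Z = cell_chainD(13)[OF c]
  show "Ident C (Z s) \<in> Hom C (Z s) (Z s)" for s using Z[of s] by simp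
  show "Ident C (Z zero) = Ident C (Dom C g)" using cell_chainD(2)[OF c] by simp
  show "r s \<cdot> Ident C (Z s) = Ident C (Cod C g) \<cdot> r s" for s using cell_chainD(4)[OF c, of s] by simp
  show "Ident C (Z j) \<cdot> f (i, j) = f (i, j) \<cdot> Ident C (Z i)" if "i \<le> j" for i j
    using cell_chainD(8)[OF c that] by simp
  show "Ident C (Z (succ s)) \<cdot> e s (y, u, v) = e s (y, Ident C (Z s) \<cdot> u, Ident C (Cod C g) \<cdot> v)"
    if \<sigma>: "(y, u, v) \<in> squares Y (r s)" for s y u v
    using cell_chain_cell(1)[OF c \<sigma>] squaresD(2,3)[OF \<sigma>] cell_chainD(4)[OF c, of s] by simp
qed

end

text \<open>The setting is a \<open>t\<close>-directed diagram of arrows \<open>wi\<close> with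
  colimit \<open>w\<close>: \<open>Ca\<close>, \<open>Da\<close> are the transition maps and
  \<open>pc\<close>, \<open>pd\<close> the colimit legs, on domains and codomains. Over each arrow
  stands a tower, and \<open>\<alpha>\<close>, \<open>\<beta>\<close> are maps of towers. No
  functoriality of \<open>\<alpha>\<close> and \<open>\<beta>\<close> is assumed; it is derived from
  uniqueness.\<close>

locale directed_cell_chains = locally_presentable_category C k
  for C :: "('o, 'm) cat" (structure) and k :: "'k::wellorder itself" +
  fixes Y :: "'m set" and t :: 'k and ro :: "'k rel"
    and wi :: "'k \<Rightarrow> 'm" and Ca Da :: "'k \<times> 'k \<Rightarrow> 'm" and w :: 'm and pc pd :: "'k \<Rightarrow> 'm"
    and Z :: "'k \<Rightarrow> 'k \<Rightarrow> 'o" and f :: "'k \<Rightarrow> 'k \<times> 'k \<Rightarrow> 'm" and r :: "'k \<Rightarrow> 'k \<Rightarrow> 'm"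
    and e :: "'k \<Rightarrow> 'k \<Rightarrow> 'm \<times> 'm \<times> 'm \<Rightarrow> 'm"
    and Zw :: "'k \<Rightarrow> 'o" and fw :: "'k \<times> 'k \<Rightarrow> 'm" and rw :: "'k \<Rightarrow> 'm"
    and ew :: "'k \<Rightarrow> 'm \<times> 'm \<times> 'm \<Rightarrow> 'm"
    and \<alpha> :: "'k \<times> 'k \<Rightarrow> 'k \<Rightarrow> 'm" and \<beta> :: "'k \<Rightarrow> 'k \<Rightarrow> 'm"
  assumes dir: "directed (chain_ord t) ro" and inf: "Cinfinite (chain_ord t)"
    and Y: "Y \<subseteq> Arr C"
    and cpt: "\<And>y. y \<in> Y \<Longrightarrow> compact_at (chain_ord t) (Dom C y) \<and> compact_at (chain_ord t) (Cod C y)"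
    and wiA: "\<And>i. i \<in> Field ro \<Longrightarrow> wi i \<in> Arr C" and wA: "w \<in> Arr C"
    and diaC: "diagram (poset_cat ro) C (\<lambda>i. Dom C (wi i)) Ca"
    and diaD: "diagram (poset_cat ro) C (\<lambda>i. Cod C (wi i)) Da"
    and colC: "colimit (poset_cat ro) C (\<lambda>i. Dom C (wi i)) Ca (Dom C w) pc"
    and colD: "colimit (poset_cat ro) C (\<lambda>i. Cod C (wi i)) Da (Cod C w) pd"
    and cc: "\<And>i. i \<in> Field ro \<Longrightarrow> cell_chain Y (wi i) (Z i) (f i) (r i) (e i)"
    and cw: "cell_chain Y w Zw fw rw ew"
    and am: "\<And>i j. (i, j) \<in> ro \<Longrightarrow> chain_map Y (Z i) (f i) (r i) (e i) (Z j) (f j) (r j) (e j)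
      (Ca (i, j)) (Da (i, j)) (\<alpha> (i, j))"
    and bm: "\<And>i. i \<in> Field ro \<Longrightarrow> chain_map Y (Z i) (f i) (r i) (e i) Zw fw rw ew (pc i) (pd i) (\<beta> i)"
begin

lemmas ord = directed_order[OF dir]

lemma Da_in: "(i, j) \<in> ro \<Longrightarrow> Da (i, j) \<in> Hom C (Cod C (wi i)) (Cod C (wi j))"
  and Ca_in: "(i, j) \<in> ro \<Longrightarrow> Ca (i, j) \<in> Hom C (Dom C (wi i)) (Dom C (wi j))"
  using diaD diaC unfolding diagram_poset_iff by blast+

lemma pd_in: "i \<in> Field ro \<Longrightarrow> pd i \<in> Hom C (Cod C (wi i)) (Cod C w)"
  using colimit_in[OF colD, of i] by simp

lemma pd_comm: "(i, j) \<in> ro \<Longrightarrow> pd j \<cdot> Da (i, j) = pd i"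
  and pc_comm: "(i, j) \<in> ro \<Longrightarrow> pc j \<cdot> Ca (i, j) = pc i"
  using colimit_comm[OF colD, of "(i, j)"] colimit_comm[OF colC, of "(i, j)"] by simp_all

lemma Da_comp: "(i, j) \<in> ro \<Longrightarrow> (j, m) \<in> ro \<Longrightarrow> Da (i, m) = Da (j, m) \<cdot> Da (i, j)"
  and Ca_comp: "(i, j) \<in> ro \<Longrightarrow> (j, m) \<in> ro \<Longrightarrow> Ca (i, m) = Ca (j, m) \<cdot> Ca (i, j)"
  using diaD diaC unfolding diagram_poset_iff by blast+

lemma al_in: "(i, j) \<in> ro \<Longrightarrow> \<alpha> (i, j) s \<in> Hom C (Z i s) (Z j s)"
  and be_in: "i \<in> Field ro \<Longrightarrow> \<beta> i s \<in> Hom C (Z i s) (Zw s)"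
  using chain_mapD(1)[OF am] chain_mapD(1)[OF bm] by blast+

lemma al_comp:
  assumes ij: "(i, j) \<in> ro" and jm: "(j, m) \<in> ro"
  shows "\<alpha> (i, m) s = \<alpha> (j, m) s \<cdot> \<alpha> (i, j) s"
proof -
  have F: "i \<in> Field ro" "j \<in> Field ro" "m \<in> Field ro" using ij jm by (auto simp: Field_def)
  have "chain_map Y (Z i) (f i) (r i) (e i) (Z m) (f m) (r m) (e m) (Ca (i, m)) (Da (i, m))
      (\<lambda>s. \<alpha> (j, m) s \<cdot> \<alpha> (i, j) s)"
    unfolding Ca_comp[OF ij jm] Da_comp[OF ij jm]
    by (rule chain_map_comp[OF cc[OF F(1)] cc[OF F(2)] cc[OF F(3)] Y Da_in[OF ij] Da_in[OF jm] am[OF ij] am[OF jm]])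
  from chain_map_unique[OF cc[OF F(1)] Y am[OF ord(3)[OF ij jm]] this] show ?thesis .
qed

lemma be_comp:
  assumes ij: "(i, j) \<in> ro"
  shows "\<beta> j s \<cdot> \<alpha> (i, j) s = \<beta> i s"
proof -
  have F: "i \<in> Field ro" "j \<in> Field ro" using ij by (auto simp: Field_def)
  have "chain_map Y (Z i) (f i) (r i) (e i) Zw fw rw ew (pc j \<cdot> Ca (i, j)) (pd j \<cdot> Da (i, j))
      (\<lambda>s. \<beta> j s \<cdot> \<alpha> (i, j) s)"
    by (rule chain_map_comp[OF cc[OF F(1)] cc[OF F(2)] cw Y Da_in[OF ij] pd_in[OF F(2)] am[OF ij] bm[OF F(2)]])
  then have "chain_map Y (Z i) (f i) (r i) (e i) Zw fw rw ew (pc i) (pd i) (\<lambda>s. \<beta> j s \<cdot> \<alpha> (i, j) s)"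
    using pc_comm[OF ij] pd_comm[OF ij] by simp
  from chain_map_unique[OF cc[OF F(1)] Y this bm[OF F(1)]] show ?thesis .
qed

lemma al_id:
  assumes i: "i \<in> Field ro"
  shows "\<alpha> (i, i) s = Ident C (Z i s)"
proof -
  have "Ca (i, i) = Ident C (Dom C (wi i))" "Da (i, i) = Ident C (Cod C (wi i))"
    using diaC diaD i unfolding diagram_poset_iff by blast+
  then have "chain_map Y (Z i) (f i) (r i) (e i) (Z i) (f i) (r i) (e i) (Ca (i, i)) (Da (i, i))
      (\<lambda>s. Ident C (Z i s))"
    using chain_map_id[OF cc[OF i] wiA[OF i]] by simp
  from chain_map_unique[OF cc[OF i] Y am[OF ord(2)[OF i]] this] show ?thesis .
qed

lemma stage_diagram: "diagram (poset_cat ro) C (\<lambda>i. Z i s) (\<lambda>m. \<alpha> m s)"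
  unfolding diagram_poset_iff
proof (intro conjI ballI allI impI)
  show "Z i s \<in> Obj C" if "i \<in> Field ro" for i by (rule cell_chainD(13)[OF cc[OF that]])
qed (rule al_id al_in al_comp; assumption)+

text \<open>Compactness of both ends of \<open>y\<close> brings \<open>u\<close> and
  \<open>v\<close> to a common stage \<open>j\<close>. There the square commutes only after
  composition with \<open>pd j\<close>; the injectivity half of compactness makes it commute at a
  later stage.\<close>

lemma square_from_stage:
  assumes col: "colimit (poset_cat ro) C (\<lambda>i. Z i s) (\<lambda>m. \<alpha> m s) (Zw s) (\<lambda>i. \<beta> i s)"
    and \<sigma>: "(y, u, v) \<in> squares Y (rw s)"
  shows "\<exists>i\<in>Field ro. \<exists>u' v'. (y, u', v') \<in> squares Y (r i s) \<and> \<beta> i s \<cdot> u' = u \<and> pd i \<cdot> v' = v"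
proof -
  note y = squaresD(1)[OF \<sigma>]
  have yA: "y \<in> Arr C" using y Y by blast
  have cD: "compact_at (chain_ord t) (Dom C y)" and cC: "compact_at (chain_ord t) (Cod C y)" using cpt[OF y] by blast+
  have rwd: "Dom C (rw s) = Zw s" "Cod C (rw s) = Cod C w" using cell_chainD(4)[OF cw, of s] by simp_all
  have u: "u \<in> Hom C (Dom C y) (Zw s)" and v: "v \<in> Hom C (Cod C y) (Cod C w)" and uv: "rw s \<cdot> u = v \<cdot> y"
    using squaresD[OF \<sigma>] rwd by simp_all
  obtain i1 u1 where i1: "i1 \<in> Field ro" "u1 \<in> Hom C (Dom C y) (Z i1 s)" "\<beta> i1 s \<cdot> u1 = u"
    using compactD(1)[OF cD dir stage_diagram col u] by blast
  obtain i2 v2 where i2: "i2 \<in> Field ro" "v2 \<in> Hom C (Cod C y) (Cod C (wi i2))" "pd i2 \<cdot> v2 = v"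
    using compactD(1)[OF cC dir diaD colD v] by blast
  obtain j where j: "j \<in> Field ro" "(i1, j) \<in> ro" "(i2, j) \<in> ro" by (rule directed_ub[OF dir inf i1(1) i2(1)])
  define uj where "uj = \<alpha> (i1, j) s \<cdot> u1"
  define vj where "vj = Da (i2, j) \<cdot> v2"
  have uj: "uj \<in> Hom C (Dom C y) (Z j s)" "\<beta> j s \<cdot> uj = u"
    using i1(2,3) al_in[OF j(2)] comp_reduce[OF be_comp[OF j(2)], of s u1] be_in[OF j(1), of s] by (simp_all add: uj_def)
  have vj: "vj \<in> Hom C (Cod C y) (Cod C (wi j))" "pd j \<cdot> vj = v"
    using i2(2,3) Da_in[OF j(3)] comp_reduce[OF pd_comm[OF j(3)], of v2] pd_in[OF j(1)] by (simp_all add: vj_def)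
  note rj = cell_chainD(4)[OF cc[OF j(1)], of s]
  have "pd j \<cdot> (r j s \<cdot> uj) = rw s \<cdot> (\<beta> j s \<cdot> uj)"
    by (rule comp_cong2[OF chain_mapD(3)[OF bm[OF j(1)], symmetric]])
      (use rj uj(1) pd_in[OF j(1)] be_in[OF j(1), of s] cell_chainD(4)[OF cw, of s] in simp_all)
  also have "\<dots> = pd j \<cdot> (vj \<cdot> y)"
    using uj(2) uv comp_reduce[OF vj(2), of y] vj(1) yA pd_in[OF j(1)] by simp
  finally have "pd j \<cdot> (r j s \<cdot> uj) = pd j \<cdot> (vj \<cdot> y)" .
  then obtain m where m: "(j, m) \<in> ro" "Da (j, m) \<cdot> (r j s \<cdot> uj) = Da (j, m) \<cdot> (vj \<cdot> y)"
    using compactD(2)[OF cD dir diaD colD j(1), of "r j s \<cdot> uj" "vj \<cdot> y"] rj uj(1) vj(1) yA by auto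
  have mF: "m \<in> Field ro" using m(1) by (rule FieldI2)
  note rm = cell_chainD(4)[OF cc[OF mF], of s]
  have "r m s \<cdot> (\<alpha> (j, m) s \<cdot> uj) = Da (j, m) \<cdot> (r j s \<cdot> uj)"
    by (rule comp_cong2[OF chain_mapD(3)[OF am[OF m(1)]]])
      (use rm rj uj(1) al_in[OF m(1), of s] Da_in[OF m(1)] in simp_all)
  then have "r m s \<cdot> (\<alpha> (j, m) s \<cdot> uj) = (Da (j, m) \<cdot> vj) \<cdot> y" using m(2) vj(1) yA Da_in[OF m(1)] by simp
  then have "(y, \<alpha> (j, m) s \<cdot> uj, Da (j, m) \<cdot> vj) \<in> squares Y (r m s)"
    using y uj(1) vj(1) al_in[OF m(1), of s] Da_in[OF m(1)] rm by (simp add: squares_def)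
  moreover have "\<beta> m s \<cdot> (\<alpha> (j, m) s \<cdot> uj) = u"
    using comp_reduce[OF be_comp[OF m(1)], of s uj] uj al_in[OF m(1), of s] be_in[OF mF, of s] by simp
  moreover have "pd m \<cdot> (Da (j, m) \<cdot> vj) = v"
    using comp_reduce[OF pd_comm[OF m(1)], of vj] vj Da_in[OF m(1)] pd_in[OF mF] by simp
  ultimately show ?thesis using mF by blast
qed

text \<open>Colimits commute with colimits, so the only real issue is the indexing of the cells: the
  squares into \<open>rw s\<close> must be the directed colimit of the squares into
  \<open>r i s\<close>. Compactness of the ends of \<open>y\<close> gives this at every ordinal
  \<open>s\<close>, as it concerns colimits over \<open>ro\<close> and not the tower.\<close>

lemma stage_colimit: "colimit (poset_cat ro) C (\<lambda>i. Z i s) (\<lambda>m. \<alpha> m s) (Zw s) (\<lambda>i. \<beta> i s)"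
proof (induction s rule: succ_less_induct)
  case zero
  show ?case unfolding cell_chainD(2)[OF cw]
  proof (rule colimit_cong[OF colC])
    show "Dom C (wi i) = Z i zero" "pc i = \<beta> i zero" if "i \<in> Obj (poset_cat ro)" for i
      using that cell_chainD(2)[OF cc, of i] chain_mapD(2)[OF bm, of i] by simp_all
    show "Ca m = \<alpha> m zero" if "m \<in> Arr (poset_cat ro)" for m
      using that chain_mapD(2)[OF am, of "fst m" "snd m"] by simp
    show "Dom (poset_cat ro) m \<in> Obj (poset_cat ro) \<and> Cod (poset_cat ro) m \<in> Obj (poset_cat ro)"
      if "m \<in> Arr (poset_cat ro)" for m using that by (cases m) (auto simp: Field_def)
  qed
next
  case (succ s)
  note col = succ
  note gd = diagram_graph_poset[OF stage_diagram]
  have fi: "f i (s, succ s) \<in> Hom C (Z i s) (Z i (succ s))" if "i \<in> Field ro" for i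
    by (rule cell_chainD(8)[OF cc[OF that] le_succ])
  have fws: "fw (s, succ s) \<in> Hom C (Zw s) (Zw (succ s))" by (rule cell_chainD(8)[OF cw le_succ])
  have bf: "\<beta> i (succ s) \<cdot> f i (s, succ s) = fw (s, succ s) \<cdot> \<beta> i s" if "i \<in> Field ro" for i
    by (rule chain_mapD(4)[OF bm[OF that] le_succ])
  have be: "\<beta> i (succ s) \<cdot> e i s (y, u, v) = ew s (y, \<beta> i s \<cdot> u, pd i \<cdot> v)"
    if "i \<in> Field ro" "(y, u, v) \<in> squares Y (r i s)" for i y u v
    by (rule chain_mapD(5)[OF bm[OF that(1)] that(2)])
  show ?case
  proof (rule colimitI)
    show "cocone (poset_cat ro) C (\<lambda>i. Z i (succ s)) (\<lambda>m. \<alpha> m (succ s)) (Zw (succ s)) (\<lambda>i. \<beta> i (succ s))"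
      unfolding cocone_def using cell_chainD(13)[OF cw] be_in be_comp by auto
  next
    fix T q assume q: "cocone (poset_cat ro) C (\<lambda>i. Z i (succ s)) (\<lambda>m. \<alpha> m (succ s)) T q"
    have qin: "q i \<in> Hom C (Z i (succ s)) T" if "i \<in> Field ro" for i
      using q that unfolding cocone_def by auto
    have T: "T \<in> Obj C" using q unfolding cocone_def by blast
    have qc: "q j \<cdot> \<alpha> (i, j) (succ s) = q i" if "(i, j) \<in> ro" for i j
      using q that unfolding cocone_def by (auto dest!: bspec[of _ _ "(i, j)"])
    have "\<exists>h\<in>Hom C (Zw s) T. \<forall>i\<in>Obj (poset_cat ro). h \<cdot> \<beta> i s = q i \<cdot> f i (s, succ s)"
    proof (rule colimit_ex[OF col T])
      show "q i \<cdot> f i (s, succ s) \<in> Hom C (Z i s) T" if "i \<in> Obj (poset_cat ro)" for i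
        using qin[of i] fi[of i] that by simp
      fix m assume "m \<in> Arr (poset_cat ro)"
      then obtain i j where m: "m = (i, j)" "(i, j) \<in> ro" by (cases m) auto
      have F: "i \<in> Field ro" "j \<in> Field ro" using m(2) by (auto simp: Field_def)
      have "(q j \<cdot> f j (s, succ s)) \<cdot> \<alpha> (i, j) s = q j \<cdot> (\<alpha> (i, j) (succ s) \<cdot> f i (s, succ s))"
        using qin[OF F(2)] fi[OF F(2)] al_in[OF m(2), of s] chain_mapD(4)[OF am[OF m(2)] le_succ, of s] by simp
      also have "\<dots> = q i \<cdot> f i (s, succ s)"
        by (rule comp_reduce[OF qc[OF m(2)]]) (use qin[OF F(2)] fi[OF F(1)] al_in[OF m(2), of "succ s"] in simp_all)
      finally show "(q (Cod (poset_cat ro) m) \<cdot> f (Cod (poset_cat ro) m) (s, succ s)) \<cdot> \<alpha> m s =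
          q (Dom (poset_cat ro) m) \<cdot> f (Dom (poset_cat ro) m) (s, succ s)" using m by simp
    qed
    then obtain h where h: "h \<in> Hom C (Zw s) T" "\<And>i. i \<in> Field ro \<Longrightarrow> h \<cdot> \<beta> i s = q i \<cdot> f i (s, succ s)" by auto
    have move: "q i \<cdot> e i s (y, u, v) = q j \<cdot> e j s (y, \<alpha> (i, j) s \<cdot> u, Da (i, j) \<cdot> v) \<and>
        (y, \<alpha> (i, j) s \<cdot> u, Da (i, j) \<cdot> v) \<in> squares Y (r j s)"
      if ij: "(i, j) \<in> ro" and \<sigma>: "(y, u, v) \<in> squares Y (r i s)" for i j y u v
    proof
      have F: "i \<in> Field ro" "j \<in> Field ro" using ij by (auto simp: Field_def)
      show "(y, \<alpha> (i, j) s \<cdot> u, Da (i, j) \<cdot> v) \<in> squares Y (r j s)"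
        by (rule chain_map_squares[OF cc[OF F(1)] cc[OF F(2)] Y Da_in[OF ij] al_in[OF ij] chain_mapD(3)[OF am[OF ij]] \<sigma>])
      have "q i \<cdot> e i s (y, u, v) = q j \<cdot> (\<alpha> (i, j) (succ s) \<cdot> e i s (y, u, v))"
        using comp_reduce[OF qc[OF ij], of "e i s (y, u, v)"] qin[OF F(2)] al_in[OF ij, of "succ s"]
          cell_chain_cell(1)[OF cc[OF F(1)] \<sigma>] by simp
      then show "q i \<cdot> e i s (y, u, v) = q j \<cdot> e j s (y, \<alpha> (i, j) s \<cdot> u, Da (i, j) \<cdot> v)"
        using chain_mapD(5)[OF am[OF ij] \<sigma>] by simp
    qed
    \<comment> \<open>Two squares at stages with the same image over \<open>w\<close> agree at a
      later stage, first in the top side (\<open>b\<close>) and then also in the bottom side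
      (\<open>n\<close>), and \<open>move\<close> does not change the value.\<close>
    have wd: "q i \<cdot> e i s (y, u, v) = q j \<cdot> e j s (y, u', v')"
      if i: "i \<in> Field ro" "(y, u, v) \<in> squares Y (r i s)" and j: "j \<in> Field ro" "(y, u', v') \<in> squares Y (r j s)"
        and eq: "\<beta> i s \<cdot> u = \<beta> j s \<cdot> u'" "pd i \<cdot> v = pd j \<cdot> v'" for i j y u v u' v'
    proof -
      have y: "y \<in> Y" by (rule squaresD(1)[OF i(2)])
      have ty: "u \<in> Hom C (Dom C y) (Z i s)" "v \<in> Hom C (Cod C y) (Cod C (wi i))"
        "u' \<in> Hom C (Dom C y) (Z j s)" "v' \<in> Hom C (Cod C y) (Cod C (wi j))"
        using squaresD(2,3)[OF i(2)] squaresD(2,3)[OF j(2)] cell_chainD(4)[OF cc[OF i(1)], of s]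
          cell_chainD(4)[OF cc[OF j(1)], of s] by simp_all
      obtain a where a: "a \<in> Field ro" "(i, a) \<in> ro" "(j, a) \<in> ro" by (rule directed_ub[OF dir inf i(1) j(1)])
      have "\<beta> a s \<cdot> (\<alpha> (i, a) s \<cdot> u) = \<beta> i s \<cdot> u"
        by (rule comp_reduce[OF be_comp[OF a(2)]]) (use ty(1) be_in[OF a(1), of s] al_in[OF a(2), of s] in simp_all)
      moreover have "\<beta> a s \<cdot> (\<alpha> (j, a) s \<cdot> u') = \<beta> j s \<cdot> u'"
        by (rule comp_reduce[OF be_comp[OF a(3)]]) (use ty(3) be_in[OF a(1), of s] al_in[OF a(3), of s] in simp_all)
      ultimately have "\<exists>b. (a, b) \<in> ro \<and> \<alpha> (a, b) s \<cdot> (\<alpha> (i, a) s \<cdot> u) = \<alpha> (a, b) s \<cdot> (\<alpha> (j, a) s \<cdot> u')"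
        using eq(1) ty(1,3) al_in[OF a(2), of s] al_in[OF a(3), of s]
        by (intro compactD(2)[OF conjunct1[OF cpt[OF y]] dir stage_diagram col a(1)]) simp_all
      then obtain b where b: "(a, b) \<in> ro" "\<alpha> (a, b) s \<cdot> (\<alpha> (i, a) s \<cdot> u) = \<alpha> (a, b) s \<cdot> (\<alpha> (j, a) s \<cdot> u')" by blast
      have bF: "b \<in> Field ro" using b(1) by (rule FieldI2)
      have ib: "(i, b) \<in> ro" "(j, b) \<in> ro" using ord(3)[OF a(2) b(1)] ord(3)[OF a(3) b(1)] .
      have ub: "\<alpha> (i, b) s \<cdot> u = \<alpha> (j, b) s \<cdot> u'"
        using b(2) ty(1,3) al_in[OF a(2), of s] al_in[OF a(3), of s] al_in[OF b(1), of s]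
        unfolding al_comp[OF a(2) b(1)] al_comp[OF a(3) b(1)] by simp
      have "pd b \<cdot> (Da (i, b) \<cdot> v) = pd i \<cdot> v"
        by (rule comp_reduce[OF pd_comm[OF ib(1)]]) (use ty(2) pd_in[OF bF] Da_in[OF ib(1)] in simp_all)
      moreover have "pd b \<cdot> (Da (j, b) \<cdot> v') = pd j \<cdot> v'"
        by (rule comp_reduce[OF pd_comm[OF ib(2)]]) (use ty(4) pd_in[OF bF] Da_in[OF ib(2)] in simp_all)
      ultimately have "\<exists>n. (b, n) \<in> ro \<and> Da (b, n) \<cdot> (Da (i, b) \<cdot> v) = Da (b, n) \<cdot> (Da (j, b) \<cdot> v')"
        using eq(2) ty(2,4) Da_in[OF ib(1)] Da_in[OF ib(2)]
        by (intro compactD(2)[OF conjunct2[OF cpt[OF y]] dir diaD colD bF]) simp_all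
      then obtain n where n: "(b, n) \<in> ro" "Da (b, n) \<cdot> (Da (i, b) \<cdot> v) = Da (b, n) \<cdot> (Da (j, b) \<cdot> v')" by blast
      note inn = ord(3)[OF ib(1) n(1)] and jn = ord(3)[OF ib(2) n(1)]
      have "\<alpha> (i, n) s \<cdot> u = \<alpha> (j, n) s \<cdot> u'"
        unfolding al_comp[OF ib(1) n(1)] al_comp[OF ib(2) n(1)]
        using ub ty(1,3) al_in[OF ib(1), of s] al_in[OF ib(2), of s] al_in[OF n(1), of s] by simp
      moreover have "Da (i, n) \<cdot> v = Da (j, n) \<cdot> v'"
        unfolding Da_comp[OF ib(1) n(1)] Da_comp[OF ib(2) n(1)]
        using n(2) ty(2,4) Da_in[OF ib(1)] Da_in[OF ib(2)] Da_in[OF n(1)] by simp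
      ultimately show ?thesis using move[OF inn i(2)] move[OF jn j(2)] by simp
    qed
    \<comment> \<open>The value at a cell over \<open>w\<close> is read off from any square at a
      stage that represents it; \<open>wd\<close> makes it independent of the
      representative.\<close>
    define \<epsilon> where "\<epsilon> = (\<lambda>\<sigma>. SOME x. \<exists>i u v. i \<in> Field ro \<and> (fst \<sigma>, u, v) \<in> squares Y (r i s) \<and>
      \<beta> i s \<cdot> u = top_side \<sigma> \<and> pd i \<cdot> v = snd (snd \<sigma>) \<and> x = q i \<cdot> e i s (fst \<sigma>, u, v))"
    have \<epsilon>: "\<epsilon> (y, \<beta> i s \<cdot> u, pd i \<cdot> v) = q i \<cdot> e i s (y, u, v)"
      if i: "i \<in> Field ro" "(y, u, v) \<in> squares Y (r i s)" for i y u v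
      unfolding \<epsilon>_def fst_conv snd_conv
    proof (rule some_equality)
      show "\<exists>j u' v'. j \<in> Field ro \<and> (y, u', v') \<in> squares Y (r j s) \<and> \<beta> j s \<cdot> u' = \<beta> i s \<cdot> u \<and>
          pd j \<cdot> v' = pd i \<cdot> v \<and> q i \<cdot> e i s (y, u, v) = q j \<cdot> e j s (y, u', v')" using i by blast
      fix x assume "\<exists>j u' v'. j \<in> Field ro \<and> (y, u', v') \<in> squares Y (r j s) \<and> \<beta> j s \<cdot> u' = \<beta> i s \<cdot> u \<and>
          pd j \<cdot> v' = pd i \<cdot> v \<and> x = q j \<cdot> e j s (y, u', v')"
      then obtain j u' v' where j: "j \<in> Field ro" "(y, u', v') \<in> squares Y (r j s)" "\<beta> j s \<cdot> u' = \<beta> i s \<cdot> u"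
          "pd j \<cdot> v' = pd i \<cdot> v" "x = q j \<cdot> e j s (y, u', v')" by blast
      show "x = q i \<cdot> e i s (y, u, v)" unfolding j(5) by (rule wd[OF j(1,2) i j(3,4)])
    qed
    have "\<exists>H\<in>Hom C (Zw (succ s)) T. H \<cdot> fw (s, succ s) = h \<and> (\<forall>\<sigma>\<in>squares Y (rw s). H \<cdot> ew s \<sigma> = \<epsilon> \<sigma>)"
    proof (rule attach_ex[OF cell_chainD(6)[OF cw] h(1)])
      fix \<sigma> assume \<sigma>0: "\<sigma> \<in> squares Y (rw s)"
      obtain y u v where \<sigma>: "\<sigma> = (y, u, v)" by (cases \<sigma>)
      obtain i u' v' where i: "i \<in> Field ro" "(y, u', v') \<in> squares Y (r i s)" "\<beta> i s \<cdot> u' = u" "pd i \<cdot> v' = v"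
        using square_from_stage[OF col \<sigma>0[unfolded \<sigma>]] by blast
      have yA: "y \<in> Arr C" using squaresD(1)[OF i(2)] Y by blast
      have u': "u' \<in> Hom C (Dom C y) (Z i s)"
        using squaresD(2)[OF i(2)] cell_chainD(4)[OF cc[OF i(1)], of s] by simp
      have e\<sigma>: "\<epsilon> \<sigma> = q i \<cdot> e i s (y, u', v')" using \<epsilon>[OF i(1,2)] i(3,4) by (simp add: \<sigma>)
      note ce = cell_chain_cell[OF cc[OF i(1)] i(2)]
      have "\<epsilon> \<sigma> \<cdot> y = (q i \<cdot> f i (s, succ s)) \<cdot> u'"
        unfolding e\<sigma> using ce qin[OF i(1)] yA u' fi[OF i(1)] by simp
      also have "\<dots> = h \<cdot> u" unfolding h(2)[OF i(1), symmetric] i(3)[symmetric]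
        using h(1) be_in[OF i(1), of s] u' by simp
      finally show "\<epsilon> \<sigma> \<in> Hom C (Cod C (fst \<sigma>)) T \<and> \<epsilon> \<sigma> \<cdot> fst \<sigma> = h \<cdot> top_side \<sigma>"
        using ce(1) qin[OF i(1)] by (simp add: \<sigma> e\<sigma>[unfolded \<sigma>])
    qed
    then obtain H where H: "H \<in> Hom C (Zw (succ s)) T" "H \<cdot> fw (s, succ s) = h"
      and He: "\<And>\<sigma>. \<sigma> \<in> squares Y (rw s) \<Longrightarrow> H \<cdot> ew s \<sigma> = \<epsilon> \<sigma>" by blast
    have "H \<cdot> \<beta> i (succ s) = q i" if i: "i \<in> Field ro" for i
    proof (rule cell_chain_eqI[OF cc[OF i] Y _ qin[OF i]])
      show "H \<cdot> \<beta> i (succ s) \<in> Hom C (Z i (succ s)) T" using H(1) be_in[OF i, of "succ s"] by simp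
      have "(H \<cdot> \<beta> i (succ s)) \<cdot> f i (s, succ s) = H \<cdot> (fw (s, succ s) \<cdot> \<beta> i s)"
        using bf[OF i] H(1) be_in[OF i, of "succ s"] fi[OF i] by simp
      also have "\<dots> = h \<cdot> \<beta> i s" by (rule comp_reduce[OF H(2)]) (use H(1) be_in[OF i, of s] fws in simp_all)
      finally show "(H \<cdot> \<beta> i (succ s)) \<cdot> f i (s, succ s) = q i \<cdot> f i (s, succ s)" using h(2)[OF i] by simp
      fix y u v assume \<sigma>: "(y, u, v) \<in> squares Y (r i s)"
      have \<sigma>': "(y, \<beta> i s \<cdot> u, pd i \<cdot> v) \<in> squares Y (rw s)"
        by (rule chain_map_squares[OF cc[OF i] cw Y pd_in[OF i] be_in[OF i] chain_mapD(3)[OF bm[OF i]] \<sigma>])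
      have "(H \<cdot> \<beta> i (succ s)) \<cdot> e i s (y, u, v) = H \<cdot> ew s (y, \<beta> i s \<cdot> u, pd i \<cdot> v)"
        using be[OF i \<sigma>] H(1) be_in[OF i, of "succ s"] cell_chain_cell(1)[OF cc[OF i] \<sigma>] by simp
      then show "(H \<cdot> \<beta> i (succ s)) \<cdot> e i s (y, u, v) = q i \<cdot> e i s (y, u, v)"
        using He[OF \<sigma>'] \<epsilon>[OF i \<sigma>] by simp
    qed
    then show "\<exists>u\<in>Hom C (Zw (succ s)) T. \<forall>i\<in>Obj (poset_cat ro). u \<cdot> \<beta> i (succ s) = q i"
      using H(1) by (intro bexI[of _ H]) simp_all
  next
    fix T U V assume U: "U \<in> Hom C (Zw (succ s)) T" and V: "V \<in> Hom C (Zw (succ s)) T"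
      and "\<And>i. i \<in> Obj (poset_cat ro) \<Longrightarrow> U \<cdot> \<beta> i (succ s) = V \<cdot> \<beta> i (succ s)"
    then have eq: "U \<cdot> \<beta> i (succ s) = V \<cdot> \<beta> i (succ s)" if "i \<in> Field ro" for i using that by simp
    show "U = V"
    proof (rule cell_chain_eqI[OF cw Y U V])
      show "U \<cdot> fw (s, succ s) = V \<cdot> fw (s, succ s)"
      proof (rule colimit_eqI[OF gd col, of _ T])
        fix i assume "i \<in> Obj (poset_cat ro)"
        then have i: "i \<in> Field ro" by simp
        have "U \<cdot> (\<beta> i (succ s) \<cdot> f i (s, succ s)) = V \<cdot> (\<beta> i (succ s) \<cdot> f i (s, succ s))"
          by (rule comp_cong2[OF eq[OF i]]) (use U V be_in[OF i, of "succ s"] fi[OF i] in simp_all)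
        then show "(U \<cdot> fw (s, succ s)) \<cdot> \<beta> i s = (V \<cdot> fw (s, succ s)) \<cdot> \<beta> i s"
          using bf[OF i] U V fws be_in[OF i, of s] by simp
      qed (use U V fws in simp_all)
      fix y u v assume \<sigma>: "(y, u, v) \<in> squares Y (rw s)"
      obtain i u' v' where i: "i \<in> Field ro" "(y, u', v') \<in> squares Y (r i s)" "\<beta> i s \<cdot> u' = u" "pd i \<cdot> v' = v"
        using square_from_stage[OF col \<sigma>] by blast
      have "U \<cdot> (\<beta> i (succ s) \<cdot> e i s (y, u', v')) = V \<cdot> (\<beta> i (succ s) \<cdot> e i s (y, u', v'))"
        by (rule comp_cong2[OF eq[OF i(1)]])
          (use U V be_in[OF i(1), of "succ s"] cell_chain_cell(1)[OF cc[OF i(1)] i(2)] in simp_all)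
      then show "U \<cdot> ew s (y, u, v) = V \<cdot> ew s (y, u, v)" using be[OF i(1,2)] i(3,4) by simp
    qed
  qed
next
  case (limit s)
  note IH = limit(2)
  note gd = diagram_graph_poset[OF stage_diagram]
  note colw = cell_chainD(11)[OF cw limit(1)] and gdw = cell_chainD(12)[OF cw, of s]
  have fws: "fw (i, j) \<in> Hom C (Zw i) (Zw j)" if "i \<le> j" for i j by (rule cell_chainD(8)[OF cw that])
  have fi: "f i (a, b) \<in> Hom C (Z i a) (Z i b)" if "i \<in> Field ro" "a \<le> b" for i a b
    by (rule cell_chainD(8)[OF cc[OF that(1)] that(2)])
  have bf: "\<beta> i b \<cdot> f i (a, b) = fw (a, b) \<cdot> \<beta> i a" if "i \<in> Field ro" "a \<le> b" for i a b
    by (rule chain_mapD(4)[OF bm[OF that(1)] that(2)])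
  show ?case
  proof (rule colimitI)
    show "cocone (poset_cat ro) C (\<lambda>i. Z i s) (\<lambda>m. \<alpha> m s) (Zw s) (\<lambda>i. \<beta> i s)"
      unfolding cocone_def using cell_chainD(13)[OF cw] be_in be_comp by auto
  next
    fix T q assume q: "cocone (poset_cat ro) C (\<lambda>i. Z i s) (\<lambda>m. \<alpha> m s) T q"
    have qin: "q i \<in> Hom C (Z i s) T" if "i \<in> Field ro" for i
      using q that unfolding cocone_def by auto
    have T: "T \<in> Obj C" using q unfolding cocone_def by blast
    have qc: "q j \<cdot> \<alpha> (i, j) s = q i" if "(i, j) \<in> ro" for i j
      using q that unfolding cocone_def by (auto dest!: bspec[of _ _ "(i, j)"])
    \<comment> \<open>Interchange of colimits: a map out of each \<open>Zw a\<close> comes from the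
      colimit over \<open>ro\<close>, and these maps are then glued along the chain.\<close>
    have "\<exists>h. h \<in> Hom C (Zw a) T \<and> (\<forall>i\<in>Field ro. h \<cdot> \<beta> i a = q i \<cdot> f i (a, s))" if a: "a < s" for a
    proof -
      have as: "a \<le> s" using a by simp
      have "\<exists>h\<in>Hom C (Zw a) T. \<forall>i\<in>Obj (poset_cat ro). h \<cdot> \<beta> i a = q i \<cdot> f i (a, s)"
      proof (rule colimit_ex[OF IH[OF a] T])
        show "q i \<cdot> f i (a, s) \<in> Hom C (Z i a) T" if "i \<in> Obj (poset_cat ro)" for i
          using qin[of i] fi[of i a s] that as by simp
        fix m assume "m \<in> Arr (poset_cat ro)"
        then obtain i j where m: "m = (i, j)" "(i, j) \<in> ro" by (cases m) auto
        have F: "i \<in> Field ro" "j \<in> Field ro" using m(2) by (auto simp: Field_def)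
        have "(q j \<cdot> f j (a, s)) \<cdot> \<alpha> (i, j) a = q j \<cdot> (\<alpha> (i, j) s \<cdot> f i (a, s))"
          using qin[OF F(2)] fi[OF F(2) as] al_in[OF m(2), of a] chain_mapD(4)[OF am[OF m(2)] as] by simp
        also have "\<dots> = q i \<cdot> f i (a, s)"
          by (rule comp_reduce[OF qc[OF m(2)]]) (use qin[OF F(2)] fi[OF F(1) as] al_in[OF m(2), of s] in simp_all)
        finally show "(q (Cod (poset_cat ro) m) \<cdot> f (Cod (poset_cat ro) m) (a, s)) \<cdot> \<alpha> m a =
            q (Dom (poset_cat ro) m) \<cdot> f (Dom (poset_cat ro) m) (a, s)" using m by simp
      qed
      then show ?thesis by auto
    qed
    then obtain h where h: "\<And>a. a < s \<Longrightarrow> h a \<in> Hom C (Zw a) T"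
      "\<And>a i. a < s \<Longrightarrow> i \<in> Field ro \<Longrightarrow> h a \<cdot> \<beta> i a = q i \<cdot> f i (a, s)" by metis
    have hc: "h b \<cdot> fw (a, b) = h a" if ab: "a \<le> b" "b < s" for a b
    proof -
      have as: "a < s" "b \<le> s" using ab by auto
      show ?thesis
      proof (rule colimit_eqI[OF gd IH[OF as(1)] _ h(1)[OF as(1)]])
        show "h b \<cdot> fw (a, b) \<in> Hom C (Zw a) T" using h(1)[OF ab(2)] fws[OF ab(1)] by simp
        fix i assume "i \<in> Obj (poset_cat ro)"
        then have i: "i \<in> Field ro" by simp
        have "(h b \<cdot> fw (a, b)) \<cdot> \<beta> i a = h b \<cdot> (\<beta> i b \<cdot> f i (a, b))"
          using bf[OF i ab(1)] h(1)[OF ab(2)] fws[OF ab(1)] be_in[OF i, of a] by simp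
        also have "\<dots> = (q i \<cdot> f i (b, s)) \<cdot> f i (a, b)"
          by (rule comp_reduce[OF h(2)[OF ab(2) i]]) (use h(1)[OF ab(2)] be_in[OF i, of b] fi[OF i ab(1)] in simp_all)
        also have "\<dots> = q i \<cdot> f i (a, s)"
          using cell_chainD(10)[OF cc[OF i] ab(1) as(2)] qin[OF i] fi[OF i ab(1)] fi[OF i as(2)] by simp
        finally show "(h b \<cdot> fw (a, b)) \<cdot> \<beta> i a = h a \<cdot> \<beta> i a" using h(2)[OF as(1) i] by simp
      qed
    qed
    have "\<exists>H\<in>Hom C (Zw s) T. \<forall>a\<in>Obj (poset_cat (chain_ord s)). H \<cdot> fw (a, s) = h a"
      by (rule colimit_ex[OF colw T]) (use h(1) hc in \<open>auto simp: chain_ord_iff\<close>)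
    then obtain H where H: "H \<in> Hom C (Zw s) T" "\<And>a. a < s \<Longrightarrow> H \<cdot> fw (a, s) = h a" by auto
    have "H \<cdot> \<beta> i s = q i" if i: "i \<in> Field ro" for i
    proof (rule colimit_eqI[OF cell_chainD(12)[OF cc[OF i]] cell_chainD(11)[OF cc[OF i] limit(1)] _ qin[OF i]])
      show "H \<cdot> \<beta> i s \<in> Hom C (Z i s) T" using H(1) be_in[OF i, of s] by simp
      fix a assume "a \<in> Obj (poset_cat (chain_ord s))"
      then have a: "a < s" "a \<le> s" by auto
      have "(H \<cdot> \<beta> i s) \<cdot> f i (a, s) = H \<cdot> (fw (a, s) \<cdot> \<beta> i a)"
        using bf[OF i a(2)] H(1) be_in[OF i, of s] fi[OF i a(2)] by simp
      also have "\<dots> = h a \<cdot> \<beta> i a"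
        by (rule comp_reduce[OF H(2)[OF a(1)]]) (use H(1) be_in[OF i, of a] fws[OF a(2)] in simp_all)
      finally show "(H \<cdot> \<beta> i s) \<cdot> f i (a, s) = q i \<cdot> f i (a, s)" using h(2)[OF a(1) i] by simp
    qed
    then show "\<exists>u\<in>Hom C (Zw s) T. \<forall>i\<in>Obj (poset_cat ro). u \<cdot> \<beta> i s = q i"
      using H(1) by (intro bexI[of _ H]) simp_all
  next
    fix T U V assume U: "U \<in> Hom C (Zw s) T" and V: "V \<in> Hom C (Zw s) T"
      and "\<And>i. i \<in> Obj (poset_cat ro) \<Longrightarrow> U \<cdot> \<beta> i s = V \<cdot> \<beta> i s"
    then have eq: "U \<cdot> \<beta> i s = V \<cdot> \<beta> i s" if "i \<in> Field ro" for i using that by simp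
    show "U = V"
    proof (rule colimit_eqI[OF gdw colw U V])
      fix a assume "a \<in> Obj (poset_cat (chain_ord s))"
      then have a: "a < s" "a \<le> s" by auto
      show "U \<cdot> fw (a, s) = V \<cdot> fw (a, s)"
      proof (rule colimit_eqI[OF gd IH[OF a(1)], of _ T])
        fix i assume "i \<in> Obj (poset_cat ro)"
        then have i: "i \<in> Field ro" by simp
        have "U \<cdot> (\<beta> i s \<cdot> f i (a, s)) = V \<cdot> (\<beta> i s \<cdot> f i (a, s))"
          by (rule comp_cong2[OF eq[OF i]]) (use U V be_in[OF i, of s] fi[OF i a(2)] in simp_all)
        then show "(U \<cdot> fw (a, s)) \<cdot> \<beta> i a = (V \<cdot> fw (a, s)) \<cdot> \<beta> i a"
          using bf[OF i a(2)] U V fws[OF a(2)] be_in[OF i, of a] by simp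
      qed (use U V fws[OF a(2)] in simp_all)
    qed
  qed
qed

end

section \<open>Raising the index of presentability\<close>

lemma (in universe) card_below:
  assumes t: "regular_above B t"
  shows "A \<subseteq> A' \<Longrightarrow> |A'| <o chain_ord t \<Longrightarrow> |A| <o chain_ord t"
    "|A'| <o chain_ord t \<Longrightarrow> |h ` A'| <o chain_ord t"
    "|A'| <o chain_ord t \<Longrightarrow> |A''| <o chain_ord t \<Longrightarrow> |A' \<union> A''| <o chain_ord t"
    "|I| <o chain_ord t \<Longrightarrow> (\<And>i. i \<in> I \<Longrightarrow> |AA i| <o chain_ord t) \<Longrightarrow> |\<Union>i\<in>I. AA i| <o chain_ord t"
    "finite FF \<Longrightarrow> |FF| <o chain_ord t"
proof -
  have c: "Cinfinite (chain_ord t)" "regularCard (chain_ord t)"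
    using t by (auto simp: regular_above_def)
  show "A \<subseteq> A' \<Longrightarrow> |A'| <o chain_ord t \<Longrightarrow> |A| <o chain_ord t"
    using card_of_mono1 ordLeq_ordLess_trans by blast
  show "|A'| <o chain_ord t \<Longrightarrow> |h ` A'| <o chain_ord t"
    using card_of_image ordLeq_ordLess_trans by blast
  show "|A'| <o chain_ord t \<Longrightarrow> |A''| <o chain_ord t \<Longrightarrow> |A' \<union> A''| <o chain_ord t"
    by (rule Un_Cinfinite_bound_strict[OF _ _ c(1)])
  show "|I| <o chain_ord t \<Longrightarrow> (\<And>i. i \<in> I \<Longrightarrow> |AA i| <o chain_ord t) \<Longrightarrow> |\<Union>i\<in>I. AA i| <o chain_ord t"
    by (rule card_of_UNION_ordLess_infinite_Field_regularCard[OF c(2,1)]) auto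
  have "Well_order (chain_ord t)" "infinite (Field (chain_ord t))"
    using c(1) by (auto simp: cinfinite_def card_order_on_def)
  then show "finite FF \<Longrightarrow> |FF| <o chain_ord t"
    by (intro finite_ordLess_infinite) (simp_all add: card_of_well_order_on Field_card_of)
qed

context locally_presentable_category
begin

text \<open>As \<open>t\<close> is an initial ordinal, an index set with fewer than \<open>t\<close>
  elements can be copied into the ordinals below \<open>t\<close>. The diagrams of generators on
  such copies form a small set, and one colimit is chosen for each of them.\<close>

lemma small_set_of_colimits:
  assumes P: "small k P" "P \<subseteq> Obj C" and t: "regular_above B t"
  shows "\<exists>Q. small k Q \<and> Q \<subseteq> Obj C \<and>
    (\<forall>(r :: 'k rel) F G S. Refl r \<and> diagram (poset_cat r) C F G \<and> S \<subseteq> Field r \<and> |S| <o chain_ord t \<and>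
      (\<forall>i\<in>S. F i \<in> P) \<longrightarrow> (\<exists>c\<in>Q. \<exists>p. colimit (poset_cat (Restr r S)) C F G c p))"
proof -
  let ?\<theta> = "{i :: 'k. i < t}"
  define A where "A = (\<Union>a\<in>P. \<Union>b\<in>P. Hom C a b)"
  have sA: "small k A" unfolding A_def by (intro small_UNION P small_Hom)
  \<comment> \<open>A shape consists of a vertex set \<open>T\<close> below \<open>t\<close>, its
    labels in \<open>P\<close>, a relation on \<open>T\<close> and its labels in \<open>A\<close>.
    All functions are extensional, to keep \<open>Sh\<close> small.\<close>
  define Sh where "Sh = (SIGMA T : Pow ?\<theta>. (T \<rightarrow>\<^sub>E P) \<times> (SIGMA r : Pow (T \<times> T). r \<rightarrow>\<^sub>E A))"
  have sT: "small k T" if "T \<in> Pow ?\<theta>" for T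
    using that small_subset[OF _ small_lessThan[of t], of T] by auto
  have sr: "small k r" if "T \<in> Pow ?\<theta>" "r \<in> Pow (T \<times> T)" for T r
    using that(2) small_subset[OF _ small_Sigma[OF sT[OF that(1)] sT[OF that(1)]], of r] by auto
  have sSh: "small k Sh" unfolding Sh_def
    by (intro small_Sigma small_Pow small_lessThan small_PiE sA P) (auto intro: sT sr)
  define ob where "ob = (\<lambda>(T :: 'k set, F :: 'k \<Rightarrow> 'o, r :: 'k rel, G :: 'k \<times> 'k \<Rightarrow> 'm). SOME c. \<exists>p. colimit (poset_cat r) C F G c p)"
  define Q where "Q = ob ` {(T, F, r, G). (T, F, r, G) \<in> Sh \<and> (\<exists>c p. colimit (poset_cat r) C F G c p)}"
  have "small k Q" unfolding Q_def by (rule small_image, rule small_subset[OF _ sSh]) auto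
  moreover have obE: "\<exists>p. colimit (poset_cat r) C F G (ob (T, F, r, G)) p"
    if "\<exists>c p. colimit (poset_cat r) C F G c p" for T F r G
    unfolding ob_def prod.case by (rule someI_ex[OF that])
  have "Q \<subseteq> Obj C"
  proof
    fix c assume "c \<in> Q"
    then obtain X where X: "X \<in> {(T, F, r, G). (T, F, r, G) \<in> Sh \<and> (\<exists>c p. colimit (poset_cat r) C F G c p)}"
      "c = ob X" unfolding Q_def by blast
    obtain T F r G where TF: "X = (T, F, r, G)" by (cases X)
    have "c = ob (T, F, r, G)" "\<exists>c p. colimit (poset_cat r) C F G c p" using X unfolding TF by blast+
    then show "c \<in> Obj C" using obE[of r F G T] colimit_obj by blast
  qed
  moreover have "\<exists>c\<in>Q. \<exists>p. colimit (poset_cat (Restr r S)) C F G c p"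
    if r: "Refl r" and dia: "diagram (poset_cat r) C F G" and S: "S \<subseteq> Field r" "|S| <o chain_ord t"
      and FP: "\<forall>i\<in>S. F i \<in> P" for r :: "'k rel" and F G S
  proof -
    have "Card_order (chain_ord t)" using t by (simp add: regular_above_def)
    then have "|?\<theta>| =o chain_ord t" using card_of_Field_ordIso[of "chain_ord t"] by simp
    then have "|S| \<le>o |?\<theta>|"
      using S(2) ordIso_symmetric ordLess_ordIso_trans ordLess_imp_ordLeq by blast
    then obtain b where b: "inj_on b S" "b ` S \<subseteq> ?\<theta>" using card_of_ordLeq[of S ?\<theta>] by blast
    define d where "d = the_inv_into S b"
    have d: "d (b i) = i" if "i \<in> S" for i unfolding d_def by (rule the_inv_into_f_f[OF b(1) that])
    define r' where "r' = (\<lambda>(i, j). (b i, b j)) ` Restr r S"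
    have refl: "(i, i) \<in> Restr r S" if "i \<in> S" for i
      using that r S(1) unfolding refl_on_def by blast
    have FS: "Field (Restr r S) = S" using refl unfolding Field_def by auto
    have Fr': "Field r' = b ` S"
    proof
      show "Field r' \<subseteq> b ` S" by (auto simp: r'_def Field_def)
      show "b ` S \<subseteq> Field r'"
      proof
        fix x assume "x \<in> b ` S"
        then obtain i where "i \<in> S" "x = b i" by blast
        then have "(x, x) \<in> r'" using refl[of i] unfolding r'_def by force
        then show "x \<in> Field r'" by (auto simp: Field_def)
      qed
    qed
    define F' where "F' = restrict (\<lambda>x. F (d x)) (b ` S)"
    define G' where "G' = restrict (\<lambda>(x, y). G (d x, d y)) r'"
    have F'b: "F' (b i) = F i" if "i \<in> S" for i using that by (simp add: F'_def d)
    have G'b: "G' (b i, b j) = G (i, j)" if "(i, j) \<in> Restr r S" for i j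
    proof -
      have "(b i, b j) \<in> r'" using that unfolding r'_def by force
      then show ?thesis using that by (simp add: G'_def d)
    qed
    have Gin: "G (i, j) \<in> Hom C (F i) (F j)" if "(i, j) \<in> r" for i j
      using dia that unfolding diagram_poset_iff by blast
    have rE: "\<exists>i j. x = b i \<and> y = b j \<and> (i, j) \<in> Restr r S" if "(x, y) \<in> r'" for x y
      using that unfolding r'_def by auto
    have G'in: "G' (x, y) \<in> Hom C (F' x) (F' y)" if xy: "(x, y) \<in> r'" for x y
    proof -
      obtain i j where ij: "x = b i" "y = b j" "(i, j) \<in> Restr r S" using rE[OF xy] by blast
      then show ?thesis using G'b[OF ij(3)] F'b[of i] F'b[of j] Gin[of i j] by auto
    qed
    have "graph_diagram (poset_cat r') C F' G'" unfolding graph_diagram_def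
    proof (intro conjI ballI)
      show "F' x \<in> Obj C" if "x \<in> Obj (poset_cat r')" for x
        using that FP P(2) F'b by (auto simp: Fr')
      fix m assume m: "m \<in> Arr (poset_cat r')"
      show "Dom (poset_cat r') m \<in> Obj (poset_cat r')" "Cod (poset_cat r') m \<in> Obj (poset_cat r')"
        "G' m \<in> Hom C (F' (Dom (poset_cat r') m)) (F' (Cod (poset_cat r') m))"
        using m G'in[of "fst m" "snd m"] by (cases m, auto simp: Field_def)+
    qed
    moreover have "small k (Obj (poset_cat r'))"
      using small_subset[OF b(2) small_lessThan] by (simp add: Fr')
    ultimately have ex: "\<exists>c p. colimit (poset_cat r') C F' G' c p"
      using graph_colimit[of "poset_cat r'" F' G'] small_rel[of r'] by simp
    have "(b ` S, F', r', G') \<in> Sh"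
    proof -
      have "F' \<in> b ` S \<rightarrow>\<^sub>E P" using FP F'b by (auto simp: F'_def)
      moreover have "G' \<in> r' \<rightarrow>\<^sub>E A"
      proof (rule PiE_I)
        fix m assume m: "m \<in> r'"
        obtain x y where xy: "m = (x, y)" by (cases m)
        obtain i j where "x = b i" "y = b j" and ij2: "(i, j) \<in> Restr r S" using rE m unfolding xy by blast
        then have ij: "m = (b i, b j)" "(i, j) \<in> Restr r S" using xy by simp_all
        then show "G' m \<in> A" using G'b[OF ij(2)] Gin[of i j] FP unfolding A_def by (auto simp del: Hom_iff)
      qed (simp add: G'_def)
      moreover have "r' \<subseteq> b ` S \<times> b ` S" by (auto simp: r'_def)
      ultimately show ?thesis using b(2) by (simp add: Sh_def)
    qed
    then have "ob (b ` S, F', r', G') \<in> Q" using ex unfolding Q_def by blast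
    moreover obtain p where col: "colimit (poset_cat r') C F' G' (ob (b ` S, F', r', G')) p"
      using obE[OF ex] by blast
    \<comment> \<open>The copy and the original have literally the same colimit vertex, so the
      chosen object itself serves, not merely an isomorphic one.\<close>
    have "colimit (poset_cat (Restr r S)) C F G (ob (b ` S, F', r', G')) (\<lambda>i. p (b i))"
    proof (rule colimit_reindex[OF col, where ?b2.0 = "\<lambda>(i, j). (b i, b j)"])
      show "bij_betw b (Obj (poset_cat (Restr r S))) (Obj (poset_cat r'))"
        using b(1) by (simp add: FS Fr' bij_betw_def)
      show "(\<lambda>(i, j). (b i, b j)) ` Arr (poset_cat (Restr r S)) = Arr (poset_cat r')"
        by (simp add: r'_def)
      show "F' (b i) = F i" if "i \<in> Obj (poset_cat (Restr r S))" for i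
        using that by (simp add: FS F'b)
      fix m assume "m \<in> Arr (poset_cat (Restr r S))"
      then obtain i j where m: "m = (i, j)" "(i, j) \<in> Restr r S" by (cases m) auto
      show "Dom (poset_cat (Restr r S)) m \<in> Obj (poset_cat (Restr r S)) \<and>
          Cod (poset_cat (Restr r S)) m \<in> Obj (poset_cat (Restr r S)) \<and>
          Dom (poset_cat r') (case m of (i, j) \<Rightarrow> (b i, b j)) = b (Dom (poset_cat (Restr r S)) m) \<and>
          Cod (poset_cat r') (case m of (i, j) \<Rightarrow> (b i, b j)) = b (Cod (poset_cat (Restr r S)) m) \<and>
          G' (case m of (i, j) \<Rightarrow> (b i, b j)) = G m"
        using m G'b[OF m(2)] by (simp add: FS)
    qed
    ultimately show ?thesis by blast
  qed
  ultimately show ?thesis by blast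
qed

text \<open>Pieces of the colimit \<open>c\<close> cut out by sets of indices: \<open>cc S\<close>
  is the colimit of the diagram restricted to \<open>S\<close> with legs \<open>\<iota> S\<close>,
  \<open>u S\<close> compares it with \<open>c\<close>, and \<open>h S S'\<close> compares two
  pieces. Membership of \<open>cc S\<close> in \<open>Q\<close> bounds the pieces independently of
  the diagram.\<close>

definition subset_colimits ::
    "'o set \<Rightarrow> 'k rel \<Rightarrow> ('k \<Rightarrow> 'o) \<Rightarrow> ('k \<times> 'k \<Rightarrow> 'm) \<Rightarrow> 'o \<Rightarrow> ('k \<Rightarrow> 'm) \<Rightarrow> 'k set set \<Rightarrow>
     ('k set \<Rightarrow> 'o) \<Rightarrow> ('k set \<Rightarrow> 'k \<Rightarrow> 'm) \<Rightarrow> ('k set \<Rightarrow> 'm) \<Rightarrow> ('k set \<Rightarrow> 'k set \<Rightarrow> 'm) \<Rightarrow> bool" where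
  "subset_colimits Q r F G c p SS cc \<iota> u h \<longleftrightarrow>
     Refl r \<and> diagram (poset_cat r) C F G \<and> colimit (poset_cat r) C F G c p \<and>
     (\<forall>S\<in>SS. S \<subseteq> Field r \<and> cc S \<in> Q \<and> colimit (poset_cat (Restr r S)) C F G (cc S) (\<iota> S) \<and>
        u S \<in> Hom C (cc S) c \<and> (\<forall>i\<in>S. u S \<cdot> \<iota> S i = p i)) \<and>
     (\<forall>S\<in>SS. \<forall>S'\<in>SS. S \<subseteq> S' \<longrightarrow> h S S' \<in> Hom C (cc S) (cc S') \<and> (\<forall>i\<in>S. h S S' \<cdot> \<iota> S i = \<iota> S' i))"

lemma Field_Restr_Refl: "Refl r \<Longrightarrow> S \<subseteq> Field r \<Longrightarrow> Field (Restr r S) = S"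
  unfolding refl_on_def Field_def by blast

lemma diagram_Restr:
  assumes "diagram (poset_cat r) C F G" shows "diagram (poset_cat (Restr r S)) C F G"
proof -
  have "Field (Restr r S) \<subseteq> Field r" by (auto simp: Field_def)
  then show ?thesis using assms unfolding diagram_poset_iff by blast
qed

lemma subset_colimits_exist:
  assumes r: "Refl r" and dia: "diagram (poset_cat r) C F G" and col: "colimit (poset_cat r) C F G c p"
    and SS: "\<And>S. S \<in> SS \<Longrightarrow> S \<subseteq> Field r"
    and Q: "\<And>S. S \<in> SS \<Longrightarrow> \<exists>c\<in>Q. \<exists>p. colimit (poset_cat (Restr r S)) C F G c p"
  shows "\<exists>cc \<iota> u h. subset_colimits Q r F G c p SS cc \<iota> u h"
proof -
  obtain cc \<iota> where cc: "\<And>S. S \<in> SS \<Longrightarrow> cc S \<in> Q"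
    "\<And>S. S \<in> SS \<Longrightarrow> colimit (poset_cat (Restr r S)) C F G (cc S) (\<iota> S)" using Q by metis
  have FS: "Field (Restr r S) = S" if "S \<in> SS" for S by (rule Field_Restr_Refl[OF r SS[OF that]])
  have uex: "\<exists>u\<in>Hom C (cc S) c. \<forall>i\<in>Obj (poset_cat (Restr r S)). u \<cdot> \<iota> S i = p i" if S: "S \<in> SS" for S
  proof (rule colimit_ex[OF cc(2)[OF S] colimit_obj[OF col]])
    show "p i \<in> Hom C (F i) c" if "i \<in> Obj (poset_cat (Restr r S))" for i
      using colimit_in[OF col, of i] that SS[OF S] by (auto simp: FS[OF S])
    show "p (Cod (poset_cat (Restr r S)) m) \<cdot> G m = p (Dom (poset_cat (Restr r S)) m)"
      if "m \<in> Arr (poset_cat (Restr r S))" for m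
      using colimit_comm[OF col, of m] that by simp
  qed
  have "\<exists>u. u \<in> Hom C (cc S) c \<and> (\<forall>i\<in>S. u \<cdot> \<iota> S i = p i)" if "S \<in> SS" for S
    using uex[OF that] unfolding poset_cat_simps FS[OF that] by blast
  then obtain u where u: "\<And>S. S \<in> SS \<Longrightarrow> u S \<in> Hom C (cc S) c \<and> (\<forall>i\<in>S. u S \<cdot> \<iota> S i = p i)" by metis
  have hex: "\<exists>h\<in>Hom C (cc S) (cc S'). \<forall>i\<in>Obj (poset_cat (Restr r S)). h \<cdot> \<iota> S i = \<iota> S' i"
    if S: "S \<in> SS" "S' \<in> SS" "S \<subseteq> S'" for S S'
  proof (rule colimit_ex[OF cc(2)[OF S(1)] colimit_obj[OF cc(2)[OF S(2)]]])
    show "\<iota> S' i \<in> Hom C (F i) (cc S')" if "i \<in> Obj (poset_cat (Restr r S))" for i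
      using colimit_in[OF cc(2)[OF S(2)], of i] that S(3) by (auto simp: FS[OF S(1)] FS[OF S(2)])
    show "\<iota> S' (Cod (poset_cat (Restr r S)) m) \<cdot> G m = \<iota> S' (Dom (poset_cat (Restr r S)) m)"
      if "m \<in> Arr (poset_cat (Restr r S))" for m
      using colimit_comm[OF cc(2)[OF S(2)], of m] that S(3) by auto
  qed
  have "\<exists>h. S \<in> SS \<and> S' \<in> SS \<and> S \<subseteq> S' \<longrightarrow> h \<in> Hom C (cc S) (cc S') \<and> (\<forall>i\<in>S. h \<cdot> \<iota> S i = \<iota> S' i)"
    for S S'
  proof (cases "S \<in> SS \<and> S' \<in> SS \<and> S \<subseteq> S'")
    case True
    then have "\<exists>h\<in>Hom C (cc S) (cc S'). \<forall>i\<in>S. h \<cdot> \<iota> S i = \<iota> S' i"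
      using hex[of S S'] FS[of S] by (simp del: Hom_iff)
    then show ?thesis by blast
  qed blast
  then obtain h where h: "\<And>S S'. S \<in> SS \<and> S' \<in> SS \<and> S \<subseteq> S' \<longrightarrow>
      h S S' \<in> Hom C (cc S) (cc S') \<and> (\<forall>i\<in>S. h S S' \<cdot> \<iota> S i = \<iota> S' i)" by metis
  have "subset_colimits Q r F G c p SS cc \<iota> u h"
    unfolding subset_colimits_def by (simp add: r dia col SS cc u h del: Hom_iff)
  then show ?thesis by blast
qed

lemma subset_colimitsD:
  assumes "subset_colimits Q r F G c p SS cc \<iota> u h"
  shows "Refl r" "diagram (poset_cat r) C F G" "colimit (poset_cat r) C F G c p"
    "S \<in> SS \<Longrightarrow> S \<subseteq> Field r" "S \<in> SS \<Longrightarrow> cc S \<in> Q"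
    "S \<in> SS \<Longrightarrow> colimit (poset_cat (Restr r S)) C F G (cc S) (\<iota> S)"
    "S \<in> SS \<Longrightarrow> u S \<in> Hom C (cc S) c" "S \<in> SS \<Longrightarrow> i \<in> S \<Longrightarrow> u S \<cdot> \<iota> S i = p i"
    "S \<in> SS \<Longrightarrow> S' \<in> SS \<Longrightarrow> S \<subseteq> S' \<Longrightarrow> h S S' \<in> Hom C (cc S) (cc S')"
    "S \<in> SS \<Longrightarrow> S' \<in> SS \<Longrightarrow> S \<subseteq> S' \<Longrightarrow> i \<in> S \<Longrightarrow> h S S' \<cdot> \<iota> S i = \<iota> S' i"
  using assms unfolding subset_colimits_def by blast+

lemma subset_colimit_in:
  assumes sc: "subset_colimits Q r F G c p SS cc \<iota> u h" and S: "S \<in> SS"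
  shows "i \<in> S \<Longrightarrow> \<iota> S i \<in> Hom C (F i) (cc S)"
    "i \<in> S \<Longrightarrow> j \<in> S \<Longrightarrow> (i, j) \<in> r \<Longrightarrow> \<iota> S j \<cdot> G (i, j) = \<iota> S i"
    "x \<in> Hom C (cc S) T \<Longrightarrow> x' \<in> Hom C (cc S) T \<Longrightarrow> (\<And>i. i \<in> S \<Longrightarrow> x \<cdot> \<iota> S i = x' \<cdot> \<iota> S i) \<Longrightarrow> x = x'"
    "T \<in> Obj C \<Longrightarrow> (\<And>i. i \<in> S \<Longrightarrow> q i \<in> Hom C (F i) T) \<Longrightarrow>
      (\<And>i j. i \<in> S \<Longrightarrow> j \<in> S \<Longrightarrow> (i, j) \<in> r \<Longrightarrow> q j \<cdot> G (i, j) = q i) \<Longrightarrow>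
      \<exists>x\<in>Hom C (cc S) T. \<forall>i\<in>S. x \<cdot> \<iota> S i = q i"
proof -
  note col = subset_colimitsD(6)[OF sc S]
  have FS: "Field (Restr r S) = S"
    by (rule Field_Restr_Refl[OF subset_colimitsD(1)[OF sc] subset_colimitsD(4)[OF sc S]])
  show "i \<in> S \<Longrightarrow> \<iota> S i \<in> Hom C (F i) (cc S)" using colimit_in[OF col, of i] by (simp add: FS)
  show "i \<in> S \<Longrightarrow> j \<in> S \<Longrightarrow> (i, j) \<in> r \<Longrightarrow> \<iota> S j \<cdot> G (i, j) = \<iota> S i"
    using colimit_comm[OF col, of "(i, j)"] by simp
  show "x \<in> Hom C (cc S) T \<Longrightarrow> x' \<in> Hom C (cc S) T \<Longrightarrow> (\<And>i. i \<in> S \<Longrightarrow> x \<cdot> \<iota> S i = x' \<cdot> \<iota> S i) \<Longrightarrow> x = x'"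
    by (rule colimit_eqI[OF diagram_graph_poset[OF diagram_Restr[OF subset_colimitsD(2)[OF sc]]] col])
      (simp_all add: FS)
  show "\<exists>x\<in>Hom C (cc S) T. \<forall>i\<in>S. x \<cdot> \<iota> S i = q i"
    if T: "T \<in> Obj C" and q: "\<And>i. i \<in> S \<Longrightarrow> q i \<in> Hom C (F i) T"
      "\<And>i j. i \<in> S \<Longrightarrow> j \<in> S \<Longrightarrow> (i, j) \<in> r \<Longrightarrow> q j \<cdot> G (i, j) = q i"
  proof -
    have "\<exists>x\<in>Hom C (cc S) T. \<forall>i\<in>Obj (poset_cat (Restr r S)). x \<cdot> \<iota> S i = q i"
      by (rule colimit_ex[OF col T]) (use q in \<open>auto simp: FS\<close>)
    then show ?thesis by (simp add: FS)
  qed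
qed

text \<open>Directedness together with the covering condition puts any two indices of
  \<open>r\<close> into one piece, so a compatible family on the pieces is the same as a cocone on
  the whole diagram. The pieces are indexed through \<open>\<pi>\<close> because the domain and the
  codomain of an arrow will share one index \<open>ro\<close>, with the two projections as
  \<open>\<pi>\<close>.\<close>

lemma subset_colimits_directed:
  fixes ro :: "'k rel"
  assumes sc: "subset_colimits Q r F G c p SS cc \<iota> u h"
    and dir: "directed l ro" and l: "Cinfinite l"
    and pi: "\<And>x. x \<in> Field ro \<Longrightarrow> \<pi> x \<in> SS" and mono: "\<And>x y. (x, y) \<in> ro \<Longrightarrow> \<pi> x \<subseteq> \<pi> y"
    and cover: "\<And>i. i \<in> Field r \<Longrightarrow> \<exists>x\<in>Field ro. i \<in> \<pi> x"
  shows "diagram (poset_cat ro) C (\<lambda>x. cc (\<pi> x)) (\<lambda>(x, y). h (\<pi> x) (\<pi> y))" (is ?dia)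
    and "colimit (poset_cat ro) C (\<lambda>x. cc (\<pi> x)) (\<lambda>(x, y). h (\<pi> x) (\<pi> y)) c (\<lambda>x. u (\<pi> x))" (is ?col)
proof -
  note D = subset_colimitsD[OF sc] and I = subset_colimit_in[OF sc]
  note ord = directed_order[OF dir]
  have hin: "h (\<pi> x) (\<pi> y) \<in> Hom C (cc (\<pi> x)) (cc (\<pi> y))" "i \<in> \<pi> x \<Longrightarrow> h (\<pi> x) (\<pi> y) \<cdot> \<iota> (\<pi> x) i = \<iota> (\<pi> y) i"
    if "(x, y) \<in> ro" for x y i
    using D(9,10)[OF pi[OF FieldI1[OF that]] pi[OF FieldI2[OF that]] mono[OF that]] by blast+
  have ccO: "cc (\<pi> x) \<in> Obj C" if "x \<in> Field ro" for x by (rule colimit_obj[OF D(6)[OF pi[OF that]]])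
  have uh: "u (\<pi> y) \<cdot> h (\<pi> x) (\<pi> y) = u (\<pi> x)" if xy: "(x, y) \<in> ro" for x y
  proof (rule I(3)[OF pi[OF FieldI1[OF xy]] _ D(7)[OF pi[OF FieldI1[OF xy]]]])
    note P = pi[OF FieldI1[OF xy]] pi[OF FieldI2[OF xy]]
    show "u (\<pi> y) \<cdot> h (\<pi> x) (\<pi> y) \<in> Hom C (cc (\<pi> x)) c" using hin(1)[OF xy] D(7)[OF P(2)] by simp
    fix i assume i: "i \<in> \<pi> x"
    then have i': "i \<in> \<pi> y" using mono[OF xy] by blast
    show "(u (\<pi> y) \<cdot> h (\<pi> x) (\<pi> y)) \<cdot> \<iota> (\<pi> x) i = u (\<pi> x) \<cdot> \<iota> (\<pi> x) i"
      using hin(1)[OF xy] hin(2)[OF xy i] D(7)[OF P(2)] D(8)[OF P(1) i] D(8)[OF P(2) i'] I(1)[OF P(1) i] by simp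
  qed
  show ?dia
    unfolding diagram_poset_iff prod.case
  proof (intro conjI ballI allI impI)
    fix x assume x: "x \<in> Field ro"
    show "cc (\<pi> x) \<in> Obj C" by (rule ccO[OF x])
    have xx: "(x, x) \<in> ro" by (rule ord(2)[OF x])
    show "h (\<pi> x) (\<pi> x) = Ident C (cc (\<pi> x))"
      by (rule I(3)[OF pi[OF x] hin(1)[OF xx]]) (use hin(2)[OF xx] I(1)[OF pi[OF x]] ccO[OF x] in simp_all)
  next
    show "h (\<pi> x) (\<pi> y) \<in> Hom C (cc (\<pi> x)) (cc (\<pi> y))" if "(x, y) \<in> ro" for x y by (rule hin(1)[OF that])
    fix x y z assume xy: "(x, y) \<in> ro" and yz: "(y, z) \<in> ro"
    note xz = ord(3)[OF xy yz]
    show "h (\<pi> x) (\<pi> z) = h (\<pi> y) (\<pi> z) \<cdot> h (\<pi> x) (\<pi> y)"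
    proof (rule I(3)[OF pi[OF FieldI1[OF xy]] hin(1)[OF xz]])
      fix i assume i: "i \<in> \<pi> x"
      then have i': "i \<in> \<pi> y" using mono[OF xy] by blast
      show "h (\<pi> x) (\<pi> z) \<cdot> \<iota> (\<pi> x) i = (h (\<pi> y) (\<pi> z) \<cdot> h (\<pi> x) (\<pi> y)) \<cdot> \<iota> (\<pi> x) i"
        using hin(1)[OF xy] hin(1)[OF yz] hin(2)[OF xy i] hin(2)[OF yz i'] hin(2)[OF xz i]
          I(1)[OF pi[OF FieldI1[OF xy]] i] by simp
    qed (use hin(1)[OF xy] hin(1)[OF yz] in simp)
  qed
  show ?col
  proof (rule colimitI)
    show "cocone (poset_cat ro) C (\<lambda>x. cc (\<pi> x)) (\<lambda>(x, y). h (\<pi> x) (\<pi> y)) c (\<lambda>x. u (\<pi> x))"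
      unfolding cocone_def using colimit_obj[OF D(3)] D(7)[OF pi] uh by auto
  next
    fix T q assume q: "cocone (poset_cat ro) C (\<lambda>x. cc (\<pi> x)) (\<lambda>(x, y). h (\<pi> x) (\<pi> y)) T q"
    have T: "T \<in> Obj C" using q unfolding cocone_def by blast
    have qin: "q x \<in> Hom C (cc (\<pi> x)) T" if "x \<in> Field ro" for x using q that unfolding cocone_def by auto
    have qc: "q y \<cdot> h (\<pi> x) (\<pi> y) = q x" if "(x, y) \<in> ro" for x y
      using q that unfolding cocone_def by (auto dest!: bspec[of _ _ "(x, y)"])
    have up: "q y \<cdot> \<iota> (\<pi> y) i = q x \<cdot> \<iota> (\<pi> x) i" if xy: "(x, y) \<in> ro" and i: "i \<in> \<pi> x" for x y i
      using comp_reduce[OF qc[OF xy], of "\<iota> (\<pi> x) i"] hin[OF xy] i qin[OF FieldI2[OF xy]]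
        I(1)[OF pi[OF FieldI1[OF xy]] i] by simp
    have same: "q x \<cdot> \<iota> (\<pi> x) i = q y \<cdot> \<iota> (\<pi> y) i"
      if x: "x \<in> Field ro" "i \<in> \<pi> x" and y: "y \<in> Field ro" "i \<in> \<pi> y" for x y i
    proof -
      obtain z where "(x, z) \<in> ro" "(y, z) \<in> ro" by (rule directed_ub[OF dir l x(1) y(1)])
      then show ?thesis using up[OF _ x(2)] up[OF _ y(2)] by metis
    qed
    obtain X where X: "\<And>i. i \<in> Field r \<Longrightarrow> X i \<in> Field ro" "\<And>i. i \<in> Field r \<Longrightarrow> i \<in> \<pi> (X i)"
      using cover by metis
    \<comment> \<open>The leg at \<open>i\<close> is read off from some piece that contains
      \<open>i\<close>; by \<open>same\<close> every such piece gives the same leg.\<close>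
    define a where "a = (\<lambda>i. q (X i) \<cdot> \<iota> (\<pi> (X i)) i)"
    have a: "a i = q x \<cdot> \<iota> (\<pi> x) i" if "x \<in> Field ro" "i \<in> \<pi> x" for x i
    proof -
      have "i \<in> Field r" using D(4)[OF pi[OF that(1)]] that(2) by blast
      then show ?thesis unfolding a_def using same[OF X(1) X(2) that] by blast
    qed
    have "\<exists>H\<in>Hom C c T. \<forall>i\<in>Obj (poset_cat r). H \<cdot> p i = a i"
    proof (rule colimit_ex[OF D(3) T])
      show "a i \<in> Hom C (F i) T" if "i \<in> Obj (poset_cat r)" for i
        unfolding a_def using qin[OF X(1)[of i]] I(1)[OF pi[OF X(1)[of i]] X(2)[of i]] that by simp
      fix m assume "m \<in> Arr (poset_cat r)"
      then obtain i j where m: "m = (i, j)" "(i, j) \<in> r" by (cases m) auto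
      have ij: "i \<in> Field r" "j \<in> Field r" using m(2) by (auto simp: Field_def)
      \<comment> \<open>Both ends of the arrow lie in one \<open>\<pi> z\<close>, and the restricted
        diagram contains every arrow between its indices.\<close>
      obtain z where z: "z \<in> Field ro" "(X i, z) \<in> ro" "(X j, z) \<in> ro"
        by (rule directed_ub[OF dir l X(1)[OF ij(1)] X(1)[OF ij(2)]])
      have iz: "i \<in> \<pi> z" "j \<in> \<pi> z" using X(2)[OF ij(1)] X(2)[OF ij(2)] mono[OF z(2)] mono[OF z(3)] by blast+
      have Gin: "G (i, j) \<in> Hom C (F i) (F j)" using D(2) m(2) unfolding diagram_poset_iff by blast
      have "a j \<cdot> G (i, j) = a i" unfolding a[OF z(1) iz(1)] a[OF z(1) iz(2)]
        using I(1)[OF pi[OF z(1)] iz(2)] I(2)[OF pi[OF z(1)] iz m(2)] qin[OF z(1)] Gin by simp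
      then show "a (Cod (poset_cat r) m) \<cdot> G m = a (Dom (poset_cat r) m)" using m by simp
    qed
    then obtain H where H: "H \<in> Hom C c T" "\<And>i. i \<in> Field r \<Longrightarrow> H \<cdot> p i = a i" by auto
    have "H \<cdot> u (\<pi> x) = q x" if x: "x \<in> Field ro" for x
    proof (rule I(3)[OF pi[OF x] _ qin[OF x]])
      show "H \<cdot> u (\<pi> x) \<in> Hom C (cc (\<pi> x)) T" using H(1) D(7)[OF pi[OF x]] by simp
      fix i assume i: "i \<in> \<pi> x"
      have "i \<in> Field r" using D(4)[OF pi[OF x]] i by blast
      then show "(H \<cdot> u (\<pi> x)) \<cdot> \<iota> (\<pi> x) i = q x \<cdot> \<iota> (\<pi> x) i"
        using H a[OF x i] D(7)[OF pi[OF x]] D(8)[OF pi[OF x] i] I(1)[OF pi[OF x] i] by simp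
    qed
    then show "\<exists>H\<in>Hom C c T. \<forall>x\<in>Obj (poset_cat ro). H \<cdot> u (\<pi> x) = q x"
      using H(1) by (intro bexI[of _ H]) simp_all
  next
    fix T U V assume U: "U \<in> Hom C c T" and V: "V \<in> Hom C c T"
      and "\<And>x. x \<in> Obj (poset_cat ro) \<Longrightarrow> U \<cdot> u (\<pi> x) = V \<cdot> u (\<pi> x)"
    then have eq: "U \<cdot> u (\<pi> x) = V \<cdot> u (\<pi> x)" if "x \<in> Field ro" for x using that by simp
    show "U = V"
    proof (rule colimit_eqI[OF diagram_graph_poset[OF D(2)] D(3) U V])
      fix i assume "i \<in> Obj (poset_cat r)"
      then obtain x where x: "x \<in> Field ro" "i \<in> \<pi> x" using cover by auto
      have "U \<cdot> (u (\<pi> x) \<cdot> \<iota> (\<pi> x) i) = V \<cdot> (u (\<pi> x) \<cdot> \<iota> (\<pi> x) i)"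
        by (rule comp_cong2[OF eq[OF x(1)]]) (use U V D(7)[OF pi[OF x(1)]] I(1)[OF pi[OF x(1)] x(2)] in simp_all)
      then show "U \<cdot> p i = V \<cdot> p i" using D(8)[OF pi[OF x(1)] x(2)] by simp
    qed
  qed
qed

text \<open>A presentation of \<open>w\<close> as an \<open>l\<close>-directed colimit in the
  category of arrows, unfolded into colimits of the domains and of the codomains over the same
  index.\<close>

definition resolution where
  "resolution l w ro wi Ca Da pc pd \<longleftrightarrow> directed l ro \<and> (\<forall>i\<in>Field ro. wi i \<in> Arr C) \<and>
     diagram (poset_cat ro) C (\<lambda>i. Dom C (wi i)) Ca \<and> diagram (poset_cat ro) C (\<lambda>i. Cod C (wi i)) Da \<and>
     colimit (poset_cat ro) C (\<lambda>i. Dom C (wi i)) Ca (Dom C w) pc \<and>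
     colimit (poset_cat ro) C (\<lambda>i. Cod C (wi i)) Da (Cod C w) pd \<and>
     (\<forall>i j. (i, j) \<in> ro \<longrightarrow> wi j \<cdot> Ca (i, j) = Da (i, j) \<cdot> wi i) \<and>
     (\<forall>i\<in>Field ro. w \<cdot> pc i = pd i \<cdot> wi i)"

text \<open>The stages are indexed by the pairs \<open>(S1, S2)\<close> of small sets of indices such that the arrow
  \<open>w\<close> restricts to the corresponding colimits: \<open>S2\<close> has to contain the indices \<open>m i\<close> through which
  \<open>w\<close> factors on \<open>F1 i\<close>, and the indices \<open>n i j\<close> at which these factorizations become compatible.\<close>

lemma arrow_resolution:
  assumes gen: "generating l P" and lt: "l \<le>o chain_ord t" and t: "regular_above B t"
  shows "\<exists>Q. small k Q \<and> Q \<subseteq> Arr C \<and> (\<forall>w\<in>Arr C. \<exists>ro wi Ca Da pc pd.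
    resolution (chain_ord t) w (ro :: 'k rel) wi Ca Da pc pd \<and> (\<forall>i\<in>Field ro. wi i \<in> Q))"
proof -
  have l: "regular_cardinal l" and P: "small k P" "P \<subseteq> Obj C" and prs: "\<And>A. A \<in> P \<Longrightarrow> presentable C l A"
    using gen generating_Obj by (auto simp: generating_def)
  \<comment> \<open>Compactness at \<open>l\<close>, not only at \<open>t\<close>, matters: the
    presentations of the two ends of \<open>w\<close> are only \<open>l\<close>-directed.\<close>
  have Pc: "compact_at l A" if "A \<in> P" for A
    using presentable_compact[OF prs[OF that] l] l ordLeq_refl unfolding regular_cardinal_def by blast
  have li: "Cinfinite l" using l by (simp add: regular_cardinal_def)
  have ti: "Cinfinite (chain_ord t)" using t by (simp add: regular_above_def)
  note cb = card_below[OF t]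
  obtain Q0 where Q0: "small k Q0" "Q0 \<subseteq> Obj C"
    and Q0c: "\<forall>(r :: 'k rel) F G S. Refl r \<and> diagram (poset_cat r) C F G \<and> S \<subseteq> Field r \<and> |S| <o chain_ord t \<and>
      (\<forall>i\<in>S. F i \<in> P) \<longrightarrow> (\<exists>c\<in>Q0. \<exists>p. colimit (poset_cat (Restr r S)) C F G c p)"
    using small_set_of_colimits[OF P t] by (elim exE conjE)
  define Q where "Q = (\<Union>a\<in>Q0. \<Union>b\<in>Q0. Hom C a b)"
  have "small k Q" unfolding Q_def by (intro small_UNION Q0 small_Hom)
  moreover have "Q \<subseteq> Arr C" by (auto simp: Q_def)
  moreover have "\<exists>ro wi Ca Da pc pd. resolution (chain_ord t) w (ro :: 'k rel) wi Ca Da pc pd \<and> (\<forall>i\<in>Field ro. wi i \<in> Q)"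
    if w: "w \<in> Arr C" for w
  proof -
    have res: "\<exists>r F G p cc \<iota> u h. directed l r \<and> (\<forall>i\<in>Field r. F i \<in> P) \<and>
      subset_colimits Q0 r F G c p {S. S \<subseteq> Field r \<and> |S| <o chain_ord t} cc \<iota> u h" if c: "c \<in> Obj C" for c
    proof -
      obtain r F G p where d: "directed l r" and dia: "diagram (poset_cat r) C F G"
        and FP: "\<And>i. i \<in> Field r \<Longrightarrow> F i \<in> P" and col: "colimit (poset_cat r) C F G c p"
        by (rule generatingE[OF gen c]) (rule that)
      have refl: "Refl r" using directed_order(1)[OF d] by (simp add: partial_order_on_def preorder_on_def)
      have "\<exists>cc \<iota> u h. subset_colimits Q0 r F G c p {S. S \<subseteq> Field r \<and> |S| <o chain_ord t} cc \<iota> u h"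
      proof (rule subset_colimits_exist[OF refl dia col])
        fix S assume "S \<in> {S. S \<subseteq> Field r \<and> |S| <o chain_ord t}"
        then have S: "S \<subseteq> Field r" "|S| <o chain_ord t" by blast+
        show "S \<subseteq> Field r" by (rule S)
        have "\<forall>i\<in>S. F i \<in> P" using FP S(1) by blast
        then show "\<exists>c\<in>Q0. \<exists>p. colimit (poset_cat (Restr r S)) C F G c p" using Q0c refl dia S by blast
      qed
      then show ?thesis using d FP by blast
    qed
    obtain r1 F1 G1 p1 c1 \<iota>1 u1 h1 where d1: "directed l r1" and F1: "\<forall>i\<in>Field r1. F1 i \<in> P"
      and s1: "subset_colimits Q0 r1 F1 G1 (Dom C w) p1 {S. S \<subseteq> Field r1 \<and> |S| <o chain_ord t} c1 \<iota>1 u1 h1"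
      using res[OF dom_in_Obj[OF w]] by (elim exE conjE) (rule that)
    obtain r2 F2 G2 p2 c2 \<iota>2 u2 h2 where d2: "directed l r2" and F2: "\<forall>i\<in>Field r2. F2 i \<in> P"
      and s2: "subset_colimits Q0 r2 F2 G2 (Cod C w) p2 {S. S \<subseteq> Field r2 \<and> |S| <o chain_ord t} c2 \<iota>2 u2 h2"
      using res[OF cod_in_Obj[OF w]] by (elim exE conjE) (rule that)
    note F1 = bspec[OF F1] and F2 = bspec[OF F2]
    note D1 = subset_colimitsD[OF s1] and D2 = subset_colimitsD[OF s2]
    note I1 = subset_colimit_in[OF s1] and I2 = subset_colimit_in[OF s2]
    have p1: "p1 i \<in> Hom C (F1 i) (Dom C w)" if "i \<in> Field r1" for i using colimit_in[OF D1(3), of i] that by simp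
    have p2: "p2 i \<in> Hom C (F2 i) (Cod C w)" if "i \<in> Field r2" for i using colimit_in[OF D2(3), of i] that by simp
    have p1c: "p1 j \<cdot> G1 (i, j) = p1 i" if "(i, j) \<in> r1" for i j using colimit_comm[OF D1(3), of "(i, j)"] that by simp
    have p2c: "p2 j \<cdot> G2 (i, j) = p2 i" if "(i, j) \<in> r2" for i j using colimit_comm[OF D2(3), of "(i, j)"] that by simp
    have G1: "G1 (i, j) \<in> Hom C (F1 i) (F1 j)" if "(i, j) \<in> r1" for i j
      using D1(2) that unfolding diagram_poset_iff by blast
    have G2: "G2 (i, j) \<in> Hom C (F2 i) (F2 j)" if "(i, j) \<in> r2" for i j
      using D2(2) that unfolding diagram_poset_iff by blast
    have G2c: "G2 (i, a) = G2 (j, a) \<cdot> G2 (i, j)" if "(i, j) \<in> r2" "(j, a) \<in> r2" for i j a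
      using D2(2) that unfolding diagram_poset_iff by blast
    have "\<exists>m\<in>Field r2. \<exists>\<mu>\<in>Hom C (F1 i) (F2 m). p2 m \<cdot> \<mu> = w \<cdot> p1 i" if i: "i \<in> Field r1" for i
      by (rule compactD(1)[OF Pc[OF F1[OF i]] d2 D2(2,3)]) (use p1[OF i] w in simp)
    then obtain m \<mu> where m: "\<And>i. i \<in> Field r1 \<Longrightarrow> m i \<in> Field r2"
      "\<And>i. i \<in> Field r1 \<Longrightarrow> \<mu> i \<in> Hom C (F1 i) (F2 (m i))" "\<And>i. i \<in> Field r1 \<Longrightarrow> p2 (m i) \<cdot> \<mu> i = w \<cdot> p1 i"
      by metis
    have "\<exists>n. (i, j) \<in> r1 \<longrightarrow> (m i, n) \<in> r2 \<and> (m j, n) \<in> r2 \<and> G2 (m i, n) \<cdot> \<mu> i = G2 (m j, n) \<cdot> (\<mu> j \<cdot> G1 (i, j))" for i j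
    proof (cases "(i, j) \<in> r1")
      case ij: True
      have F: "i \<in> Field r1" "j \<in> Field r1" using ij by (auto simp: Field_def)
      obtain a where a: "a \<in> Field r2" "(m i, a) \<in> r2" "(m j, a) \<in> r2"
        by (rule directed_ub[OF d2 li m(1)[OF F(1)] m(1)[OF F(2)]])
      note H = m(2)[OF F(1)] m(2)[OF F(2)] G2[OF a(2)] G2[OF a(3)] G1[OF ij] p2[OF a(1)] p1[OF F(2)]
      have "p2 a \<cdot> (G2 (m i, a) \<cdot> \<mu> i) = p2 (m i) \<cdot> \<mu> i"
        by (rule comp_reduce[OF p2c[OF a(2)]]) (use H in simp_all)
      moreover have "p2 a \<cdot> (G2 (m j, a) \<cdot> (\<mu> j \<cdot> G1 (i, j))) = p2 (m j) \<cdot> (\<mu> j \<cdot> G1 (i, j))"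
        by (rule comp_reduce[OF p2c[OF a(3)]]) (use H in simp_all)
      moreover have "p2 (m j) \<cdot> (\<mu> j \<cdot> G1 (i, j)) = (w \<cdot> p1 j) \<cdot> G1 (i, j)"
        by (rule comp_reduce[OF m(3)[OF F(2)]]) (use H p2[OF m(1)[OF F(2)]] in simp_all)
      moreover have "(w \<cdot> p1 j) \<cdot> G1 (i, j) = w \<cdot> p1 i" using p1c[OF ij] H w by simp
      ultimately have "p2 a \<cdot> (G2 (m i, a) \<cdot> \<mu> i) = p2 a \<cdot> (G2 (m j, a) \<cdot> (\<mu> j \<cdot> G1 (i, j)))"
        using m(3)[OF F(1)] by simp
      then have "\<exists>n. (a, n) \<in> r2 \<and> G2 (a, n) \<cdot> (G2 (m i, a) \<cdot> \<mu> i) = G2 (a, n) \<cdot> (G2 (m j, a) \<cdot> (\<mu> j \<cdot> G1 (i, j)))"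
        by (intro compactD(2)[OF Pc[OF F1[OF F(1)]] d2 D2(2,3) a(1)]) (use H in simp_all)
      then obtain n where n: "(a, n) \<in> r2"
        "G2 (a, n) \<cdot> (G2 (m i, a) \<cdot> \<mu> i) = G2 (a, n) \<cdot> (G2 (m j, a) \<cdot> (\<mu> j \<cdot> G1 (i, j)))" by blast
      have "G2 (m i, n) \<cdot> \<mu> i = G2 (m j, n) \<cdot> (\<mu> j \<cdot> G1 (i, j))"
        unfolding G2c[OF a(2) n(1)] G2c[OF a(3) n(1)] using n(2) H G2[OF n(1)] by simp
      then show ?thesis using directed_order(3)[OF d2 a(2) n(1)] directed_order(3)[OF d2 a(3) n(1)] by blast
    qed simp
    then obtain n where n: "\<And>i j. (i, j) \<in> r1 \<Longrightarrow> (m i, n i j) \<in> r2 \<and> (m j, n i j) \<in> r2 \<and>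
        G2 (m i, n i j) \<cdot> \<mu> i = G2 (m j, n i j) \<cdot> (\<mu> j \<cdot> G1 (i, j))" by metis
    \<comment> \<open>By regularity of \<open>t\<close> this set again has fewer than
      \<open>t\<close> elements. It also supplies the \<open>n i j\<close>, so that the maps
      \<open>\<mu> i\<close> become a cocone inside the piece given by \<open>S2\<close>.\<close>
    define need where "need = (\<lambda>S. m ` S \<union> (\<Union>i\<in>S. n i ` {j \<in> S. (i, j) \<in> r1}))"
    have need_small: "|need S| <o chain_ord t" if S: "|S| <o chain_ord t" for S
      unfolding need_def by (intro cb(3) cb(2) cb(4) S) (rule cb(1)[OF _ S], blast)
    have need_Field: "need S \<subseteq> Field r2" if "S \<subseteq> Field r1" for S
      unfolding need_def using that m(1) by (auto intro: FieldI2[OF conjunct1[OF n]])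
    define \<Xi> where "\<Xi> = {(S1, S2). S1 \<subseteq> Field r1 \<and> |S1| <o chain_ord t \<and> S2 \<subseteq> Field r2 \<and> |S2| <o chain_ord t \<and>
        need S1 \<subseteq> S2}"
    have "small k \<Xi>"
    proof (rule small_subset)
      show "\<Xi> \<subseteq> Pow (Field r1) \<times> Pow (Field r2)" by (auto simp: \<Xi>_def)
      show "small k (Pow (Field r1) \<times> Pow (Field r2))"
        using d1 d2 unfolding directed_def by (intro small_Sigma small_Pow) (auto simp: small_def)
    qed
    then obtain b :: "'k set \<times> 'k set \<Rightarrow> 'k" where b: "inj_on b \<Xi>" using small_embed by blast
    define d where "d = the_inv_into \<Xi> b"
    have db: "d (b X) = X" if "X \<in> \<Xi>" for X unfolding d_def by (rule the_inv_into_f_f[OF b that])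
    define ro where "ro = {(b X, b X') | X X'. X \<in> \<Xi> \<and> X' \<in> \<Xi> \<and> fst X \<subseteq> fst X' \<and> snd X \<subseteq> snd X'}"
    have roI: "(b X, b X') \<in> ro" if "X \<in> \<Xi>" "X' \<in> \<Xi>" "fst X \<subseteq> fst X'" "snd X \<subseteq> snd X'" for X X'
      using that unfolding ro_def by blast
    have Fro: "Field ro = b ` \<Xi>"
    proof
      show "Field ro \<subseteq> b ` \<Xi>" by (auto simp: ro_def Field_def)
      show "b ` \<Xi> \<subseteq> Field ro" using roI[OF _ _ subset_refl subset_refl] by (auto simp: Field_def)
    qed
    have dX: "d x \<in> \<Xi>" if "x \<in> Field ro" for x using that db unfolding Fro by auto
    have roD: "fst (d x) \<subseteq> fst (d y)" "snd (d x) \<subseteq> snd (d y)" if "(x, y) \<in> ro" for x y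
      using that db unfolding ro_def by auto
    have dir: "directed (chain_ord t) ro" unfolding directed_def
    proof (intro conjI allI impI)
      have "refl_on (Field ro) ro" unfolding refl_on_def Fro
        using roI by (auto simp: ro_def)
      moreover have "trans ro"
      proof (rule transI)
        fix x y z assume "(x, y) \<in> ro" "(y, z) \<in> ro"
        then obtain X Y Y' Z where X: "x = b X" "y = b Y" "X \<in> \<Xi>" "Y \<in> \<Xi>" "fst X \<subseteq> fst Y" "snd X \<subseteq> snd Y"
          "y = b Y'" "z = b Z" "Y' \<in> \<Xi>" "Z \<in> \<Xi>" "fst Y' \<subseteq> fst Z" "snd Y' \<subseteq> snd Z" unfolding ro_def by blast
        have "Y = Y'" using X b by (metis inj_onD)
        then show "(x, z) \<in> ro" using X unfolding ro_def by blast
      qed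
      moreover have "antisym ro"
      proof (rule antisymI)
        fix x y assume "(x, y) \<in> ro" "(y, x) \<in> ro"
        then have "d x = d y" "x \<in> b ` \<Xi>" "y \<in> b ` \<Xi>"
          using roD[of x y] roD[of y x] Fro by (auto simp: prod_eq_iff Field_def)
        then show "x = y" using db by auto
      qed
      ultimately show "Partial_order ro"
        by (auto simp: partial_order_on_def preorder_on_def Field_def)
      show "small TYPE('k) (Field ro)"
        using small_image[OF \<open>small k \<Xi>\<close>, of b] unfolding Fro by (simp add: small_def)
      fix S assume S: "S \<subseteq> Field ro" "|S| <o chain_ord t"
      define U1 where "U1 = (\<Union>x\<in>S. fst (d x))"
      \<comment> \<open>\<open>need\<close> depends on the first component only, so adding
        \<open>need U1\<close> once restores the condition of \<open>\<Xi>\<close> and no iteration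
        is called for.\<close>
      define U2 where "U2 = (\<Union>x\<in>S. snd (d x)) \<union> need U1"
      have dS: "d x \<in> \<Xi>" if "x \<in> S" for x using dX that S(1) by blast
      have 1: "U1 \<subseteq> Field r1" "(\<Union>x\<in>S. snd (d x)) \<subseteq> Field r2"
        unfolding U1_def using dS by (auto simp: \<Xi>_def split: prod.splits; fastforce)+
      have 2: "|U1| <o chain_ord t" "|\<Union>x\<in>S. snd (d x)| <o chain_ord t"
        unfolding U1_def by (intro cb(4) S(2); use dS in \<open>fastforce simp: \<Xi>_def\<close>)+
      have "(U1, U2) \<in> \<Xi>"
        using 1 2 need_Field[OF 1(1)] cb(3)[OF 2(2) need_small[OF 2(1)]] unfolding \<Xi>_def U2_def by auto
      moreover have "(x, b (U1, U2)) \<in> ro" if x: "x \<in> S" for x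
      proof -
        have "(b (d x), b (U1, U2)) \<in> ro"
          using x by (intro roI dS[OF x] \<open>(U1, U2) \<in> \<Xi>\<close>) (auto simp: U1_def U2_def)
        moreover have "b (d x) = x" using x S(1) db unfolding Fro by auto
        ultimately show ?thesis by simp
      qed
      ultimately show "\<exists>y\<in>Field ro. \<forall>x\<in>S. (x, y) \<in> ro" unfolding Fro by blast
    qed
    let ?\<pi>1 = "\<lambda>x. fst (d x)" and ?\<pi>2 = "\<lambda>x. snd (d x)"
    have pi1: "?\<pi>1 x \<in> {S. S \<subseteq> Field r1 \<and> |S| <o chain_ord t}" and pi2: "?\<pi>2 x \<in> {S. S \<subseteq> Field r2 \<and> |S| <o chain_ord t}"
      and pn: "need (?\<pi>1 x) \<subseteq> ?\<pi>2 x" if "x \<in> Field ro" for x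
      using dX[OF that] unfolding \<Xi>_def by auto
    have cov1: "\<exists>x\<in>Field ro. i \<in> ?\<pi>1 x" if i: "i \<in> Field r1" for i
    proof -
      have "({i}, need {i}) \<in> \<Xi>"
        using i cb(5)[of "{i}"] need_small[of "{i}"] need_Field[of "{i}"] by (simp add: \<Xi>_def)
      then show ?thesis using db unfolding Fro by (intro bexI[of _ "b ({i}, need {i})"]) auto
    qed
    have cov2: "\<exists>x\<in>Field ro. i \<in> ?\<pi>2 x" if i: "i \<in> Field r2" for i
    proof -
      \<comment> \<open>\<open>need {}\<close> is empty, so an index of the codomain can be covered
        with nothing on the side of the domain.\<close>
      have "({}, {i}) \<in> \<Xi>" using i cb(5)[of "{i}"] cb(5)[of "{}"] by (simp add: \<Xi>_def need_def)
      then show ?thesis using db unfolding Fro by (intro bexI[of _ "b ({}, {i})"]) auto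
    qed
    note R1 = subset_colimits_directed[where \<pi> = ?\<pi>1, OF s1 dir ti pi1 roD(1) cov1]
    note R2 = subset_colimits_directed[where \<pi> = ?\<pi>2, OF s2 dir ti pi2 roD(2) cov2]
    have mi: "m i \<in> ?\<pi>2 x" "i \<in> Field r1" if "x \<in> Field ro" "i \<in> ?\<pi>1 x" for x i
      using pn[OF that(1)] that(2) pi1[OF that(1)] unfolding need_def by auto
    have "\<exists>v\<in>Hom C (c1 (?\<pi>1 x)) (c2 (?\<pi>2 x)). \<forall>i\<in>?\<pi>1 x. v \<cdot> \<iota>1 (?\<pi>1 x) i = \<iota>2 (?\<pi>2 x) (m i) \<cdot> \<mu> i"
      if x: "x \<in> Field ro" for x
    proof (rule I1(4)[OF pi1[OF x]])
      show "c2 (?\<pi>2 x) \<in> Obj C" by (rule colimit_obj[OF D2(6)[OF pi2[OF x]]])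
      show "\<iota>2 (?\<pi>2 x) (m i) \<cdot> \<mu> i \<in> Hom C (F1 i) (c2 (?\<pi>2 x))" if i: "i \<in> ?\<pi>1 x" for i
        using I2(1)[OF pi2[OF x] mi(1)[OF x i]] m(2)[OF mi(2)[OF x i]] by simp
      fix i j assume i: "i \<in> ?\<pi>1 x" and j: "j \<in> ?\<pi>1 x" and ij: "(i, j) \<in> r1"
      have nx: "n i j \<in> ?\<pi>2 x" using pn[OF x] i j ij unfolding need_def by auto
      have nij: "(m i, n i j) \<in> r2" "(m j, n i j) \<in> r2"
        "G2 (m i, n i j) \<cdot> \<mu> i = G2 (m j, n i j) \<cdot> (\<mu> j \<cdot> G1 (i, j))" using n[OF ij] by blast+
      note H = I2(1)[OF pi2[OF x] mi(1)[OF x i]] I2(1)[OF pi2[OF x] mi(1)[OF x j]] I2(1)[OF pi2[OF x] nx]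
        m(2)[OF mi(2)[OF x i]] m(2)[OF mi(2)[OF x j]] G1[OF ij] G2[OF nij(1)] G2[OF nij(2)]
      have "(\<iota>2 (?\<pi>2 x) (m j) \<cdot> \<mu> j) \<cdot> G1 (i, j) = \<iota>2 (?\<pi>2 x) (m j) \<cdot> (\<mu> j \<cdot> G1 (i, j))" using H by simp
      also have "\<dots> = \<iota>2 (?\<pi>2 x) (n i j) \<cdot> (G2 (m j, n i j) \<cdot> (\<mu> j \<cdot> G1 (i, j)))"
        by (rule comp_reduce[OF I2(2)[OF pi2[OF x] mi(1)[OF x j] nx nij(2)], symmetric]) (use H in simp_all)
      also have "\<dots> = \<iota>2 (?\<pi>2 x) (n i j) \<cdot> (G2 (m i, n i j) \<cdot> \<mu> i)" using nij(3) by simp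
      also have "\<dots> = \<iota>2 (?\<pi>2 x) (m i) \<cdot> \<mu> i"
        by (rule comp_reduce[OF I2(2)[OF pi2[OF x] mi(1)[OF x i] nx nij(1)]]) (use H in simp_all)
      finally show "(\<iota>2 (?\<pi>2 x) (m j) \<cdot> \<mu> j) \<cdot> G1 (i, j) = \<iota>2 (?\<pi>2 x) (m i) \<cdot> \<mu> i" .
    qed
    then obtain wi where wi: "\<And>x. x \<in> Field ro \<Longrightarrow> wi x \<in> Hom C (c1 (?\<pi>1 x)) (c2 (?\<pi>2 x))"
      "\<And>x i. x \<in> Field ro \<Longrightarrow> i \<in> ?\<pi>1 x \<Longrightarrow> wi x \<cdot> \<iota>1 (?\<pi>1 x) i = \<iota>2 (?\<pi>2 x) (m i) \<cdot> \<mu> i" by metis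
    let ?Ca = "\<lambda>(x, y). h1 (?\<pi>1 x) (?\<pi>1 y)" and ?Da = "\<lambda>(x, y). h2 (?\<pi>2 x) (?\<pi>2 y)"
    have wiD: "c1 (?\<pi>1 x) = Dom C (wi x)" "c2 (?\<pi>2 x) = Cod C (wi x)" if "x \<in> Field ro" for x
      using wi(1)[OF that] by simp_all
    \<comment> \<open>\<open>resolution\<close> speaks of \<open>Dom C (wi x)\<close> and
      \<open>Cod C (wi x)\<close>, which agree with the chosen colimit objects only for
      \<open>x\<close> in the field of \<open>ro\<close>.\<close>
    have dcong: "diagram (poset_cat ro) C F'' G'"
      if d: "diagram (poset_cat ro) C F' G'" and eq: "\<And>x. x \<in> Field ro \<Longrightarrow> F' x = F'' x" for F' F'' G'
      unfolding diagram_poset_iff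
    proof (intro conjI ballI allI impI)
      show "F'' x \<in> Obj C" "G' (x, x) = Ident C (F'' x)" if "x \<in> Field ro" for x
        using d that unfolding diagram_poset_iff eq[OF that, symmetric] by blast+
      show "G' (x, y) \<in> Hom C (F'' x) (F'' y)" if xy: "(x, y) \<in> ro" for x y
        using d xy unfolding diagram_poset_iff eq[OF FieldI1[OF xy], symmetric] eq[OF FieldI2[OF xy], symmetric]
        by blast
      show "G' (x, z) = G' (y, z) \<cdot> G' (x, y)" if "(x, y) \<in> ro" "(y, z) \<in> ro" for x y z
        using d that unfolding diagram_poset_iff by blast
    qed
    have ccong: "colimit (poset_cat ro) C F'' G' c' p'"
      if "colimit (poset_cat ro) C F' G' c' p'" "\<And>x. x \<in> Field ro \<Longrightarrow> F' x = F'' x" for F' F'' G' c' p'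
      by (rule colimit_cong[OF that(1)]) (use that(2) in \<open>auto simp: Field_def\<close>)
    have "resolution (chain_ord t) w ro wi ?Ca ?Da (\<lambda>x. u1 (?\<pi>1 x)) (\<lambda>x. u2 (?\<pi>2 x))"
      unfolding resolution_def
    proof (intro conjI ballI allI impI)
      show "directed (chain_ord t) ro" by (rule dir)
      show "diagram (poset_cat ro) C (\<lambda>i. Dom C (wi i)) ?Ca" by (rule dcong[OF R1(1) wiD(1)])
      show "diagram (poset_cat ro) C (\<lambda>i. Cod C (wi i)) ?Da" by (rule dcong[OF R2(1) wiD(2)])
      show "colimit (poset_cat ro) C (\<lambda>i. Dom C (wi i)) ?Ca (Dom C w) (\<lambda>x. u1 (?\<pi>1 x))"
        by (rule ccong[OF R1(2) wiD(1)])
      show "colimit (poset_cat ro) C (\<lambda>i. Cod C (wi i)) ?Da (Cod C w) (\<lambda>x. u2 (?\<pi>2 x))"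
        by (rule ccong[OF R2(2) wiD(2)])
      show "wi x \<in> Arr C" if "x \<in> Field ro" for x using wi(1)[OF that] by simp
    next
      fix x y assume xy: "(x, y) \<in> ro"
      have x: "x \<in> Field ro" and y: "y \<in> Field ro" using xy by (auto simp: Field_def)
      note H1 = D1(9,10)[OF pi1[OF x] pi1[OF y] roD(1)[OF xy]] and H2 = D2(9,10)[OF pi2[OF x] pi2[OF y] roD(2)[OF xy]]
      have "wi y \<cdot> h1 (?\<pi>1 x) (?\<pi>1 y) = h2 (?\<pi>2 x) (?\<pi>2 y) \<cdot> wi x"
      proof (rule I1(3)[OF pi1[OF x], of _ "c2 (?\<pi>2 y)"])
        fix i assume i: "i \<in> ?\<pi>1 x"
        then have iy: "i \<in> ?\<pi>1 y" using roD(1)[OF xy] by blast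
        note H = H1(1) H2(1) I1(1)[OF pi1[OF x] i] I2(1)[OF pi2[OF x] mi(1)[OF x i]] wi(1)[OF x] wi(1)[OF y]
          m(2)[OF mi(2)[OF x i]]
        have "(wi y \<cdot> h1 (?\<pi>1 x) (?\<pi>1 y)) \<cdot> \<iota>1 (?\<pi>1 x) i = \<iota>2 (?\<pi>2 y) (m i) \<cdot> \<mu> i"
          using H H1(2)[OF i] wi(2)[OF y iy] by simp
        also have "\<dots> = h2 (?\<pi>2 x) (?\<pi>2 y) \<cdot> (\<iota>2 (?\<pi>2 x) (m i) \<cdot> \<mu> i)"
          by (rule comp_reduce[OF H2(2)[OF mi(1)[OF x i]], symmetric]) (use H in simp_all)
        also have "\<dots> = (h2 (?\<pi>2 x) (?\<pi>2 y) \<cdot> wi x) \<cdot> \<iota>1 (?\<pi>1 x) i"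
          using H wi(2)[OF x i] by simp
        finally show "(wi y \<cdot> h1 (?\<pi>1 x) (?\<pi>1 y)) \<cdot> \<iota>1 (?\<pi>1 x) i = (h2 (?\<pi>2 x) (?\<pi>2 y) \<cdot> wi x) \<cdot> \<iota>1 (?\<pi>1 x) i" .
      qed (use H1(1) H2(1) wi(1)[OF x] wi(1)[OF y] in simp_all)
      then show "wi y \<cdot> ?Ca (x, y) = ?Da (x, y) \<cdot> wi x" by simp
    next
      fix x assume x: "x \<in> Field ro"
      note U = D1(7)[OF pi1[OF x]] D2(7)[OF pi2[OF x]]
      show "w \<cdot> u1 (?\<pi>1 x) = u2 (?\<pi>2 x) \<cdot> wi x"
      proof (rule I1(3)[OF pi1[OF x], of _ "Cod C w"])
        fix i assume i: "i \<in> ?\<pi>1 x"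
        note H = U wi(1)[OF x] I1(1)[OF pi1[OF x] i] I2(1)[OF pi2[OF x] mi(1)[OF x i]] m(2)[OF mi(2)[OF x i]] w
        have "(u2 (?\<pi>2 x) \<cdot> wi x) \<cdot> \<iota>1 (?\<pi>1 x) i = u2 (?\<pi>2 x) \<cdot> (\<iota>2 (?\<pi>2 x) (m i) \<cdot> \<mu> i)"
          using H wi(2)[OF x i] by simp
        also have "\<dots> = p2 (m i) \<cdot> \<mu> i"
          by (rule comp_reduce[OF D2(8)[OF pi2[OF x] mi(1)[OF x i]]]) (use H in simp_all)
        also have "\<dots> = (w \<cdot> u1 (?\<pi>1 x)) \<cdot> \<iota>1 (?\<pi>1 x) i"
          using m(3)[OF mi(2)[OF x i]] D1(8)[OF pi1[OF x] i] H by simp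
        finally show "(w \<cdot> u1 (?\<pi>1 x)) \<cdot> \<iota>1 (?\<pi>1 x) i = (u2 (?\<pi>2 x) \<cdot> wi x) \<cdot> \<iota>1 (?\<pi>1 x) i" by simp
      qed (use U wi(1)[OF x] w in simp_all)
    qed
    moreover have "wi x \<in> Q" if x: "x \<in> Field ro" for x
      using wi(1)[OF x] D1(5)[OF pi1[OF x]] D2(5)[OF pi2[OF x]] unfolding Q_def by blast
    ultimately show ?thesis by blast
  qed
  ultimately show ?thesis by blast
qed

section \<open>Smith's theorem: the solution set condition\<close>

lemma cell_chain_saturated:
  assumes Y: "small k Y" "Y \<subseteq> Arr C" and c: "cell_chain Y g Z f r e"
  shows "f (zero, s) \<in> cof k C Y"
proof (rule chain_in_closed[OF _ _ cell_chainD(1)[OF c, of s]])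
  note sat = saturated_cof'[OF Y(2)]
  show "transfinite_composition_closed k C (cof k C Y)" "isos C \<subseteq> cof k C Y"
    by (rule saturatedD[OF sat])+
  show "f (i, succ i) \<in> cof k C Y" for i
  proof (rule attach_in_saturated[OF sat small_squares[OF Y(1)] cell_chainD(6)[OF c]])
    fix \<sigma> assume \<sigma>: "\<sigma> \<in> squares Y (r i)"
    obtain y u v where [simp]: "\<sigma> = (y, u, v)" by (cases \<sigma>)
    have "Dom C (r i) = Z i" using cell_chainD(4)[OF c, of i] by simp
    then show "fst \<sigma> \<in> cof k C Y \<and> top_side \<sigma> \<in> Hom C (Dom C (fst \<sigma>)) (Z i)"
      using squaresD(1,2)[of y u v Y "r i"] \<sigma> subset_cof[of Y k C] by auto
  qed
qed simp_all

text \<open>The compactness argument of the small object argument again, now with the cell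
  \<open>e s\<close> of the square at stage \<open>s\<close> as its solution.\<close>

lemma cell_chain_rlp:
  assumes Y: "Y \<subseteq> Arr C" and c: "cell_chain Y g Z f r e" and t: "regular_above B t"
    and cpt: "\<And>y. y \<in> Y \<Longrightarrow> compact_at (chain_ord t) (Dom C y)"
  shows "r t \<in> rlp C Y"
proof -
  note fin = cell_chainD(8)[OF c] and rin = cell_chainD(4)[OF c] and rc = cell_chainD(5)[OF c]
  note ch = cell_chainD(1)[OF c, of t]
  have "lifts C y (r t)" if y: "y \<in> Y" for y
  proof (rule liftsI)
    fix u v assume u: "u \<in> Hom C (Dom C y) (Dom C (r t))" and v: "v \<in> Hom C (Cod C y) (Cod C (r t))"
      and uv: "r t \<cdot> u = v \<cdot> y"
    have yA: "y \<in> Arr C" using y Y by blast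
    have u: "u \<in> Hom C (Dom C y) (Z t)" and v: "v \<in> Hom C (Cod C y) (Cod C g)" using u v rin[of t] by simp_all
    have "\<exists>s\<in>Field (chain_ord t). \<exists>u'\<in>Hom C (Dom C y) (Z s). f (s, t) \<cdot> u' = u"
      by (rule compactD(1)[OF cpt[OF y] directed_chain_ord[OF t] smooth_chain_diagram[OF ch order_refl]
        smooth_chainD(5)[OF ch order_refl regular_limit[OF t]] u])
    then obtain s u' where s: "s < t" and u': "u' \<in> Hom C (Dom C y) (Z s)" "f (s, t) \<cdot> u' = u" by auto
    have st: "succ s \<le> t" "s \<le> t" using s less_imp_le[OF s] by simp_all
    have "r s \<cdot> u' = r t \<cdot> (f (s, t) \<cdot> u')"
      by (rule comp_reduce[OF rc[OF st(2)], symmetric]) (use rin[of t] fin[OF st(2)] u' in simp_all)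
    then have \<sigma>: "(y, u', v) \<in> squares Y (r s)" using y u' v uv rin[of s] by (simp add: squares_def)
    note H = cell_chain_cell[OF c \<sigma>] u' fin[OF st(1)] fin[OF le_succ[of s]] rin[of t] yA
    have "(f (succ s, t) \<cdot> e s (y, u', v)) \<cdot> y = f (succ s, t) \<cdot> (f (s, succ s) \<cdot> u')" using H by simp
    also have "\<dots> = f (s, t) \<cdot> u'"
      by (rule comp_reduce[OF cell_chainD(10)[OF c le_succ st(1)]]) (use H in simp_all)
    finally have 1: "(f (succ s, t) \<cdot> e s (y, u', v)) \<cdot> y = u" using u' by simp
    have "r t \<cdot> (f (succ s, t) \<cdot> e s (y, u', v)) = r (succ s) \<cdot> e s (y, u', v)"
      by (rule comp_reduce[OF rc[OF st(1)]]) (use H in simp_all)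
    then have "r t \<cdot> (f (succ s, t) \<cdot> e s (y, u', v)) = v" using cell_chainD(7)[OF c \<sigma>] by simp
    then show "\<exists>d\<in>Hom C (Cod C y) (Dom C (r t)). d \<cdot> y = u \<and> r t \<cdot> d = v"
      using 1 H by (intro bexI[of _ "f (succ s, t) \<cdot> e s (y, u', v)"]) simp_all
  qed
  then show ?thesis using rin[of t] by (simp add: rlp_def)
qed

lemma resolutionD:
  assumes "resolution l w ro wi Ca Da pc pd"
  shows "directed l ro" "i \<in> Field ro \<Longrightarrow> wi i \<in> Arr C"
    "diagram (poset_cat ro) C (\<lambda>i. Dom C (wi i)) Ca" "diagram (poset_cat ro) C (\<lambda>i. Cod C (wi i)) Da"
    "colimit (poset_cat ro) C (\<lambda>i. Dom C (wi i)) Ca (Dom C w) pc"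
    "colimit (poset_cat ro) C (\<lambda>i. Cod C (wi i)) Da (Cod C w) pd"
    "(i, j) \<in> ro \<Longrightarrow> wi j \<cdot> Ca (i, j) = Da (i, j) \<cdot> wi i"
    "i \<in> Field ro \<Longrightarrow> w \<cdot> pc i = pd i \<cdot> wi i"
  using assms unfolding resolution_def by blast+

text \<open>The factorization of \<open>w\<close> is the directed colimit of the factorizations of the arrows \<open>wi i\<close>.\<close>

lemma square_through_stage:
  fixes ro :: "'k rel"
  assumes Y: "Y \<subseteq> Arr C" and t: "regular_above B t"
    and cptY: "\<forall>y\<in>Y. compact_at (chain_ord t) (Dom C y) \<and> compact_at (chain_ord t) (Cod C y)"
    and res: "resolution (chain_ord t) w ro wi Ca Da pc pd" and w: "w \<in> Arr C"
    and cc: "\<forall>g\<in>Arr C. cell_chain Y g (Z g) (f g) (r g) (e g)"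
    and x: "x \<in> Arr C" "compact_at (chain_ord t) (Dom C x)" "compact_at (chain_ord t) (Cod C x)"
    and u: "u \<in> Hom C (Dom C x) (Dom C w)" and d: "d \<in> Hom C (Cod C x) (Z w t)"
    and sq: "d \<cdot> x = f w (zero, t) \<cdot> u"
  shows "\<exists>i u' d' a b. i \<in> Field ro \<and> u' \<in> Hom C (Dom C x) (Dom C (wi i)) \<and> d' \<in> Hom C (Cod C x) (Z (wi i) t) \<and>
    f (wi i) (zero, t) \<cdot> u' = d' \<cdot> x \<and> a \<in> Hom C (Dom C (wi i)) (Dom C w) \<and> b \<in> Hom C (Z (wi i) t) (Cod C w) \<and>
    w \<cdot> a = b \<cdot> f (wi i) (zero, t) \<and> a \<cdot> u' = u \<and> b \<cdot> d' = r w t \<cdot> d"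
proof -
  note R = resolutionD[OF res] and cptY = bspec[OF cptY] and cc = bspec[OF cc]
  have inf: "Cinfinite (chain_ord t)" using t by (simp add: regular_above_def)
  have Ca: "Ca (i, j) \<in> Hom C (Dom C (wi i)) (Dom C (wi j))" "Da (i, j) \<in> Hom C (Cod C (wi i)) (Cod C (wi j))"
    if "(i, j) \<in> ro" for i j using R(3,4) that unfolding diagram_poset_iff by blast+
  have pcd: "pc i \<in> Hom C (Dom C (wi i)) (Dom C w)" "pd i \<in> Hom C (Cod C (wi i)) (Cod C w)"
    if "i \<in> Field ro" for i using colimit_in[OF R(5), of i] colimit_in[OF R(6), of i] that by simp_all
  note cci = cc[OF R(2)]
  let ?cm = "\<lambda>g g'. chain_map Y (Z g) (f g) (r g) (e g) (Z g') (f g') (r g') (e g')"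
  have "\<exists>\<alpha>. ?cm (wi (fst m)) (wi (snd m)) (Ca m) (Da m) \<alpha>" if m: "m \<in> ro" for m
  proof -
    obtain i j where ij: "m = (i, j)" by (cases m)
    have ij': "(i, j) \<in> ro" using m ij by simp
    show ?thesis unfolding ij fst_conv snd_conv
      by (rule chain_map_exists[OF cci[OF FieldI1[OF ij']] cci[OF FieldI2[OF ij']] Y Ca[OF ij'] R(7)[OF ij']])
  qed
  then have "\<exists>\<alpha>. \<forall>m\<in>ro. ?cm (wi (fst m)) (wi (snd m)) (Ca m) (Da m) (\<alpha> m)" by (intro bchoice ballI)
  then obtain \<alpha> where al: "\<forall>m\<in>ro. ?cm (wi (fst m)) (wi (snd m)) (Ca m) (Da m) (\<alpha> m)" by (rule exE)
  have "\<exists>\<beta>. ?cm (wi i) w (pc i) (pd i) \<beta>" if i: "i \<in> Field ro" for i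
    by (rule chain_map_exists[OF cci[OF i] cc[OF w] Y pcd[OF i] R(8)[OF i]])
  then have "\<exists>\<beta>. \<forall>i\<in>Field ro. ?cm (wi i) w (pc i) (pd i) (\<beta> i)" by (intro bchoice ballI)
  then obtain \<beta> where be: "\<forall>i\<in>Field ro. ?cm (wi i) w (pc i) (pd i) (\<beta> i)" by (rule exE)
  interpret D: directed_cell_chains C k Y t ro wi Ca Da w pc pd "\<lambda>i. Z (wi i)" "\<lambda>i. f (wi i)" "\<lambda>i. r (wi i)"
      "\<lambda>i. e (wi i)" "Z w" "f w" "r w" "e w" \<alpha> \<beta>
  proof unfold_locales
    show "?cm (wi i) (wi j) (Ca (i, j)) (Da (i, j)) (\<alpha> (i, j))" if "(i, j) \<in> ro" for i j
      using bspec[OF al that] by simp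
    show "?cm (wi i) w (pc i) (pd i) (\<beta> i)" if "i \<in> Field ro" for i by (rule bspec[OF be that])
  qed (fact R(1) inf Y w R(3) R(4) R(5) R(6) cc[OF w] | erule cptY | erule R(2) | erule cci)+
  obtain i1 u1 where i1: "i1 \<in> Field ro" "u1 \<in> Hom C (Dom C x) (Dom C (wi i1))" "pc i1 \<cdot> u1 = u"
    using compactD(1)[OF x(2) R(1,3,5) u] by blast
  obtain i2 d2 where i2: "i2 \<in> Field ro" "d2 \<in> Hom C (Cod C x) (Z (wi i2) t)" "\<beta> i2 t \<cdot> d2 = d"
    using compactD(1)[OF x(3) R(1) D.stage_diagram D.stage_colimit d] by blast
  obtain i where i: "i \<in> Field ro" "(i1, i) \<in> ro" "(i2, i) \<in> ro" by (rule directed_ub[OF R(1) inf i1(1) i2(1)])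
  have zt: "zero \<le> t" by simp
  have f0: "f (wi j) (zero, t) \<in> Hom C (Dom C (wi j)) (Z (wi j) t)" if "j \<in> Field ro" for j
    using cell_chainD(8)[OF cci[OF that] zt] cell_chainD(2)[OF cci[OF that]] by simp
  have fw0: "f w (zero, t) \<in> Hom C (Dom C w) (Z w t)"
    using cell_chainD(8)[OF cc[OF w] zt] cell_chainD(2)[OF cc[OF w]] by simp
  define u' where "u' = Ca (i1, i) \<cdot> u1"
  define d' where "d' = \<alpha> (i2, i) t \<cdot> d2"
  have u': "u' \<in> Hom C (Dom C x) (Dom C (wi i))" "pc i \<cdot> u' = u"
    using comp_reduce[OF D.pc_comm[OF i(2)], of u1] i1(2,3) Ca(1)[OF i(2)] pcd(1)[OF i(1)] by (simp_all add: u'_def)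
  have d': "d' \<in> Hom C (Cod C x) (Z (wi i) t)" "\<beta> i t \<cdot> d' = d"
    using comp_reduce[OF D.be_comp[OF i(3)], of t d2] i2(2,3) D.al_in[OF i(3), of t] D.be_in[OF i(1), of t]
    by (simp_all add: d'_def)
  note bi = D.be_in[OF i(1), of t]
  have "\<beta> i t \<cdot> (f (wi i) (zero, t) \<cdot> u') = f w (zero, t) \<cdot> (pc i \<cdot> u')"
  proof (rule comp_cong2)
    show "\<beta> i t \<cdot> f (wi i) (zero, t) = f w (zero, t) \<cdot> pc i"
      using chain_mapD(4)[OF D.bm[OF i(1)] zt] chain_mapD(2)[OF D.bm[OF i(1)]] by simp
  qed (use bi f0[OF i(1)] fw0 u' pcd(1)[OF i(1)] in simp_all)
  also have "\<dots> = (\<beta> i t \<cdot> d') \<cdot> x" using u'(2) d'(2) sq by simp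
  finally have "\<beta> i t \<cdot> (d' \<cdot> x) = \<beta> i t \<cdot> (f (wi i) (zero, t) \<cdot> u')" using bi d'(1) x(1) by simp
  \<comment> \<open>The square at stage \<open>i\<close> commutes after composition with the colimit
    leg \<open>\<beta> i t\<close>; compactness of \<open>Dom C x\<close> moves the equation to a
    later stage \<open>j\<close>.\<close>
  then have "\<exists>j. (i, j) \<in> ro \<and> \<alpha> (i, j) t \<cdot> (d' \<cdot> x) = \<alpha> (i, j) t \<cdot> (f (wi i) (zero, t) \<cdot> u')"
    using d'(1) x(1) f0[OF i(1)] u'(1)
    by (intro compactD(2)[OF x(2) R(1) D.stage_diagram D.stage_colimit i(1)]) simp_all
  then obtain j where j: "(i, j) \<in> ro" "\<alpha> (i, j) t \<cdot> (d' \<cdot> x) = \<alpha> (i, j) t \<cdot> (f (wi i) (zero, t) \<cdot> u')" by blast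
  have jF: "j \<in> Field ro" using j(1) by (rule FieldI2)
  note A = D.al_in[OF j(1), of t] Ca(1)[OF j(1)] f0[OF jF] f0[OF i(1)] d'(1) u'(1) x(1)
  have "f (wi j) (zero, t) \<cdot> (Ca (i, j) \<cdot> u') = \<alpha> (i, j) t \<cdot> (f (wi i) (zero, t) \<cdot> u')"
  proof (rule comp_cong2)
    show "f (wi j) (zero, t) \<cdot> Ca (i, j) = \<alpha> (i, j) t \<cdot> f (wi i) (zero, t)"
      using chain_mapD(4)[OF D.am[OF j(1)] zt] chain_mapD(2)[OF D.am[OF j(1)]] by simp
  qed (use A in simp_all)
  then have s1: "f (wi j) (zero, t) \<cdot> (Ca (i, j) \<cdot> u') = (\<alpha> (i, j) t \<cdot> d') \<cdot> x" using j(2) A by simp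
  note rj = cell_chainD(4)[OF cci[OF jF], of t]
  have "r (wi j) t \<cdot> f (wi j) (zero, t) = wi j"
    using cell_chainD(5)[OF cci[OF jF] zt] cell_chainD(3)[OF cci[OF jF]] by simp
  \<comment> \<open>The square from the first factor of \<open>wi j\<close> to \<open>w\<close>: its
    bottom runs through the second factor of \<open>wi j\<close> and then along
    \<open>pd j\<close>.\<close>
  then have s2: "w \<cdot> pc j = (pd j \<cdot> r (wi j) t) \<cdot> f (wi j) (zero, t)"
    using R(8)[OF jF] rj A(3) pcd(2)[OF jF] by simp
  have s3: "pc j \<cdot> (Ca (i, j) \<cdot> u') = u"
    using comp_reduce[OF D.pc_comm[OF j(1)], of u'] u' A pcd(1)[OF jF] by simp
  have "(pd j \<cdot> r (wi j) t) \<cdot> (\<alpha> (i, j) t \<cdot> d') = pd j \<cdot> (r (wi j) t \<cdot> (\<alpha> (i, j) t \<cdot> d'))"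
    using rj A pcd(2)[OF jF] by simp
  also have "\<dots> = r w t \<cdot> (\<beta> j t \<cdot> (\<alpha> (i, j) t \<cdot> d'))"
    by (rule comp_cong2[OF chain_mapD(3)[OF D.bm[OF jF], symmetric]])
      (use rj A pcd(2)[OF jF] D.be_in[OF jF, of t] cell_chainD(4)[OF cc[OF w], of t] in simp_all)
  also have "\<beta> j t \<cdot> (\<alpha> (i, j) t \<cdot> d') = d"
    using comp_reduce[OF D.be_comp[OF j(1)], of t d'] d' A D.be_in[OF jF, of t] by simp
  finally have s4: "(pd j \<cdot> r (wi j) t) \<cdot> (\<alpha> (i, j) t \<cdot> d') = r w t \<cdot> d" .
  show ?thesis
    by (rule exI[of _ j], rule exI[of _ "Ca (i, j) \<cdot> u'"], rule exI[of _ "\<alpha> (i, j) t \<cdot> d'"], rule exI[of _ "pc j"],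
        rule exI[of _ "pd j \<cdot> r (wi j) t"], intro conjI jF s1 s2 s3 s4)
      (use A rj pcd[OF jF] in simp_all)
qed

text \<open>The lifting hypothesis is used on the second factor of a weak equivalence
  \<open>w\<close>: it lies in \<open>rlp C Y\<close> by construction and in \<open>W\<close> by
  2-out-of-3. The lift \<open>d\<close> replaces \<open>w\<close> by its first factor, and only the
  latter has to be approximated by stages.\<close>

lemma solution_set_condition:
  assumes Y: "small k Y" "Y \<subseteq> Arr C" and W: "W \<subseteq> Arr C" "two_out_of_three C W"
    and cofW: "cof k C Y \<subseteq> W" and lift: "\<And>p. p \<in> rlp C Y \<Longrightarrow> p \<in> W \<Longrightarrow> lifts C x p" and x: "x \<in> Arr C"
  shows "solution_set_condition_at k (arrow_cat C) W x"
proof -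
  define Obs where "Obs = {Dom C x, Cod C x} \<union> Dom C ` Y \<union> Cod C ` Y"
  have Obs: "small k Obs" "Obs \<subseteq> Obj C"
  proof -
    show "small k Obs" unfolding Obs_def by (intro small_Un small_image Y) (simp add: small_finite)
    show "Obs \<subseteq> Obj C" using Y x by (auto simp: Obs_def)
  qed
  obtain l P where gen: "generating l P" using ex_generating by blast
  obtain t where lt: "l \<le>o chain_ord t" and t: "regular_above ({} :: nat set) t"
    and cpt: "\<And>A. A \<in> Obs \<Longrightarrow> compact_at (chain_ord t) A"
    using compact_above[OF gen Obs small_finite[of "{} :: nat set"]] by auto
  obtain Q where Q: "small k Q" "Q \<subseteq> Arr C"
    and Qres: "\<And>w. w \<in> Arr C \<Longrightarrow> \<exists>ro wi Ca Da pc pd.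
      resolution (chain_ord t) w (ro :: 'k rel) wi Ca Da pc pd \<and> (\<forall>i\<in>Field ro. wi i \<in> Q)"
    using arrow_resolution[OF gen lt t] by blast
  have "\<exists>c. \<forall>g\<in>Arr C. cell_chain Y g (fst (c g)) (fst (snd (c g))) (fst (snd (snd (c g)))) (snd (snd (snd (c g))))"
  proof (rule bchoice, rule ballI)
    fix g assume "g \<in> Arr C"
    then obtain Z f r e where "cell_chain Y g Z f r e" using cell_chain_exists[OF Y] by blast
    then show "\<exists>c. cell_chain Y g (fst c) (fst (snd c)) (fst (snd (snd c))) (snd (snd (snd c)))"
      by (intro exI[of _ "(Z, f, r, e)"]) simp
  qed
  then obtain c where c: "\<forall>g\<in>Arr C.
      cell_chain Y g (fst (c g)) (fst (snd (c g))) (fst (snd (snd (c g)))) (snd (snd (snd (c g))))"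
    by (rule exE)
  define Z where "Z = (\<lambda>g. fst (c g))"
  define f where "f = (\<lambda>g. fst (snd (c g)))"
  define r where "r = (\<lambda>g. fst (snd (snd (c g))))"
  define e where "e = (\<lambda>g. snd (snd (snd (c g))))"
  have cc: "cell_chain Y g (Z g) (f g) (r g) (e g)" if "g \<in> Arr C" for g
    unfolding Z_def f_def r_def e_def by (rule bspec[OF c that])
  \<comment> \<open>First factors are taken for every \<open>q\<close> in \<open>Q\<close>, in
    \<open>W\<close> or not. They are in \<open>W\<close> because they lie in
    \<open>cof k C Y\<close>.\<close>
  define T where "T = (\<lambda>q. f q (zero, t)) ` Q"
  have T: "small k T" "T \<subseteq> W"
    using Q cell_chain_saturated[OF Y cc] cofW by (auto simp: T_def intro: small_image)
  define S where "S = {(x', u, v, \<tau>). x' = x \<and> \<tau> \<in> T \<and> (x', u, v, \<tau>) \<in> Arr (arrow_cat C)}"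
  have sS: "small k S"
  proof (rule small_subset)
    show "S \<subseteq> {x} \<times> (\<Union>\<tau>\<in>T. Hom C (Dom C x) (Dom C \<tau>) \<times> Hom C (Cod C x) (Cod C \<tau>) \<times> {\<tau>})"
      by (auto simp: S_def arrow_cat_simps)
    show "small k ({x} \<times> (\<Union>\<tau>\<in>T. Hom C (Dom C x) (Dom C \<tau>) \<times> Hom C (Cod C x) (Cod C \<tau>) \<times> {\<tau>}))"
      by (intro small_Sigma small_UNION T small_Hom small_finite) simp_all
  qed
  show ?thesis unfolding solution_set_condition_at_def
  proof (intro exI[of _ S] conjI ballI impI sS)
    show "S \<subseteq> {f \<in> Arr (arrow_cat C). Dom (arrow_cat C) f = x \<and> Cod (arrow_cat C) f \<in> W}"
      using T(2) by (auto simp: S_def arrow_cat_simps)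
    fix sq assume sq: "sq \<in> Arr (arrow_cat C)" "Dom (arrow_cat C) sq = x \<and> Cod (arrow_cat C) sq \<in> W"
    obtain x' u v w where sqd: "sq = (x', u, v, w)" by (cases sq)
    have x': "x' = x" and wW: "w \<in> W" and w: "w \<in> Arr C" and u: "u \<in> Hom C (Dom C x) (Dom C w)"
      and v: "v \<in> Hom C (Cod C x) (Cod C w)" and uv: "w \<cdot> u = v \<cdot> x"
      using sq unfolding sqd arrow_cat_simps by auto
    have zt: "zero \<le> t" by simp
    note c = cc[OF w]
    have fw: "f w (zero, t) \<in> Hom C (Dom C w) (Z w t)" using cell_chainD(8)[OF c zt] cell_chainD(2)[OF c] by simp
    have rf: "r w t \<cdot> f w (zero, t) = w" using cell_chainD(5)[OF c zt] cell_chainD(3)[OF c] by simp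
    note rt = cell_chainD(4)[OF c, of t]
    have fW: "f w (zero, t) \<in> W" using cell_chain_saturated[OF Y c] cofW by blast
    have "r w t \<in> W"
      by (rule two_out_of_threeD(2)[OF W(2), of "f w (zero, t)"]) (use fw rt rf wW fW in simp_all)
    moreover have "r w t \<in> rlp C Y"
      by (rule cell_chain_rlp[OF Y(2) c t]) (auto intro: cpt simp: Obs_def)
    ultimately have "lifts C x (r w t)" by (rule lift[rotated])
    moreover have "r w t \<cdot> (f w (zero, t) \<cdot> u) = v \<cdot> x"
      using comp_reduce[OF rf, of u] uv fw rt u by simp
    moreover have "f w (zero, t) \<cdot> u \<in> Hom C (Dom C x) (Dom C (r w t))" "v \<in> Hom C (Cod C x) (Cod C (r w t))"
      using fw rt u v by simp_all
    ultimately obtain d where d: "d \<in> Hom C (Cod C x) (Dom C (r w t))" "d \<cdot> x = f w (zero, t) \<cdot> u" "r w t \<cdot> d = v"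
      using lifts_ex[of C x "r w t"] by blast
    have d': "d \<in> Hom C (Cod C x) (Z w t)" using d(1) rt by simp
    obtain ro wi Ca Da pc pd where res: "resolution (chain_ord t) w (ro :: 'k rel) wi Ca Da pc pd"
      and wiQ: "\<forall>i\<in>Field ro. wi i \<in> Q" using Qres[OF w] by (elim exE conjE)
    have cY: "\<forall>y\<in>Y. compact_at (chain_ord t) (Dom C y) \<and> compact_at (chain_ord t) (Cod C y)"
      using cpt by (auto simp: Obs_def)
    have ccA: "\<forall>g\<in>Arr C. cell_chain Y g (Z g) (f g) (r g) (e g)" by (rule ballI) (rule cc)
    have cx: "compact_at (chain_ord t) (Dom C x)" "compact_at (chain_ord t) (Cod C x)"
      using cpt by (auto simp: Obs_def)
    obtain i u' d' a b where i: "i \<in> Field ro" and st: "u' \<in> Hom C (Dom C x) (Dom C (wi i))"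
      "d' \<in> Hom C (Cod C x) (Z (wi i) t)" "f (wi i) (zero, t) \<cdot> u' = d' \<cdot> x"
      "a \<in> Hom C (Dom C (wi i)) (Dom C w)" "b \<in> Hom C (Z (wi i) t) (Cod C w)"
      "w \<cdot> a = b \<cdot> f (wi i) (zero, t)" "a \<cdot> u' = u" "b \<cdot> d' = r w t \<cdot> d"
      using square_through_stage[OF Y(2) t cY res w ccA x cx u d' d(2)] by (elim exE conjE)
    let ?\<tau> = "f (wi i) (zero, t)"
    note ci = cc[OF resolutionD(2)[OF res i]]
    have \<tau>: "?\<tau> \<in> Hom C (Dom C (wi i)) (Z (wi i) t)"
      using cell_chainD(8)[OF ci zt] cell_chainD(2)[OF ci] by simp
    have \<tau>T: "?\<tau> \<in> T" using wiQ i unfolding T_def by blast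
    have "(x, u', d', ?\<tau>) \<in> S" using \<tau>T \<tau> st(1-3) x by (simp add: S_def arrow_cat_simps)
    moreover have "(?\<tau>, a, b, w) \<in> Hom (arrow_cat C) (Cod (arrow_cat C) (x, u', d', ?\<tau>)) (Cod (arrow_cat C) sq)"
      using \<tau> st(4-6) w unfolding Hom_def sqd by (simp add: arrow_cat_simps)
    moreover have "sq = Comp (arrow_cat C) (?\<tau>, a, b, w) (x, u', d', ?\<tau>)"
      using st(7,8) d(3) unfolding sqd x' arrow_cat_simps by simp
    ultimately show "\<exists>s\<in>S. \<exists>g\<in>Hom (arrow_cat C) (Cod (arrow_cat C) s) (Cod (arrow_cat C) sq).
        sq = Comp (arrow_cat C) g s" by blast
  qed
qed

lemma smith_necessity:
  assumes X: "X \<subseteq> Arr C" and m: "make_combinatorial_model_category k C (cof k C X) W"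
  shows "(two_out_of_three C W \<and> retract_closed C W) \<and> rlp C X \<subseteq> W \<and>
    (pushout_closed C (cof k C X \<inter> W) \<and> transfinite_composition_closed k C (cof k C X \<inter> W)) \<and>
    (\<forall>x\<in>X. solution_set_condition_at k (arrow_cat C) W x)"
proof -
  let ?Fb = "rlp C (cof k C X \<inter> W)"
  have W: "W \<subseteq> Arr C" "two_out_of_three C W" "retract_closed C W"
    and wfs: "weak_factorization_system C (cof k C X) (?Fb \<inter> W)" "weak_factorization_system C (cof k C X \<inter> W) ?Fb"
    and cg: "cofibrantly_generated k C (cof k C X \<inter> W) ?Fb"
    using m unfolding make_combinatorial_model_category_def combinatorial_model_category_def model_category_def
    by blast+
  have tf: "?Fb \<inter> W = rlp C X"
    using wfs(1) rlp_cof[OF X] unfolding weak_factorization_system_def by simp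
  have tc: "cof k C X \<inter> W = llp C ?Fb" using wfs(2) unfolding weak_factorization_system_def by blast
  \<comment> \<open>Closure under pushout and transfinite composition comes from the description of
    the trivial cofibrations by a left lifting property.\<close>
  have sat: "saturated k C (cof k C X \<inter> W)" by (subst tc, rule saturated_llp) (auto simp: rlp_def)
  obtain Y where Y: "Y \<subseteq> Arr C" "small k Y" "?Fb = rlp C Y" using cg unfolding cofibrantly_generated_def by blast
  have "cof k C Y = cof k C X \<inter> W"
    by (rule trans[OF cof_eq_llp_rlp[OF Y(2,1)] tc[unfolded Y(3), symmetric]])
  then have cofY: "cof k C Y \<subseteq> W" by simp
  have "solution_set_condition_at k (arrow_cat C) W x" if x: "x \<in> X" for x
  proof (rule solution_set_condition[OF Y(2,1) W(1,2) cofY])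
    \<comment> \<open>Such a \<open>p\<close> is a fibration in \<open>W\<close>, and by
      \<open>tf\<close> these are exactly the members of \<open>rlp C X\<close>.\<close>
    show "lifts C x p" if "p \<in> rlp C Y" "p \<in> W" for p
      using that x tf Y(3) by (auto simp: rlp_def)
    show "x \<in> Arr C" using x X by blast
  qed
  then show ?thesis using W(2,3) tf saturatedD(3,4)[OF sat] by blast
qed

end

theorem theorem4p2:
  fixes K :: "('o, 'm) cat" and X W :: "'m set"
  assumes "inaccessible TYPE('k::wellorder)"
    and "locally_presentable TYPE('k) K"
    and "X \<subseteq> Arr K" and "small TYPE('k) X"
    and "W \<subseteq> Arr K"
  shows "make_combinatorial_model_category TYPE('k) K (cof TYPE('k) K X) W \<longleftrightarrow>
    (two_out_of_three K W \<and> retract_closed K W) \<and>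
    rlp K X \<subseteq> W \<and>
    (pushout_closed K (cof TYPE('k) K X \<inter> W) \<and>
     transfinite_composition_closed TYPE('k) K (cof TYPE('k) K X \<inter> W)) \<and>
    (\<forall>x\<in>X. solution_set_condition_at TYPE('k) (arrow_cat K) W x)"
proof -
  interpret locally_presentable_category K "TYPE('k)"
    using assms(1,2) unfolding locally_presentable_category_def locally_presentable_category_axioms_def
      universe_def locally_presentable_def by blast
  show ?thesis
    using smith_necessity[OF assms(3), of W] smith_construction[OF assms(4,3,5)] by blast
qed

end
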